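(* Let $\mathcal T\in\mathrm{Tree}(k)$ and $\mathcal T_j\in\mathrm{Tree}(n_j)$ for $j=1,\dots,k$. Then \[ \boxplus_{\mathcal T}(\boxplus_{\mathcal T_1},\dots,\boxplus_{\mathcal T_k})=\boxplus_{\mathcal T(\mathcal T_1,\dots,\mathcal T_k)}, \] that is, for all $\mathcal B$-valued laws $\mu_{j,i}$ ($1\le j\le k$, $1\le i\le n_j$), \[ \boxplus_{\mathcal T}\bigl(\boxplus_{\mathcal T_1}(\mu_{1,1},\dots,\mu_{1,n_1}),\dots,\boxplus_{\mathcal T_k}(\mu_{k,1},\dots,\mu_{k,n_k})\bigr)=\boxplus_{\mathcal T(\mathcal T_1,\dots,\mathcal T_k)}(\mu_{1,1},\dots,\mu_{1,n_1},\dots,\mu_{k,1},\dots,\mu_{k,n_k}). \] In other words, $\mathcal T\mapsto\boxplus_{\mathcal T}$ is an operad morphism.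
   Context: $\mathcal B$ is a unital $C^*$-algebra. For a right Hilbert $\mathcal B$-module $\mathcal H$, $\mathcal L(\mathcal H)$ is the $C^*$-algebra of bounded adjointable right-$\mathcal B$-modular operators. A $\mathcal B$-$\mathcal B$-correspondence is a right Hilbert $\mathcal B$-module with a left action given by a unital $*$-homomorphism $\mathcal B\to\mathcal L(\mathcal H)$. A $\mathcal B$-central unit vector is $\xi\in\mathcal H$ with $\langle\xi,\xi\rangle=1$, $b\xi=\xi b$ for all $b\in\mathcal B$; then $\mathcal H=\mathcal B\xi\oplus\mathcal H^\circ$, $\mathcal H^\circ=\{h:\langle h,\xi\rangle=0\}$. Laws: $\mathcal B\langle X\rangle$ is the universal unital $*$-algebra generated by $\mathcal B$ and a self-adjoint indeterminate $X$. A $\mathcal B$-valued law is a unital $\mathcal B$-$\mathcal B$-bimodule map $\mu:\mathcal B\langle X\rangle\to\mathcal B$ that is completely positive ($\mu^{(m)}(P^*P)\ge0$ for $P\in M_m(\mathcal B\langle X\rangle)$) and exponentially bounded ($\|\mu(b_0Xb_1\cdots Xb_\ell)\|\le MR^\ell\|b_0\|\cdots\|b_\ell\|$ for some $M,R>0$). Trees: $[N]=\{1,\dots,N\}$. A string on $[N]$ is alternating if consecutive letters differ. $\mathcal T_{N,\mathrm{free}}$ is the graph whose vertices are the alternating strings on $[N]$ (including the empty string $\emptyset$), with an edge between $s$ and $js$ whenever $js$ is alternating, rooted at $\emptyset$. $\mathrm{Tree}(N)$ is the set of connected subgraphs containing $\emptyset$, each identified with its vertex set. Composition of trees: let $N_j=n_1+\dots+n_j$,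 $N=N_k$, and $\iota_j:[n_j]\to[N]$, $\iota_j(i)=N_{j-1}+i$; $(\iota_j)_*(s)$ is the string obtained by applying $\iota_j$ to each letter of $s$. Then $\mathcal T(\mathcal T_1,\dots,\mathcal T_k)\in\mathrm{Tree}(N)$ has vertex set consisting of all strings $(\iota_{i_1})_*(s_1)\cdots(\iota_{i_\ell})_*(s_\ell)$ with $\ell\ge0$, $i_1\cdots i_\ell\in\mathcal T$ and $s_m\in\mathcal T_{i_m}\setminus\{\emptyset\}$ for $m=1,\dots,\ell$. This makes $\mathrm{Tree}$ an operad with identity $\{\emptyset,1\}\in\mathrm{Tree}(1)$. $\mathcal T$-free convolution: given correspondences with $\mathcal B$-central unit vectors $(\mathcal H_j,\xi_j)$, $j\in[N]$, and $\mathcal T\in\mathrm{Tree}(N)$, put $\mathcal H=\bigoplus_{s\in\mathcal T}\mathcal H_s^\circ$, $\mathcal H_\emptyset^\circ=\mathcal B$, $\mathcal H^\circ_{j_1\cdots j_m}=\mathcal H_{j_1}^\circ\otimes_{\mathcal B}\cdots\otimes_{\mathcal B}\mathcal H_{j_m}^\circ$, $\xi=1\in\mathcal H_\emptyset^\circ$. $\lambda_{\mathcal T,j}:\mathcal L(\mathcal H_j)\to\mathcal L(\mathcal H)$ is the $*$-homomorphism for which $\lambda_{\mathcal T,j}(x)$ acts on $\mathcal H_s^\circ\oplus\mathcal H_{js}^\circ\cong\mathcal H_j\otimes_{\mathcal B}\mathcal H_s^\circ$ as $x\otimes\mathrm{id}$ when $s\in\mathcal T$ does not begin with $j$ and $js\in\mathcal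 T$, and as zero on $\mathcal H_s^\circ$ when $s\in\mathcal T$ does not begin with $j$ and $js\notin\mathcal T$. For laws $\mu_1,\dots,\mu_N$, let $\mathcal H_j=L^2(\mathcal B\langle X\rangle,\mu_j)$ (separation-completion for $\langle p,q\rangle=\mu_j(p^*q)$), $\xi_j$ the class of $1$, $X_j\in\mathcal L(\mathcal H_j)$ multiplication by $X$; then $\boxplus_{\mathcal T}(\mu_1,\dots,\mu_N)$ is the law of $\sum_{j=1}^N\lambda_{\mathcal T,j}(X_j)$ with respect to $a\mapsto\langle\xi,a\xi\rangle$. *)

theory Defs
  imports "HOL-Analysis.Analysis" "HOL-Library.Poly_Mapping"
begin

section \<open>Unital C*-algebras\<close>

text \<open>The zero algebra is allowed: \<open>monoid_mult\<close> rather than \<open>ring_1\<close>.\<close>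

class unital_cstar = real_normed_algebra + monoid_mult + banach +
  fixes scaleC :: "complex \<Rightarrow> 'a \<Rightarrow> 'a"
    and cstar :: "'a \<Rightarrow> 'a"
  assumes scaleC_add_right: "scaleC c (a + b) = scaleC c a + scaleC c b"
    and scaleC_add_left: "scaleC (c + d) a = scaleC c a + scaleC d a"
    and scaleC_scaleC: "scaleC c (scaleC d a) = scaleC (c * d) a"
    and scaleC_of_real: "scaleC (complex_of_real r) a = scaleR r a"
    and norm_scaleC: "norm (scaleC c a) = cmod c * norm a"
    and mult_scaleC_left: "scaleC c a * b = scaleC c (a * b)"
    and mult_scaleC_right: "a * scaleC c b = scaleC c (a * b)"
    and cstar_add: "cstar (a + b) = cstar a + cstar b"
    and cstar_scaleC: "cstar (scaleC c a) = scaleC (cnj c) (cstar a)"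
    and cstar_mult: "cstar (a * b) = cstar b * cstar a"
    and cstar_cstar: "cstar (cstar a) = a"
    and cstar_identity: "norm (cstar a * a) = (norm a)\<^sup>2"

text \<open>Positivity in the C*-algebra of \<open>m \<times> m\<close> matrices over \<open>'b\<close>; only the entries with
  indices below \<open>m\<close> matter.\<close>

definition mat_pos :: "nat \<Rightarrow> (nat \<Rightarrow> nat \<Rightarrow> 'b::unital_cstar) \<Rightarrow> bool" where
  "mat_pos m A \<longleftrightarrow> (\<exists>C. \<forall>i<m. \<forall>k<m. A i k = (\<Sum>l<m. cstar (C l i) * C l k))"


section \<open>The *-algebra generated by B and a self-adjoint indeterminate\<close>

text \<open>The universal algebra is the algebra of expressions in \<open>Coef b\<close> and \<open>Indet\<close> modulo the
  least congruence that imposes the axioms of a unital complex algebra and makes \<open>Coef\<close> a unital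
  homomorphism. The complex scalar \<open>c\<close> acts as multiplication by \<open>Coef (scaleC c 1)\<close>; the rule
  \<open>scalar_central\<close> makes this an algebra over the complex numbers.\<close>

datatype 'b bterm = Coef 'b | Indet | Plus "'b bterm" "'b bterm" | Times "'b bterm" "'b bterm"

inductive bterm_eq :: "'b::unital_cstar bterm \<Rightarrow> 'b bterm \<Rightarrow> bool" where
  refl: "bterm_eq p p"
| sym: "bterm_eq p q \<Longrightarrow> bterm_eq q p"
| trans: "bterm_eq p q \<Longrightarrow> bterm_eq q r \<Longrightarrow> bterm_eq p r"
| Plus_cong: "bterm_eq p p' \<Longrightarrow> bterm_eq q q' \<Longrightarrow> bterm_eq (Plus p q) (Plus p' q')"
| Times_cong: "bterm_eq p p' \<Longrightarrow> bterm_eq q q' \<Longrightarrow> bterm_eq (Times p q) (Times p' q')"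
| Plus_assoc: "bterm_eq (Plus (Plus p q) r) (Plus p (Plus q r))"
| Plus_comm: "bterm_eq (Plus p q) (Plus q p)"
| Plus_zero: "bterm_eq (Plus (Coef 0) p) p"
| Plus_neg: "bterm_eq (Plus (Times (Coef (- 1)) p) p) (Coef 0)"
| Times_assoc: "bterm_eq (Times (Times p q) r) (Times p (Times q r))"
| Times_one_left: "bterm_eq (Times (Coef 1) p) p"
| Times_one_right: "bterm_eq (Times p (Coef 1)) p"
| distrib_left: "bterm_eq (Times p (Plus q r)) (Plus (Times p q) (Times p r))"
| distrib_right: "bterm_eq (Times (Plus p q) r) (Plus (Times p r) (Times q r))"
| Coef_add: "bterm_eq (Coef (a + b)) (Plus (Coef a) (Coef b))"
| Coef_mult: "bterm_eq (Coef (a * b)) (Times (Coef a) (Coef b))"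
| scalar_central: "bterm_eq (Times (Coef (scaleC c 1)) p) (Times p (Coef (scaleC c 1)))"

primrec bterm_star :: "'b::unital_cstar bterm \<Rightarrow> 'b bterm" where
  "bterm_star (Coef b) = Coef (cstar b)"
| "bterm_star Indet = Indet"
| "bterm_star (Plus p q) = Plus (bterm_star p) (bterm_star q)"
| "bterm_star (Times p q) = Times (bterm_star q) (bterm_star p)"

lemma cstar_one: "cstar (1::'b::unital_cstar) = 1"
  by (metis cstar_cstar cstar_mult mult_1_left mult_1_right)

lemma cstar_zero: "cstar (0::'b::unital_cstar) = 0"
  by (metis add_cancel_right_right cstar_add)

lemma cstar_minus: "cstar (- a::'b::unital_cstar) = - cstar a"
  by (metis add_eq_0_iff cstar_add cstar_zero)

lemma bterm_minus_central:
  "bterm_eq (Times (Coef (- 1 :: 'b::unital_cstar)) p) (Times p (Coef (- 1)))"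
proof -
  have "scaleC (- 1) (1::'b) = - 1"
    using scaleC_of_real[of "- 1" "1::'b"] by simp
  then show ?thesis using bterm_eq.scalar_central[of "- 1" p] by simp
qed

lemma bterm_star_cong: "bterm_eq p q \<Longrightarrow> bterm_eq (bterm_star p) (bterm_star q)"
proof (induction rule: bterm_eq.induct)
  case (Plus_neg p)
  have "bterm_eq (Plus (Times (bterm_star p) (Coef (- 1))) (bterm_star p))
      (Plus (Times (Coef (- 1)) (bterm_star p)) (bterm_star p))"
    by (intro bterm_eq.Plus_cong bterm_eq.refl bterm_eq.sym[OF bterm_minus_central])
  then show ?case
    using bterm_eq.trans[OF _ bterm_eq.Plus_neg]
    by (simp add: cstar_minus cstar_one cstar_zero)
next
  case (scalar_central c p)
  show ?case
    using bterm_eq.sym[OF bterm_eq.scalar_central[of "cnj c" "bterm_star p"]]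
    by (simp add: cstar_scaleC cstar_one)
qed (auto intro: bterm_eq.intros simp: cstar_one cstar_zero cstar_add cstar_mult)

quotient_type (overloaded) 'b bpoly = "'b::unital_cstar bterm" / bterm_eq
  by (intro equivpI reflpI sympI transpI) (blast intro: bterm_eq.intros)+

instantiation bpoly :: (unital_cstar) "{ring, monoid_mult}"
begin

lift_definition zero_bpoly :: "'a bpoly" is "Coef 0" .
lift_definition one_bpoly :: "'a bpoly" is "Coef 1" .
lift_definition plus_bpoly :: "'a bpoly \<Rightarrow> 'a bpoly \<Rightarrow> 'a bpoly" is Plus
  by (rule bterm_eq.Plus_cong)
lift_definition times_bpoly :: "'a bpoly \<Rightarrow> 'a bpoly \<Rightarrow> 'a bpoly" is Times
  by (rule bterm_eq.Times_cong)
lift_definition uminus_bpoly :: "'a bpoly \<Rightarrow> 'a bpoly" is "Times (Coef (- 1))"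
  by (rule bterm_eq.Times_cong[OF bterm_eq.refl])
definition minus_bpoly :: "'a bpoly \<Rightarrow> 'a bpoly \<Rightarrow> 'a bpoly" where
  "minus_bpoly p q = p + - q"

instance
  by standard (simp add: minus_bpoly_def | transfer, blast intro: bterm_eq.intros)+

end

lift_definition coef :: "'b::unital_cstar \<Rightarrow> 'b bpoly" is Coef .

lift_definition indet :: "'b::unital_cstar bpoly" is Indet .

lift_definition pstar :: "'b::unital_cstar bpoly \<Rightarrow> 'b bpoly" is bterm_star
  by (rule bterm_star_cong)


section \<open>Laws\<close>

text \<open>\<open>monomial b\<^sub>0 [b\<^sub>1, \<dots>, b\<^sub>l]\<close> is \<open>b\<^sub>0 X b\<^sub>1 X \<dots> X b\<^sub>l\<close>.\<close>

definition monomial :: "'b::unital_cstar \<Rightarrow> 'b list \<Rightarrow> 'b bpoly" where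
  "monomial b0 bs = foldl (\<lambda>p b. p * indet * coef b) (coef b0) bs"

type_synonym 'b law = "'b bpoly \<Rightarrow> 'b"

definition is_law :: "'b::unital_cstar law \<Rightarrow> bool" where
  "is_law \<mu> \<longleftrightarrow>
     \<mu> 1 = 1 \<and>
     (\<forall>p q. \<mu> (p + q) = \<mu> p + \<mu> q) \<and>
     (\<forall>a p b. \<mu> (coef a * p * coef b) = a * \<mu> p * b) \<and>
     (\<forall>m P. mat_pos m (\<lambda>i k. \<mu> (\<Sum>l<m. pstar (P l i) * P l k))) \<and>
     (\<exists>M>0. \<exists>R>0. \<forall>b0 bs.
        norm (\<mu> (monomial b0 bs)) \<le> M * R ^ length bs * norm b0 * prod_list (map norm bs))"


section \<open>Correspondences and their separation-completions\<close>

text \<open>A record of this type stands for a correspondence over \<open>'b\<close>, or for a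
  correspondence before separation and completion, with a possibly degenerate inner product.
  Inner products are conjugate linear in the first argument. Scalar multiplication by \<open>c\<close> is
  \<open>\<lambda>h. ract H h (scaleC c 1)\<close>.\<close>

record ('b, 'h) corr =
  carr :: "'h set"
  nul :: 'h
  add :: "'h \<Rightarrow> 'h \<Rightarrow> 'h"
  lact :: "'b \<Rightarrow> 'h \<Rightarrow> 'h"
  ract :: "'h \<Rightarrow> 'b \<Rightarrow> 'h"
  inn :: "'h \<Rightarrow> 'h \<Rightarrow> 'b"

definition sub :: "('b::unital_cstar, 'h) corr \<Rightarrow> 'h \<Rightarrow> 'h \<Rightarrow> 'h" where
  "sub H h k = add H h (ract H k (- 1))"

definition hnorm :: "('b::unital_cstar, 'h) corr \<Rightarrow> 'h \<Rightarrow> real" where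
  "hnorm H h = sqrt (norm (inn H h h))"

definition cauchy_seqs :: "('b::unital_cstar, 'h) corr \<Rightarrow> (nat \<Rightarrow> 'h) set" where
  "cauchy_seqs H = {v. (\<forall>n. v n \<in> carr H) \<and>
     (\<forall>e>0. \<exists>N. \<forall>m\<ge>N. \<forall>n\<ge>N. hnorm H (sub H (v m) (v n)) < e)}"

definition null_rel :: "('b::unital_cstar, 'h) corr \<Rightarrow> ((nat \<Rightarrow> 'h) \<times> (nat \<Rightarrow> 'h)) set" where
  "null_rel H = {(v, w). v \<in> cauchy_seqs H \<and> w \<in> cauchy_seqs H \<and>
     (\<lambda>n. hnorm H (sub H (v n) (w n))) \<longlonglongrightarrow> 0}"

definition completion :: "('b::unital_cstar, 'h) corr \<Rightarrow> ('b, (nat \<Rightarrow> 'h) set) corr" where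
  "completion H = \<lparr>
     carr = cauchy_seqs H // null_rel H,
     nul = null_rel H `` {\<lambda>n. nul H},
     add = (\<lambda>C D. \<Union>v\<in>C. \<Union>w\<in>D. null_rel H `` {\<lambda>n. add H (v n) (w n)}),
     lact = (\<lambda>b C. \<Union>v\<in>C. null_rel H `` {\<lambda>n. lact H b (v n)}),
     ract = (\<lambda>C b. \<Union>v\<in>C. null_rel H `` {\<lambda>n. ract H (v n) b}),
     inn = (\<lambda>C D. THE l. \<forall>v\<in>C. \<forall>w\<in>D. (\<lambda>n. inn H (v n) (w n)) \<longlonglongrightarrow> l) \<rparr>"

definition embed :: "('b::unital_cstar, 'h) corr \<Rightarrow> 'h \<Rightarrow> (nat \<Rightarrow> 'h) set" where
  "embed H h = null_rel H `` {\<lambda>n. h}"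


section \<open>Adjointable operators\<close>

text \<open>Operators are extensional functions on the carrier, so that an operator is determined by
  its values there.\<close>

definition adjointable :: "('b::unital_cstar, 'h) corr \<Rightarrow> ('h \<Rightarrow> 'h) set" where
  "adjointable H = {x \<in> carr H \<rightarrow>\<^sub>E carr H.
     (\<forall>h\<in>carr H. \<forall>k\<in>carr H. x (add H h k) = add H (x h) (x k)) \<and>
     (\<forall>h\<in>carr H. \<forall>b. x (ract H h b) = ract H (x h) b) \<and>
     (\<exists>K. \<forall>h\<in>carr H. hnorm H (x h) \<le> K * hnorm H h) \<and>
     (\<exists>y\<in>carr H \<rightarrow> carr H. \<forall>h\<in>carr H. \<forall>k\<in>carr H. inn H (x h) k = inn H h (y k))}"

definition op_zero :: "('b::unital_cstar, 'h) corr \<Rightarrow> 'h \<Rightarrow> 'h" where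
  "op_zero H = (\<lambda>h\<in>carr H. nul H)"

definition op_add :: "('b::unital_cstar, 'h) corr \<Rightarrow> ('h \<Rightarrow> 'h) \<Rightarrow> ('h \<Rightarrow> 'h) \<Rightarrow> 'h \<Rightarrow> 'h" where
  "op_add H x y = (\<lambda>h\<in>carr H. add H (x h) (y h))"

primrec bterm_eval ::
  "('b::unital_cstar, 'h) corr \<Rightarrow> ('h \<Rightarrow> 'h) \<Rightarrow> 'b bterm \<Rightarrow> 'h \<Rightarrow> 'h" where
  "bterm_eval H x (Coef b) = (\<lambda>h\<in>carr H. lact H b h)"
| "bterm_eval H x Indet = x"
| "bterm_eval H x (Plus p q) = op_add H (bterm_eval H x p) (bterm_eval H x q)"
| "bterm_eval H x (Times p q) = (\<lambda>h\<in>carr H. bterm_eval H x p (bterm_eval H x q h))"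

text \<open>The law of \<open>x\<close> with respect to the vector state of \<open>\<xi>\<close>. For \<open>x\<close> in \<open>adjointable H\<close>,
  with \<open>H\<close> a correspondence, evaluation respects \<open>bterm_eq\<close>, so the choice of the
  representative is immaterial.\<close>

definition law_of :: "('b::unital_cstar, 'h) corr \<Rightarrow> 'h \<Rightarrow> ('h \<Rightarrow> 'h) \<Rightarrow> 'b law" where
  "law_of H \<xi> x p = inn H \<xi> (bterm_eval H x (rep_bpoly p) \<xi>)"


section \<open>The correspondence of a law\<close>

definition L2_pre :: "'b::unital_cstar law \<Rightarrow> ('b, 'b bpoly) corr" where
  "L2_pre \<mu> = \<lparr> carr = UNIV, nul = 0, add = (+),
     lact = (\<lambda>b p. coef b * p), ract = (\<lambda>p b. p * coef b),
     inn = (\<lambda>p q. \<mu> (pstar p * q)) \<rparr>"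

definition L2 :: "'b::unital_cstar law \<Rightarrow> ('b, (nat \<Rightarrow> 'b bpoly) set) corr" where
  "L2 \<mu> = completion (L2_pre \<mu>)"

definition L2_one :: "'b::unital_cstar law \<Rightarrow> (nat \<Rightarrow> 'b bpoly) set" where
  "L2_one \<mu> = embed (L2_pre \<mu>) 1"

definition L2_mult ::
  "'b::unital_cstar law \<Rightarrow> (nat \<Rightarrow> 'b bpoly) set \<Rightarrow> (nat \<Rightarrow> 'b bpoly) set" where
  "L2_mult \<mu> = (\<lambda>C\<in>carr (L2 \<mu>). \<Union>v\<in>C. null_rel (L2_pre \<mu>) `` {\<lambda>n. indet * v n})"


section \<open>Tensor products and direct sums\<close>

definition centered :: "('b::unital_cstar, 'h) corr \<Rightarrow> 'h \<Rightarrow> ('b, 'h) corr" where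
  "centered H \<xi> = H\<lparr>carr := {h \<in> carr H. inn H h \<xi> = 0}\<rparr>"

text \<open>For a string \<open>s = [j\<^sub>1, \<dots>, j\<^sub>m]\<close>, the value of \<open>tensor_inn K s b [h\<^sub>1, \<dots>, h\<^sub>m] [k\<^sub>1, \<dots>, k\<^sub>m]\<close>
  is the inner product of \<open>h\<^sub>1 \<otimes> \<dots> \<otimes> h\<^sub>m\<close> with \<open>b (k\<^sub>1 \<otimes> \<dots> \<otimes> k\<^sub>m)\<close>, obtained by iterating
  \<open>\<langle>h \<otimes> t, k \<otimes> u\<rangle> = \<langle>t, \<langle>h, k\<rangle> u\<rangle>\<close>; the empty tensor product is \<open>'b\<close> itself.\<close>

fun tensor_inn ::
  "(nat \<Rightarrow> ('b::unital_cstar, 'h) corr) \<Rightarrow> nat list \<Rightarrow> 'b \<Rightarrow> 'h list \<Rightarrow> 'h list \<Rightarrow> 'b" where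
  "tensor_inn K (j # s) b (h # t) (k # u) =
     tensor_inn K s (inn (K j) h (lact (K j) b k)) t u"
| "tensor_inn K _ b _ _ = b"

text \<open>The module spanned by the simple tensors, before separation and completion: the free right
  module over \<open>'b\<close> on the set of simple tensors, \<open>Poly_Mapping.single w b\<close> standing for
  \<open>(w\<^sub>1 \<otimes> \<dots> \<otimes> w\<^sub>m) b\<close>. The separation divides out the relations of the balanced tensor product.\<close>

definition tensor_pre ::
  "(nat \<Rightarrow> ('b::unital_cstar, 'h) corr) \<Rightarrow> nat list \<Rightarrow> ('b, 'h list \<Rightarrow>\<^sub>0 'b) corr" where
  "tensor_pre K s = \<lparr>
     carr = {f. \<forall>w\<in>Poly_Mapping.keys f. list_all2 (\<lambda>j h. h \<in> carr (K j)) s w},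
     nul = 0,
     add = (+),
     lact = (\<lambda>b f. \<Sum>w\<in>Poly_Mapping.keys f. (case w of
         [] \<Rightarrow> Poly_Mapping.single [] (b * Poly_Mapping.lookup f [])
       | h # t \<Rightarrow> Poly_Mapping.single (lact (K (hd s)) b h # t) (Poly_Mapping.lookup f w))),
     ract = (\<lambda>f b. Poly_Mapping.map (\<lambda>c. c * b) f),
     inn = (\<lambda>f g. \<Sum>w\<in>Poly_Mapping.keys f. \<Sum>w'\<in>Poly_Mapping.keys g.
         cstar (Poly_Mapping.lookup f w) * tensor_inn K s 1 w w' * Poly_Mapping.lookup g w') \<rparr>"

definition tensor ::
  "(nat \<Rightarrow> ('b::unital_cstar, 'h) corr) \<Rightarrow> nat list \<Rightarrow> ('b, (nat \<Rightarrow> 'h list \<Rightarrow>\<^sub>0 'b) set) corr" where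
  "tensor K s = completion (tensor_pre K s)"

definition simple_tensor ::
  "(nat \<Rightarrow> ('b::unital_cstar, 'h) corr) \<Rightarrow> nat list \<Rightarrow> 'h list \<Rightarrow> (nat \<Rightarrow> 'h list \<Rightarrow>\<^sub>0 'b) set" where
  "simple_tensor K s w = embed (tensor_pre K s) (Poly_Mapping.single w 1)"

definition direct_sum ::
  "'s set \<Rightarrow> ('s \<Rightarrow> ('b::unital_cstar, 'h) corr) \<Rightarrow> ('b, 's \<Rightarrow> 'h) corr" where
  "direct_sum S K = \<lparr>
     carr = {h \<in> (\<Pi>\<^sub>E s\<in>S. carr (K s)). (\<lambda>s. inn (K s) (h s) (h s)) summable_on S},
     nul = (\<lambda>s\<in>S. nul (K s)),
     add = (\<lambda>h k. \<lambda>s\<in>S. add (K s) (h s) (k s)),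
     lact = (\<lambda>b h. \<lambda>s\<in>S. lact (K s) b (h s)),
     ract = (\<lambda>h b. \<lambda>s\<in>S. ract (K s) (h s) b),
     inn = (\<lambda>h k. \<Sum>\<^sub>\<infinity>s\<in>S. inn (K s) (h s) (k s)) \<rparr>"

definition summand ::
  "'s set \<Rightarrow> ('s \<Rightarrow> ('b::unital_cstar, 'h) corr) \<Rightarrow> 's \<Rightarrow> 'h \<Rightarrow> 's \<Rightarrow> 'h" where
  "summand S K s v = (\<lambda>s'\<in>S. if s' = s then v else nul (K s'))"


section \<open>Rooted subtrees of the free tree and their composition\<close>

definition alternating :: "nat \<Rightarrow> nat list set" where
  "alternating N = {s. set s \<subseteq> {1..N} \<and> (\<forall>i. Suc i < length s \<longrightarrow> s ! i \<noteq> s ! Suc i)}"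

definition tree_edges :: "nat \<Rightarrow> (nat list \<times> nat list) set" where
  "tree_edges N = {(s, t). s \<in> alternating N \<and> t \<in> alternating N \<and>
     ((\<exists>j. t = j # s) \<or> (\<exists>j. s = j # t))}"

definition Tree :: "nat \<Rightarrow> nat list set set" where
  "Tree N = {T. T \<subseteq> alternating N \<and> [] \<in> T \<and>
     (\<forall>s\<in>T. ([], s) \<in> (tree_edges N \<inter> T \<times> T)\<^sup>*)}"

text \<open>In \<open>shift ns j\<close> and \<open>tree_compose ns T Ts\<close> the lists \<open>ns = [n\<^sub>1, \<dots>, n\<^sub>k]\<close> and
  \<open>Ts = [T\<^sub>1, \<dots>, T\<^sub>k]\<close> are indexed from 0, whereas letters of strings start at 1.\<close>

definition shift :: "nat list \<Rightarrow> nat \<Rightarrow> nat \<Rightarrow> nat" where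
  "shift ns j i = sum_list (take (j - 1) ns) + i"

definition tree_compose :: "nat list \<Rightarrow> nat list set \<Rightarrow> nat list set list \<Rightarrow> nat list set" where
  "tree_compose ns T Ts = {concat (map2 (\<lambda>j s. map (shift ns j) s) js ss) | js ss.
     js \<in> T \<and> list_all2 (\<lambda>j s. s \<in> Ts ! (j - 1) - {[]}) js ss}"


section \<open>Convolution along a tree\<close>

context
  fixes T :: "nat list set" and H :: "nat \<Rightarrow> ('b::unital_cstar, 'h) corr" and \<xi> :: "nat \<Rightarrow> 'h"
begin

definition centered_family :: "nat \<Rightarrow> ('b, 'h) corr" where
  "centered_family j = centered (H j) (\<xi> j)"

definition tree_product :: "('b, nat list \<Rightarrow> (nat \<Rightarrow> 'h list \<Rightarrow>\<^sub>0 'b) set) corr" where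
  "tree_product = direct_sum T (tensor centered_family)"

definition tree_vec :: "nat list \<Rightarrow> 'h list \<Rightarrow> nat list \<Rightarrow> (nat \<Rightarrow> 'h list \<Rightarrow>\<^sub>0 'b) set" where
  "tree_vec s w = summand T (tensor centered_family) s (simple_tensor centered_family s w)"

definition vacuum :: "nat list \<Rightarrow> (nat \<Rightarrow> 'h list \<Rightarrow>\<^sub>0 'b) set" where
  "vacuum = tree_vec [] []"

text \<open>The image of \<open>h \<otimes> t\<close>, where \<open>h\<close> is in \<open>H j\<close> and \<open>t = w\<^sub>1 \<otimes> \<dots> \<otimes> w\<^sub>m\<close>, under the isomorphism onto
  the sum of the components at \<open>s\<close> and \<open>j # s\<close>: writing \<open>h = \<langle>\<xi>, h\<rangle> \<xi> + h\<^sub>0\<close> with \<open>h\<^sub>0\<close> orthogonal to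
  \<open>\<xi>\<close>, it is \<open>\<langle>\<xi>, h\<rangle> t + h\<^sub>0 \<otimes> t\<close>.\<close>

definition attach ::
  "nat \<Rightarrow> nat list \<Rightarrow> 'h \<Rightarrow> 'h list \<Rightarrow> nat list \<Rightarrow> (nat \<Rightarrow> 'h list \<Rightarrow>\<^sub>0 'b) set" where
  "attach j s h w = add tree_product
     (lact tree_product (inn (H j) (\<xi> j) h) (tree_vec s w))
     (tree_vec (j # s) (sub (H j) h (ract (H j) (\<xi> j) (inn (H j) (\<xi> j) h)) # w))"

text \<open>The conditions are imposed on simple tensors only; by boundedness and linearity they
  determine the operator.\<close>

definition tree_rep :: "nat \<Rightarrow> ('h \<Rightarrow> 'h) \<Rightarrow>
    (nat list \<Rightarrow> (nat \<Rightarrow> 'h list \<Rightarrow>\<^sub>0 'b) set) \<Rightarrow> nat list \<Rightarrow> (nat \<Rightarrow> 'h list \<Rightarrow>\<^sub>0 'b) set" where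
  "tree_rep j x = (THE y. y \<in> adjointable tree_product \<and>
     (\<forall>s\<in>T. \<forall>w. (s = [] \<or> hd s \<noteq> j) \<longrightarrow> list_all2 (\<lambda>i h. h \<in> carr (centered_family i)) s w \<longrightarrow>
        (if j # s \<in> T
         then \<forall>h\<in>carr (H j). y (attach j s h w) = attach j s (x h) w
         else y (tree_vec s w) = nul tree_product)))"

end

text \<open>The laws are \<open>\<mu>\<^sub>1, \<dots>, \<mu>\<^sub>N\<close> with \<open>N = length \<mu>s\<close> and \<open>\<mu>\<^sub>j = \<mu>s ! (j - 1)\<close>.\<close>

definition boxplus :: "nat list set \<Rightarrow> 'b::unital_cstar law list \<Rightarrow> 'b law" where
  "boxplus T \<mu>s =
     (let \<mu> = (\<lambda>j. \<mu>s ! (j - 1));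
          H = (\<lambda>j. L2 (\<mu> j));
          \<xi> = (\<lambda>j. L2_one (\<mu> j));
          HT = tree_product T H \<xi>
      in law_of HT (vacuum T H \<xi>)
           (foldr (\<lambda>j. op_add HT (tree_rep T H \<xi> j (L2_mult (\<mu> j))))
              [1..<Suc (length \<mu>s)] (op_zero HT)))"

end

theory Submission
  imports Defs
begin

text \<open>The convolution law sees only the component at \<open>\<emptyset>\<close> of the vectors obtained from the vacuum by
  the left action of \<open>\<B>\<close> and the operator \<open>X\<^sub>1 + \<dots> + X\<^sub>N\<close>. All these vectors are sums of
  simple tensors of centred polynomials \<open>p - \<mu> p\<close>, on which both act by explicit formulas. Decoding a string of the
  composed tree as a string of \<open>T\<close> decorated with strings of the blocks, and replacing a centred polynomial
  of a block law by the part of \<open>p(X) \<xi>\<close> orthogonal to \<open>\<xi>\<close>, relates such sums for the iterated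
  convolution to sums for the composed tree. The relation contains the pair of vacua, is preserved by the
  operations, and related vectors have the same vacuum component, so the two laws agree; no isomorphism of
  Hilbert modules is needed.

  The rest is the existence of the objects involved: positivity of \<open>a\<^sup>* a\<close>, completion and interior
  tensor products of correspondences, and boundedness of multiplication by \<open>X\<close> and of the tree
  representations, which follows from symmetry and exponential growth on a dense set of vectors.\<close>

section \<open>Positive elements of a C*-algebra\<close>

text \<open>A representation changes only the first letter of a string, and consecutive letters of a
  string of the outer tree differ. Hence a string of the composed tree splits uniquely into maximal
  segments lying in one block, and the variables of block \<open>j\<close> together act on a leading
  segment, possibly empty, as the convolved variable of that block does; the rest is a spectator.
  The delicate point is the vacuum: the vector \<open>p(X) \<xi>\<close> of a block has the
  component \<open>\<nu> p\<close> along \<open>\<xi>\<close>, which turns into a left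
  multiplication of the rest of the tensor. It is the same scalar that the outer convolution splits
  off when it centres \<open>p\<close>. A relation is used instead of a map because vectors are
  given by lists of terms, and a map would have to be independent of the list. Since each
  representation is introduced by a definite description, the laws mean nothing before a unique
  bounded operator on a completion has been found. Since block laws are fed into another
  convolution, only properties of laws that survive convolution may be used.\<close>

lemma norm_one_le: "norm (1::'b::unital_cstar) \<le> 1"
proof -
  \<comment> \<open>The unit is idempotent and self-adjoint, so its norm is 0 or 1; the value 0
    occurs in the zero algebra, which the class admits.\<close>
  have "norm (1::'b) = (norm (1::'b))\<^sup>2"
    using cstar_identity[of "1::'b"] by (simp add: cstar_one)
  then show ?thesis
    by (smt (verit) mult_cancel_right1 power2_eq_square)
qed

lemma norm_cstar: "norm (cstar a) = norm (a::'b::unital_cstar)"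
proof -
  have *: "norm b \<le> norm (cstar b)" for b :: 'b
  proof (cases "norm b = 0")
    case False
    have "norm b * norm b \<le> norm (cstar b) * norm b"
      using cstar_identity[of b] norm_mult_ineq[of "cstar b" b] by (simp add: power2_eq_square)
    then show ?thesis using False by (simp add: mult_le_cancel_right)
  qed simp
  show ?thesis using *[of a] *[of "cstar a"] by (simp add: cstar_cstar)
qed

lemma cstar_scaleR: "cstar (scaleR r a) = scaleR r (cstar (a::'b::unital_cstar))"
  by (metis complex_cnj_complex_of_real cstar_scaleC scaleC_of_real)

lemma scaleC_minus_right: "scaleC c (- a) = - scaleC c (a::'b::unital_cstar)"
  using scaleC_add_right[of c "- a" a] scaleC_add_right[of c 0 0] by (metis add.right_inverse add_eq_0_iff add.commute add_cancel_right_right)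

lemma scaleC_diff_right: "scaleC c (a - b) = scaleC c a - scaleC c (b::'b::unital_cstar)"
  using scaleC_add_right[of c a "- b"] by (simp add: scaleC_minus_right)

lemma scaleC_minus_one: "scaleC (- 1) a = - (a::'b::unital_cstar)"
  using scaleC_of_real[of "- 1" a] by simp

lemma scaleC_minus_i: "scaleC (- \<i>) a = - scaleC \<i> (a::'b::unital_cstar)"
  using scaleC_scaleC[of "- 1" \<i> a] by (simp add: scaleC_minus_one)

lemmas scaleC_simps = scaleC_add_right scaleC_diff_right scaleC_minus_right scaleC_minus_one
  scaleC_minus_i scaleC_scaleC mult_scaleC_left mult_scaleC_right

lemma cstar_diff: "cstar (a - b::'b::unital_cstar) = cstar a - cstar b"
  using cstar_add[of a "- b"] by (simp add: cstar_minus)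

lemma cstar_sum: "cstar (sum f A :: 'b::unital_cstar) = (\<Sum>x\<in>A. cstar (f x))"
  by (induction A rule: infinite_finite_induct) (auto simp: cstar_zero cstar_add)

lemma bounded_linear_cstar: "bounded_linear (cstar :: 'b::unital_cstar \<Rightarrow> 'b)"
  by (rule bounded_linear_intro[where K = 1]) (auto simp: cstar_add cstar_scaleR norm_cstar)

lemmas tendsto_cstar = bounded_linear.tendsto[OF bounded_linear_cstar]

lemma cstar_power: "cstar (a ^ n) = cstar (a::'b::unital_cstar) ^ n"
  by (induction n) (auto simp: cstar_one cstar_mult power_commutes)

lemma norm_power_le: "norm ((x::'b::unital_cstar) ^ n) \<le> norm x ^ n"
proof (induction n)
  case (Suc n)
  have "norm (x ^ Suc n) \<le> norm x * norm (x ^ n)" by (simp add: norm_mult_ineq)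
  also have "\<dots> \<le> norm x * norm x ^ n" using Suc by (simp add: mult_left_mono)
  finally show ?case by simp
qed (simp add: norm_one_le)

section \<open>The square root of \<open>1 - x\<close> by its binomial series on the closed unit
  ball\<close>

definition sqrt_coeff :: "nat \<Rightarrow> real" where
  "sqrt_coeff n = (1/2 gchoose n) * (-1) ^ n"

lemma sqrt_coeff_0: "sqrt_coeff 0 = 1"
  by (simp add: sqrt_coeff_def)

lemma sqrt_coeff_Suc: "sqrt_coeff (Suc n) = sqrt_coeff n * ((real n - 1/2) / (real n + 1))"
proof -
  have "real (Suc n) * (1/2 gchoose Suc n) = (1/2 - real n) * (1/2 gchoose n)"
    using gbinomial_absorb_comp[of "1/2::real" n] gbinomial_absorption[of n "1/2::real"] by simp
  then have "(1/2 gchoose Suc n) = (1/2 - real n) * (1/2 gchoose n) / (real n + 1)"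
    by (simp add: field_simps)
  then have "sqrt_coeff (Suc n) = (1/2 - real n) * (1/2 gchoose n) / (real n + 1) * (- 1) ^ Suc n"
    by (simp only: sqrt_coeff_def)
  then show ?thesis by (simp add: sqrt_coeff_def field_simps)
qed

text \<open>The ratio of consecutive coefficients is nonnegative from index 1 on, so all of them
  inherit the sign of the coefficient \<open>- 1/2\<close> at index 1.\<close>

lemma sqrt_coeff_nonpos: "sqrt_coeff (Suc n) \<le> 0"
proof (induction n)
  case (Suc n)
  then show ?case
    unfolding sqrt_coeff_Suc[of "Suc n"] by (intro mult_nonpos_nonneg) auto
qed (simp add: sqrt_coeff_Suc sqrt_coeff_0)

text \<open>A closed form for the partial sums at \<open>x = 1\<close>. What counts is the sign of
  the right-hand side, which shows that they are nonnegative.\<close>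

lemma sqrt_coeff_partial_sum: "(\<Sum>k\<le>n. sqrt_coeff k) = - 2 * (real n + 1) * sqrt_coeff (Suc n)"
proof (induction n)
  case (Suc n)
  have "sqrt_coeff (Suc (Suc n)) * (real n + 2) = sqrt_coeff (Suc n) * (real n + 1/2)"
    by (simp add: sqrt_coeff_Suc[of "Suc n"] field_simps)
  then show ?case using Suc by (simp add: algebra_simps)
qed (simp add: sqrt_coeff_Suc sqrt_coeff_0)

text \<open>Past index 0 the absolute values are the negated coefficients, so they add up to 1 minus
  a nonnegative partial sum. This gives absolute convergence up to the boundary of the unit
  ball.\<close>

lemma sqrt_coeff_abs_sum: "(\<Sum>k<n. \<bar>sqrt_coeff (Suc k)\<bar>) \<le> 1"
proof -
  have "(\<Sum>k<n. \<bar>sqrt_coeff (Suc k)\<bar>) = - (\<Sum>k<n. sqrt_coeff (Suc k))"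
    unfolding sum_negf[symmetric] by (intro sum.cong) (auto simp: sqrt_coeff_nonpos)
  also have "\<dots> = 1 - (\<Sum>k\<le>n. sqrt_coeff k)"
    by (simp add: sum.lessThan_Suc_shift sqrt_coeff_0 del: sum.lessThan_Suc flip: lessThan_Suc_atMost)
  finally have "(\<Sum>k<n. \<bar>sqrt_coeff (Suc k)\<bar>) = 1 - (\<Sum>k\<le>n. sqrt_coeff k)" .
  moreover have "(\<Sum>k\<le>n. sqrt_coeff k) \<ge> 0"
    unfolding sqrt_coeff_partial_sum using sqrt_coeff_nonpos[of n]
    by (intro mult_nonpos_nonpos) auto
  ultimately show ?thesis by simp
qed

text \<open>Vandermonde's identity with both exponents \<open>1/2\<close>: the square of the series
  has the coefficients of \<open>1 - x\<close>.\<close>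

lemma sqrt_coeff_convolution:
  "(\<Sum>k\<le>n. sqrt_coeff k * sqrt_coeff (n - k)) = (if n = 0 then 1 else if n = 1 then - 1 else 0)"
proof -
  have "(\<Sum>k\<le>n. sqrt_coeff k * sqrt_coeff (n - k)) =
      (\<Sum>k\<le>n. (1/2 gchoose k) * (1/2 gchoose (n - k)) * (-1) ^ n)"
  proof (rule sum.cong, simp)
    fix k assume "k \<in> {..n}"
    then have "(-1::real) ^ k * (-1) ^ (n - k) = (-1) ^ n" by (simp flip: power_add)
    then show "sqrt_coeff k * sqrt_coeff (n - k) = (1/2 gchoose k) * (1/2 gchoose (n - k)) * (-1) ^ n"
      by (simp add: sqrt_coeff_def mult.assoc mult.left_commute)
  qed
  also have "\<dots> = (1 gchoose n) * (-1) ^ n"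
    using gbinomial_Vandermonde[of "1/2::real" "1/2" n]
    by (simp add: atLeast0AtMost flip: sum_distrib_right)
  also have "(1::real) gchoose n = of_nat (1 choose n)"
    using binomial_gbinomial[of 1 n, where 'a = real] by simp
  finally show ?thesis by (auto simp: le_Suc_eq binomial_eq_0)
qed

definition sqrt_one_minus :: "'b::unital_cstar \<Rightarrow> 'b" where
  "sqrt_one_minus x = suminf (\<lambda>n. sqrt_coeff n *\<^sub>R x ^ n)"

context
  fixes x :: "'b::unital_cstar"
  assumes x: "norm x \<le> 1"
begin

lemma norm_power_le_1: "norm (x ^ n) \<le> 1"
  using norm_power_le[of x n] power_le_one[of "norm x" n] x by auto

lemma sqrt_summable_norm: "summable (\<lambda>n. norm (sqrt_coeff n *\<^sub>R x ^ n))"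
proof -
  have "summable (\<lambda>n. \<bar>sqrt_coeff (Suc n)\<bar>)"
    by (rule summableI_nonneg_bounded[OF _ sqrt_coeff_abs_sum]) simp
  then have "summable (\<lambda>n. \<bar>sqrt_coeff n\<bar>)" using summable_Suc_iff[of "\<lambda>n. \<bar>sqrt_coeff n\<bar>"] by simp
  then show ?thesis
    using norm_power_le_1
    by (elim summable_comparison_test'[where N = 0]) (simp add: mult_left_le)
qed

lemma sqrt_one_minus_sums: "(\<lambda>n. sqrt_coeff n *\<^sub>R x ^ n) sums sqrt_one_minus x"
  unfolding sqrt_one_minus_def
  using summable_norm_cancel[OF sqrt_summable_norm] by (rule summable_sums)

lemma sqrt_one_minus_square: "sqrt_one_minus x * sqrt_one_minus x = 1 - x"
proof -
  let ?f = "\<lambda>n. sqrt_coeff n *\<^sub>R x ^ n"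
  have "(\<Sum>i\<le>n. ?f i * ?f (n - i)) = (\<Sum>i\<le>n. sqrt_coeff i * sqrt_coeff (n - i)) *\<^sub>R x ^ n" for n
    unfolding scaleR_left.sum by (intro sum.cong) (auto simp flip: power_add)
  then have "(\<lambda>n. (if n = 0 then 1 else if n = 1 then - 1 else 0) *\<^sub>R x ^ n) sums
      (sqrt_one_minus x * sqrt_one_minus x)"
    using Cauchy_product_sums[OF sqrt_summable_norm sqrt_summable_norm]
    by (simp add: sqrt_coeff_convolution flip: sqrt_one_minus_def)
  moreover have "(\<lambda>n. (if n = 0 then 1 else if n = 1 then - 1 else 0) *\<^sub>R x ^ n) sums (1 - x)"
    using sums_finite[of "{0,1}" "\<lambda>n. (if n = 0 then 1 else if n = 1 then - 1 else 0) *\<^sub>R x ^ n"]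
    by simp
  ultimately show ?thesis by (rule sums_unique2)
qed

lemma sqrt_one_minus_commute:
  assumes "y * x = x * y"
  shows "y * sqrt_one_minus x = sqrt_one_minus x * y"
proof -
  have *: "y * x ^ n = x ^ n * y" for n
    by (induction n) (auto simp: assms mult.assoc[symmetric], simp add: mult.assoc)
  have "(\<lambda>n. y * (sqrt_coeff n *\<^sub>R x ^ n)) sums (y * sqrt_one_minus x)"
    using sqrt_one_minus_sums by (rule sums_mult)
  moreover have "(\<lambda>n. (sqrt_coeff n *\<^sub>R x ^ n) * y) sums (sqrt_one_minus x * y)"
    using sqrt_one_minus_sums by (rule sums_mult2)
  ultimately show ?thesis by (simp add: * sums_iff)
qed

lemma sqrt_one_minus_selfadjoint:
  assumes "cstar x = x"
  shows "cstar (sqrt_one_minus x) = sqrt_one_minus x"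
proof -
  have "(\<lambda>n. cstar (sqrt_coeff n *\<^sub>R x ^ n)) sums cstar (sqrt_one_minus x)"
    using bounded_linear.sums[OF bounded_linear_cstar sqrt_one_minus_sums] .
  then show ?thesis using sqrt_one_minus_sums
    by (simp add: cstar_scaleR cstar_power assms sums_iff)
qed

text \<open>The coefficients past index 0 have absolute sum at most 1. In terms of
  \<open>pos\<close> below, this makes the root positive with witness \<open>t = 1\<close>.\<close>

lemma norm_one_minus_sqrt: "norm (1 - sqrt_one_minus x) \<le> 1"
proof -
  have "(\<lambda>n. sqrt_coeff (Suc n) *\<^sub>R x ^ Suc n) sums (sqrt_one_minus x - 1)"
    using sqrt_one_minus_sums by (subst sums_Suc_iff) (simp add: sqrt_coeff_0)
  then have "(\<lambda>n. \<Sum>k<n. sqrt_coeff (Suc k) *\<^sub>R x ^ Suc k) \<longlonglongrightarrow> sqrt_one_minus x - 1"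
    by (simp add: sums_def)
  moreover have "norm (\<Sum>k<n. sqrt_coeff (Suc k) *\<^sub>R x ^ Suc k) \<le> 1" for n
  proof -
    have "norm (\<Sum>k<n. sqrt_coeff (Suc k) *\<^sub>R x ^ Suc k) \<le> (\<Sum>k<n. \<bar>sqrt_coeff (Suc k)\<bar>)"
      using norm_power_le_1 by (intro sum_norm_le) (simp add: mult_left_le del: power_Suc)
    then show ?thesis using sqrt_coeff_abs_sum[of n] by linarith
  qed
  ultimately have "norm (sqrt_one_minus x - 1) \<le> 1"
    by (intro Lim_norm_ubound[of sequentially]) (auto intro: always_eventually)
  then show ?thesis by (simp add: norm_minus_commute)
qed

end

text \<open>If \<open>w\<^sup>2 + v\<^sup>2 = 1\<close> then \<open>w + i v\<close> is unitary, and \<open>w\<close> is its real part.\<close>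

lemma norm_le_1_if_squares:
  fixes w v :: "'b::unital_cstar"
  assumes "cstar w = w" "cstar v = v" "w * v = v * w" "w * w + v * v = 1"
  shows "norm w \<le> 1"
proof -
  define u where "u = w + scaleC \<i> v"
  have su: "cstar u = w - scaleC \<i> v"
    using assms by (simp add: u_def cstar_add cstar_scaleC scaleC_simps)
  have "cstar u * u = w * w + v * v"
    unfolding su unfolding u_def using assms(3)
    by (simp add: algebra_simps scaleC_simps)
  then have "(norm u)\<^sup>2 \<le> 1" using assms(4) cstar_identity[of u] norm_one_le[where 'b = 'b] by simp
  then have "norm u \<le> 1" by (simp add: power2_le_iff_abs_le abs_square_le_1)
  moreover have "2 *\<^sub>R w = u + cstar u" unfolding su unfolding u_def by (simp add: scaleR_2)
  then have "2 * norm w \<le> norm u + norm (cstar u)"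
    by (metis abs_numeral norm_scaleR norm_triangle_ineq)
  ultimately show ?thesis by (simp add: norm_cstar)
qed

text \<open>For a self-adjoint element the condition says that the spectrum lies in
  \<open>[0, 2 t]\<close>. In this form positivity of sums is the triangle inequality, and spectra
  can be avoided.\<close>

definition pos :: "'b::unital_cstar \<Rightarrow> bool" where
  "pos a \<longleftrightarrow> cstar a = a \<and> (\<exists>t\<ge>0. norm (t *\<^sub>R 1 - a) \<le> t)"

lemma pos_cstar: "pos a \<Longrightarrow> cstar a = a"
  by (simp add: pos_def)

lemma pos_add: assumes "pos a" "pos b" shows "pos (a + b)"
proof -
  obtain s t where "s \<ge> 0" "norm (s *\<^sub>R 1 - a) \<le> s" "t \<ge> 0" "norm (t *\<^sub>R 1 - b) \<le> t"
    using assms by (auto simp: pos_def)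
  moreover have "norm ((s + t) *\<^sub>R 1 - (a + b)) \<le> norm (s *\<^sub>R 1 - a) + norm (t *\<^sub>R 1 - b)"
    using norm_triangle_ineq[of "s *\<^sub>R 1 - a" "t *\<^sub>R 1 - b"] by (simp add: algebra_simps)
  ultimately show ?thesis
    using assms by (auto simp: pos_def cstar_add intro!: exI[of _ "s + t"])
qed

lemma pos_scaleR: assumes "pos a" "r \<ge> 0" shows "pos (r *\<^sub>R a)"
proof -
  obtain s where "s \<ge> 0" "norm (s *\<^sub>R 1 - a) \<le> s"
    using assms by (auto simp: pos_def)
  moreover have "norm ((r * s) *\<^sub>R 1 - r *\<^sub>R a) = r * norm (s *\<^sub>R 1 - a)"
    using assms(2) by (metis abs_of_nonneg norm_scaleR scaleR_right_diff_distrib scaleR_scaleR)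
  ultimately show ?thesis
    using assms by (auto simp: pos_def cstar_scaleR mult_left_mono intro!: exI[of _ "r * s"])
qed

lemma pos_0: "pos 0"
  by (auto simp: pos_def cstar_zero intro!: exI[of _ 0])

lemma pos_sum: "(\<And>x. x \<in> A \<Longrightarrow> pos (f x)) \<Longrightarrow> pos (sum f A)"
  by (induction A rule: infinite_finite_induct) (auto simp: pos_0 pos_add)

lemma pos_scalar: "r \<ge> 0 \<Longrightarrow> pos (r *\<^sub>R 1)"
  by (auto simp: pos_def cstar_scaleR cstar_one intro!: exI[of _ r])

text \<open>Write \<open>a = t (1 - x)\<close> with \<open>norm x \<le> 1\<close> and take
  \<open>sqrt t\<close> times the series at \<open>x\<close>. The commutation clause holds because
  the root is a limit of polynomials in \<open>a\<close>; it serves to produce commuting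
  roots.\<close>

lemma pos_sqrt:
  fixes a :: "'b::unital_cstar"
  assumes "pos a"
  obtains h where "pos h" "h * h = a" "\<And>y. y * a = a * y \<Longrightarrow> y * h = h * y"
proof -
  obtain t where t: "t \<ge> 0" "norm (t *\<^sub>R 1 - a) \<le> t" and sa: "cstar a = a"
    using assms by (auto simp: pos_def)
  show ?thesis
  proof (cases "t = 0")
    case True
    then have "a = 0" using t by simp
    then show ?thesis using that[of 0] by (simp add: pos_0)
  next
    case False
    then have "t > 0" using t by simp
    define x where "x = 1 - (1/t) *\<^sub>R a"
    have "x = (1/t) *\<^sub>R (t *\<^sub>R 1 - a)" using \<open>t > 0\<close> by (simp add: x_def algebra_simps)
    then have "norm x = norm (t *\<^sub>R 1 - a) / t" using \<open>t > 0\<close> by simp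
    then have nx: "norm x \<le> 1" using t(2) \<open>t > 0\<close> by simp
    have sx: "cstar x = x" by (simp add: x_def cstar_diff cstar_one cstar_scaleR sa)
    define h where "h = sqrt t *\<^sub>R sqrt_one_minus x"
    have "pos (sqrt_one_minus x)"
      using sqrt_one_minus_selfadjoint[OF nx sx] norm_one_minus_sqrt[OF nx]
      by (auto simp: pos_def intro!: exI[of _ 1])
    then have "pos h" using t by (simp add: h_def pos_scaleR)
    moreover have "h * h = a"
      using \<open>t > 0\<close> sqrt_one_minus_square[OF nx] by (simp add: h_def) (simp add: x_def)
    moreover have "y * h = h * y" if "y * a = a * y" for y
    proof -
      have "y * x = x * y" using that by (simp add: x_def algebra_simps)
      then show ?thesis using sqrt_one_minus_commute[OF nx] by (simp add: h_def)
    qed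
    ultimately show ?thesis using that by blast
  qed
qed

lemma norm_selfadjoint_square: "cstar h = h \<Longrightarrow> norm (h * h) = (norm (h::'b::unital_cstar))\<^sup>2"
  using cstar_identity[of h] by simp

text \<open>After scaling to \<open>norm g = 1\<close>, the root \<open>w\<close> of
  \<open>1 - g * g\<close> commutes with \<open>g\<close>, and \<open>w * w + g * g = 1\<close>. So
  \<open>norm w \<le> 1\<close>, and \<open>1 - g * g\<close> is the square of
  \<open>w\<close>.\<close>

lemma norm_diff_square_le:
  fixes h :: "'b::unital_cstar"
  assumes "cstar h = h"
  shows "norm (norm (h * h) *\<^sub>R 1 - h * h) \<le> norm (h * h)"
proof (cases "h = 0")
  case False
  define r where "r = norm h"
  have r: "r > 0" using False by (simp add: r_def)
  define g where "g = (1/r) *\<^sub>R h"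
  have g: "norm g = 1" "cstar g = g" using r assms by (auto simp: g_def r_def cstar_scaleR)
  have ngg: "norm (g * g) \<le> 1" using norm_selfadjoint_square[OF g(2)] g(1) by simp
  define w where "w = sqrt_one_minus (g * g)"
  have ww: "w * w = 1 - g * g" unfolding w_def by (rule sqrt_one_minus_square[OF ngg])
  have sw: "cstar w = w" unfolding w_def
    by (rule sqrt_one_minus_selfadjoint[OF ngg]) (simp add: cstar_mult g)
  have "g * w = w * g" unfolding w_def
    by (rule sqrt_one_minus_commute[OF ngg]) (simp add: mult.assoc)
  then have "norm w \<le> 1" using norm_le_1_if_squares[of w g] sw g ww by simp
  then have "norm (w * w) \<le> 1" using norm_selfadjoint_square[OF sw] by (simp add: power_le_one)
  then have "norm (1 - g * g) \<le> 1" using ww by simp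
  moreover have nhh: "norm (h * h) = r * r"
    by (simp add: norm_selfadjoint_square[OF assms] power2_eq_square r_def)
  moreover have "h = r *\<^sub>R g" using r by (simp add: g_def)
  then have "norm (h * h) *\<^sub>R 1 - h * h = (r * r) *\<^sub>R (1 - g * g)"
    unfolding nhh by (simp add: scaleR_right_diff_distrib)
  then have "norm (norm (h * h) *\<^sub>R 1 - h * h) = (r * r) * norm (1 - g * g)" by simp
  ultimately show ?thesis using r by (simp add: mult_left_le)
qed simp

lemma pos_square: "cstar h = h \<Longrightarrow> pos (h * h)"
  using norm_diff_square_le[of h] unfolding pos_def
  by (auto simp: cstar_mult intro!: exI[of _ "norm (h * h)"])

text \<open>The witness in \<open>pos\<close> may always be the norm, since \<open>a\<close> is the
  square of its root and the estimate for squares applies. Without a quantifier, the condition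
  passes to limits.\<close>

lemma pos_iff_norm: "pos a \<longleftrightarrow> cstar a = a \<and> norm (norm a *\<^sub>R 1 - a) \<le> norm a"
proof
  assume a: "pos a"
  then obtain h where "pos h" "h * h = a" using pos_sqrt by blast
  then show "cstar a = a \<and> norm (norm a *\<^sub>R 1 - a) \<le> norm a"
    using norm_diff_square_le[OF pos_cstar] pos_cstar[OF a] by blast
next
  assume "cstar a = a \<and> norm (norm a *\<^sub>R 1 - a) \<le> norm a"
  then show "pos a" unfolding pos_def by (intro conjI exI[of _ "norm a"]) auto
qed

lemma pos_norm_minus:
  assumes "cstar a = a"
  shows "pos (norm a *\<^sub>R 1 - a)"
proof -
  have "norm (norm a *\<^sub>R 1 - (norm a *\<^sub>R 1 - a)) \<le> norm a" by simp
  then show ?thesis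
    unfolding pos_def using assms
    by (intro conjI exI[of _ "norm a"]) (auto simp: cstar_diff cstar_scaleR cstar_one)
qed

lemma pos_Lim:
  assumes "F \<noteq> bot" "(f \<longlongrightarrow> a) F" "\<forall>\<^sub>F x in F. pos (f x)"
  shows "pos a"
proof -
  have "((\<lambda>x. cstar (f x)) \<longlongrightarrow> cstar a) F" by (rule tendsto_cstar[OF assms(2)])
  moreover have "((\<lambda>x. cstar (f x)) \<longlongrightarrow> a) F"
    using assms(3) by (intro Lim_transform_eventually[OF assms(2)]) (auto elim!: eventually_mono simp: pos_cstar)
  ultimately have "cstar a = a" using assms(1) tendsto_unique by blast
  moreover have "norm (norm a *\<^sub>R 1 - a) \<le> norm a"
  proof (rule tendsto_le[OF assms(1)])
    show "((\<lambda>x. norm (f x)) \<longlongrightarrow> norm a) F" by (intro tendsto_intros assms)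
    show "((\<lambda>x. norm (norm (f x) *\<^sub>R 1 - f x)) \<longlongrightarrow> norm (norm a *\<^sub>R 1 - a)) F"
      by (intro tendsto_intros assms)
    show "\<forall>\<^sub>F x in F. norm (norm (f x) *\<^sub>R 1 - f x) \<le> norm (f x)"
      using assms(3) by eventually_elim (simp add: pos_iff_norm)
  qed
  ultimately show ?thesis by (simp add: pos_iff_norm)
qed

text \<open>The roots \<open>w\<close> of \<open>a\<close> and \<open>v\<close> of
  \<open>1 - a\<close> commute and satisfy \<open>w * w + v * v = 1\<close>, so \<open>w\<close> is
  the real part of a unitary.\<close>

lemma pos_le_1:
  fixes a :: "'b::unital_cstar"
  assumes "pos a" "pos (1 - a)"
  shows "norm a \<le> 1"
proof -
  obtain w where w: "pos w" "w * w = a" "\<And>y. y * a = a * y \<Longrightarrow> y * w = w * y"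
    using pos_sqrt[OF assms(1)] by blast
  obtain v where v: "pos v" "v * v = 1 - a" "\<And>y. y * (1 - a) = (1 - a) * y \<Longrightarrow> y * v = v * y"
    using pos_sqrt[OF assms(2)] by blast
  have "w * a = a * w" using w(2) by (auto simp: mult.assoc)
  then have "w * v = v * w" using v(3)[of w] by (simp add: algebra_simps)
  then have "norm w \<le> 1" using norm_le_1_if_squares[of w v] w(1,2) v(1,2) by (simp add: pos_cstar)
  then show ?thesis using w(2) norm_selfadjoint_square[OF pos_cstar[OF w(1)]] by (simp add: power_le_one)
qed

lemma pos_norm_le:
  assumes "pos a" "pos (r *\<^sub>R 1 - a)" "r \<ge> 0"
  shows "norm a \<le> r"
proof (rule field_le_epsilon)
  fix e :: real assume e: "e > 0"
  \<comment> \<open>The slack \<open>e\<close> keeps \<open>c\<close> positive when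
    \<open>r = 0\<close>, so that division by \<open>c\<close> reduces the claim to
    \<open>pos_le_1\<close>.\<close>
  define c where "c = r + e"
  have c: "c > 0" using assms e by (simp add: c_def)
  have "c *\<^sub>R 1 - a = (r *\<^sub>R 1 - a) + e *\<^sub>R 1" by (simp add: c_def algebra_simps)
  then have "pos (c *\<^sub>R 1 - a)" using pos_add[OF assms(2) pos_scalar[of e]] e by (simp only: less_imp_le)
  then have "pos ((1/c) *\<^sub>R (c *\<^sub>R 1 - a))" by (rule pos_scaleR) (use c in simp)
  then have "pos (1 - (1/c) *\<^sub>R a)" using c by (simp add: algebra_simps)
  moreover have "pos ((1/c) *\<^sub>R a)" using pos_scaleR[OF assms(1)] c by simp
  ultimately have "norm ((1/c) *\<^sub>R a) \<le> 1" by (intro pos_le_1)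
  then have "norm a / c \<le> 1" using c by simp
  then show "norm a \<le> r + e" using c by (simp add: c_def field_simps)
qed

lemma pos_norm_mono:
  assumes "pos a" "pos (b - a)"
  shows "norm a \<le> norm b"
proof -
  have b: "cstar b = b"
    using pos_add[OF assms(2,1)] by (simp add: pos_cstar)
  have "pos ((norm b *\<^sub>R 1 - b) + (b - a))" by (intro pos_add pos_norm_minus b assms)
  then show ?thesis using pos_norm_le[OF assms(1), of "norm b"] by simp
qed

lemma pos_antisym: "pos a \<Longrightarrow> pos (- a) \<Longrightarrow> a = 0"
  using pos_norm_mono[of a 0] by simp

text \<open>A spectral radius argument. If \<open>q = (1 + d) t\<close> with \<open>d > 0\<close>,
  Bernoulli's inequality at the exponent \<open>2 ^ n\<close>, squared, makes the power at
  \<open>2 ^ Suc n\<close> grow quadratically in \<open>2 ^ n\<close>, which beats the linear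
  factor. Powers of two are the exponents at which norms of self-adjoint elements are
  multiplicative.\<close>

lemma pow2_root_le:
  fixes q t K :: real
  assumes "q \<ge> 0" "t > 0" and b: "\<And>n. q ^ (2 ^ n) \<le> t ^ (2 ^ n) * (1 + 2 ^ n * K)"
  shows "q \<le> t"
proof (rule ccontr)
  assume "\<not> q \<le> t"
  define d where "d = q / t - 1"
  have d: "d > 0" using \<open>\<not> q \<le> t\<close> assms by (simp add: d_def)
  have lower: "(q / t) ^ (2 ^ n) \<le> 1 + 2 ^ n * K" for n
    using b[of n] assms by (simp add: power_divide field_simps)
  have "(2 ^ n * d)\<^sup>2 \<le> 1 + 2 ^ n * (2 * K)" for n :: nat
  proof -
    have "1 + real (2 ^ n) * d \<le> (1 + d) ^ (2 ^ n)" using d by (intro Bernoulli_inequality) simp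
    then have "2 ^ n * d \<le> (q / t) ^ (2 ^ n)" by (simp add: d_def)
    then have "(2 ^ n * d)\<^sup>2 \<le> ((q / t) ^ (2 ^ n))\<^sup>2" using d by (intro power_mono) auto
    also have "\<dots> = (q / t) ^ (2 ^ Suc n)" by (simp add: mult.commute flip: power_mult)
    finally show ?thesis using lower[of "Suc n"] by (simp add: mult_ac)
  qed
  then have *: "2 ^ n * d\<^sup>2 \<le> 1 + 2 * \<bar>K\<bar>" for n :: nat
  proof -
    have "2 ^ n * (2 ^ n * d\<^sup>2) \<le> 1 + 2 ^ n * (2 * K)"
      using \<open>(2 ^ n * d)\<^sup>2 \<le> 1 + 2 ^ n * (2 * K)\<close> by (simp add: power2_eq_square mult_ac)
    moreover have "2 ^ n * (2 * K) \<le> 2 ^ n * (2 * \<bar>K\<bar>)" by (intro mult_left_mono) auto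
    moreover have "2 ^ n * (1 + 2 * \<bar>K\<bar>) = 2 ^ n + 2 ^ n * (2 * \<bar>K\<bar>)" by (simp add: ring_distribs)
    ultimately have "2 ^ n * (2 ^ n * d\<^sup>2) \<le> 2 ^ n * (1 + 2 * \<bar>K\<bar>)"
      using two_realpow_ge_one[of n] by linarith
    then show ?thesis by simp
  qed
  obtain n where "(1 + 2 * \<bar>K\<bar>) / d\<^sup>2 < 2 ^ n" using real_arch_pow[of 2] by auto
  then show False using *[of n] d by (simp add: field_simps)
qed

lemma norm_pow2_selfadjoint:
  "cstar h = h \<Longrightarrow> norm ((h::'b::unital_cstar) ^ (2 ^ n)) = norm h ^ (2 ^ n)"
proof (induction n)
  case (Suc n)
  have "norm (h ^ (2 ^ Suc n)) = norm (h ^ (2 ^ n) * h ^ (2 ^ n))"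
    by (simp add: mult_2 flip: power_add)
  also have "\<dots> = (norm h ^ (2 ^ n))\<^sup>2"
    using Suc by (subst norm_selfadjoint_square) (auto simp: cstar_power)
  finally show ?case by (simp add: mult.commute flip: power_mult)
qed simp

text \<open>The nonzero spectra of \<open>y\<^sup>* y\<close> and \<open>y y\<^sup>*\<close> agree; here in the form
  \<open>(t + y y\<^sup>*)\<^sup>n = t\<^sup>n + y q\<^sub>n y\<^sup>*\<close> with \<open>norm q\<^sub>n \<le> n t\<^sup>n\<^sup>-\<^sup>1\<close>.\<close>

lemma pos_minus_swap:
  fixes y :: "'b::unital_cstar"
  assumes "pos (- (cstar y * y))"
  shows "pos (- (y * cstar y))"
proof -
  \<comment> \<open>\<open>t\<close> dominates the norm of \<open>cstar y * y\<close>, and the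
    summand 1 gives \<open>t \<ge> 1\<close>, so that the cruder bound \<open>n t ^ n\<close> on
    \<open>q\<close> closes the induction.\<close>
  define t where "t = (norm y)\<^sup>2 + 1"
  have t: "t > 0" "t \<ge> 1" by (auto simp: t_def add_nonneg_pos)
  define z where "z = cstar y * y"
  have "pos (- z)" using assms by (simp add: z_def)
  have "norm z \<le> t" using cstar_identity[of y] by (simp add: z_def t_def)
  have "norm (norm z *\<^sub>R 1 - (- z)) \<le> norm z"
    using \<open>pos (- z)\<close> by (simp add: pos_iff_norm)
  moreover have "t *\<^sub>R 1 + z = (norm z *\<^sub>R 1 + z) + (t - norm z) *\<^sub>R 1"
    by (simp add: scaleR_left_diff_distrib)
  then have "norm (t *\<^sub>R 1 + z) \<le> norm (norm z *\<^sub>R 1 + z) + norm ((t - norm z) *\<^sub>R (1::'b))"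
    by (metis norm_triangle_ineq)
  moreover have "norm ((t - norm z) *\<^sub>R (1::'b)) \<le> t - norm z"
    using mult_left_le[OF norm_one_le[where 'b = 'b], of "t - norm z"] \<open>norm z \<le> t\<close> by simp
  ultimately have A: "norm (t *\<^sub>R 1 + z) \<le> t" by simp
  define s where "s = t *\<^sub>R 1 + y * cstar y"
  have "\<exists>q. s ^ n = t ^ n *\<^sub>R 1 + y * q * cstar y \<and> norm q \<le> real n * t ^ n" for n
  proof (induction n)
    case (Suc n)
    then obtain q where q: "s ^ n = t ^ n *\<^sub>R 1 + y * q * cstar y" "norm q \<le> real n * t ^ n" by blast
    \<comment> \<open>Moving \<open>s\<close> past \<open>y\<close> by
      \<open>s * y = y * (t *\<^sub>R 1 + z)\<close> produces the factor
      \<open>t *\<^sub>R 1 + z\<close>, which has norm at most \<open>t\<close> because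
      \<open>- z\<close> is positive.\<close>
    let ?q = "t ^ n *\<^sub>R 1 + (t *\<^sub>R 1 + z) * q"
    have "s ^ Suc n = t ^ Suc n *\<^sub>R 1 + y * ?q * cstar y"
      unfolding power_Suc q(1) by (simp add: s_def z_def algebra_simps)
    moreover have "norm ?q \<le> real (Suc n) * t ^ Suc n"
    proof -
      have "norm ?q \<le> norm (t ^ n *\<^sub>R (1::'b)) + norm ((t *\<^sub>R 1 + z) * q)" by (rule norm_triangle_ineq)
      also have "norm (t ^ n *\<^sub>R (1::'b)) \<le> t ^ n"
        using t norm_one_le[where 'b = 'b] by (simp add: mult_left_le)
      also have "t ^ n \<le> t ^ Suc n" using t by simp
      also have "norm ((t *\<^sub>R 1 + z) * q) \<le> t * (real n * t ^ n)"
        using A q(2) t by (intro order_trans[OF norm_mult_ineq] mult_mono) auto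
      finally show ?thesis by (simp add: algebra_simps)
    qed
    ultimately show ?case by blast
  qed (auto intro!: exI[of _ 0])
  then have B: "norm (s ^ n) \<le> t ^ n * (1 + real n * (norm y)\<^sup>2)" for n
  proof -
    obtain q where q: "s ^ n = t ^ n *\<^sub>R 1 + y * q * cstar y" "norm q \<le> real n * t ^ n"
      using \<open>\<exists>q. s ^ n = t ^ n *\<^sub>R 1 + y * q * cstar y \<and> norm q \<le> real n * t ^ n\<close> by blast
    have "norm (s ^ n) \<le> norm (t ^ n *\<^sub>R (1::'b)) + norm (y * q * cstar y)"
      unfolding q(1) by (rule norm_triangle_ineq)
    also have "norm (t ^ n *\<^sub>R (1::'b)) \<le> t ^ n"
      using t norm_one_le[where 'b = 'b] by (simp add: mult_left_le)
    also have "norm (y * q * cstar y) \<le> norm y * norm q * norm (cstar y)"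
      by (meson mult_right_mono norm_ge_zero norm_mult_ineq order_trans)
    also have "\<dots> \<le> norm y * (real n * t ^ n) * norm y"
      using q(2) by (simp add: norm_cstar mult_left_mono mult_right_mono)
    finally show ?thesis by (simp add: algebra_simps power2_eq_square)
  qed
  have ss: "cstar s = s" by (simp add: s_def cstar_add cstar_scaleR cstar_one cstar_mult cstar_cstar)
  have "norm s \<le> t"
  proof (rule pow2_root_le[where K = "(norm y)\<^sup>2"])
    show "norm s ^ 2 ^ n \<le> t ^ 2 ^ n * (1 + 2 ^ n * (norm y)\<^sup>2)" for n
      using B[of "2 ^ n"] norm_pow2_selfadjoint[OF ss, of n] by simp
  qed (use t in auto)
  then show ?thesis
    unfolding pos_def s_def using t
    by (auto simp: cstar_minus cstar_mult cstar_cstar intro!: exI[of _ t])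
qed

text \<open>With \<open>h\<close> and \<open>k\<close> twice the real and, up to sign, twice the
  imaginary part of \<open>y\<close>, the sum is half of \<open>h * h + k * k\<close>.\<close>

lemma pos_plus_swap:
  fixes y :: "'b::unital_cstar"
  shows "pos (cstar y * y + y * cstar y)"
proof -
  define h where "h = y + cstar y"
  define k where "k = scaleC \<i> (y - cstar y)"
  have "cstar h = h" by (simp add: h_def cstar_add cstar_cstar add.commute)
  moreover have "cstar k = k" by (simp add: k_def cstar_scaleC cstar_diff cstar_cstar scaleC_simps)
  ultimately have "pos (h * h + k * k)" by (intro pos_add pos_square)
  moreover have "h * h + k * k = 2 *\<^sub>R (cstar y * y + y * cstar y)"
    by (simp add: h_def k_def scaleC_simps algebra_simps scaleR_2)
  ultimately show ?thesis using pos_scaleR[of "h * h + k * k" "1/2"] by simp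
qed

text \<open>Kaplansky's argument: with \<open>v = \<bar>x\<bar>\<close> and \<open>d = v - x\<close> twice the negative part of
  \<open>x = a\<^sup>* a\<close>, the element \<open>y = a d\<close> satisfies \<open>y\<^sup>* y = - v d\<^sup>2 \<le> 0\<close>, which forces \<open>d = 0\<close>.\<close>

lemma pos_cstar_mult_self:
  fixes a :: "'b::unital_cstar"
  shows "pos (cstar a * a)"
proof -
  define x where "x = cstar a * a"
  have sx: "cstar x = x" by (simp add: x_def cstar_mult cstar_cstar)
  obtain v where v: "pos v" "v * v = x * x" "\<And>y. y * (x * x) = (x * x) * y \<Longrightarrow> y * v = v * y"
    using pos_sqrt[OF pos_square[OF sx]] by blast
  \<comment> \<open>This second root exhibits \<open>v * d * d\<close> as the square of the
    self-adjoint element \<open>r * d\<close>.\<close>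
  obtain r where r: "pos r" "r * r = v" "\<And>y. y * v = v * y \<Longrightarrow> y * r = r * y"
    using pos_sqrt[OF v(1)] by blast
  have xv: "x * v = v * x" by (rule v(3)) (rule mult.assoc[symmetric])
  define d where "d = v - x"
  have sd: "cstar d = d" using v(1) sx by (simp add: d_def cstar_diff pos_cstar)
  have "d * v = v * d" using xv by (simp add: d_def algebra_simps)
  then have rd: "d * r = r * d" by (rule r(3))
  have xd: "x * d = - (v * d)" using xv v(2) by (simp add: d_def algebra_simps)
  have vdd: "v * d * d = (r * d) * (r * d)"
    unfolding r(2)[symmetric] by (metis mult.assoc rd)
  define y where "y = a * d"
  have "cstar y * y = d * (x * d)" by (simp add: y_def x_def cstar_mult sd mult.assoc)
  also have "\<dots> = - (v * d * d)" unfolding xd using \<open>d * v = v * d\<close> by (simp add: mult.assoc[symmetric])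
  finally have yy: "cstar y * y = - (v * d * d)" .
  have "cstar (r * d) = r * d" by (simp add: cstar_mult sd pos_cstar[OF r(1)] rd)
  then have "pos (v * d * d)" unfolding vdd by (rule pos_square)
  then have "pos (- (y * cstar y))" by (intro pos_minus_swap) (simp add: yy)
  \<comment> \<open>Subtracting \<open>cstar y * y = - (v * d * d)\<close> from the positive sum of
    \<open>pos_plus_swap\<close> leaves \<open>y * cstar y\<close>. The swap gave the opposite sign,
    so it vanishes.\<close>
  moreover have "pos (y * cstar y)"
    using pos_add[OF pos_plus_swap[of y] \<open>pos (v * d * d)\<close>] by (simp add: yy)
  ultimately have "y * cstar y = 0" using pos_antisym by blast
  then have "y = 0" using cstar_identity[of "cstar y"] by (simp add: cstar_cstar norm_cstar)
  then have "v * d * d = 0" using yy by (simp add: cstar_zero)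
  \<comment> \<open>Since \<open>v * v = x * x\<close>, the cube of \<open>d\<close> is twice
    \<open>v * d * d = 0\<close>, and a self-adjoint element with a vanishing power is 0.\<close>
  moreover have "d * d = v * d + v * d"
    using xv v(2) by (simp add: d_def algebra_simps)
  then have "d * d * d = (v * d + v * d) * d" by simp
  then have "d * d * d = v * d * d + v * d * d" by (simp add: ring_distribs)
  ultimately have "(d * d) * (d * d) = 0" by (simp add: mult.assoc[symmetric])
  then have "norm (d * d) = 0" using norm_selfadjoint_square[of "d * d"] by (simp add: cstar_mult sd)
  then have "d = 0" using norm_selfadjoint_square[OF sd] by simp
  then show ?thesis using v(1) by (simp add: d_def x_def)
qed

lemma pos_conj: assumes "pos a" shows "pos (cstar b * a * b)"
proof -
  obtain h where h: "pos h" "h * h = a" using pos_sqrt[OF assms] by blast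
  then have "cstar b * a * b = cstar (h * b) * (h * b)"
    by (simp add: cstar_mult pos_cstar mult.assoc flip: h(2))
  then show ?thesis by (simp add: pos_cstar_mult_self)
qed

text \<open>A closed cone of matrices that contains the matrices \<open>C\<^sup>* C\<close>; working with it avoids the
  C*-algebra structure of matrices.\<close>

definition gram_pos :: "nat \<Rightarrow> (nat \<Rightarrow> nat \<Rightarrow> 'b::unital_cstar) \<Rightarrow> bool" where
  "gram_pos m A \<longleftrightarrow> (\<forall>e>0. \<exists>r C. \<forall>i<m. \<forall>k<m.
     norm (A i k - (\<Sum>l<(r::nat). cstar (C l i) * C l k)) < e)"

lemma gram_posE:
  assumes "gram_pos m A" "e > 0"
  obtains r :: nat and C
  where "\<And>i k. i < m \<Longrightarrow> k < m \<Longrightarrow> norm (A i k - (\<Sum>l<r. cstar (C l i) * C l k)) < e"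
  using assms unfolding gram_pos_def by blast

lemma gram_posI: "(\<And>i k. i < m \<Longrightarrow> k < m \<Longrightarrow> A i k = (\<Sum>l<(r::nat). cstar (C l i) * C l k)) \<Longrightarrow> gram_pos m A"
  unfolding gram_pos_def by (intro allI impI exI[of _ r] exI[of _ C]) simp

lemma gram_pos_rank1: "gram_pos m (\<lambda>i k. cstar (c i) * c k)"
  by (rule gram_posI[where r = 1 and C = "\<lambda>_. c"]) simp

lemma gram_pos_cong: "(\<And>i k. i < m \<Longrightarrow> k < m \<Longrightarrow> A i k = B i k) \<Longrightarrow> gram_pos m A = gram_pos m B"
  unfolding gram_pos_def by simp

lemma gram_pos_limit:
  assumes "\<And>e. e > 0 \<Longrightarrow> \<exists>B. gram_pos m B \<and> (\<forall>i<m. \<forall>k<m. norm (A i k - B i k) < e)"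
  shows "gram_pos m A"
  unfolding gram_pos_def
proof (intro allI impI)
  fix e :: real assume "e > 0"
  then obtain B where B: "gram_pos m B" "\<forall>i<m. \<forall>k<m. norm (A i k - B i k) < e / 2"
    using assms[of "e / 2"] by auto
  obtain r C where C: "\<And>i k. i < m \<Longrightarrow> k < m \<Longrightarrow> norm (B i k - (\<Sum>l<(r::nat). cstar (C l i) * C l k)) < e / 2"
    by (rule gram_posE[OF B(1) half_gt_zero[OF \<open>e > 0\<close>]]) blast
  show "\<exists>(r::nat) C. \<forall>i<m. \<forall>k<m. norm (A i k - (\<Sum>l<r. cstar (C l i) * C l k)) < e"
  proof (intro exI allI impI)
    fix i k assume "i < m" "k < m"
    then have "norm (A i k - B i k) < e / 2" "norm (B i k - (\<Sum>l<r. cstar (C l i) * C l k)) < e / 2"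
      using B C by auto
    then show "norm (A i k - (\<Sum>l<r. cstar (C l i) * C l k)) < e"
      using norm_triangle_ineq[of "A i k - B i k" "B i k - (\<Sum>l<r. cstar (C l i) * C l k)"] by simp
  qed
qed

lemma gram_pos_add:
  assumes "gram_pos m A" "gram_pos m B"
  shows "gram_pos m (\<lambda>i k. A i k + B i k)"
  unfolding gram_pos_def
proof (intro allI impI)
  fix e :: real assume "e > 0"
  obtain r C where C: "\<And>i k. i < m \<Longrightarrow> k < m \<Longrightarrow> norm (A i k - (\<Sum>l<(r::nat). cstar (C l i) * C l k)) < e / 2"
    by (rule gram_posE[OF assms(1) half_gt_zero[OF \<open>e > 0\<close>]]) blast
  obtain s D where D: "\<And>i k. i < m \<Longrightarrow> k < m \<Longrightarrow> norm (B i k - (\<Sum>l<(s::nat). cstar (D l i) * D l k)) < e / 2"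
    by (rule gram_posE[OF assms(2) half_gt_zero[OF \<open>e > 0\<close>]]) blast
  define E where "E = (\<lambda>l. if l < r then C l else D (l - r))"
  have E: "(\<Sum>l<r + s. cstar (E l i) * E l k) =
      (\<Sum>l<r. cstar (C l i) * C l k) + (\<Sum>l<s. cstar (D l i) * D l k)" for i k
  proof -
    have "(\<Sum>l<r + s. cstar (E l i) * E l k) =
      (\<Sum>l<r. cstar (E l i) * E l k) + (\<Sum>l<s. cstar (E (l + r) i) * E (l + r) k)"
      by (induction s) (auto simp: add_ac)
    then show ?thesis by (simp add: E_def)
  qed
  show "\<exists>(r::nat) C. \<forall>i<m. \<forall>k<m. norm (A i k + B i k - (\<Sum>l<r. cstar (C l i) * C l k)) < e"
  proof (intro exI[of _ "r + s"] exI[of _ E] allI impI)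
    fix i k assume "i < m" "k < m"
    then have "norm (A i k - (\<Sum>l<r. cstar (C l i) * C l k)) < e / 2"
       "norm (B i k - (\<Sum>l<s. cstar (D l i) * D l k)) < e / 2" using C D by auto
    then show "norm (A i k + B i k - (\<Sum>l<r + s. cstar (E l i) * E l k)) < e"
      unfolding E using norm_triangle_ineq[of "A i k - (\<Sum>l<r. cstar (C l i) * C l k)"
          "B i k - (\<Sum>l<s. cstar (D l i) * D l k)"] by (simp add: algebra_simps)
  qed
qed

lemma gram_pos_sum:
  assumes "\<And>x. x \<in> S \<Longrightarrow> gram_pos m (A x)"
  shows "gram_pos m (\<lambda>i k. \<Sum>x\<in>S. A x i k)"
  using assms
proof (induction S rule: infinite_finite_induct)
  case (insert x F)
  then show ?case using gram_pos_add[of m "A x" "\<lambda>i k. \<Sum>x\<in>F. A x i k"] by simp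
qed (use gram_pos_rank1[of m "\<lambda>_. 0"] in simp_all)

text \<open>A Gram matrix with rows \<open>C l\<close> becomes the Gram matrix with entries
  \<open>\<Sum>a<n. C l a * c i a\<close>, so only the approximation error needs care.\<close>

lemma gram_pos_compress:
  assumes "gram_pos n A"
  shows "gram_pos m (\<lambda>i k. \<Sum>a<n. \<Sum>b<n. cstar (c i a) * A a b * c k b)"
proof (rule gram_pos_limit)
  fix e :: real assume "e > 0"
  \<comment> \<open>Bounds the total weight with which errors in \<open>A\<close> enter any one
    entry of the result; the 1 makes it positive.\<close>
  define M where "M = 1 + (\<Sum>i<m. \<Sum>k<m. \<Sum>a<n. \<Sum>b<n. norm (c i a) * norm (c k b))"
  have M: "M > 0" unfolding M_def by (intro add_pos_nonneg sum_nonneg mult_nonneg_nonneg) auto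
  obtain r C where C: "\<And>a b. a < n \<Longrightarrow> b < n \<Longrightarrow> norm (A a b - (\<Sum>l<(r::nat). cstar (C l a) * C l b)) < e / M"
    by (rule gram_posE[OF assms divide_pos_pos[OF \<open>e > 0\<close> M]]) blast
  define B where "B = (\<lambda>a b. \<Sum>l<r. cstar (C l a) * C l b)"
  let ?G = "\<lambda>i k. \<Sum>a<n. \<Sum>b<n. cstar (c i a) * B a b * c k b"
  have "?G i k = (\<Sum>l<r. cstar (\<Sum>a<n. C l a * c i a) * (\<Sum>b<n. C l b * c k b))" for i k
  proof -
    have "?G i k = (\<Sum>a<n. \<Sum>b<n. \<Sum>l<r. cstar (C l a * c i a) * (C l b * c k b))"
      by (simp add: B_def sum_distrib_left sum_distrib_right cstar_mult mult.assoc)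
    also have "\<dots> = (\<Sum>a<n. \<Sum>l<r. \<Sum>b<n. cstar (C l a * c i a) * (C l b * c k b))"
      by (rule sum.cong[OF HOL.refl], rule sum.swap)
    also have "\<dots> = (\<Sum>l<r. \<Sum>a<n. \<Sum>b<n. cstar (C l a * c i a) * (C l b * c k b))"
      by (rule sum.swap)
    finally show ?thesis by (simp add: cstar_sum sum_product)
  qed
  then have "gram_pos m ?G" by (intro gram_posI) auto
  moreover have "norm ((\<Sum>a<n. \<Sum>b<n. cstar (c i a) * A a b * c k b) - ?G i k) < e"
    if "i < m" "k < m" for i k
  proof -
    have "(\<Sum>a<n. \<Sum>b<n. cstar (c i a) * A a b * c k b) - ?G i k =
        (\<Sum>a<n. \<Sum>b<n. cstar (c i a) * (A a b - B a b) * c k b)"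
      by (simp add: algebra_simps sum_subtractf)
    also have "norm \<dots> \<le> (\<Sum>a<n. \<Sum>b<n. norm (c i a) * norm (c k b) * (e / M))"
    proof (intro sum_norm_le)
      fix a b assume "a \<in> {..<n}" "b \<in> {..<n}"
      then have "norm (A a b - B a b) \<le> e / M" using C[of a b] by (simp add: B_def)
      moreover have "norm (cstar (c i a) * (A a b - B a b) * c k b) \<le>
          norm (cstar (c i a)) * norm (A a b - B a b) * norm (c k b)"
        by (meson mult_right_mono norm_ge_zero norm_mult_ineq order_trans)
      moreover have "norm (cstar (c i a)) * norm (A a b - B a b) * norm (c k b) \<le>
          norm (c i a) * (e / M) * norm (c k b)"
        using \<open>norm (A a b - B a b) \<le> e / M\<close> unfolding norm_cstar
        by (intro mult_left_mono mult_right_mono) auto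
      ultimately show "norm (cstar (c i a) * (A a b - B a b) * c k b) \<le> norm (c i a) * norm (c k b) * (e / M)"
        by (simp add: mult_ac)
    qed
    also have "\<dots> = (\<Sum>a<n. \<Sum>b<n. norm (c i a) * norm (c k b)) * (e / M)"
      by (simp only: sum_distrib_right)
    also have "\<dots> < M * (e / M)"
    proof (intro mult_strict_right_mono)
      have "(\<Sum>a<n. \<Sum>b<n. norm (c i a) * norm (c k b)) \<le>
         (\<Sum>k<m. \<Sum>a<n. \<Sum>b<n. norm (c i a) * norm (c k b))"
        using that by (intro member_le_sum) (auto intro!: sum_nonneg)
      also have "\<dots> \<le> (\<Sum>i<m. \<Sum>k<m. \<Sum>a<n. \<Sum>b<n. norm (c i a) * norm (c k b))"
        using that by (intro member_le_sum) (auto intro!: sum_nonneg)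
      finally show "(\<Sum>a<n. \<Sum>b<n. norm (c i a) * norm (c k b)) < M" by (simp add: M_def)
    qed (use \<open>e > 0\<close> M in simp)
    finally show ?thesis using M by simp
  qed
  ultimately show "\<exists>B. gram_pos m B \<and>
      (\<forall>i<m. \<forall>k<m. norm ((\<Sum>a<n. \<Sum>b<n. cstar (c i a) * A a b * c k b) - B i k) < e)"
    by blast
qed

text \<open>Here positivity of \<open>cstar a * a\<close> is spent: the approximating diagonal
  entries are sums of such elements, and \<open>pos\<close> is closed.\<close>

lemma gram_pos_diag:
  assumes "gram_pos m A" "i < m"
  shows "pos (A i i)"
proof -
  have "\<exists>a. norm (A i i - a) < 1 / real (Suc n) \<and> pos a" for n
  proof -
    have "1 / real (Suc n) > 0" by simp
    then obtain r C where "\<And>i k. i < m \<Longrightarrow> k < m \<Longrightarrow>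
        norm (A i k - (\<Sum>l<(r::nat). cstar (C l i) * C l k)) < 1 / real (Suc n)"
      by (rule gram_posE[OF assms(1)]) blast
    then show ?thesis using assms(2)
      by (intro exI[of _ "\<Sum>l<r. cstar (C l i) * C l i"]) (auto intro!: pos_sum pos_cstar_mult_self)
  qed
  then obtain a where a: "\<And>n. norm (A i i - a n) < 1 / real (Suc n)" "\<And>n. pos (a n)" by metis
  have "(\<lambda>n. A i i - a n) \<longlonglongrightarrow> 0"
    by (rule LIMSEQ_norm_0) (use a(1) in \<open>auto simp: less_imp_le\<close>)
  then have "(\<lambda>n. A i i - (A i i - a n)) \<longlonglongrightarrow> A i i - 0" by (intro tendsto_intros)
  then show ?thesis using a(2) by (intro pos_Lim[of sequentially a]) auto
qed

section \<open>Correspondences with degenerate inner product\<close>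

text \<open>All module axioms are required only after pairing with arbitrary vectors, so that they also
  hold for the formal objects before separation.\<close>

locale precorr =
  fixes H :: "('b::unital_cstar, 'h) corr"
  assumes nul_closed: "nul H \<in> carr H"
    and add_closed: "h \<in> carr H \<Longrightarrow> k \<in> carr H \<Longrightarrow> add H h k \<in> carr H"
    and lact_closed: "h \<in> carr H \<Longrightarrow> lact H b h \<in> carr H"
    and ract_closed: "h \<in> carr H \<Longrightarrow> ract H h b \<in> carr H"
    and inn_nul: "h \<in> carr H \<Longrightarrow> inn H h (nul H) = 0"
    and inn_add: "h \<in> carr H \<Longrightarrow> k \<in> carr H \<Longrightarrow> l \<in> carr H \<Longrightarrow>
      inn H h (add H k l) = inn H h k + inn H h l"
    and inn_ract: "h \<in> carr H \<Longrightarrow> k \<in> carr H \<Longrightarrow> inn H h (ract H k b) = inn H h k * b"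
    and inn_star: "h \<in> carr H \<Longrightarrow> k \<in> carr H \<Longrightarrow> cstar (inn H h k) = inn H k h"
    and inn_lact: "h \<in> carr H \<Longrightarrow> k \<in> carr H \<Longrightarrow> inn H h (lact H b k) = inn H (lact H (cstar b) h) k"
    and inn_lact_add: "h \<in> carr H \<Longrightarrow> k \<in> carr H \<Longrightarrow>
      inn H h (lact H (a + b) k) = inn H h (lact H a k) + inn H h (lact H b k)"
    and inn_lact_mult: "h \<in> carr H \<Longrightarrow> k \<in> carr H \<Longrightarrow>
      inn H h (lact H (a * b) k) = inn H h (lact H a (lact H b k))"
    and inn_lact_scalar: "h \<in> carr H \<Longrightarrow> k \<in> carr H \<Longrightarrow>
      inn H h (lact H (scaleC c 1) k) = scaleC c (inn H h k)"
    and inn_gram: "(\<And>i. i < m \<Longrightarrow> f i \<in> carr H) \<Longrightarrow> gram_pos m (\<lambda>i k. inn H (f i) (f k))"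
begin

lemma inn_nul_left: "h \<in> carr H \<Longrightarrow> inn H (nul H) h = 0"
  using inn_nul[of h] inn_star[of h "nul H"] by (simp add: nul_closed cstar_zero)

lemma inn_add_left: "h \<in> carr H \<Longrightarrow> k \<in> carr H \<Longrightarrow> l \<in> carr H \<Longrightarrow>
    inn H (add H h k) l = inn H h l + inn H k l"
  using inn_add[of l h k] inn_star by (metis add_closed cstar_add)

lemma inn_ract_left: "h \<in> carr H \<Longrightarrow> k \<in> carr H \<Longrightarrow> inn H (ract H h b) k = cstar b * inn H h k"
  using inn_ract[of k h b] inn_star by (metis ract_closed cstar_mult)

lemma sub_closed: "h \<in> carr H \<Longrightarrow> k \<in> carr H \<Longrightarrow> sub H h k \<in> carr H"
  by (simp add: sub_def add_closed ract_closed)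

lemma inn_sub: "h \<in> carr H \<Longrightarrow> k \<in> carr H \<Longrightarrow> l \<in> carr H \<Longrightarrow>
    inn H h (sub H k l) = inn H h k - inn H h l"
  by (simp add: sub_def inn_add ract_closed inn_ract)

lemma inn_sub_left: "h \<in> carr H \<Longrightarrow> k \<in> carr H \<Longrightarrow> l \<in> carr H \<Longrightarrow>
    inn H (sub H h k) l = inn H h l - inn H k l"
  by (simp add: sub_def inn_add_left ract_closed inn_ract_left cstar_minus cstar_one)

lemma inn_lact_one: "h \<in> carr H \<Longrightarrow> k \<in> carr H \<Longrightarrow> inn H h (lact H 1 k) = inn H h k"
  using inn_lact_scalar[of h k 1] by (metis of_real_1 scaleC_of_real scaleR_one)

lemma inn_lact_scaleR: "h \<in> carr H \<Longrightarrow> k \<in> carr H \<Longrightarrow>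
    inn H h (lact H (r *\<^sub>R 1) k) = r *\<^sub>R inn H h k"
  using inn_lact_scalar[of h k "complex_of_real r"] by (simp add: scaleC_of_real)

lemma inn_lact_diff: "h \<in> carr H \<Longrightarrow> k \<in> carr H \<Longrightarrow>
    inn H h (lact H (a - b) k) = inn H h (lact H a k) - inn H h (lact H b k)"
  using inn_lact_add[of h k "a - b" b] by simp

lemma inn_lact_zero: "h \<in> carr H \<Longrightarrow> k \<in> carr H \<Longrightarrow> inn H h (lact H 0 k) = 0"
  using inn_lact_diff[of h k 0 0] by simp

lemmas closed = nul_closed add_closed lact_closed ract_closed sub_closed
lemmas inn_simps = inn_nul inn_nul_left inn_add inn_add_left inn_ract inn_ract_left inn_sub inn_sub_left

lemma pos_inn: "h \<in> carr H \<Longrightarrow> pos (inn H h h)"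
  using gram_pos_diag[OF inn_gram[of 1 "\<lambda>_. h"], of 0] by simp

lemma hnorm_nonneg: "hnorm H h \<ge> 0"
  by (simp add: hnorm_def)

lemma hnorm_square: "(hnorm H h)\<^sup>2 = norm (inn H h h)"
  by (simp add: hnorm_def)

text \<open>Expand the positive element \<open>\<langle>g, g\<rangle>\<close> for
  \<open>g = k - h s a\<close>, where \<open>a = \<langle>h, k\<rangle>\<close> and
  \<open>s = 1 / N\<close>, and estimate \<open>cstar a * \<langle>h, h\<rangle> * a\<close> by
  \<open>N\<close> times \<open>cstar a * a\<close>. The slack \<open>e\<close> in \<open>N\<close>
  keeps it positive when \<open>\<langle>h, h\<rangle> = 0\<close>.\<close>

lemma cauchy_schwarz:
  assumes h: "h \<in> carr H" and k: "k \<in> carr H"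
  shows "norm (inn H h k) \<le> hnorm H h * hnorm H k"
proof -
  define a where "a = inn H h k"
  have as: "inn H k h = cstar a" using inn_star[OF h k] by (simp add: a_def)
  have main: "norm (cstar a * a) \<le> (norm (inn H h h) + e) * norm (inn H k k)" if e: "e > 0" for e
  proof -
    define N where "N = norm (inn H h h) + e"
    have N: "N > 0" using e by (simp add: N_def add_nonneg_pos)
    define s where "s = 1 / N"
    have s: "s > 0" "s * N = 1" using N by (auto simp: s_def)
    define g where "g = sub H k (ract H h (s *\<^sub>R a))"
    have "inn H g g = inn H k k - (2 * s) *\<^sub>R (cstar a * a) + (s * s) *\<^sub>R (cstar a * inn H h h * a)"
      using h k by (simp add: g_def inn_simps closed as cstar_scaleR scaleR_2 algebra_simps
          flip: a_def scaleR_scaleR)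
    moreover have "pos (inn H g g)" by (rule pos_inn) (simp add: g_def closed h k)
    ultimately have p1: "pos (inn H k k - (2 * s) *\<^sub>R (cstar a * a) + (s * s) *\<^sub>R (cstar a * inn H h h * a))"
      by simp
    have "N *\<^sub>R 1 - inn H h h = (norm (inn H h h) *\<^sub>R 1 - inn H h h) + e *\<^sub>R 1"
      by (simp add: N_def scaleR_left_distrib)
    then have "pos (N *\<^sub>R 1 - inn H h h)"
      using pos_add[OF pos_norm_minus[OF pos_cstar[OF pos_inn[OF h]]] pos_scalar[of e]] e by (simp only: less_imp_le)
    then have "pos (cstar a * (N *\<^sub>R 1 - inn H h h) * a)" by (rule pos_conj)
    then have p2: "pos ((s * s) *\<^sub>R (cstar a * (N *\<^sub>R 1 - inn H h h) * a))"
      by (rule pos_scaleR) (use s in simp)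
    have "(s * s) *\<^sub>R (cstar a * (N *\<^sub>R 1 - inn H h h) * a) =
        (s * (s * N)) *\<^sub>R (cstar a * a) - (s * s) *\<^sub>R (cstar a * inn H h h * a)"
      by (simp add: algebra_simps)
    then have p2': "pos (s *\<^sub>R (cstar a * a) - (s * s) *\<^sub>R (cstar a * inn H h h * a))"
      using p2 s(2) by simp
    have "pos (inn H k k - s *\<^sub>R (cstar a * a))"
      using pos_add[OF p1 p2'] by (simp add: algebra_simps scaleR_2 flip: scaleR_scaleR)
    then have "norm (s *\<^sub>R (cstar a * a)) \<le> norm (inn H k k)"
      using s by (intro pos_norm_mono pos_scaleR pos_cstar_mult_self) auto
    then have "N * (s * norm (cstar a * a)) \<le> N * norm (inn H k k)"
      using s N by (intro mult_left_mono) auto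
    then show ?thesis using s by (simp add: N_def[symmetric] mult.assoc[symmetric] mult.commute)
  qed
  have "norm (cstar a * a) \<le> norm (inn H h h) * norm (inn H k k)"
  proof (rule field_le_epsilon)
    fix e :: real assume e: "e > 0"
    define d where "d = e / (norm (inn H k k) + 1)"
    have d: "d > 0" using e by (auto simp: d_def intro!: divide_pos_pos add_nonneg_pos)
    have "d * norm (inn H k k) \<le> d * (norm (inn H k k) + 1)" using d by simp
    also have "\<dots> = e" by (simp add: d_def add_nonneg_eq_0_iff)
    finally show "norm (cstar a * a) \<le> norm (inn H h h) * norm (inn H k k) + e"
      using main[OF d] by (simp add: algebra_simps)
  qed
  then have "(norm a)\<^sup>2 \<le> (hnorm H h * hnorm H k)\<^sup>2"
    by (simp add: cstar_identity power_mult_distrib hnorm_square)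
  then show ?thesis
    unfolding a_def by (rule power2_le_imp_le) (simp add: hnorm_nonneg)
qed

text \<open>Before separation, vectors that the module axioms would identify are only
  indistinguishable under pairing. This lemma transfers norms between such vectors.\<close>

lemma hnorm_cong:
  assumes "h \<in> carr H" "k \<in> carr H" "\<And>l. l \<in> carr H \<Longrightarrow> inn H l h = inn H l k"
  shows "hnorm H h = hnorm H k"
proof -
  have "inn H h h = inn H h k" using assms by blast
  also have "\<dots> = cstar (inn H k h)" using inn_star assms by metis
  also have "inn H k h = inn H k k" using assms by blast
  finally show ?thesis using inn_star[of k k] assms by (simp add: hnorm_def)
qed

lemma hnorm_nul: "hnorm H (nul H) = 0"
  by (simp add: hnorm_def inn_nul nul_closed)

lemma hnorm_sub_0:
  assumes "h \<in> carr H" "k \<in> carr H" "\<And>l. l \<in> carr H \<Longrightarrow> inn H l h = inn H l k"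
  shows "hnorm H (sub H h k) = 0"
  using hnorm_cong[of "sub H h k" "nul H"] assms by (simp add: closed inn_simps hnorm_nul)

lemma hnorm_triangle:
  assumes "h \<in> carr H" "k \<in> carr H"
  shows "hnorm H (add H h k) \<le> hnorm H h + hnorm H k"
proof -
  have "(hnorm H (add H h k))\<^sup>2 = norm ((inn H h h + inn H k h) + (inn H h k + inn H k k))"
    using assms by (simp add: hnorm_square inn_simps closed)
  also have "\<dots> \<le> norm (inn H h h) + norm (inn H k h) + (norm (inn H h k) + norm (inn H k k))"
    by (meson add_mono norm_triangle_ineq order_trans)
  also have "\<dots> \<le> (hnorm H h)\<^sup>2 + hnorm H k * hnorm H h + (hnorm H h * hnorm H k + (hnorm H k)\<^sup>2)"
    unfolding hnorm_square using assms by (intro add_mono cauchy_schwarz order_refl)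
  also have "\<dots> = (hnorm H h + hnorm H k)\<^sup>2" by (simp add: power2_eq_square algebra_simps)
  finally show ?thesis by (rule power2_le_imp_le) (simp add: hnorm_nonneg)
qed

lemma hnorm_ract:
  assumes "h \<in> carr H"
  shows "hnorm H (ract H h b) \<le> hnorm H h * norm b"
proof -
  have "(hnorm H (ract H h b))\<^sup>2 = norm (cstar b * inn H h h * b)"
    using assms by (simp add: hnorm_square inn_simps closed mult.assoc)
  also have "\<dots> \<le> norm (cstar b) * norm (inn H h h) * norm b"
    by (meson mult_right_mono norm_ge_zero norm_mult_ineq order_trans)
  also have "\<dots> = (hnorm H h * norm b)\<^sup>2"
    by (simp add: norm_cstar hnorm_square power_mult_distrib power2_eq_square[of "norm b"])
  finally show ?thesis by (rule power2_le_imp_le) (simp add: hnorm_nonneg)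
qed

text \<open>Let \<open>c\<close> be the root of \<open>norm (cstar b * b) - cstar b * b\<close>.
  Positivity of \<open>\<langle>c h, c h\<rangle>\<close> is then the estimate of
  \<open>\<langle>b h, b h\<rangle>\<close> by \<open>norm (cstar b * b)\<close> times
  \<open>\<langle>h, h\<rangle>\<close>.\<close>

lemma hnorm_lact:
  assumes h: "h \<in> carr H"
  shows "hnorm H (lact H b h) \<le> norm b * hnorm H h"
proof -
  have "pos (norm (cstar b * b) *\<^sub>R 1 - cstar b * b)"
    by (rule pos_norm_minus) (simp add: cstar_mult cstar_cstar)
  then obtain c where c: "pos c" "c * c = norm (cstar b * b) *\<^sub>R 1 - cstar b * b"
    using pos_sqrt by blast
  have sq: "inn H h (lact H (cstar a * a) h) = inn H (lact H a h) (lact H a h)" for a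
    using inn_lact_mult[of h h "cstar a" a] inn_lact[of h "lact H a h" "cstar a"] h
    by (simp add: lact_closed cstar_cstar)
  have "inn H h (lact H (cstar c * c) h) = norm (cstar b * b) *\<^sub>R inn H h h - inn H (lact H b h) (lact H b h)"
    using h by (simp add: c pos_cstar[OF c(1)] inn_lact_diff inn_lact_scaleR sq)
  then have "pos (norm (cstar b * b) *\<^sub>R inn H h h - inn H (lact H b h) (lact H b h))"
    using sq[of c] pos_inn[of "lact H c h"] h by (simp add: closed)
  then have "norm (inn H (lact H b h) (lact H b h)) \<le> norm (norm (cstar b * b) *\<^sub>R inn H h h)"
    using h by (intro pos_norm_mono pos_inn) (auto simp: closed)
  then have "(hnorm H (lact H b h))\<^sup>2 \<le> (norm b * hnorm H h)\<^sup>2"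
    by (simp add: hnorm_square power_mult_distrib cstar_identity)
  then show ?thesis by (rule power2_le_imp_le) (simp add: hnorm_nonneg)
qed

lemma hnorm_sub_self: "h \<in> carr H \<Longrightarrow> hnorm H (sub H h h) = 0"
  by (rule hnorm_sub_0) auto

lemma hnorm_sub_commute:
  assumes "h \<in> carr H" "k \<in> carr H"
  shows "hnorm H (sub H h k) = hnorm H (sub H k h)"
  using assms by (simp add: hnorm_def inn_simps closed algebra_simps)

lemma hnorm_sub_triangle:
  assumes "h \<in> carr H" "k \<in> carr H" "l \<in> carr H"
  shows "hnorm H (sub H h l) \<le> hnorm H (sub H h k) + hnorm H (sub H k l)"
proof -
  have "hnorm H (sub H h l) = hnorm H (add H (sub H h k) (sub H k l))"
    using assms by (intro hnorm_cong) (auto simp: closed inn_simps)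
  then show ?thesis using hnorm_triangle assms by (simp add: closed)
qed

lemma hnorm_le_sub:
  assumes "h \<in> carr H" "k \<in> carr H"
  shows "hnorm H h \<le> hnorm H k + hnorm H (sub H h k)"
proof -
  have "hnorm H h = hnorm H (add H k (sub H h k))"
    using assms by (intro hnorm_cong) (auto simp: closed inn_simps)
  then show ?thesis using hnorm_triangle[of k "sub H h k"] assms by (simp add: closed)
qed

lemma hnorm_sub_add:
  assumes "h \<in> carr H" "k \<in> carr H" "h' \<in> carr H" "k' \<in> carr H"
  shows "hnorm H (sub H (add H h k) (add H h' k')) \<le> hnorm H (sub H h h') + hnorm H (sub H k k')"
proof -
  have "hnorm H (sub H (add H h k) (add H h' k')) = hnorm H (add H (sub H h h') (sub H k k'))"
    using assms by (intro hnorm_cong) (auto simp: closed inn_simps)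
  then show ?thesis using hnorm_triangle assms by (simp add: closed)
qed

lemma hnorm_sub_ract:
  assumes "h \<in> carr H" "k \<in> carr H"
  shows "hnorm H (sub H (ract H h b) (ract H k b)) \<le> hnorm H (sub H h k) * norm b"
proof -
  have "hnorm H (sub H (ract H h b) (ract H k b)) = hnorm H (ract H (sub H h k) b)"
    using assms by (intro hnorm_cong) (auto simp: closed inn_simps algebra_simps)
  then show ?thesis using hnorm_ract assms by (simp add: closed)
qed

lemma hnorm_sub_lact:
  assumes "h \<in> carr H" "k \<in> carr H"
  shows "hnorm H (sub H (lact H b h) (lact H b k)) \<le> norm b * hnorm H (sub H h k)"
proof -
  have "hnorm H (sub H (lact H b h) (lact H b k)) = hnorm H (lact H b (sub H h k))"
    using assms by (intro hnorm_cong) (auto simp: closed inn_simps inn_lact)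
  then show ?thesis using hnorm_lact assms by (simp add: closed)
qed

lemma norm_inn_diff:
  assumes "h \<in> carr H" "k \<in> carr H" "h' \<in> carr H" "k' \<in> carr H"
  shows "norm (inn H h k - inn H h' k') \<le>
    hnorm H (sub H h h') * hnorm H k + hnorm H h' * hnorm H (sub H k k')"
proof -
  have "inn H h k - inn H h' k' = inn H (sub H h h') k + inn H h' (sub H k k')"
    using assms by (simp add: inn_simps)
  also have "norm \<dots> \<le> norm (inn H (sub H h h') k) + norm (inn H h' (sub H k k'))"
    by (rule norm_triangle_ineq)
  also have "\<dots> \<le> hnorm H (sub H h h') * hnorm H k + hnorm H h' * hnorm H (sub H k k')"
    using assms by (intro add_mono cauchy_schwarz) (auto simp: closed)
  finally show ?thesis .
qed

end


definition hlim :: "('b::unital_cstar, 'h) corr \<Rightarrow> (nat \<Rightarrow> 'h) \<Rightarrow> 'h \<Rightarrow> bool" where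
  "hlim H v h \<longleftrightarrow> (\<forall>n. v n \<in> carr H) \<and> h \<in> carr H \<and> (\<lambda>n. hnorm H (sub H (v n) h)) \<longlonglongrightarrow> 0"

definition hdense :: "('b::unital_cstar, 'h) corr \<Rightarrow> 'h set \<Rightarrow> bool" where
  "hdense H D \<longleftrightarrow> D \<subseteq> carr H \<and> (\<forall>h\<in>carr H. \<forall>e>0. \<exists>v\<in>D. hnorm H (sub H h v) < e)"

text \<open>Symmetric bounded operators; on a Hilbert module these are the self-adjoint elements of
  \<open>adjointable H\<close>.\<close>

definition sym_op :: "('b::unital_cstar, 'h) corr \<Rightarrow> ('h \<Rightarrow> 'h) \<Rightarrow> bool" where
  "sym_op H x \<longleftrightarrow> x \<in> carr H \<rightarrow>\<^sub>E carr H \<and>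
     (\<exists>K. \<forall>h\<in>carr H. hnorm H (x h) \<le> K * hnorm H h) \<and>
     (\<forall>h\<in>carr H. \<forall>k\<in>carr H. inn H (x h) k = inn H h (x k))"

lemma sym_op_closed: "sym_op H x \<Longrightarrow> h \<in> carr H \<Longrightarrow> x h \<in> carr H"
  by (auto simp: sym_op_def)

lemma sym_op_inn: "sym_op H x \<Longrightarrow> h \<in> carr H \<Longrightarrow> k \<in> carr H \<Longrightarrow> inn H (x h) k = inn H h (x k)"
  by (auto simp: sym_op_def)

lemma bounded_constant:
  assumes "\<exists>K. \<forall>h\<in>S. f h \<le> K * g h" "\<And>h. h \<in> S \<Longrightarrow> g h \<ge> (0::real)"
  obtains K :: real where "K > 0" "\<And>h. h \<in> S \<Longrightarrow> f h \<le> K * g h"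
proof -
  obtain K where "\<forall>h\<in>S. f h \<le> K * g h" using assms by blast
  then have "f h \<le> (\<bar>K\<bar> + 1) * g h" if "h \<in> S" for h
    using that assms(2)[OF that] by (smt (verit) mult_right_mono)
  then show ?thesis using that[of "\<bar>K\<bar> + 1"] by simp
qed

text \<open>Logarithmic convexity makes the ratios of consecutive terms nondecreasing, so a first
  ratio above \<open>K\<close> would force geometric growth faster than
  \<open>K ^ n\<close>.\<close>

lemma log_convex_growth:
  fixes a :: "nat \<Rightarrow> real"
  assumes nonneg: "\<And>n. a n \<ge> 0" and conv: "\<And>n. (a (Suc n))\<^sup>2 \<le> a n * a (Suc (Suc n))"
    and growth: "\<And>n. a n \<le> C * K ^ n" and K: "K > 0"
  shows "a 1 \<le> K * a 0"
proof (rule ccontr)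
  assume "\<not> a 1 \<le> K * a 0"
  then have gt: "a 1 > K * a 0" by simp
  have "a 0 > 0"
  proof (rule ccontr)
    assume "\<not> a 0 > 0"
    then have "a 0 = 0" using nonneg[of 0] by simp
    then show False using conv[of 0] gt by simp
  qed
  define r where "r = a 1 / a 0"
  have r: "r > K" using gt \<open>a 0 > 0\<close> by (simp add: r_def pos_less_divide_eq)
  have step: "a n > 0 \<and> a (Suc n) \<ge> r * a n" for n
  proof (induction n)
    case 0
    then show ?case using \<open>a 0 > 0\<close> by (simp add: r_def)
  next
    case (Suc n)
    then have p: "a (Suc n) > 0" using r K by (smt (verit) mult_pos_pos)
    have "a n * (r * a (Suc n)) \<le> a (Suc n) * a (Suc n)"
      using mult_right_mono[of "r * a n" "a (Suc n)" "a (Suc n)"] Suc p by (simp add: mult_ac)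
    also have "\<dots> \<le> a n * a (Suc (Suc n))" using conv[of n] by (simp add: power2_eq_square)
    finally show ?case using Suc p by simp
  qed
  have lower: "a n \<ge> r ^ n * a 0" for n
  proof (induction n)
    case (Suc n)
    have "r * (r ^ n * a 0) \<le> r * a n" using Suc r K by (intro mult_left_mono) auto
    then show ?case using step[of n] by (simp add: mult.assoc)
  qed simp
  have "(r / K) ^ n \<le> C / a 0" for n
  proof -
    have "r ^ n * a 0 \<le> C * K ^ n" using lower growth by (rule order_trans)
    then show ?thesis using \<open>a 0 > 0\<close> K by (simp add: power_divide field_simps)
  qed
  moreover obtain n where "C / a 0 < (r / K) ^ n"
    using real_arch_pow[of "r / K" "C / a 0"] r K by auto
  ultimately show False by (meson not_less)
qed

lemma LIMSEQ_squeeze_0: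
  "g \<longlonglongrightarrow> 0 \<Longrightarrow> (\<And>n. 0 \<le> f n) \<Longrightarrow> (\<And>n. f n \<le> g n) \<Longrightarrow> f \<longlonglongrightarrow> (0::real)"
  by (rule tendsto_sandwich[of "\<lambda>_. 0" f _ g]) auto

context precorr
begin

lemma hlim_closed: "hlim H v h \<Longrightarrow> h \<in> carr H" "hlim H v h \<Longrightarrow> v n \<in> carr H"
  by (auto simp: hlim_def)

lemma hlim_const: "h \<in> carr H \<Longrightarrow> hlim H (\<lambda>_. h) h"
  by (simp add: hlim_def hnorm_sub_self)

lemma hlim_hnorm:
  assumes "hlim H v h"
  shows "(\<lambda>n. hnorm H (v n)) \<longlonglongrightarrow> hnorm H h"
proof (rule LIMSEQ_I)
  fix e :: real assume "e > 0"
  have z: "(\<lambda>n. hnorm H (sub H (v n) h)) \<longlonglongrightarrow> 0" using assms by (simp add: hlim_def)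
  then obtain N where N: "\<And>n. n \<ge> N \<Longrightarrow> norm (hnorm H (sub H (v n) h) - 0) < e"
    using LIMSEQ_D[OF z \<open>e > 0\<close>] by blast
  have "\<bar>hnorm H (v n) - hnorm H h\<bar> \<le> hnorm H (sub H (v n) h)" for n
    using hnorm_le_sub[of "v n" h] hnorm_le_sub[of h "v n"] hnorm_sub_commute[of "v n" h]
      hlim_closed[OF assms] by (auto simp: abs_le_iff)
  then show "\<exists>N. \<forall>n\<ge>N. norm (hnorm H (v n) - hnorm H h) < e"
    using N by (intro exI[of _ N]) (fastforce intro: le_less_trans)
qed

lemma hlim_inn:
  assumes v: "hlim H v h" and w: "hlim H w k"
  shows "(\<lambda>n. inn H (v n) (w n)) \<longlonglongrightarrow> inn H h k"
proof -
  have "(\<lambda>n. hnorm H (sub H (v n) h) * hnorm H (w n) + hnorm H h * hnorm H (sub H (w n) k)) \<longlonglongrightarrow>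
      0 * hnorm H k + hnorm H h * 0"
    using v w hlim_hnorm[OF w] unfolding hlim_def by (intro tendsto_intros) auto
  then have "(\<lambda>n. inn H (v n) (w n) - inn H h k) \<longlonglongrightarrow> 0"
    by (intro tendsto_0_le[where K = 1 and g = "\<lambda>n. inn H (v n) (w n) - inn H h k"])
      (auto intro!: always_eventually norm_inn_diff hlim_closed[OF v] hlim_closed[OF w]
        simp: hnorm_nonneg)
  then show ?thesis by (simp add: LIM_zero_iff)
qed

lemma hdense_hlim:
  assumes "hdense H D" "h \<in> carr H"
  obtains v where "\<And>n. v n \<in> D" "hlim H v h"
proof -
  have "\<exists>v\<in>D. hnorm H (sub H h v) < 1 / real (Suc n)" for n
    using assms unfolding hdense_def by (meson divide_pos_pos of_nat_0_less_iff zero_less_Suc zero_less_one)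
  then obtain v where v: "\<And>n. v n \<in> D" "\<And>n. hnorm H (sub H h (v n)) < 1 / real (Suc n)" by metis
  then have c: "v n \<in> carr H" for n using assms by (auto simp: hdense_def)
  have "(\<lambda>n. hnorm H (sub H (v n) h)) \<longlonglongrightarrow> 0"
  proof (rule LIMSEQ_squeeze_0)
    show "(\<lambda>n. 1 / real (Suc n)) \<longlonglongrightarrow> 0" by (rule LIMSEQ_Suc[OF lim_1_over_n])
    show "hnorm H (sub H (v n) h) \<le> 1 / real (Suc n)" for n
      using v(2)[of n] by (simp add: hnorm_sub_commute[OF c assms(2)])
  qed (simp add: hnorm_nonneg)
  then show ?thesis using that[of v] v(1) c assms(2) by (simp add: hlim_def)
qed

lemma hdense_inn_eq:
  assumes "hdense H D" "h \<in> carr H" "k \<in> carr H" "\<And>v. v \<in> D \<Longrightarrow> inn H v h = inn H v k"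
    and "l \<in> carr H"
  shows "inn H l h = inn H l k"
proof -
  obtain v where v: "\<And>n. v n \<in> D" "hlim H v l" using hdense_hlim assms by blast
  have "(\<lambda>n. inn H (v n) h) \<longlonglongrightarrow> inn H l h" "(\<lambda>n. inn H (v n) k) \<longlonglongrightarrow> inn H l k"
    by (intro hlim_inn[OF v(2) hlim_const] assms)+
  moreover have "(\<lambda>n. inn H (v n) h) = (\<lambda>n. inn H (v n) k)" using assms(4) v(1) by auto
  ultimately show ?thesis using LIMSEQ_unique by metis
qed

lemma hlim_cauchy:
  assumes "hlim H v h"
  shows "v \<in> cauchy_seqs H"
  unfolding cauchy_seqs_def
proof (intro CollectI conjI allI impI)
  fix e :: real assume "e > 0"
  note c = hlim_closed[OF assms]
  have z: "(\<lambda>n. hnorm H (sub H (v n) h)) \<longlonglongrightarrow> 0" using assms by (simp add: hlim_def)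
  then obtain N where N: "\<And>n. n \<ge> N \<Longrightarrow> norm (hnorm H (sub H (v n) h) - 0) < e / 2"
    using LIMSEQ_D[OF z, of "e / 2"] \<open>e > 0\<close> by auto
  show "\<exists>N. \<forall>m\<ge>N. \<forall>n\<ge>N. hnorm H (sub H (v m) (v n)) < e"
  proof (intro exI allI impI)
    fix m n assume "m \<ge> N" "n \<ge> N"
    then have "hnorm H (sub H (v m) h) < e / 2" "hnorm H (sub H (v n) h) < e / 2"
      using N[of m] N[of n] by auto
    then show "hnorm H (sub H (v m) (v n)) < e"
      using hnorm_sub_triangle[of "v m" h "v n"] hnorm_sub_commute[of h "v n"] c by simp
  qed
qed (simp add: hlim_closed[OF assms])

lemma cauchy_comparison:
  assumes v: "v \<in> cauchy_seqs H" and w: "\<And>n. w n \<in> carr G"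
    and le: "\<And>m n. hnorm G (sub G (w m) (w n)) \<le> K * hnorm H (sub H (v m) (v n))"
  shows "w \<in> cauchy_seqs G"
  unfolding cauchy_seqs_def
proof (intro CollectI conjI allI impI w)
  fix e :: real assume "e > 0"
  define L where "L = \<bar>K\<bar> + 1"
  have L: "L > 0" by (simp add: L_def)
  obtain N where N: "\<And>m n. m \<ge> N \<Longrightarrow> n \<ge> N \<Longrightarrow> hnorm H (sub H (v m) (v n)) < e / L"
    using v divide_pos_pos[OF \<open>e > 0\<close> L] unfolding cauchy_seqs_def by blast
  have "hnorm G (sub G (w m) (w n)) < e" if "m \<ge> N" "n \<ge> N" for m n
  proof -
    have "hnorm G (sub G (w m) (w n)) \<le> L * hnorm H (sub H (v m) (v n))"
      using le[of m n] hnorm_nonneg[of "sub H (v m) (v n)"]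
      by (smt (verit, best) L_def mult_right_mono)
    also have "\<dots> < L * (e / L)" using N[OF that] L by (intro mult_strict_left_mono)
    finally show ?thesis using L by simp
  qed
  then show "\<exists>N. \<forall>m\<ge>N. \<forall>n\<ge>N. hnorm G (sub G (w m) (w n)) < e" by blast
qed

end


text \<open>Separation is phrased through pairings, the form in which the axioms of
  \<open>precorr\<close> are stated, so every module identity follows by pairing with an arbitrary
  vector.\<close>

locale hcorr = precorr +
  assumes separated: "h \<in> carr H \<Longrightarrow> k \<in> carr H \<Longrightarrow> (\<And>l. l \<in> carr H \<Longrightarrow> inn H l h = inn H l k) \<Longrightarrow> h = k"
    and complete: "v \<in> cauchy_seqs H \<Longrightarrow> \<exists>h. hlim H v h"
begin

lemma hdense_eqI:
  assumes "hdense H D" "h \<in> carr H" "k \<in> carr H" "\<And>v. v \<in> D \<Longrightarrow> inn H v h = inn H v k"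
  shows "h = k"
  by (rule separated[OF assms(2,3)]) (use hdense_inn_eq[OF assms(1-3)] assms(4) in blast)

lemma hlim_unique: "hlim H v h \<Longrightarrow> hlim H v k \<Longrightarrow> h = k"
  by (rule separated, auto intro: hlim_closed)
    (meson LIMSEQ_unique hlim_const hlim_inn)

lemma add_commute: "h \<in> carr H \<Longrightarrow> k \<in> carr H \<Longrightarrow> add H h k = add H k h"
  by (rule separated) (auto simp: closed inn_simps)

lemma add_assoc: "h \<in> carr H \<Longrightarrow> k \<in> carr H \<Longrightarrow> l \<in> carr H \<Longrightarrow> add H (add H h k) l = add H h (add H k l)"
  by (rule separated) (auto simp: closed inn_simps)

lemma add_nul: "h \<in> carr H \<Longrightarrow> add H h (nul H) = h" "h \<in> carr H \<Longrightarrow> add H (nul H) h = h"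
  by (rule separated; auto simp: closed inn_simps)+

lemma add_swap: "h \<in> carr H \<Longrightarrow> k \<in> carr H \<Longrightarrow> h' \<in> carr H \<Longrightarrow> k' \<in> carr H \<Longrightarrow>
    add H (add H h k) (add H h' k') = add H (add H h h') (add H k k')"
  by (rule separated) (auto simp: closed inn_simps)

lemma ract_add: "h \<in> carr H \<Longrightarrow> k \<in> carr H \<Longrightarrow> ract H (add H h k) b = add H (ract H h b) (ract H k b)"
  by (rule separated) (auto simp: closed inn_simps ring_distribs)

lemma ract_ract: "h \<in> carr H \<Longrightarrow> ract H (ract H h a) b = ract H h (a * b)"
  by (rule separated) (auto simp: closed inn_simps mult.assoc)

lemma ract_nul: "ract H (nul H) b = nul H"
  by (rule separated) (auto simp: closed inn_simps)

lemma ract_one: "h \<in> carr H \<Longrightarrow> ract H h 1 = h"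
  by (rule separated) (auto simp: closed inn_simps)

lemma lact_nul: "lact H b (nul H) = nul H"
  by (rule separated) (auto simp: closed inn_simps inn_lact)

lemma lact_add: "h \<in> carr H \<Longrightarrow> k \<in> carr H \<Longrightarrow> lact H b (add H h k) = add H (lact H b h) (lact H b k)"
  by (rule separated) (auto simp: closed inn_simps inn_lact)

lemma lact_ract: "h \<in> carr H \<Longrightarrow> lact H a (ract H h b) = ract H (lact H a h) b"
  by (rule separated) (auto simp: closed inn_simps inn_lact)

lemma lact_mult: "h \<in> carr H \<Longrightarrow> lact H (a * b) h = lact H a (lact H b h)"
  by (rule separated) (auto simp: closed inn_lact_mult)

lemma lact_plus: "h \<in> carr H \<Longrightarrow> lact H (a + b) h = add H (lact H a h) (lact H b h)"
  by (rule separated) (auto simp: closed inn_lact_add inn_simps)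

lemma lact_one: "h \<in> carr H \<Longrightarrow> lact H 1 h = h"
  by (rule separated) (auto simp: closed inn_lact_one)

lemma lact_zero: "h \<in> carr H \<Longrightarrow> lact H 0 h = nul H"
  by (rule separated) (auto simp: closed inn_lact_zero inn_nul)

lemma lact_scalar: "h \<in> carr H \<Longrightarrow> lact H (scaleC c 1) h = ract H h (scaleC c 1)"
  by (rule separated) (auto simp: closed inn_lact_scalar inn_simps mult_scaleC_right)

text \<open>Linearity is not built into \<open>sym_op\<close>: it results from moving the operator
  to the other side of the pairing and separating. Right modularity follows in the same way.\<close>

lemma sym_op_add:
  "sym_op H x \<Longrightarrow> h \<in> carr H \<Longrightarrow> k \<in> carr H \<Longrightarrow> x (add H h k) = add H (x h) (x k)"
  by (rule separated) (auto simp: closed inn_simps sym_op_closed sym_op_inn[symmetric])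

lemma sym_op_ract: "sym_op H x \<Longrightarrow> h \<in> carr H \<Longrightarrow> x (ract H h b) = ract H (x h) b"
  by (rule separated) (auto simp: closed inn_simps sym_op_closed sym_op_inn[symmetric])

lemma sym_op_nul: "sym_op H x \<Longrightarrow> x (nul H) = nul H"
  by (rule separated) (auto simp: closed inn_simps sym_op_closed sym_op_inn[symmetric])

lemma sym_op_adjointable: "sym_op H x \<Longrightarrow> x \<in> adjointable H"
  by (auto simp: adjointable_def sym_op_add sym_op_ract) (auto simp: sym_op_def)

text \<open>Adjointable operators are bounded, so agreement on a dense set is enough. This is the
  uniqueness half of the definite description in \<open>tree_rep\<close>.\<close>

lemma adjointable_eqI:
  assumes x: "x \<in> adjointable H" and y: "y \<in> adjointable H"
    and D: "hdense H {h \<in> carr H. x h = y h}"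
  shows "x = y"
proof (rule ext)
  fix h
  show "x h = y h"
  proof (cases "h \<in> carr H")
    case True
    obtain v where v: "\<And>n. v n \<in> {h \<in> carr H. x h = y h}" "hlim H v h"
      using hdense_hlim[OF D True] by blast
    have lim: "hlim H (\<lambda>n. z (v n)) (z h)" if z: "z \<in> adjointable H" for z
    proof -
      have zs: "z (sub H k l) = sub H (z k) (z l)" if "k \<in> carr H" "l \<in> carr H" for k l
        using z that by (simp add: adjointable_def sub_def ract_closed)
      have zc: "z k \<in> carr H" if "k \<in> carr H" for k
        using z that by (auto simp: adjointable_def)
      have "\<exists>K. \<forall>h\<in>carr H. hnorm H (z h) \<le> K * hnorm H h"
        using z by (simp add: adjointable_def)
      then obtain K where K: "K > 0" "\<And>h. h \<in> carr H \<Longrightarrow> hnorm H (z h) \<le> K * hnorm H h"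
        by (rule bounded_constant) (auto simp: hnorm_nonneg)
      have "(\<lambda>n. K * hnorm H (sub H (v n) h)) \<longlonglongrightarrow> 0"
        using v(2) unfolding hlim_def by (intro tendsto_mult_right_zero) auto
      then have "(\<lambda>n. hnorm H (sub H (z (v n)) (z h))) \<longlonglongrightarrow> 0"
        by (rule LIMSEQ_squeeze_0[of "\<lambda>n. K * hnorm H (sub H (v n) h)"])
(use v(1) True in \<open>auto simp: hnorm_nonneg zs[symmetric] closed intro!: K(2)\<close>)
      then show ?thesis using v(1) True zc by (simp add: hlim_def)
    qed
    have "(\<lambda>n. x (v n)) = (\<lambda>n. y (v n))" using v(1) by auto
    then show ?thesis using hlim_unique[OF lim[OF x]] lim[OF y] by simp
  next
    case False
    then show ?thesis using x y by (auto simp: adjointable_def PiE_def extensional_def)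
  qed
qed

text \<open>The bound \<open>\<parallel>y v\<parallel> \<le> K \<parallel>v\<parallel>\<close> comes for free from symmetry and the growth condition:
  \<open>\<parallel>y v\<parallel>\<^sup>2 = \<parallel>\<langle>v, y\<^sup>2 v\<rangle>\<parallel> \<le> \<parallel>v\<parallel> \<parallel>y\<^sup>2 v\<parallel>\<close> makes \<open>n \<mapsto> \<parallel>y\<^sup>n v\<parallel>\<close> logarithmically convex.\<close>

lemma symmetric_extension:
  assumes G: "G \<subseteq> carr H \<times> carr H"
    and Gadd: "\<And>v w v' w'. (v, w) \<in> G \<Longrightarrow> (v', w') \<in> G \<Longrightarrow> (add H v v', add H w w') \<in> G"
    and Gract: "\<And>v w b. (v, w) \<in> G \<Longrightarrow> (ract H v b, ract H w b) \<in> G"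
    and Gsym: "\<And>v w v' w'. (v, w) \<in> G \<Longrightarrow> (v', w') \<in> G \<Longrightarrow> inn H w v' = inn H v w'"
    and dense: "hdense H (Domain G)"
    and K: "K > 0"
    and growth: "\<And>v w. (v, w) \<in> G \<Longrightarrow> \<exists>C z. z 0 = v \<and> z 1 = w \<and>
      (\<forall>n. (z n, z (Suc n)) \<in> G \<and> hnorm H (z n) \<le> C * K ^ n)"
  shows "\<exists>y. sym_op H y \<and> (\<forall>(v, w)\<in>G. y v = w)"
proof -
  have bound: "hnorm H w \<le> K * hnorm H v" if vw: "(v, w) \<in> G" for v w
  proof -
    obtain C z where z: "z 0 = v" "z 1 = w" "\<And>n. (z n, z (Suc n)) \<in> G"
      "\<And>n. hnorm H (z n) \<le> C * K ^ n"
      using growth[OF vw] by blast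
    have "(hnorm H (z (Suc n)))\<^sup>2 \<le> hnorm H (z n) * hnorm H (z (Suc (Suc n)))" for n
      using Gsym[OF z(3)[of n] z(3)[of "Suc n"]] G z(3)[of n] z(3)[of "Suc n"]
      by (auto simp: hnorm_square intro!: cauchy_schwarz)
    then show ?thesis
      using log_convex_growth[of "\<lambda>n. hnorm H (z n)" C K] z hnorm_nonneg K by simp
  qed
  have Gsub: "(sub H v v', sub H w w') \<in> G" if "(v, w) \<in> G" "(v', w') \<in> G" for v w v' w'
    unfolding sub_def using that by (intro Gadd Gract)
  have ex: "\<exists>w. \<exists>v u. (\<forall>n. (v n, u n) \<in> G) \<and> hlim H v h \<and> hlim H u w" if h: "h \<in> carr H" for h
  proof -
    obtain v where v: "\<And>n. v n \<in> Domain G" "hlim H v h" using hdense_hlim[OF dense h] by blast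
    then obtain u where u: "\<And>n. (v n, u n) \<in> G" unfolding Domain_iff by metis
    have "u \<in> cauchy_seqs H"
      using G u bound[OF Gsub[OF u u]] by (intro cauchy_comparison[OF hlim_cauchy[OF v(2)]]) blast+
    then show ?thesis using complete u v(2) by blast
  qed
  \<comment> \<open>The choice of the limit is harmless: on \<open>G\<close> it is forced by
    \<open>bound\<close> for differences, and elsewhere only the existence of an approximating
    sequence in \<open>G\<close> is used.\<close>
  define y where "y = (\<lambda>h\<in>carr H. SOME w. \<exists>v u. (\<forall>n. (v n, u n) \<in> G) \<and> hlim H v h \<and> hlim H u w)"
  have y: "\<exists>v u. (\<forall>n. (v n, u n) \<in> G) \<and> hlim H v h \<and> hlim H u (y h)" if "h \<in> carr H" for h
    using someI_ex[OF ex[OF that]] that by (simp add: y_def)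
  have yG: "y v = w" if vw: "(v, w) \<in> G" for v w
  proof -
    have vc: "v \<in> carr H" "w \<in> carr H" using vw G by auto
    obtain s u where su: "\<And>n. (s n, u n) \<in> G" "hlim H s v" "hlim H u (y v)" using y[OF vc(1)] by blast
    have "(\<lambda>n. K * hnorm H (sub H (s n) v)) \<longlonglongrightarrow> 0"
      using su(2) unfolding hlim_def by (intro tendsto_mult_right_zero) auto
    then have "(\<lambda>n. hnorm H (sub H (u n) w)) \<longlonglongrightarrow> 0"
      by (rule LIMSEQ_squeeze_0[of "\<lambda>n. K * hnorm H (sub H (s n) v)"])
(auto simp: hnorm_nonneg intro!: bound Gsub su(1) vw)
    then have "hlim H u w" using vc hlim_closed[OF su(3)] by (simp add: hlim_def)
    then show ?thesis using su(3) by (rule hlim_unique[symmetric])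
  qed
  have yc: "y h \<in> carr H" if "h \<in> carr H" for h
    using y[OF that] hlim_closed by blast
  have "sym_op H y"
    unfolding sym_op_def
  proof (intro conjI ballI exI[of _ K])
    show "y \<in> carr H \<rightarrow>\<^sub>E carr H" using yc by (auto simp: y_def)
  next
    fix h assume h: "h \<in> carr H"
    obtain v u where vu: "\<And>n. (v n, u n) \<in> G" "hlim H v h" "hlim H u (y h)" using y[OF h] by blast
    show "hnorm H (y h) \<le> K * hnorm H h"
    proof (rule tendsto_le[OF sequentially_bot])
      show "(\<lambda>n. K * hnorm H (v n)) \<longlonglongrightarrow> K * hnorm H h" by (intro tendsto_intros hlim_hnorm vu)
      show "(\<lambda>n. hnorm H (u n)) \<longlonglongrightarrow> hnorm H (y h)" by (intro hlim_hnorm vu)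
    qed (simp add: bound vu(1))
  next
    fix h k assume h: "h \<in> carr H" and k: "k \<in> carr H"
    obtain v u where vu: "\<And>n. (v n, u n) \<in> G" "hlim H v h" "hlim H u (y h)" using y[OF h] by blast
    obtain s t where st: "\<And>n. (s n, t n) \<in> G" "hlim H s k" "hlim H t (y k)" using y[OF k] by blast
    have "(\<lambda>n. inn H (u n) (s n)) \<longlonglongrightarrow> inn H (y h) k" by (intro hlim_inn vu st)
    moreover have "(\<lambda>n. inn H (u n) (s n)) \<longlonglongrightarrow> inn H h (y k)"
      using hlim_inn[OF vu(2) st(3)] Gsym[OF vu(1) st(1)] by simp
    ultimately show "inn H (y h) k = inn H h (y k)" by (rule LIMSEQ_unique)
  qed
  then show ?thesis using yG by blast
qed

end

section \<open>Separation and completion\<close>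

context precorr
begin

lemma cauchy_closed: "v \<in> cauchy_seqs H \<Longrightarrow> v n \<in> carr H"
  by (simp add: cauchy_seqs_def)

lemma cauchyD: "v \<in> cauchy_seqs H \<Longrightarrow> e > 0 \<Longrightarrow> \<exists>N. \<forall>m\<ge>N. \<forall>n\<ge>N. hnorm H (sub H (v m) (v n)) < e"
  by (simp add: cauchy_seqs_def)

lemma cauchy_const: "h \<in> carr H \<Longrightarrow> (\<lambda>_. h) \<in> cauchy_seqs H"
  by (simp add: cauchy_seqs_def hnorm_sub_self)

lemma cauchy_add:
  assumes v: "v \<in> cauchy_seqs H" and w: "w \<in> cauchy_seqs H"
  shows "(\<lambda>n. add H (v n) (w n)) \<in> cauchy_seqs H"
  unfolding cauchy_seqs_def
proof (intro CollectI conjI allI impI add_closed cauchy_closed v w)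
  fix e :: real assume "e > 0"
  then obtain M N where M: "\<And>m n. m \<ge> M \<Longrightarrow> n \<ge> M \<Longrightarrow> hnorm H (sub H (v m) (v n)) < e / 2"
    and N: "\<And>m n. m \<ge> N \<Longrightarrow> n \<ge> N \<Longrightarrow> hnorm H (sub H (w m) (w n)) < e / 2"
    using cauchyD[OF v, of "e / 2"] cauchyD[OF w, of "e / 2"] half_gt_zero by metis
  have "hnorm H (sub H (add H (v m) (w m)) (add H (v n) (w n))) < e" if "m \<ge> max M N" "n \<ge> max M N" for m n
    using hnorm_sub_add[of "v m" "w m" "v n" "w n"] M[of m n] N[of m n] that cauchy_closed[OF v] cauchy_closed[OF w]
    by simp
  then show "\<exists>N. \<forall>m\<ge>N. \<forall>n\<ge>N. hnorm H (sub H (add H (v m) (w m)) (add H (v n) (w n))) < e" by blast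
qed

lemma cauchy_lact: "v \<in> cauchy_seqs H \<Longrightarrow> (\<lambda>n. lact H b (v n)) \<in> cauchy_seqs H"
  by (rule cauchy_comparison[where v = v and K = "norm b"]) (auto intro!: hnorm_sub_lact simp: closed cauchy_closed)

lemma cauchy_ract: "v \<in> cauchy_seqs H \<Longrightarrow> (\<lambda>n. ract H (v n) b) \<in> cauchy_seqs H"
  by (rule cauchy_comparison[where v = v and K = "norm b"])
    (auto intro!: hnorm_sub_ract simp: closed cauchy_closed mult.commute[of "norm b"])

lemma cauchy_bounded:
  assumes v: "v \<in> cauchy_seqs H"
  obtains B where "B > 0" "\<And>n. hnorm H (v n) \<le> B"
proof -
  obtain N where N: "\<And>m n. m \<ge> N \<Longrightarrow> n \<ge> N \<Longrightarrow> hnorm H (sub H (v m) (v n)) < 1"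
    using cauchyD[OF v, of 1] by auto
  define B where "B = hnorm H (v N) + 1 + (\<Sum>i<N. hnorm H (v i))"
  have "hnorm H (v n) \<le> B" for n
  proof (cases "n < N")
    case True
    then have "hnorm H (v n) \<le> (\<Sum>i<N. hnorm H (v i))"
      by (intro member_le_sum) (auto simp: hnorm_nonneg)
    then show ?thesis using hnorm_nonneg[of "v N"] by (simp add: B_def)
  next
    case False
    then have "hnorm H (v n) \<le> hnorm H (v N) + 1"
      using hnorm_le_sub[of "v n" "v N"] N[of n N] cauchy_closed[OF v] by simp
    moreover have "(\<Sum>i<N. hnorm H (v i)) \<ge> 0" by (intro sum_nonneg hnorm_nonneg)
    ultimately show ?thesis by (simp add: B_def)
  qed
  moreover have "B > 0" unfolding B_def
    by (intro add_pos_nonneg add_nonneg_pos sum_nonneg hnorm_nonneg) auto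
  ultimately show ?thesis using that by blast
qed

lemma equiv_null_rel: "equiv (cauchy_seqs H) (null_rel H)"
proof (rule equivI)
  show "null_rel H \<subseteq> cauchy_seqs H \<times> cauchy_seqs H" by (auto simp: null_rel_def)
  show "refl_on (cauchy_seqs H) (null_rel H)"
    by (auto simp: refl_on_def null_rel_def hnorm_sub_self cauchy_closed)
  show "Relation.sym (null_rel H)"
  proof (rule symI)
    fix v w assume "(v, w) \<in> null_rel H"
    then show "(w, v) \<in> null_rel H"
      using hnorm_sub_commute[of "v _" "w _"] by (auto simp: null_rel_def cauchy_closed)
  qed
  show "Relation.trans (null_rel H)"
  proof (rule transI)
    fix u v w assume uv: "(u, v) \<in> null_rel H" and vw: "(v, w) \<in> null_rel H"
    then have "(\<lambda>n. hnorm H (sub H (u n) (v n)) + hnorm H (sub H (v n) (w n))) \<longlonglongrightarrow> 0"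
      unfolding null_rel_def by (intro tendsto_add_zero) auto
    then have "(\<lambda>n. hnorm H (sub H (u n) (w n))) \<longlonglongrightarrow> 0"
      by (rule LIMSEQ_squeeze_0)
        (use uv vw in \<open>auto simp: hnorm_nonneg null_rel_def intro!: hnorm_sub_triangle cauchy_closed\<close>)
    then show "(u, w) \<in> null_rel H" using uv vw by (auto simp: null_rel_def)
  qed
qed

definition cl :: "(nat \<Rightarrow> 'h) \<Rightarrow> (nat \<Rightarrow> 'h) set" where
  "cl v = null_rel H `` {v}"

lemma cl_eq_iff: "v \<in> cauchy_seqs H \<Longrightarrow> w \<in> cauchy_seqs H \<Longrightarrow> cl v = cl w \<longleftrightarrow> (v, w) \<in> null_rel H"
  unfolding cl_def by (rule eq_equiv_class_iff[OF equiv_null_rel])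

lemma in_cl_iff: "w \<in> cl v \<longleftrightarrow> (v, w) \<in> null_rel H"
  by (simp add: cl_def)

lemma cl_self: "v \<in> cauchy_seqs H \<Longrightarrow> v \<in> cl v"
  unfolding cl_def by (rule equiv_class_self[OF equiv_null_rel])

lemma in_cl_cauchy: "w \<in> cl v \<Longrightarrow> w \<in> cauchy_seqs H"
  by (auto simp: in_cl_iff null_rel_def)

lemma carr_completion: "C \<in> carr (completion H) \<longleftrightarrow> (\<exists>v\<in>cauchy_seqs H. C = cl v)"
  by (auto simp: completion_def quotient_def cl_def)

text \<open>The operations of \<open>completion\<close> are unions over all representatives; for a
  Lipschitz map the classes in the union coincide. This serves both module actions and
  multiplication by the indeterminate.\<close>

lemma completion_lift:
  assumes v: "v \<in> cauchy_seqs H" and f: "\<And>h. h \<in> carr H \<Longrightarrow> f h \<in> carr H"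
    and lip: "\<And>h k. h \<in> carr H \<Longrightarrow> k \<in> carr H \<Longrightarrow> hnorm H (sub H (f h) (f k)) \<le> K * hnorm H (sub H h k)"
  shows "(\<Union>u\<in>cl v. null_rel H `` {\<lambda>n. f (u n)}) = cl (\<lambda>n. f (v n))" (is ?eq)
    and "(\<lambda>n. f (v n)) \<in> cauchy_seqs H" (is ?c)
proof -
  have c: "(\<lambda>n. f (u n)) \<in> cauchy_seqs H" if "u \<in> cauchy_seqs H" for u
    using that by (intro cauchy_comparison[where v = u and w = "\<lambda>n. f (u n)" and K = K])
      (auto intro!: f lip simp: cauchy_closed)
  then show ?c using v by blast
  have "null_rel H `` {\<lambda>n. f (u n)} = cl (\<lambda>n. f (v n))" if u: "u \<in> cl v" for u
  proof -
    have uc: "u \<in> cauchy_seqs H" using in_cl_cauchy u .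
    have "(\<lambda>n. hnorm H (sub H (v n) (u n))) \<longlonglongrightarrow> 0" using u by (simp add: in_cl_iff null_rel_def)
    then have "(\<lambda>n. K * hnorm H (sub H (v n) (u n))) \<longlonglongrightarrow> 0" by (rule tendsto_mult_right_zero)
    then have "(\<lambda>n. hnorm H (sub H (f (v n)) (f (u n)))) \<longlonglongrightarrow> 0"
      by (rule LIMSEQ_squeeze_0) (auto simp: hnorm_nonneg intro!: lip cauchy_closed v uc)
    then have "cl (\<lambda>n. f (v n)) = cl (\<lambda>n. f (u n))"
      using c[OF v] c[OF uc] by (simp add: cl_eq_iff null_rel_def)
    then show ?thesis by (simp add: cl_def)
  qed
  then show ?eq using cl_self[OF v] by blast
qed

lemma nul_completion: "nul (completion H) = cl (\<lambda>_. nul H)"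
  by (simp add: completion_def cl_def)

lemma lact_completion: "v \<in> cauchy_seqs H \<Longrightarrow> lact (completion H) b (cl v) = cl (\<lambda>n. lact H b (v n))"
  unfolding completion_def corr.simps
  by (rule completion_lift(1)[where K = "norm b"]) (auto intro!: closed hnorm_sub_lact)

lemma ract_completion: "v \<in> cauchy_seqs H \<Longrightarrow> ract (completion H) (cl v) b = cl (\<lambda>n. ract H (v n) b)"
  unfolding completion_def corr.simps
  by (rule completion_lift(1)[where K = "norm b"])
    (auto intro!: closed hnorm_sub_ract simp: mult.commute[of "norm b"])

lemma add_completion:
  assumes v: "v \<in> cauchy_seqs H" and w: "w \<in> cauchy_seqs H"
  shows "add (completion H) (cl v) (cl w) = cl (\<lambda>n. add H (v n) (w n))"
proof -
  have "null_rel H `` {\<lambda>n. add H (v' n) (w' n)} = cl (\<lambda>n. add H (v n) (w n))"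
    if v': "v' \<in> cl v" and w': "w' \<in> cl w" for v' w'
  proof -
    note c = v w in_cl_cauchy[OF v'] in_cl_cauchy[OF w']
    have "(\<lambda>n. hnorm H (sub H (v n) (v' n)) + hnorm H (sub H (w n) (w' n))) \<longlonglongrightarrow> 0"
      using v' w' by (intro tendsto_add_zero) (simp_all add: in_cl_iff null_rel_def)
    then have "(\<lambda>n. hnorm H (sub H (add H (v n) (w n)) (add H (v' n) (w' n)))) \<longlonglongrightarrow> 0"
      by (rule LIMSEQ_squeeze_0) (auto simp: hnorm_nonneg intro!: hnorm_sub_add cauchy_closed c)
    then have "cl (\<lambda>n. add H (v n) (w n)) = cl (\<lambda>n. add H (v' n) (w' n))"
      using c by (subst cl_eq_iff) (auto simp: null_rel_def cauchy_add)
    then show ?thesis by (simp add: cl_def)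
  qed
  then show ?thesis
    unfolding completion_def corr.simps using cl_self[OF v] cl_self[OF w] by blast
qed

lemma inn_cauchy_tendsto:
  assumes v: "v \<in> cauchy_seqs H" and w: "w \<in> cauchy_seqs H"
  shows "\<exists>l. (\<lambda>n. inn H (v n) (w n)) \<longlonglongrightarrow> l"
proof -
  obtain A where A: "A > 0" "\<And>n. hnorm H (v n) \<le> A" by (rule cauchy_bounded[OF v]) blast
  obtain B where B: "B > 0" "\<And>n. hnorm H (w n) \<le> B" by (rule cauchy_bounded[OF w]) blast
  have "Cauchy (\<lambda>n. inn H (v n) (w n))"
  proof (rule CauchyI)
    fix e :: real assume "e > 0"
    obtain M where M: "\<And>m n. m \<ge> M \<Longrightarrow> n \<ge> M \<Longrightarrow> hnorm H (sub H (v m) (v n)) < e / 2 / B"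
      using cauchyD[OF v, of "e / 2 / B"] B \<open>e > 0\<close> by auto
    obtain N where N: "\<And>m n. m \<ge> N \<Longrightarrow> n \<ge> N \<Longrightarrow> hnorm H (sub H (w m) (w n)) < e / 2 / A"
      using cauchyD[OF w, of "e / 2 / A"] A \<open>e > 0\<close> by auto
    have "norm (inn H (v m) (w m) - inn H (v n) (w n)) < e" if "m \<ge> max M N" "n \<ge> max M N" for m n
    proof -
      have "norm (inn H (v m) (w m) - inn H (v n) (w n)) \<le>
          hnorm H (sub H (v m) (v n)) * hnorm H (w m) + hnorm H (v n) * hnorm H (sub H (w m) (w n))"
        by (intro norm_inn_diff cauchy_closed v w)
      also have "\<dots> \<le> hnorm H (sub H (v m) (v n)) * B + A * hnorm H (sub H (w m) (w n))"
        by (intro add_mono mult_left_mono mult_right_mono A B hnorm_nonneg)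
      also have "\<dots> < e / 2 / B * B + A * (e / 2 / A)"
        using M[of m n] N[of m n] that A B by (intro add_strict_mono mult_strict_left_mono mult_strict_right_mono) auto
      finally show ?thesis using A B by simp
    qed
    then show "\<exists>M. \<forall>m\<ge>M. \<forall>n\<ge>M. norm (inn H (v m) (w m) - inn H (v n) (w n)) < e" by blast
  qed
  then show ?thesis by (simp add: Cauchy_convergent_iff convergent_def)
qed

text \<open>The definite description in the inner product of \<open>completion\<close> needs one
  limit for all representatives. Equivalent sequences differ by a null sequence and Cauchy sequences
  are bounded, so the inner products differ by a null sequence.\<close>

lemma inn_completion:
  assumes v: "v \<in> cauchy_seqs H" and w: "w \<in> cauchy_seqs H"
  shows "(\<lambda>n. inn H (v n) (w n)) \<longlonglongrightarrow> inn (completion H) (cl v) (cl w)"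
proof -
  obtain l where l: "(\<lambda>n. inn H (v n) (w n)) \<longlonglongrightarrow> l" using inn_cauchy_tendsto[OF v w] by blast
  obtain A where A: "A > 0" "\<And>n. hnorm H (v n) \<le> A" by (rule cauchy_bounded[OF v]) blast
  have ev: "(\<lambda>n. inn H (v' n) (w' n)) \<longlonglongrightarrow> l" if v': "v' \<in> cl v" and w': "w' \<in> cl w" for v' w'
  proof -
    note c = v w in_cl_cauchy[OF v'] in_cl_cauchy[OF w']
    obtain B where B: "B > 0" "\<And>n. hnorm H (w' n) \<le> B" by (rule cauchy_bounded[OF c(4)]) blast
    have z: "(\<lambda>n. hnorm H (sub H (v n) (v' n)) * B + A * hnorm H (sub H (w n) (w' n))) \<longlonglongrightarrow> 0"
      using v' w' by (intro tendsto_add_zero tendsto_mult_left_zero tendsto_mult_right_zero)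
        (simp_all add: in_cl_iff null_rel_def)
    have "norm (inn H (v' n) (w' n) - inn H (v n) (w n)) \<le>
        hnorm H (sub H (v n) (v' n)) * B + A * hnorm H (sub H (w n) (w' n))" for n
    proof -
      have "norm (inn H (v' n) (w' n) - inn H (v n) (w n)) \<le>
        hnorm H (sub H (v' n) (v n)) * hnorm H (w' n) + hnorm H (v n) * hnorm H (sub H (w' n) (w n))"
        by (intro norm_inn_diff cauchy_closed c)
      also have "\<dots> \<le> hnorm H (sub H (v' n) (v n)) * B + A * hnorm H (sub H (w' n) (w n))"
        by (intro add_mono mult_left_mono mult_right_mono A B hnorm_nonneg)
      finally show ?thesis
        by (simp add: hnorm_sub_commute[OF cauchy_closed[OF c(1)] cauchy_closed[OF c(3)]]
            hnorm_sub_commute[OF cauchy_closed[OF c(2)] cauchy_closed[OF c(4)]])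
    qed
    then have "(\<lambda>n. norm (inn H (v' n) (w' n) - inn H (v n) (w n))) \<longlonglongrightarrow> 0"
      by (intro LIMSEQ_squeeze_0[OF z]) auto
    then have "(\<lambda>n. inn H (v' n) (w' n) - inn H (v n) (w n)) \<longlonglongrightarrow> 0"
      by (simp add: tendsto_norm_zero_iff)
    then have "(\<lambda>n. (inn H (v' n) (w' n) - inn H (v n) (w n)) + inn H (v n) (w n)) \<longlonglongrightarrow> 0 + l"
      using l by (rule tendsto_add)
    then show ?thesis by simp
  qed
  have "(THE l. \<forall>v'\<in>cl v. \<forall>w'\<in>cl w. (\<lambda>n. inn H (v' n) (w' n)) \<longlonglongrightarrow> l) = l"
  proof (rule the_equality)
    fix l' assume "\<forall>v'\<in>cl v. \<forall>w'\<in>cl w. (\<lambda>n. inn H (v' n) (w' n)) \<longlonglongrightarrow> l'"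
    then have "(\<lambda>n. inn H (v n) (w n)) \<longlonglongrightarrow> l'" using cl_self[OF v] cl_self[OF w] by blast
    then show "l' = l" using l by (rule LIMSEQ_unique)
  qed (use ev in blast)
  then show ?thesis using l by (simp add: completion_def)
qed

lemma inn_completion_eqI:
  assumes "v \<in> cauchy_seqs H" "w \<in> cauchy_seqs H" "(\<lambda>n. inn H (v n) (w n)) \<longlonglongrightarrow> l"
  shows "inn (completion H) (cl v) (cl w) = l"
  using inn_completion[OF assms(1,2)] assms(3) by (rule LIMSEQ_unique)

lemmas completion_simps = nul_completion add_completion lact_completion ract_completion
  cauchy_add cauchy_lact cauchy_ract cauchy_const nul_closed

text \<open>Each axiom is the limit of the same axiom for representatives. For the Gram condition,
  one sufficiently late index approximates all entries of the finite matrix at once.\<close>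

lemma precorr_completion: "precorr (completion H)"
proof
  show "nul (completion H) \<in> carr (completion H)"
    by (auto simp: carr_completion nul_completion intro!: cauchy_const nul_closed)
  fix C D E a b c
  assume C: "C \<in> carr (completion H)"
  then obtain u where u: "u \<in> cauchy_seqs H" "C = cl u" by (auto simp: carr_completion)
  note uc = cauchy_closed[OF u(1)]
  show "lact (completion H) b C \<in> carr (completion H)"
    using u(1) by (auto simp: carr_completion u(2) lact_completion intro: cauchy_lact)
  show "ract (completion H) C b \<in> carr (completion H)"
    using u(1) by (auto simp: carr_completion u(2) ract_completion intro: cauchy_ract)
  show "inn (completion H) C (nul (completion H)) = 0"
    using u(1) by (auto simp: u(2) completion_simps inn_nul cauchy_closed intro!: inn_completion_eqI)
  assume D: "D \<in> carr (completion H)"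
  then obtain v where v: "v \<in> cauchy_seqs H" "D = cl v" by (auto simp: carr_completion)
  note vc = cauchy_closed[OF v(1)]
  note uv = inn_completion[OF u(1) v(1)]
  show "add (completion H) C D \<in> carr (completion H)"
    using u(1) v(1) by (auto simp: carr_completion u(2) v(2) add_completion intro: cauchy_add)
  show "inn (completion H) C (ract (completion H) D b) = inn (completion H) C D * b"
    unfolding u v by (simp add: completion_simps u v)
      (rule inn_completion_eqI, auto simp: completion_simps u v inn_ract uc vc intro!: tendsto_mult_right uv)
  show "cstar (inn (completion H) C D) = inn (completion H) D C"
    unfolding u v by (rule HOL.sym, rule inn_completion_eqI)
      (use tendsto_cstar[OF uv] in \<open>auto simp: u v inn_star uc vc\<close>)
  show "inn (completion H) C (lact (completion H) b D) = inn (completion H) (lact (completion H) (cstar b) C) D"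
    unfolding u v by (simp add: completion_simps u v)
      (rule inn_completion_eqI, auto simp: completion_simps u v inn_lact uc vc intro!: inn_completion)
  show "inn (completion H) C (lact (completion H) (a + b) D) =
      inn (completion H) C (lact (completion H) a D) + inn (completion H) C (lact (completion H) b D)"
    unfolding u v by (simp add: completion_simps u v)
      (rule inn_completion_eqI, auto simp: completion_simps u v inn_lact_add uc vc intro!: tendsto_add inn_completion)
  show "inn (completion H) C (lact (completion H) (a * b) D) =
      inn (completion H) C (lact (completion H) a (lact (completion H) b D))"
    unfolding u v by (simp add: completion_simps u v)
      (rule inn_completion_eqI, auto simp: completion_simps u v inn_lact_mult uc vc intro!: inn_completion)
  have bl: "bounded_linear (scaleC c :: 'b \<Rightarrow> 'b)"
    by (rule bounded_linear_intro[where K = "cmod c"])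
      (auto simp: scaleC_add_right norm_scaleC scaleC_scaleC simp flip: scaleC_of_real, simp add: mult.commute)
  show "inn (completion H) C (lact (completion H) (scaleC c 1) D) = scaleC c (inn (completion H) C D)"
    unfolding u v by (simp add: completion_simps u v)
      (rule inn_completion_eqI, auto simp: completion_simps u v inn_lact_scalar uc vc
        intro!: bounded_linear.tendsto[OF bl] uv)
  assume E: "E \<in> carr (completion H)"
  then obtain w where w: "w \<in> cauchy_seqs H" "E = cl w" by (auto simp: carr_completion)
  note wc = cauchy_closed[OF w(1)]
  show "inn (completion H) C (add (completion H) D E) = inn (completion H) C D + inn (completion H) C E"
    unfolding u v w by (simp add: completion_simps u v w)
      (rule inn_completion_eqI, auto simp: completion_simps u v w inn_add uc vc wc intro!: tendsto_add inn_completion)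
next
  fix m and f :: "nat \<Rightarrow> (nat \<Rightarrow> 'h) set"
  assume "\<And>i. i < m \<Longrightarrow> f i \<in> carr (completion H)"
  then have "\<forall>i<m. \<exists>v\<in>cauchy_seqs H. f i = cl v" by (simp add: carr_completion)
  then obtain v where v: "\<And>i. i < m \<Longrightarrow> v i \<in> cauchy_seqs H" "\<And>i. i < m \<Longrightarrow> f i = cl (v i)"
    by metis
  show "gram_pos m (\<lambda>i k. inn (completion H) (f i) (f k))"
  proof (rule gram_pos_limit)
    fix e :: real assume "e > 0"
    have "\<forall>\<^sub>F n in sequentially. norm (inn H (v i n) (v k n) - inn (completion H) (f i) (f k)) < e"
      if "i < m" "k < m" for i k
      using tendstoD[OF inn_completion[OF v(1)[OF that(1)] v(1)[OF that(2)]] \<open>e > 0\<close>] v(2) that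
      by (simp add: dist_norm)
    then have "\<forall>\<^sub>F n in sequentially. \<forall>i\<in>{..<m}. \<forall>k\<in>{..<m}.
        norm (inn H (v i n) (v k n) - inn (completion H) (f i) (f k)) < e"
      by (intro eventually_ball_finite ballI finite_lessThan) auto
    then obtain n where "\<And>i k. i < m \<Longrightarrow> k < m \<Longrightarrow>
        norm (inn H (v i n) (v k n) - inn (completion H) (f i) (f k)) < e"
      unfolding eventually_sequentially by (metis lessThan_iff order_refl)
    then show "\<exists>B. gram_pos m B \<and> (\<forall>i<m. \<forall>k<m. norm (inn (completion H) (f i) (f k) - B i k) < e)"
      using inn_gram[of m "\<lambda>i. v i n"] v(1)
      by (intro exI[of _ "\<lambda>i k. inn H (v i n) (v k n)"]) (auto simp: norm_minus_commute cauchy_closed)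
  qed
qed

lemma hnorm_completion:
  assumes v: "v \<in> cauchy_seqs H"
  shows "(\<lambda>n. hnorm H (v n)) \<longlonglongrightarrow> hnorm (completion H) (cl v)"
  unfolding hnorm_def by (intro tendsto_intros inn_completion v)

lemma cauchy_sub: "v \<in> cauchy_seqs H \<Longrightarrow> w \<in> cauchy_seqs H \<Longrightarrow> (\<lambda>n. sub H (v n) (w n)) \<in> cauchy_seqs H"
  unfolding sub_def by (intro cauchy_add cauchy_ract)

lemma sub_completion:
  "v \<in> cauchy_seqs H \<Longrightarrow> w \<in> cauchy_seqs H \<Longrightarrow>
    sub (completion H) (cl v) (cl w) = cl (\<lambda>n. sub H (v n) (w n))"
  unfolding sub_def by (simp add: completion_simps)

lemma embed_eq_cl: "embed H h = cl (\<lambda>_. h)"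
  by (simp add: embed_def cl_def)

lemma embed_closed: "h \<in> carr H \<Longrightarrow> embed H h \<in> carr (completion H)"
  by (auto simp: embed_eq_cl carr_completion intro: cauchy_const)

lemma inn_embed: "h \<in> carr H \<Longrightarrow> k \<in> carr H \<Longrightarrow> inn (completion H) (embed H h) (embed H k) = inn H h k"
  unfolding embed_eq_cl by (rule inn_completion_eqI) (auto intro: cauchy_const)

lemma embed_add: "h \<in> carr H \<Longrightarrow> k \<in> carr H \<Longrightarrow>
    add (completion H) (embed H h) (embed H k) = embed H (add H h k)"
  by (simp add: embed_eq_cl completion_simps)

lemma embed_lact: "h \<in> carr H \<Longrightarrow> lact (completion H) b (embed H h) = embed H (lact H b h)"
  by (simp add: embed_eq_cl completion_simps)

lemma embed_ract: "h \<in> carr H \<Longrightarrow> ract (completion H) (embed H h) b = embed H (ract H h b)"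
  by (simp add: embed_eq_cl completion_simps)

lemma embed_nul: "embed H (nul H) = nul (completion H)"
  by (simp add: embed_eq_cl nul_completion)

lemma embed_sub: "h \<in> carr H \<Longrightarrow> k \<in> carr H \<Longrightarrow>
    sub (completion H) (embed H h) (embed H k) = embed H (sub H h k)"
  by (simp add: sub_def embed_add embed_ract closed)

lemma hnorm_embed: "h \<in> carr H \<Longrightarrow> hnorm (completion H) (embed H h) = hnorm H h"
  by (simp add: hnorm_def inn_embed)

lemma hlim_embed:
  assumes v: "v \<in> cauchy_seqs H"
  shows "hlim (completion H) (\<lambda>n. embed H (v n)) (cl v)"
  unfolding hlim_def
proof (intro conjI allI embed_closed cauchy_closed v)
  show "cl v \<in> carr (completion H)" using v by (auto simp: carr_completion)
  show "(\<lambda>n. hnorm (completion H) (sub (completion H) (embed H (v n)) (cl v))) \<longlonglongrightarrow> 0"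
  proof (rule LIMSEQ_I)
    fix e :: real assume "e > 0"
    obtain N where N: "\<And>m n. m \<ge> N \<Longrightarrow> n \<ge> N \<Longrightarrow> hnorm H (sub H (v m) (v n)) < e / 2"
      using cauchyD[OF v, of "e / 2"] \<open>e > 0\<close> by auto
    have "hnorm (completion H) (sub (completion H) (embed H (v n)) (cl v)) \<le> e / 2" if "n \<ge> N" for n
    proof -
      have c: "(\<lambda>m. sub H (v n) (v m)) \<in> cauchy_seqs H"
        by (intro cauchy_sub cauchy_const cauchy_closed v)
      have "(\<lambda>m. hnorm H (sub H (v n) (v m))) \<longlonglongrightarrow> hnorm (completion H) (sub (completion H) (embed H (v n)) (cl v))"
        using hnorm_completion[OF c] v cauchy_closed[OF v]
        by (simp add: embed_eq_cl sub_completion cauchy_const)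
      moreover have "\<forall>m\<ge>N. hnorm H (sub H (v n) (v m)) \<le> e / 2" using N that by (simp add: less_imp_le)
      ultimately show ?thesis by (intro LIMSEQ_le_const2) auto
    qed
    then show "\<exists>N. \<forall>n\<ge>N. norm (hnorm (completion H) (sub (completion H) (embed H (v n)) (cl v)) - 0) < e"
      using \<open>e > 0\<close> precorr.hnorm_nonneg[OF precorr_completion] by (intro exI[of _ N]) fastforce
  qed
qed

lemma hdense_embed: "hdense (completion H) (embed H ` carr H)"
  unfolding hdense_def
proof (intro conjI ballI allI impI)
  show "embed H ` carr H \<subseteq> carr (completion H)" using embed_closed by blast
  fix C and e :: real assume "C \<in> carr (completion H)" "e > 0"
  then obtain v where v: "v \<in> cauchy_seqs H" "C = cl v" by (auto simp: carr_completion)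
  have z: "(\<lambda>n. hnorm (completion H) (sub (completion H) (embed H (v n)) C)) \<longlonglongrightarrow> 0"
    using hlim_embed[OF v(1)] by (simp add: hlim_def v)
  obtain n where "\<And>m. m \<ge> n \<Longrightarrow> norm (hnorm (completion H) (sub (completion H) (embed H (v m)) C) - 0) < e"
    using LIMSEQ_D[OF z \<open>e > 0\<close>] by blast
  from this[of n] have "hnorm (completion H) (sub (completion H) (embed H (v n)) C) < e" by simp
  then show "\<exists>w\<in>embed H ` carr H. hnorm (completion H) (sub (completion H) C w) < e"
    using precorr.hnorm_sub_commute[OF precorr_completion \<open>C \<in> carr (completion H)\<close> embed_closed[OF cauchy_closed[OF v(1)]]]
    by (intro bexI[of _ "embed H (v n)"]) (auto intro: cauchy_closed v)
qed

text \<open>Completeness: choose for each \<open>V n\<close> an element of \<open>H\<close> at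
  distance below \<open>1 / Suc n\<close>. These elements form a Cauchy sequence in
  \<open>H\<close>, and its class is the limit.\<close>

lemma hcorr_completion: "hcorr (completion H)"
proof -
  interpret c: precorr "completion H" by (rule precorr_completion)
  show ?thesis
  proof
    fix C D assume C: "C \<in> carr (completion H)" and D: "D \<in> carr (completion H)"
      and eq: "\<And>E. E \<in> carr (completion H) \<Longrightarrow> inn (completion H) E C = inn (completion H) E D"
    obtain v w where v: "v \<in> cauchy_seqs H" "C = cl v" and w: "w \<in> cauchy_seqs H" "D = cl w"
      using C D by (auto simp: carr_completion)
    have "(\<lambda>n. hnorm H (sub H (v n) (w n))) \<longlonglongrightarrow> hnorm (completion H) (sub (completion H) C D)"
      using hnorm_completion[OF cauchy_sub[OF v(1) w(1)]] by (simp add: v w sub_completion)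
    also have "hnorm (completion H) (sub (completion H) C D) = 0" using c.hnorm_sub_0[OF C D eq] .
    finally show "C = D" using v w by (simp add: cl_eq_iff null_rel_def)
  next
    fix V assume V: "V \<in> cauchy_seqs (completion H)"
    have "\<exists>h\<in>carr H. hnorm (completion H) (sub (completion H) (V n) (embed H h)) < 1 / real (Suc n)" for n
    proof -
      have "1 / real (Suc n) > 0" by simp
      then show ?thesis using hdense_embed c.cauchy_closed[OF V, of n] unfolding hdense_def by blast
    qed
    then obtain u where u: "\<And>n. u n \<in> carr H"
      "\<And>n. hnorm (completion H) (sub (completion H) (V n) (embed H (u n))) < 1 / real (Suc n)" by metis
    define d where "d = (\<lambda>n. hnorm (completion H) (sub (completion H) (V n) (embed H (u n))))"
    have d0: "d \<longlonglongrightarrow> 0"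
      by (rule LIMSEQ_squeeze_0[OF LIMSEQ_Suc[OF lim_1_over_n]])
        (use u(2) in \<open>auto simp: d_def c.hnorm_nonneg less_imp_le\<close>)
    note cc = c.cauchy_closed[OF V] embed_closed[OF u(1)]
    have uC: "u \<in> cauchy_seqs H"
      unfolding cauchy_seqs_def
    proof (intro CollectI conjI allI impI u(1))
      fix e :: real assume "e > 0"
      obtain M where M: "\<And>m n. m \<ge> M \<Longrightarrow> n \<ge> M \<Longrightarrow> hnorm (completion H) (sub (completion H) (V m) (V n)) < e / 3"
        using c.cauchyD[OF V, of "e / 3"] \<open>e > 0\<close> by auto
      obtain N where N: "\<And>n. n \<ge> N \<Longrightarrow> norm (d n - 0) < e / 3" using LIMSEQ_D[OF d0, of "e / 3"] \<open>e > 0\<close> by auto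
      have "hnorm H (sub H (u m) (u n)) < e" if "m \<ge> max M N" "n \<ge> max M N" for m n
      proof -
        have "hnorm H (sub H (u m) (u n)) = hnorm (completion H) (sub (completion H) (embed H (u m)) (embed H (u n)))"
          using u(1) by (simp add: embed_sub hnorm_embed closed)
        also have "\<dots> \<le> d m + (hnorm (completion H) (sub (completion H) (V m) (V n)) + d n)"
          using c.hnorm_sub_triangle[OF cc(2)[of m] cc(1)[of m] cc(2)[of n]]
            c.hnorm_sub_triangle[OF cc(1)[of m] cc(1)[of n] cc(2)[of n]]
            c.hnorm_sub_commute[OF cc(2)[of m] cc(1)[of m]] by (simp add: d_def)
        also have "\<dots> < e" using M[of m n] N[of m] N[of n] that by auto
        finally show ?thesis .
      qed
      then show "\<exists>N. \<forall>m\<ge>N. \<forall>n\<ge>N. hnorm H (sub H (u m) (u n)) < e" by blast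
    qed
    have clu: "cl u \<in> carr (completion H)" using uC by (auto simp: carr_completion)
    have "(\<lambda>n. d n + hnorm (completion H) (sub (completion H) (embed H (u n)) (cl u))) \<longlonglongrightarrow> 0"
      using hlim_embed[OF uC] by (intro tendsto_add_zero d0) (simp add: hlim_def)
    then have "(\<lambda>n. hnorm (completion H) (sub (completion H) (V n) (cl u))) \<longlonglongrightarrow> 0"
      by (rule LIMSEQ_squeeze_0)
        (auto simp: d_def c.hnorm_nonneg intro!: c.hnorm_sub_triangle cc clu)
    then show "\<exists>C. hlim (completion H) V C" using cc clu by (auto simp: hlim_def)
  qed
qed

end

section \<open>Interior tensor products\<close>

definition admissible :: "(nat \<Rightarrow> ('b, 'h) corr) \<Rightarrow> nat list \<Rightarrow> 'h list \<Rightarrow> bool" where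
  "admissible K s w \<longleftrightarrow> list_all2 (\<lambda>j h. h \<in> carr (K j)) s w"

lemma admissible_Nil [simp]: "admissible K [] w \<longleftrightarrow> w = []" "admissible K s [] \<longleftrightarrow> s = []"
  by (auto simp: admissible_def)

lemma admissible_Cons [simp]:
  "admissible K (j # s) (h # w) \<longleftrightarrow> h \<in> carr (K j) \<and> admissible K s w"
  by (auto simp: admissible_def)

lemma admissible_ConsE:
  assumes "admissible K (j # s) w"
  obtains h t where "w = h # t" "h \<in> carr (K j)" "admissible K s t"
  using assms by (auto simp: admissible_def list_all2_Cons1)

definition precorrs :: "(nat \<Rightarrow> ('b::unital_cstar, 'h) corr) \<Rightarrow> nat list \<Rightarrow> bool" where
  "precorrs K s \<longleftrightarrow> (\<forall>j\<in>set s. precorr (K j))"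

lemma precorrs_Cons [simp]: "precorrs K (j # s) \<longleftrightarrow> precorr (K j) \<and> precorrs K s"
  by (simp add: precorrs_def)

lemma precorrs_Nil [simp]: "precorrs K []"
  by (simp add: precorrs_def)

lemma tensor_inn_add:
  "precorrs K s \<Longrightarrow> admissible K s w \<Longrightarrow> admissible K s w' \<Longrightarrow>
    tensor_inn K s (a + b) w w' = tensor_inn K s a w w' + tensor_inn K s b w w'"
proof (induction s arbitrary: a b w w')
  case (Cons j s)
  then show ?case
    by (auto elim!: admissible_ConsE simp: precorr.inn_lact_add)
qed simp

lemma tensor_inn_scaleC:
  "precorrs K s \<Longrightarrow> admissible K s w \<Longrightarrow> admissible K s w' \<Longrightarrow>
    tensor_inn K s (scaleC c a) w w' = scaleC c (tensor_inn K s a w w')"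
proof (induction s arbitrary: a w w')
  case (Cons j s)
  have "inn (K j) h (lact (K j) (scaleC c a) k) = scaleC c (inn (K j) h (lact (K j) a k))"
    if "h \<in> carr (K j)" "k \<in> carr (K j)" for h k
    using precorr.inn_lact_mult[of "K j" h k "scaleC c 1" a] precorr.inn_lact_scalar[of "K j" h "lact (K j) a k" c]
      precorr.lact_closed[of "K j" k a] Cons.prems that by (simp add: mult_scaleC_left)
  then show ?case using Cons by (auto elim!: admissible_ConsE)
qed simp

lemma tensor_inn_scaleR:
  "precorrs K s \<Longrightarrow> admissible K s w \<Longrightarrow> admissible K s w' \<Longrightarrow>
    tensor_inn K s (r *\<^sub>R a) w w' = r *\<^sub>R tensor_inn K s a w w'"
  by (metis scaleC_of_real tensor_inn_scaleC)

text \<open>For fixed vectors the pairing is bounded in its coefficient. This provides the constant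
  with which iterates of an operator on the first factor grow inside a tensor.\<close>

lemma tensor_inn_bounded:
  "precorrs K s \<Longrightarrow> admissible K s w \<Longrightarrow> admissible K s w' \<Longrightarrow>
    \<exists>C\<ge>0. \<forall>b. norm (tensor_inn K s b w w') \<le> C * norm b"
proof (induction s arbitrary: w w')
  case (Cons j s)
  obtain h t where w: "w = h # t" "h \<in> carr (K j)" "admissible K s t"
    using Cons.prems(2) by (rule admissible_ConsE)
  obtain k u where w': "w' = k # u" "k \<in> carr (K j)" "admissible K s u"
    using Cons.prems(3) by (rule admissible_ConsE)
  interpret precorr "K j" using Cons.prems by simp
  obtain C where C: "C \<ge> 0" "\<And>b. norm (tensor_inn K s b t u) \<le> C * norm b"
    using Cons.IH[OF _ w(3) w'(3)] Cons.prems(1) by auto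
  have "norm (inn (K j) h (lact (K j) b k)) \<le> hnorm (K j) h * (norm b * hnorm (K j) k)" for b
    using cauchy_schwarz[of h "lact (K j) b k"] hnorm_lact[of k b] w w'
    by (meson hnorm_nonneg lact_closed mult_left_mono order_trans)
  then have "norm (tensor_inn K (j # s) b w w') \<le> C * (hnorm (K j) h * (norm b * hnorm (K j) k))" for b
    unfolding w(1) w'(1) tensor_inn.simps using C by (meson mult_left_mono order_trans)
  then show ?case
    using C(1) by (intro exI[of _ "C * (hnorm (K j) h * hnorm (K j) k)"])
      (auto simp: hnorm_nonneg mult_ac)
qed (auto intro: exI[of _ 1])

lemma tensor_inn_star:
  "precorrs K s \<Longrightarrow> admissible K s w \<Longrightarrow> admissible K s w' \<Longrightarrow>
    cstar (tensor_inn K s b w w') = tensor_inn K s (cstar b) w' w"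
proof (induction s arbitrary: b w w')
  case (Cons j s)
  have "cstar (inn (K j) h (lact (K j) b k)) = inn (K j) k (lact (K j) (cstar b) h)"
    if "h \<in> carr (K j)" "k \<in> carr (K j)" for h k
    using that Cons.prems precorr.inn_star[of "K j" h "lact (K j) b k"] precorr.inn_lact[of "K j" k h "cstar b"]
    by (simp add: cstar_cstar precorr.lact_closed)
  then show ?case using Cons by (auto elim!: admissible_ConsE)
qed simp

text \<open>A left action on the first factor is absorbed into the coefficient. The left action on
  formal tensors changes the word, and this is how its pairings are computed.\<close>

lemma tensor_inn_lact:
  assumes "precorr (K j)" "precorrs K s" "h \<in> carr (K j)" "k \<in> carr (K j)"
  shows "tensor_inn K (j # s) a (h # t) (lact (K j) b k # u) = tensor_inn K (j # s) (a * b) (h # t) (k # u)"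
    and "tensor_inn K (j # s) a (lact (K j) b h # t) (k # u) = tensor_inn K (j # s) (cstar b * a) (h # t) (k # u)"
  using assms precorr.inn_lact_mult[of "K j" h k a b] precorr.inn_lact_mult[of "K j" h k "cstar b" a]
    precorr.inn_lact[of "K j" h "lact (K j) a k" "cstar b"]
  by (simp_all add: precorr.lact_closed cstar_cstar)

text \<open>The induction needs an arbitrary coefficient matrix \<open>A\<close>, because peeling
  off the first factors replaces \<open>A i k\<close> by
  \<open>\<langle>h i, A i k (h k)\<rangle>\<close>. If \<open>A i k\<close> is close to
  \<open>\<Sum>l<r. cstar (C l i) * C l k\<close>, that matrix is close to a sum of Gram matrices of
  the vectors \<open>C l i (h i)\<close>.\<close>

lemma gram_pos_tensor_inn:
  "precorrs K s \<Longrightarrow> gram_pos m A \<Longrightarrow> (\<And>i. i < m \<Longrightarrow> admissible K s (W i)) \<Longrightarrow>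
    gram_pos m (\<lambda>i k. tensor_inn K s (A i k) (W i) (W k))"
proof (induction s arbitrary: A W)
  case Nil
  show ?case using Nil(2) by simp
next
  case (Cons j s)
  interpret precorr "K j" using Cons.prems by simp
  define h where "h = (\<lambda>i. hd (W i))"
  define t where "t = (\<lambda>i. tl (W i))"
  have W: "W i = h i # t i" "h i \<in> carr (K j)" "admissible K s (t i)" if "i < m" for i
    using Cons.prems(3)[OF that] by (auto elim!: admissible_ConsE simp: h_def t_def)
  have "gram_pos m (\<lambda>i k. inn (K j) (h i) (lact (K j) (A i k) (h k)))"
  proof (rule gram_pos_limit)
    fix e :: real assume "e > 0"
    \<comment> \<open>A strict common bound for the norms of the first factors; an error in
      \<open>A\<close> is amplified by at most \<open>M * M\<close>.\<close>
    define M where "M = 1 + (\<Sum>i<m. hnorm (K j) (h i))"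
    have M: "M > 0" unfolding M_def by (intro add_pos_nonneg sum_nonneg hnorm_nonneg) auto
    have hM: "hnorm (K j) (h i) < M" if "i < m" for i
      using member_le_sum[of i "{..<m}" "\<lambda>i. hnorm (K j) (h i)"] that hnorm_nonneg
      by (simp add: M_def)
    obtain r C where C: "\<And>i k. i < m \<Longrightarrow> k < m \<Longrightarrow>
        norm (A i k - (\<Sum>l<(r::nat). cstar (C l i) * C l k)) < e / (M * M)"
      using M \<open>e > 0\<close> by (rule_tac gram_posE[OF Cons.prems(2), of "e / (M * M)"]) auto
    define B where "B = (\<lambda>i k. \<Sum>l<r. cstar (C l i) * C l k)"
    have lsum: "inn (K j) x (lact (K j) (\<Sum>l<n. f l) y) = (\<Sum>l<n. inn (K j) x (lact (K j) (f l) y))"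
      if "x \<in> carr (K j)" "y \<in> carr (K j)" for x y f and n :: nat
      using that by (induction n) (auto simp: inn_lact_zero inn_lact_add)
    have "gram_pos m (\<lambda>i k. \<Sum>l<r. inn (K j) (lact (K j) (C l i) (h i)) (lact (K j) (C l k) (h k)))"
      by (intro gram_pos_sum inn_gram lact_closed W)
    also have "?this \<longleftrightarrow> gram_pos m (\<lambda>i k. inn (K j) (h i) (lact (K j) (B i k) (h k)))"
      using W by (intro gram_pos_cong)
        (simp add: B_def lsum inn_lact_mult inn_lact[of "h _" "lact (K j) _ (h _)"] lact_closed cstar_cstar)
    finally have "gram_pos m (\<lambda>i k. inn (K j) (h i) (lact (K j) (B i k) (h k)))" .
    moreover have "norm (inn (K j) (h i) (lact (K j) (A i k) (h k)) - inn (K j) (h i) (lact (K j) (B i k) (h k))) < e"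
      if ik: "i < m" "k < m" for i k
    proof -
      have "norm (inn (K j) (h i) (lact (K j) (A i k) (h k)) - inn (K j) (h i) (lact (K j) (B i k) (h k))) =
          norm (inn (K j) (h i) (lact (K j) (A i k - B i k) (h k)))"
        using W ik by (simp add: inn_lact_diff)
      also have "\<dots> \<le> hnorm (K j) (h i) * hnorm (K j) (lact (K j) (A i k - B i k) (h k))"
        using W ik by (intro cauchy_schwarz lact_closed) auto
      also have "\<dots> \<le> M * (norm (A i k - B i k) * M)"
        using W ik hM[of i] hM[of k]
        by (intro mult_mono order_trans[OF hnorm_lact] mult_nonneg_nonneg hnorm_nonneg)
          (use M in \<open>auto intro: less_imp_le\<close>)
      also have "\<dots> < M * (e / (M * M) * M)"
        using C[OF ik] M unfolding B_def[symmetric] by (intro mult_strict_left_mono mult_strict_right_mono) (auto simp: B_def)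
      finally show ?thesis using M by simp
    qed
    ultimately show "\<exists>B. gram_pos m B \<and>
        (\<forall>i<m. \<forall>k<m. norm (inn (K j) (h i) (lact (K j) (A i k) (h k)) - B i k) < e)"
      by blast
  qed
  then have "gram_pos m (\<lambda>i k. tensor_inn K s (inn (K j) (h i) (lact (K j) (A i k) (h k))) (t i) (t k))"
    using Cons.prems(1) W by (intro Cons.IH) auto
  then show ?case
    by (rule gram_pos_cong[THEN iffD1, rotated]) (simp add: W)
qed

definition lact_single :: "(nat \<Rightarrow> ('b::unital_cstar, 'h) corr) \<Rightarrow> nat list \<Rightarrow> 'b \<Rightarrow> 'h list \<Rightarrow> 'b \<Rightarrow> 'h list \<Rightarrow>\<^sub>0 'b" where
  "lact_single K s b w c = (case w of [] \<Rightarrow> Poly_Mapping.single [] (b * c)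
     | h # t \<Rightarrow> Poly_Mapping.single (lact (K (hd s)) b h # t) c)"

section \<open>The formal tensor module over a string and its completion\<close>

context
  fixes K :: "nat \<Rightarrow> ('b::unital_cstar, 'h) corr" and s :: "nat list"
  assumes K: "precorrs K s"
begin

abbreviation (input) "tpre \<equiv> tensor_pre K s"

lemma carr_tensor_pre: "f \<in> carr tpre \<longleftrightarrow> (\<forall>w\<in>Poly_Mapping.keys f. admissible K s w)"
  by (simp add: tensor_pre_def admissible_def)

lemma nul_tensor_pre: "nul tpre = 0"
  by (simp add: tensor_pre_def)

lemma add_tensor_pre: "add tpre f g = f + g"
  by (simp add: tensor_pre_def)

lemma lookup_ract_tensor_pre: "Poly_Mapping.lookup (ract tpre f b) w = Poly_Mapping.lookup f w * b"
  by (auto simp: tensor_pre_def Poly_Mapping.map.rep_eq when_def)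

lemma ract_tensor_pre_single: "ract tpre (Poly_Mapping.single w c) b = Poly_Mapping.single w (c * b)"
  by (rule poly_mapping_eqI) (auto simp: lookup_ract_tensor_pre lookup_single when_def)

text \<open>Index sets larger than the keys allow pairings of different functions to be compared
  over a common set of words.\<close>

lemma inn_tensor_pre:
  assumes "finite A" "Poly_Mapping.keys f \<subseteq> A" "finite B" "Poly_Mapping.keys g \<subseteq> B"
  shows "inn tpre f g = (\<Sum>w\<in>A. \<Sum>w'\<in>B.
    cstar (Poly_Mapping.lookup f w) * tensor_inn K s 1 w w' * Poly_Mapping.lookup g w')"
proof -
  have "inn tpre f g = (\<Sum>w\<in>Poly_Mapping.keys f. \<Sum>w'\<in>B.
      cstar (Poly_Mapping.lookup f w) * tensor_inn K s 1 w w' * Poly_Mapping.lookup g w')"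
    unfolding tensor_pre_def corr.simps
    using assms by (intro sum.cong HOL.refl sum.mono_neutral_left) (auto simp: in_keys_iff)
  also have "\<dots> = (\<Sum>w\<in>A. \<Sum>w'\<in>B.
      cstar (Poly_Mapping.lookup f w) * tensor_inn K s 1 w w' * Poly_Mapping.lookup g w')"
    using assms by (intro sum.mono_neutral_left) (auto simp: in_keys_iff cstar_zero)
  finally show ?thesis .
qed

lemma inn_tensor_pre_add: "inn tpre f (g + h) = inn tpre f g + inn tpre f h"
proof -
  let ?B = "Poly_Mapping.keys g \<union> Poly_Mapping.keys h"
  have "finite ?B" "Poly_Mapping.keys (g + h) \<subseteq> ?B" by (auto simp: keys_add subset_trans[OF keys_add])
  then show ?thesis
    using inn_tensor_pre[of "Poly_Mapping.keys f" f ?B g] inn_tensor_pre[of "Poly_Mapping.keys f" f ?B h]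
      inn_tensor_pre[of "Poly_Mapping.keys f" f ?B "g + h"]
    by (simp add: lookup_add ring_distribs sum.distrib)
qed

lemma inn_tensor_pre_sum: "inn tpre f (\<Sum>x\<in>A. g x) = (\<Sum>x\<in>A. inn tpre f (g x))"
proof (induction A rule: infinite_finite_induct)
  case (insert x F)
  then show ?case by (simp add: inn_tensor_pre_add)
qed (simp_all add: tensor_pre_def)

lemma inn_tensor_pre_single:
  "inn tpre f (Poly_Mapping.single w c) =
    (\<Sum>u\<in>Poly_Mapping.keys f. cstar (Poly_Mapping.lookup f u) * tensor_inn K s 1 u w * c)"
  by (subst inn_tensor_pre[of "Poly_Mapping.keys f" f "{w}"]) auto

lemma inn_tensor_pre_star:
  assumes "f \<in> carr tpre" "g \<in> carr tpre"
  shows "cstar (inn tpre f g) = inn tpre g f"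
proof -
  have "cstar (inn tpre f g) = (\<Sum>w\<in>Poly_Mapping.keys f. \<Sum>w'\<in>Poly_Mapping.keys g.
      cstar (Poly_Mapping.lookup g w') * tensor_inn K s 1 w' w * Poly_Mapping.lookup f w)"
    using assms unfolding carr_tensor_pre
    by (simp add: tensor_pre_def cstar_sum cstar_mult cstar_cstar tensor_inn_star[OF K] cstar_one mult.assoc)
  also have "\<dots> = inn tpre g f"
    unfolding tensor_pre_def corr.simps by (rule sum.swap)
  finally show ?thesis .
qed

lemma lact_tensor_pre:
  assumes "finite A" "Poly_Mapping.keys f \<subseteq> A"
  shows "lact tpre b f = (\<Sum>w\<in>A. lact_single K s b w (Poly_Mapping.lookup f w))"
proof -
  have "lact tpre b f = (\<Sum>w\<in>Poly_Mapping.keys f. lact_single K s b w (Poly_Mapping.lookup f w))"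
    unfolding tensor_pre_def corr.simps
    by (intro sum.cong HOL.refl) (simp add: lact_single_def split: list.split)
  also have "\<dots> = (\<Sum>w\<in>A. lact_single K s b w (Poly_Mapping.lookup f w))"
    using assms by (intro sum.mono_neutral_left) (auto simp: in_keys_iff lact_single_def split: list.split)
  finally show ?thesis .
qed

lemma lact_tensor_pre_single: "lact tpre b (Poly_Mapping.single w c) = lact_single K s b w c"
  by (subst lact_tensor_pre[of "{w}"]) auto

lemma lact_tensor_pre_add: "lact tpre b (f + g) = lact tpre b f + lact tpre b g"
proof -
  let ?B = "Poly_Mapping.keys f \<union> Poly_Mapping.keys g"
  have *: "lact_single K s b w (c + d) = lact_single K s b w c + lact_single K s b w d" for w c d
    by (auto simp: lact_single_def single_add ring_distribs split: list.split)
  have "finite ?B" "Poly_Mapping.keys (f + g) \<subseteq> ?B" by (auto simp: keys_add subset_trans[OF keys_add])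
  then show ?thesis
    using lact_tensor_pre[of ?B f b] lact_tensor_pre[of ?B g b] lact_tensor_pre[of ?B "f + g" b]
    by (simp add: lookup_add * sum.distrib)
qed

lemma lact_tensor_pre_sum: "lact tpre b (\<Sum>x\<in>A. g x) = (\<Sum>x\<in>A. lact tpre b (g x))"
proof (induction A rule: infinite_finite_induct)
  case (insert x F)
  then show ?case by (simp add: lact_tensor_pre_add)
qed (simp_all add: tensor_pre_def)

lemma admissible_lact_single:
  assumes "admissible K s w" "u \<in> Poly_Mapping.keys (lact_single K s b w c)"
  shows "admissible K s u"
  using assms K by (cases s; cases w) (auto simp: lact_single_def precorr.lact_closed split: if_splits)

lemma tensor_inn_lact_single:
  assumes "admissible K s w" "f \<in> carr tpre"
  shows "inn tpre f (lact tpre a (lact_single K s b w c)) =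
    (\<Sum>u\<in>Poly_Mapping.keys f. cstar (Poly_Mapping.lookup f u) * tensor_inn K s (a * b) u w * c)"
proof (cases s)
  case Nil
  then have "w = []" using assms by simp
  then show ?thesis
    by (simp add: lact_single_def lact_tensor_pre_single inn_tensor_pre_single mult.assoc)
next
  case (Cons j s')
  then obtain h t where w: "w = h # t" "h \<in> carr (K j)" "admissible K s' t"
    using assms(1) by (auto elim: admissible_ConsE)
  interpret precorr "K j" using K Cons by simp
  have c: "lact (K j) b h \<in> carr (K j)" using w by (simp add: lact_closed)
  have hs: "hd s = j" using Cons by simp
  have "inn tpre f (lact tpre a (lact_single K s b w c)) = (\<Sum>u\<in>Poly_Mapping.keys f.
      cstar (Poly_Mapping.lookup f u) * tensor_inn K s 1 u (lact (K j) a (lact (K j) b h) # t) * c)"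
    unfolding w(1) by (simp add: lact_single_def lact_tensor_pre_single inn_tensor_pre_single hs)
  also have "\<dots> = (\<Sum>u\<in>Poly_Mapping.keys f. cstar (Poly_Mapping.lookup f u) * tensor_inn K s (a * b) u w * c)"
  proof (rule sum.cong[OF HOL.refl])
    fix u assume "u \<in> Poly_Mapping.keys f"
    then have "admissible K s u" using assms(2) by (simp add: carr_tensor_pre)
    then have "admissible K (j # s') u" using Cons by simp
    then obtain k v where u: "u = k # v" "k \<in> carr (K j)" "admissible K s' v" by (rule admissible_ConsE)
    have "tensor_inn K s 1 u (lact (K j) a (lact (K j) b h) # t) = tensor_inn K s (a * b) u w"
      using tensor_inn_lact(1)[of K j s' k "lact (K j) b h" 1 v a t]
        tensor_inn_lact(1)[of K j s' k h a v b t] K w u c Cons by simp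
    then show "cstar (Poly_Mapping.lookup f u) * tensor_inn K s 1 u (lact (K j) a (lact (K j) b h) # t) * c =
        cstar (Poly_Mapping.lookup f u) * tensor_inn K s (a * b) u w * c" by simp
  qed
  finally show ?thesis .
qed

lemma lact_single_one: "admissible K s w \<Longrightarrow> f \<in> carr tpre \<Longrightarrow> inn tpre f (lact_single K s b w c) =
    (\<Sum>u\<in>Poly_Mapping.keys f. cstar (Poly_Mapping.lookup f u) * tensor_inn K s b u w * c)"
proof (cases s)
  case (Cons j s')
  assume w: "admissible K s w" and f: "f \<in> carr tpre"
  obtain h t where w': "w = h # t" "h \<in> carr (K j)" using w Cons by (auto elim: admissible_ConsE)
  have hs: "hd s = j" using Cons by simp
  have "inn tpre f (lact_single K s b w c) = (\<Sum>u\<in>Poly_Mapping.keys f.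
      cstar (Poly_Mapping.lookup f u) * tensor_inn K s 1 u (lact (K j) b h # t) * c)"
    unfolding w'(1) by (simp add: lact_single_def inn_tensor_pre_single hs)
  also have "\<dots> = (\<Sum>u\<in>Poly_Mapping.keys f. cstar (Poly_Mapping.lookup f u) * tensor_inn K s b u w * c)"
  proof (rule sum.cong[OF HOL.refl])
    fix u assume "u \<in> Poly_Mapping.keys f"
    then have "admissible K s u" using f by (simp add: carr_tensor_pre)
    then have "admissible K (j # s') u" using Cons by simp
    then obtain k v where u: "u = k # v" "k \<in> carr (K j)" "admissible K s' v" by (rule admissible_ConsE)
    have "tensor_inn K s 1 u (lact (K j) b h # t) = tensor_inn K s b u w"
      using tensor_inn_lact(1)[of K j s' k h 1 v b t] K w' u Cons by simp
    then show "cstar (Poly_Mapping.lookup f u) * tensor_inn K s 1 u (lact (K j) b h # t) * c =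
        cstar (Poly_Mapping.lookup f u) * tensor_inn K s b u w * c" by simp
  qed
  finally show ?thesis .
next
  case Nil
  assume "admissible K s w"
  then have "w = []" using Nil by simp
  then show ?thesis by (simp add: lact_single_def inn_tensor_pre_single mult.assoc)
qed

lemma inn_lact_tensor_pre:
  assumes "f \<in> carr tpre" "g \<in> carr tpre"
  shows "inn tpre f (lact tpre b g) = (\<Sum>w\<in>Poly_Mapping.keys g. \<Sum>u\<in>Poly_Mapping.keys f.
    cstar (Poly_Mapping.lookup f u) * tensor_inn K s b u w * Poly_Mapping.lookup g w)"
  using assms by (subst lact_tensor_pre[of "Poly_Mapping.keys g"])
    (auto simp: inn_tensor_pre_sum lact_single_one carr_tensor_pre intro!: sum.cong)

lemma keys_lact_tensor_pre:
  assumes "f \<in> carr tpre"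
  shows "lact tpre b f \<in> carr tpre"
  unfolding carr_tensor_pre
proof
  fix u assume "u \<in> Poly_Mapping.keys (lact tpre b f)"
  then have "u \<in> Poly_Mapping.keys (\<Sum>w\<in>Poly_Mapping.keys f. lact_single K s b w (Poly_Mapping.lookup f w))"
    by (subst (asm) lact_tensor_pre[of "Poly_Mapping.keys f"]) auto
  then have "\<exists>w\<in>Poly_Mapping.keys f. u \<in> Poly_Mapping.keys (lact_single K s b w (Poly_Mapping.lookup f w))"
    by (auto simp: in_keys_iff lookup_sum) (meson sum.neutral)
  then show "admissible K s u" using assms admissible_lact_single by (auto simp: carr_tensor_pre)
qed

lemma precorr_tensor_pre: "precorr tpre"
proof
  show "nul tpre \<in> carr tpre" by (simp add: carr_tensor_pre nul_tensor_pre)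
  fix f g h and a b :: 'b and c
  assume f: "f \<in> carr tpre"
  show "lact tpre b f \<in> carr tpre" by (rule keys_lact_tensor_pre[OF f])
  show "ract tpre f b \<in> carr tpre" using f
    by (auto simp: carr_tensor_pre in_keys_iff lookup_ract_tensor_pre)
  show "inn tpre f (nul tpre) = 0" by (simp add: tensor_pre_def)
  assume g: "g \<in> carr tpre"
  show "add tpre f g \<in> carr tpre" using f g keys_add[of f g] by (auto simp: carr_tensor_pre add_tensor_pre)
  show "inn tpre f (ract tpre g b) = inn tpre f g * b"
  proof -
    have "Poly_Mapping.keys (ract tpre g b) \<subseteq> Poly_Mapping.keys g"
      by (auto simp: in_keys_iff lookup_ract_tensor_pre)
    then show ?thesis
      by (subst (1 2) inn_tensor_pre[of "Poly_Mapping.keys f" f "Poly_Mapping.keys g"])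
        (auto simp: lookup_ract_tensor_pre sum_distrib_right mult.assoc)
  qed
  show "cstar (inn tpre f g) = inn tpre g f" by (rule inn_tensor_pre_star[OF f g])
  show "inn tpre f (lact tpre (a + b) g) = inn tpre f (lact tpre a g) + inn tpre f (lact tpre b g)"
    using f g by (simp add: inn_lact_tensor_pre carr_tensor_pre tensor_inn_add[OF K] ring_distribs sum.distrib)
  show "inn tpre f (lact tpre (scaleC c 1) g) = scaleC c (inn tpre f g)"
  proof -
    have s: "scaleC c (sum q A) = (\<Sum>x\<in>A. scaleC c (q x :: 'b))" for q and A :: "'x set"
      by (induction A rule: infinite_finite_induct)
        (auto simp: scaleC_add_right intro: scaleC_diff_right[of c 0 0, simplified])
    have "inn tpre f g = (\<Sum>w\<in>Poly_Mapping.keys g. \<Sum>u\<in>Poly_Mapping.keys f.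
        cstar (Poly_Mapping.lookup f u) * tensor_inn K s 1 u w * Poly_Mapping.lookup g w)"
      unfolding tensor_pre_def corr.simps by (rule sum.swap)
    then show ?thesis
      using f g by (simp add: inn_lact_tensor_pre carr_tensor_pre tensor_inn_scaleC[OF K] s
          mult_scaleC_left mult_scaleC_right)
  qed
  show "inn tpre f (lact tpre (a * b) g) = inn tpre f (lact tpre a (lact tpre b g))"
    using f g by (subst (2) lact_tensor_pre[of "Poly_Mapping.keys g" g])
      (auto simp: inn_lact_tensor_pre lact_tensor_pre_sum inn_tensor_pre_sum tensor_inn_lact_single
        carr_tensor_pre intro!: sum.cong)
  show "inn tpre f (lact tpre b g) = inn tpre (lact tpre (cstar b) f) g"
  proof -
    have "inn tpre (lact tpre (cstar b) f) g = cstar (inn tpre g (lact tpre (cstar b) f))"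
      using f g by (simp add: inn_tensor_pre_star keys_lact_tensor_pre)
    also have "\<dots> = (\<Sum>w\<in>Poly_Mapping.keys f. \<Sum>u\<in>Poly_Mapping.keys g.
        cstar (Poly_Mapping.lookup f w) * tensor_inn K s b w u * Poly_Mapping.lookup g u)"
      using f g by (simp add: inn_lact_tensor_pre carr_tensor_pre cstar_sum cstar_mult cstar_cstar
          tensor_inn_star[OF K] mult.assoc)
    also have "\<dots> = inn tpre f (lact tpre b g)"
      using f g by (subst sum.swap) (simp add: inn_lact_tensor_pre)
    finally show ?thesis by simp
  qed
  assume h: "h \<in> carr tpre"
  show "inn tpre f (add tpre g h) = inn tpre f g + inn tpre f h"
    by (simp add: add_tensor_pre inn_tensor_pre_add)
next
  fix m and f :: "nat \<Rightarrow> 'h list \<Rightarrow>\<^sub>0 'b"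
  assume f: "\<And>i. i < m \<Longrightarrow> f i \<in> carr tpre"
  \<comment> \<open>Enumerating the finitely many words involved exhibits the Gram matrix of the
    \<open>f i\<close> as a compression, by their coefficients, of the matrix of pairings of
    words.\<close>
  define A where "A = (\<Union>i<m. Poly_Mapping.keys (f i))"
  have A: "finite A" "\<And>i. i < m \<Longrightarrow> Poly_Mapping.keys (f i) \<subseteq> A" by (auto simp: A_def)
  obtain W where W: "bij_betw W {0..<card A} A" using ex_bij_betw_nat_finite[OF A(1)] by blast
  then have W': "bij_betw W {..<card A} A" by (simp add: atLeast0LessThan)
  have adm: "admissible K s (W a)" if "a < card A" for a
    using bij_betwE[OF W'] that f by (fastforce simp: A_def carr_tensor_pre)
  have eq: "inn tpre (f i) (f k) = (\<Sum>a<card A. \<Sum>b<card A.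
      cstar (Poly_Mapping.lookup (f i) (W a)) * tensor_inn K s 1 (W a) (W b) * Poly_Mapping.lookup (f k) (W b))"
    if "i < m" "k < m" for i k
    using that A by (subst inn_tensor_pre[of A _ A]) (simp_all flip: sum.reindex_bij_betw[OF W'])
  have "gram_pos (card A) (\<lambda>a b. tensor_inn K s 1 (W a) (W b))"
    using gram_pos_rank1[of "card A" "\<lambda>_. 1"] by (intro gram_pos_tensor_inn K adm) (simp add: cstar_one)
  then have "gram_pos m (\<lambda>i k. \<Sum>a<card A. \<Sum>b<card A.
      cstar (Poly_Mapping.lookup (f i) (W a)) * tensor_inn K s 1 (W a) (W b) * Poly_Mapping.lookup (f k) (W b))"
    by (rule gram_pos_compress)
  then show "gram_pos m (\<lambda>i k. inn tpre (f i) (f k))"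
    by (rule gram_pos_cong[THEN iffD1, rotated]) (simp add: eq)
qed

lemma hcorr_tensor: "hcorr (tensor K s)"
  unfolding tensor_def by (rule precorr.hcorr_completion[OF precorr_tensor_pre])

lemma single_closed: "admissible K s w \<Longrightarrow> Poly_Mapping.single w c \<in> carr tpre"
  by (auto simp: carr_tensor_pre)

lemma simple_tensor_closed: "admissible K s w \<Longrightarrow> simple_tensor K s w \<in> carr (tensor K s)"
  unfolding simple_tensor_def tensor_def
  by (intro precorr.embed_closed precorr_tensor_pre single_closed)

lemma inn_lact_simple_tensor:
  assumes "admissible K s w" "admissible K s w'"
  shows "inn (tensor K s) (simple_tensor K s w) (lact (tensor K s) b (simple_tensor K s w')) = tensor_inn K s b w w'"
proof -
  interpret precorr tpre by (rule precorr_tensor_pre)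
  show ?thesis
    \<comment> \<open>In the zero algebra \<open>Poly_Mapping.single w 1\<close> is the zero
      function and has no keys, hence the case distinction.\<close>
    using assms by (cases "(1::'b) = 0")
      (auto simp: simple_tensor_def tensor_def embed_lact inn_embed single_closed lact_closed
        inn_lact_tensor_pre cstar_one, metis mult_1_left mult_zero_left)
qed

text \<open>A formal tensor is a finite sum of right multiples of simple tensors, so the conditions
  put the image of the whole uncompleted module into \<open>D\<close>.\<close>

lemma hdense_simple_tensors:
  assumes D: "D \<subseteq> carr (tensor K s)" "nul (tensor K s) \<in> D"
    "\<And>v w. v \<in> D \<Longrightarrow> w \<in> D \<Longrightarrow> add (tensor K s) v w \<in> D"
    "\<And>w b. admissible K s w \<Longrightarrow> ract (tensor K s) (simple_tensor K s w) b \<in> D"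
  shows "hdense (tensor K s) D"
proof -
  interpret precorr tpre by (rule precorr_tensor_pre)
  have D': "embed tpre f \<in> D" if f: "f \<in> carr tpre" for f
  proof -
    have sub: "embed tpre (\<Sum>w\<in>A. Poly_Mapping.single w (Poly_Mapping.lookup f w)) \<in> D"
      if "finite A" "\<And>w. w \<in> A \<Longrightarrow> admissible K s w" for A
      using that
    proof (induction A rule: finite_induct)
      case empty
      then show ?case using D(2) embed_nul by (simp add: tensor_def nul_tensor_pre)
    next
      case (insert w A)
      have adm: "\<And>u. u \<in> A \<Longrightarrow> admissible K s u" using insert.prems by blast
      have c: "(\<Sum>w\<in>A. Poly_Mapping.single w (Poly_Mapping.lookup f w)) \<in> carr tpre"
        using insert.hyps(1) adm
      proof (induction A rule: finite_induct)
        case empty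
        then show ?case using nul_closed by (simp add: nul_tensor_pre)
      next
        case (insert w A)
        then show ?case
          using add_closed[OF single_closed[of w "Poly_Mapping.lookup f w"]] insert.prems
          by (simp add: add_tensor_pre)
      qed
      have "embed tpre (Poly_Mapping.single w (Poly_Mapping.lookup f w)) \<in> D"
        using D(4)[of w "Poly_Mapping.lookup f w"] insert.prems
        by (simp add: simple_tensor_def tensor_def embed_ract single_closed ract_tensor_pre_single)
      moreover have "embed tpre (\<Sum>w\<in>A. Poly_Mapping.single w (Poly_Mapping.lookup f w)) \<in> D"
        using insert.IH adm by blast
      ultimately have "add (tensor K s) (embed tpre (Poly_Mapping.single w (Poly_Mapping.lookup f w)))
          (embed tpre (\<Sum>w\<in>A. Poly_Mapping.single w (Poly_Mapping.lookup f w))) \<in> D"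
        by (rule D(3))
      then show ?case
        using insert.hyps insert.prems embed_add[OF single_closed c, of w "Poly_Mapping.lookup f w"]
        by (simp add: tensor_def add_tensor_pre)
    qed
    have "(\<Sum>w\<in>Poly_Mapping.keys f. Poly_Mapping.single w (Poly_Mapping.lookup f w)) = f"
      by (rule poly_mapping_eqI) (auto simp: lookup_sum lookup_single when_def in_keys_iff)
    then show ?thesis using sub[of "Poly_Mapping.keys f"] f by (simp add: carr_tensor_pre)
  qed
  show ?thesis
    unfolding hdense_def
  proof (intro conjI ballI allI impI D(1))
    fix h and e :: real assume "h \<in> carr (tensor K s)" "e > 0"
    then obtain v where "v \<in> embed tpre ` carr tpre" "hnorm (tensor K s) (sub (tensor K s) h v) < e"
      using hdense_embed unfolding hdense_def tensor_def by blast
    then show "\<exists>v\<in>D. hnorm (tensor K s) (sub (tensor K s) h v) < e" using D' by blast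
  qed
qed

end

section \<open>Direct sums\<close>

text \<open>The carrier of a direct sum asks for convergence of the elements
  \<open>\<langle>h s, h s\<rangle>\<close> in the algebra, which is weaker than convergence of
  their norms. Completeness turns it into smallness of the finite sums that avoid a fixed finite
  set.\<close>

lemma summable_on_Cauchy:
  fixes f :: "'a \<Rightarrow> 'b::banach"
  shows "f summable_on A \<longleftrightarrow> (\<forall>e>0. \<exists>F0. finite F0 \<and> F0 \<subseteq> A \<and>
    (\<forall>F. finite F \<longrightarrow> F \<subseteq> A \<longrightarrow> F \<inter> F0 = {} \<longrightarrow> norm (sum f F) < e))" (is "_ \<longleftrightarrow> ?C")
proof
  assume "f summable_on A"
  then obtain l where l: "(sum f \<longlongrightarrow> l) (finite_subsets_at_top A)"
    by (auto simp: summable_on_def has_sum_def)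
  show ?C
  proof (intro allI impI)
    fix e :: real assume "e > 0"
    then have "\<forall>\<^sub>F F in finite_subsets_at_top A. dist (sum f F) l < e / 2"
      by (intro tendstoD[OF l]) simp
    then obtain F0 where F0: "finite F0" "F0 \<subseteq> A"
      "\<And>F. finite F \<Longrightarrow> F0 \<subseteq> F \<Longrightarrow> F \<subseteq> A \<Longrightarrow> dist (sum f F) l < e / 2"
      by (auto simp: eventually_finite_subsets_at_top)
    have "norm (sum f F) < e" if F: "finite F" "F \<subseteq> A" "F \<inter> F0 = {}" for F
    proof -
      have "sum f (F \<union> F0) = sum f F + sum f F0" using F F0 by (intro sum.union_disjoint) auto
      then have "norm (sum f F) = dist (sum f (F \<union> F0)) (sum f F0)" by (simp add: dist_norm)
      also have "\<dots> \<le> dist (sum f (F \<union> F0)) l + dist (sum f F0) l" by (rule dist_triangle2)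
      also have "\<dots> < e / 2 + e / 2" by (rule add_strict_mono) (use F0 F in auto)
      also have "\<dots> = e" by simp
      finally show ?thesis .
    qed
    then show "\<exists>F0. finite F0 \<and> F0 \<subseteq> A \<and>
        (\<forall>F. finite F \<longrightarrow> F \<subseteq> A \<longrightarrow> F \<inter> F0 = {} \<longrightarrow> norm (sum f F) < e)"
      using F0 by blast
  qed
next
  assume C: ?C
  have "cauchy_filter (filtermap (sum f) (finite_subsets_at_top A))"
    unfolding cauchy_filter_metric_filtermap
  proof (intro allI impI)
    fix e :: real assume "e > 0"
    then obtain F0 where F0: "finite F0" "F0 \<subseteq> A"
      "\<And>F. finite F \<Longrightarrow> F \<subseteq> A \<Longrightarrow> F \<inter> F0 = {} \<Longrightarrow> norm (sum f F) < e / 2"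
      using C[rule_format, of "e / 2"] by auto
    have "dist (sum f F) (sum f F') < e" if F: "finite F \<and> F0 \<subseteq> F \<and> F \<subseteq> A" "finite F' \<and> F0 \<subseteq> F' \<and> F' \<subseteq> A" for F F'
    proof -
      have "sum f F = sum f (F - F0) + sum f F0" "sum f F' = sum f (F' - F0) + sum f F0"
        using F by (simp_all add: sum.subset_diff)
      then have "dist (sum f F) (sum f F') = norm (sum f (F - F0) - sum f (F' - F0))"
        by (simp add: dist_norm)
      also have "\<dots> \<le> norm (sum f (F - F0)) + norm (sum f (F' - F0))" by (rule norm_triangle_ineq4)
      also have "\<dots> < e / 2 + e / 2" by (intro add_strict_mono F0(3)) (use F in auto)
      also have "\<dots> = e" by simp
      finally show ?thesis .
    qed
    then show "\<exists>P. eventually P (finite_subsets_at_top A) \<and> (\<forall>x y. P x \<and> P y \<longrightarrow> dist (sum f x) (sum f y) < e)"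
      using F0 by (intro exI[of _ "\<lambda>F. finite F \<and> F0 \<subseteq> F \<and> F \<subseteq> A"])
        (auto simp: eventually_finite_subsets_at_top)
  qed
  moreover have "complete (UNIV :: 'b set)"
    by (meson Cauchy_convergent UNIV_I complete_def convergent_def)
  ultimately obtain l where "(sum f \<longlongrightarrow> l) (finite_subsets_at_top A)"
    using complete_uniform[where S = "UNIV :: 'b set"] by (force simp: filterlim_def)
  then show "f summable_on A" by (auto simp: summable_on_def has_sum_def)
qed

text \<open>Its norm measures the part of a family over a finite set \<open>F\<close>. Being a
  \<open>precorr\<close>, it supplies Cauchy-Schwarz and the triangle inequality for tails of
  vectors of the direct sum.\<close>

definition fprod :: "'s set \<Rightarrow> ('s \<Rightarrow> ('b::unital_cstar, 'h) corr) \<Rightarrow> ('b, 's \<Rightarrow> 'h) corr" where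
  "fprod F K = \<lparr>
     carr = {h. \<forall>s\<in>F. h s \<in> carr (K s)},
     nul = (\<lambda>s. nul (K s)),
     add = (\<lambda>h k s. add (K s) (h s) (k s)),
     lact = (\<lambda>b h s. lact (K s) b (h s)),
     ract = (\<lambda>h b s. ract (K s) (h s) b),
     inn = (\<lambda>h k. \<Sum>s\<in>F. inn (K s) (h s) (k s)) \<rparr>"

lemma sub_fprod: "sub (fprod F K) h k = (\<lambda>s. sub (K s) (h s) (k s))"
  by (simp add: sub_def fprod_def)

lemma scaleC_sum: "scaleC c (sum q A) = (\<Sum>x\<in>A. scaleC c (q x :: 'b::unital_cstar))"
  by (induction A rule: infinite_finite_induct)
    (auto simp: scaleC_add_right intro: scaleC_diff_right[of c 0 0, simplified])

lemma precorr_fprod: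
  assumes "\<And>s. s \<in> F \<Longrightarrow> precorr (K s)"
  shows "precorr (fprod F K)"
proof
  show "gram_pos m (\<lambda>i k. inn (fprod F K) (f i) (f k))"
    if "\<And>i. i < m \<Longrightarrow> f i \<in> carr (fprod F K)" for m f
    unfolding fprod_def corr.simps using that assms
    by (intro gram_pos_sum precorr.inn_gram) (auto simp: fprod_def)
  fix h k l and a b :: 'b and c
  assume h: "h \<in> carr (fprod F K)"
  then have h': "\<And>s. s \<in> F \<Longrightarrow> h s \<in> carr (K s)" by (simp add: fprod_def)
  show "lact (fprod F K) b h \<in> carr (fprod F K)" "ract (fprod F K) h b \<in> carr (fprod F K)"
    using h' assms by (auto simp: fprod_def precorr.closed)
  show "inn (fprod F K) h (nul (fprod F K)) = 0"
    using h' assms by (auto simp: fprod_def precorr.inn_nul)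
  assume "k \<in> carr (fprod F K)"
  then have k': "\<And>s. s \<in> F \<Longrightarrow> k s \<in> carr (K s)" by (simp add: fprod_def)
  show "add (fprod F K) h k \<in> carr (fprod F K)"
    using h' k' assms by (auto simp: fprod_def precorr.closed)
  show "inn (fprod F K) h (ract (fprod F K) k b) = inn (fprod F K) h k * b"
    using h' k' assms by (auto simp: fprod_def precorr.inn_ract sum_distrib_right intro!: sum.cong)
  show "cstar (inn (fprod F K) h k) = inn (fprod F K) k h"
    using h' k' assms by (auto simp: fprod_def precorr.inn_star cstar_sum intro!: sum.cong)
  show "inn (fprod F K) h (lact (fprod F K) b k) = inn (fprod F K) (lact (fprod F K) (cstar b) h) k"
    using h' k' assms by (auto simp: fprod_def precorr.inn_lact intro!: sum.cong)
  show "inn (fprod F K) h (lact (fprod F K) (a + b) k) =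
      inn (fprod F K) h (lact (fprod F K) a k) + inn (fprod F K) h (lact (fprod F K) b k)"
    using h' k' assms by (auto simp: fprod_def precorr.inn_lact_add simp flip: sum.distrib intro!: sum.cong)
  show "inn (fprod F K) h (lact (fprod F K) (a * b) k) =
      inn (fprod F K) h (lact (fprod F K) a (lact (fprod F K) b k))"
    using h' k' assms by (auto simp: fprod_def precorr.inn_lact_mult intro!: sum.cong)
  show "inn (fprod F K) h (lact (fprod F K) (scaleC c 1) k) = scaleC c (inn (fprod F K) h k)"
    using h' k' assms by (auto simp: fprod_def precorr.inn_lact_scalar scaleC_sum intro!: sum.cong)
  assume "l \<in> carr (fprod F K)"
  then have l': "\<And>s. s \<in> F \<Longrightarrow> l s \<in> carr (K s)" by (simp add: fprod_def)
  show "inn (fprod F K) h (add (fprod F K) k l) = inn (fprod F K) h k + inn (fprod F K) h l"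
    using h' k' l' assms by (auto simp: fprod_def precorr.inn_add simp flip: sum.distrib intro!: sum.cong)
qed (use assms in \<open>auto simp: fprod_def precorr.nul_closed\<close>)

section \<open>Hilbert direct sums of a family of correspondences\<close>

context
  fixes S :: "'s set" and K :: "'s \<Rightarrow> ('b::unital_cstar, 'h) corr"
  assumes K: "\<And>s. s \<in> S \<Longrightarrow> hcorr (K s)"
begin

abbreviation (input) "DS \<equiv> direct_sum S K"
abbreviation (input) "fnorm F h \<equiv> hnorm (fprod F K) h"

lemma K': "s \<in> S \<Longrightarrow> precorr (K s)"
  using K by (simp add: hcorr_def)

lemma fprod: "F \<subseteq> S \<Longrightarrow> precorr (fprod F K)"
  by (rule precorr_fprod) (use K' in auto)

lemma fnorm_cong: "(\<And>s. s \<in> F \<Longrightarrow> h s = k s) \<Longrightarrow> fnorm F h = fnorm F k"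
  by (simp add: hnorm_def fprod_def)

text \<open>Tails are measured by seminorms instead of squares, so that triangle inequalities apply
  to them; the passage exchanges \<open>e\<close> with its square or its root.\<close>

lemma carr_direct_sum:
  "h \<in> carr DS \<longleftrightarrow> h \<in> (\<Pi>\<^sub>E s\<in>S. carr (K s)) \<and> (\<forall>e>0. \<exists>F0. finite F0 \<and> F0 \<subseteq> S \<and>
    (\<forall>F. finite F \<longrightarrow> F \<subseteq> S \<longrightarrow> F \<inter> F0 = {} \<longrightarrow> fnorm F h < e))"
proof -
  have *: "norm (\<Sum>s\<in>F. inn (K s) (h s) (h s)) < e \<longleftrightarrow> fnorm F h < sqrt e" if "e > 0" for e F
    by (simp add: hnorm_def fprod_def)
  have **: "norm (\<Sum>s\<in>F. inn (K s) (h s) (h s)) < e\<^sup>2 \<longleftrightarrow> fnorm F h < e" if "e > 0" for e F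
    using *[of "e\<^sup>2" F] that by simp
  show ?thesis
    unfolding direct_sum_def corr.simps mem_Collect_eq summable_on_Cauchy
  proof (intro conj_cong HOL.refl iffI allI impI)
    fix e :: real assume "\<forall>e>0. \<exists>F0. finite F0 \<and> F0 \<subseteq> S \<and> (\<forall>F. finite F \<longrightarrow> F \<subseteq> S \<longrightarrow>
      F \<inter> F0 = {} \<longrightarrow> norm (\<Sum>s\<in>F. inn (K s) (h s) (h s)) < e)" "e > 0"
    then have "\<exists>F0. finite F0 \<and> F0 \<subseteq> S \<and> (\<forall>F. finite F \<longrightarrow> F \<subseteq> S \<longrightarrow>
      F \<inter> F0 = {} \<longrightarrow> norm (\<Sum>s\<in>F. inn (K s) (h s) (h s)) < e\<^sup>2)" by simp
    then show "\<exists>F0. finite F0 \<and> F0 \<subseteq> S \<and> (\<forall>F. finite F \<longrightarrow> F \<subseteq> S \<longrightarrow> F \<inter> F0 = {} \<longrightarrow> fnorm F h < e)"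
      by (simp only: **[OF \<open>e > 0\<close>])
  next
    fix e :: real assume "\<forall>e>0. \<exists>F0. finite F0 \<and> F0 \<subseteq> S \<and> (\<forall>F. finite F \<longrightarrow> F \<subseteq> S \<longrightarrow>
      F \<inter> F0 = {} \<longrightarrow> fnorm F h < e)" "e > 0"
    then have "\<exists>F0. finite F0 \<and> F0 \<subseteq> S \<and> (\<forall>F. finite F \<longrightarrow> F \<subseteq> S \<longrightarrow>
      F \<inter> F0 = {} \<longrightarrow> fnorm F h < sqrt e)" by simp
    then show "\<exists>F0. finite F0 \<and> F0 \<subseteq> S \<and> (\<forall>F. finite F \<longrightarrow> F \<subseteq> S \<longrightarrow>
      F \<inter> F0 = {} \<longrightarrow> norm (\<Sum>s\<in>F. inn (K s) (h s) (h s)) < e)"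
      by (simp only: *[OF \<open>e > 0\<close>])
  qed
qed

lemma carr_component: "h \<in> carr DS \<Longrightarrow> s \<in> S \<Longrightarrow> h s \<in> carr (K s)"
  by (auto simp: direct_sum_def)

lemma carr_fprod: "h \<in> carr DS \<Longrightarrow> F \<subseteq> S \<Longrightarrow> h \<in> carr (fprod F K)"
  by (auto simp: fprod_def carr_component)

lemma carr_dominated:
  assumes g: "g \<in> (\<Pi>\<^sub>E s\<in>S. carr (K s))" and h: "h \<in> carr DS" and k: "k \<in> carr DS"
    and le: "\<And>F. finite F \<Longrightarrow> F \<subseteq> S \<Longrightarrow> fnorm F g \<le> c * fnorm F h + d * fnorm F k"
  shows "g \<in> carr DS"
  unfolding carr_direct_sum
proof (intro conjI g allI impI)
  fix e :: real assume "e > 0"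
  define C where "C = \<bar>c\<bar> + \<bar>d\<bar> + 1"
  have C: "C > 0" by (simp add: C_def add_nonneg_pos)
  obtain F1 F2 where F: "finite F1" "F1 \<subseteq> S" "finite F2" "F2 \<subseteq> S"
    "\<And>F. finite F \<Longrightarrow> F \<subseteq> S \<Longrightarrow> F \<inter> F1 = {} \<Longrightarrow> fnorm F h < e / C"
    "\<And>F. finite F \<Longrightarrow> F \<subseteq> S \<Longrightarrow> F \<inter> F2 = {} \<Longrightarrow> fnorm F k < e / C"
    using h k divide_pos_pos[OF \<open>e > 0\<close> C] unfolding carr_direct_sum by metis
  have "fnorm F g < e" if "finite F" "F \<subseteq> S" "F \<inter> (F1 \<union> F2) = {}" for F
  proof -
    have n: "fnorm F h \<ge> 0" "fnorm F k \<ge> 0" by (simp_all add: hnorm_def)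
    have m: "c * x \<le> \<bar>c\<bar> * (e / C)" if "0 \<le> x" "x \<le> e / C" for c x
      using that by (meson abs_ge_self abs_ge_zero mult_left_mono mult_right_mono order_trans)
    have "fnorm F h < e / C" "fnorm F k < e / C" using F(5,6) that by auto
    then have "c * fnorm F h + d * fnorm F k \<le> \<bar>c\<bar> * (e / C) + \<bar>d\<bar> * (e / C)"
      by (intro add_mono m n) auto
    also have "\<dots> = (\<bar>c\<bar> + \<bar>d\<bar>) * (e / C)" by (simp only: ring_distribs)
    also have "\<dots> < C * (e / C)" using C \<open>e > 0\<close> by (intro mult_strict_right_mono) (auto simp: C_def)
    also have "\<dots> = e" using C by simp
    finally show ?thesis using le[OF that(1,2)] by simp
  qed
  then show "\<exists>F0. finite F0 \<and> F0 \<subseteq> S \<and> (\<forall>F. finite F \<longrightarrow> F \<subseteq> S \<longrightarrow> F \<inter> F0 = {} \<longrightarrow> fnorm F g < e)"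
    using F by (intro exI[of _ "F1 \<union> F2"]) auto
qed

text \<open>Cauchy-Schwarz on finite sets that avoid the bulk of both vectors: it suffices that one
  tail is below \<open>e\<close> and the other below 1.\<close>

lemma inn_summable:
  assumes h: "h \<in> carr DS" and k: "k \<in> carr DS"
  shows "(\<lambda>s. inn (K s) (h s) (k s)) summable_on S"
  unfolding summable_on_Cauchy
proof (intro allI impI)
  fix e :: real assume "e > 0"
  obtain F1 F2 where F: "finite F1" "F1 \<subseteq> S" "finite F2" "F2 \<subseteq> S"
    "\<And>F. finite F \<Longrightarrow> F \<subseteq> S \<Longrightarrow> F \<inter> F1 = {} \<Longrightarrow> fnorm F h < e"
    "\<And>F. finite F \<Longrightarrow> F \<subseteq> S \<Longrightarrow> F \<inter> F2 = {} \<Longrightarrow> fnorm F k < 1"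
    using h k \<open>e > 0\<close> zero_less_one unfolding carr_direct_sum by metis
  have "norm (\<Sum>s\<in>F. inn (K s) (h s) (k s)) < e" if "finite F" "F \<subseteq> S" "F \<inter> (F1 \<union> F2) = {}" for F
  proof -
    have "norm (\<Sum>s\<in>F. inn (K s) (h s) (k s)) \<le> fnorm F h * fnorm F k"
      using precorr.cauchy_schwarz[OF fprod carr_fprod[OF h] carr_fprod[OF k], of F] that
      by (simp add: fprod_def)
    also have "fnorm F k < 1" using F(6) that by auto
    then have "fnorm F h * fnorm F k \<le> fnorm F h"
      by (intro mult_left_le) (simp_all add: precorr.hnorm_nonneg[OF fprod] that)
    also have "\<dots> < e" using F(5)[of F] that by auto
    finally show ?thesis .
  qed
  then show "\<exists>F0. finite F0 \<and> F0 \<subseteq> S \<and>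
      (\<forall>F. finite F \<longrightarrow> F \<subseteq> S \<longrightarrow> F \<inter> F0 = {} \<longrightarrow> norm (\<Sum>s\<in>F. inn (K s) (h s) (k s)) < e)"
    using F by (intro exI[of _ "F1 \<union> F2"]) auto
qed

lemma inn_has_sum:
  "h \<in> carr DS \<Longrightarrow> k \<in> carr DS \<Longrightarrow> ((\<lambda>s. inn (K s) (h s) (k s)) has_sum inn DS h k) S"
  unfolding direct_sum_def corr.simps
  by (rule has_sum_infsum) (rule inn_summable, simp_all add: direct_sum_def)

lemma inn_direct_sum_eqI:
  "((\<lambda>s. inn (K s) (h s) (k s)) has_sum l) S \<Longrightarrow> inn DS h k = l"
  unfolding direct_sum_def corr.simps by (rule infsumI)

lemma direct_sum_apply:
  "s \<in> S \<Longrightarrow> nul DS s = nul (K s)" "s \<in> S \<Longrightarrow> add DS h k s = add (K s) (h s) (k s)"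
  "s \<in> S \<Longrightarrow> lact DS b h s = lact (K s) b (h s)" "s \<in> S \<Longrightarrow> ract DS h b s = ract (K s) (h s) b"
  "s \<in> S \<Longrightarrow> sub DS h k s = sub (K s) (h s) (k s)"
  by (simp_all add: direct_sum_def sub_def)

lemma direct_sum_PiE:
  "nul DS \<in> (\<Pi>\<^sub>E s\<in>S. carr (K s))"
  "h \<in> carr DS \<Longrightarrow> k \<in> carr DS \<Longrightarrow> add DS h k \<in> (\<Pi>\<^sub>E s\<in>S. carr (K s))"
  "h \<in> carr DS \<Longrightarrow> lact DS b h \<in> (\<Pi>\<^sub>E s\<in>S. carr (K s))"
  "h \<in> carr DS \<Longrightarrow> ract DS h b \<in> (\<Pi>\<^sub>E s\<in>S. carr (K s))"
  using K' by (auto simp: direct_sum_def precorr.closed PiE_iff)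

lemma nul_direct_sum: "nul DS \<in> carr DS"
proof -
  have "fnorm F (nul DS) = 0" if "F \<subseteq> S" for F
  proof -
    have "fnorm F (nul DS) = fnorm F (nul (fprod F K))"
      by (rule fnorm_cong) (use that in \<open>auto simp: direct_sum_apply fprod_def\<close>)
    then show ?thesis using precorr.hnorm_nul[OF fprod[OF that]] by simp
  qed
  then show ?thesis
    unfolding carr_direct_sum using direct_sum_PiE(1) by (intro conjI allI impI exI[of _ "{}"]) auto
qed

lemma fnorm_add:
  assumes "h \<in> carr DS" "k \<in> carr DS" "F \<subseteq> S"
  shows "fnorm F (add DS h k) \<le> fnorm F h + fnorm F k"
proof -
  have "fnorm F (add DS h k) = fnorm F (add (fprod F K) h k)"
    by (rule fnorm_cong) (use assms in \<open>auto simp: direct_sum_apply fprod_def\<close>)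
  then show ?thesis using precorr.hnorm_triangle[OF fprod] assms by (simp add: carr_fprod)
qed

lemma fnorm_lact:
  assumes "h \<in> carr DS" "F \<subseteq> S"
  shows "fnorm F (lact DS b h) \<le> norm b * fnorm F h"
proof -
  have "fnorm F (lact DS b h) = fnorm F (lact (fprod F K) b h)"
    by (rule fnorm_cong) (use assms in \<open>auto simp: direct_sum_apply fprod_def\<close>)
  then show ?thesis using precorr.hnorm_lact[OF fprod] assms by (simp add: carr_fprod)
qed

lemma fnorm_ract:
  assumes "h \<in> carr DS" "F \<subseteq> S"
  shows "fnorm F (ract DS h b) \<le> norm b * fnorm F h"
proof -
  have "fnorm F (ract DS h b) = fnorm F (ract (fprod F K) h b)"
    by (rule fnorm_cong) (use assms in \<open>auto simp: direct_sum_apply fprod_def\<close>)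
  then show ?thesis using precorr.hnorm_ract[OF fprod carr_fprod] assms by (simp add: mult.commute)
qed

lemma direct_sum_closed:
  "h \<in> carr DS \<Longrightarrow> k \<in> carr DS \<Longrightarrow> add DS h k \<in> carr DS"
  "h \<in> carr DS \<Longrightarrow> lact DS b h \<in> carr DS"
  "h \<in> carr DS \<Longrightarrow> ract DS h b \<in> carr DS"
proof -
  show "h \<in> carr DS \<Longrightarrow> k \<in> carr DS \<Longrightarrow> add DS h k \<in> carr DS"
    by (rule carr_dominated[where h = h and k = k and c = 1 and d = 1])
      (simp_all add: direct_sum_PiE(2) fnorm_add)
  show "h \<in> carr DS \<Longrightarrow> lact DS b h \<in> carr DS"
    by (rule carr_dominated[where h = h and k = h and c = "norm b" and d = 0])
      (simp_all add: direct_sum_PiE(3) fnorm_lact)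
  show "h \<in> carr DS \<Longrightarrow> ract DS h b \<in> carr DS"
    by (rule carr_dominated[where h = h and k = h and c = "norm b" and d = 0])
      (simp_all add: direct_sum_PiE(4) fnorm_ract)
qed

lemma precorr_direct_sum: "precorr DS"
proof
  show "nul DS \<in> carr DS" by (rule nul_direct_sum)
  fix h k l and a b :: 'b and c
  assume h: "h \<in> carr DS"
  show "lact DS b h \<in> carr DS" "ract DS h b \<in> carr DS" by (intro direct_sum_closed h)+
  show "inn DS h (nul DS) = 0"
    using h K' by (intro inn_direct_sum_eqI has_sum_0)
      (auto simp: direct_sum_apply precorr.inn_nul carr_component)
  assume k: "k \<in> carr DS"
  note hk = inn_has_sum[OF h k]
  note simps = direct_sum_apply K' carr_component[OF h] carr_component[OF k]
  show "add DS h k \<in> carr DS" by (intro direct_sum_closed h k)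
  show "inn DS h (ract DS k b) = inn DS h k * b"
    using has_sum_bounded_linear[OF bounded_linear_mult_left[of b] hk]
    by (intro inn_direct_sum_eqI) (simp cong: has_sum_cong add: simps precorr.inn_ract)
  show "cstar (inn DS h k) = inn DS k h"
    using has_sum_bounded_linear[OF bounded_linear_cstar hk]
    by (intro inn_direct_sum_eqI[symmetric]) (simp cong: has_sum_cong add: simps precorr.inn_star)
  show "inn DS h (lact DS b k) = inn DS (lact DS (cstar b) h) k"
    using inn_has_sum[OF direct_sum_closed(2)[OF h, of "cstar b"] k]
    by (intro inn_direct_sum_eqI) (simp cong: has_sum_cong add: simps precorr.inn_lact)
  show "inn DS h (lact DS (a + b) k) = inn DS h (lact DS a k) + inn DS h (lact DS b k)"
    using has_sum_add[OF inn_has_sum[OF h direct_sum_closed(2)[OF k, of a]]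
        inn_has_sum[OF h direct_sum_closed(2)[OF k, of b]]]
    by (intro inn_direct_sum_eqI) (simp cong: has_sum_cong add: simps precorr.inn_lact_add)
  show "inn DS h (lact DS (a * b) k) = inn DS h (lact DS a (lact DS b k))"
    using inn_has_sum[OF h direct_sum_closed(2)[OF direct_sum_closed(2)[OF k, of b], of a]]
    by (intro inn_direct_sum_eqI) (simp cong: has_sum_cong add: simps precorr.inn_lact_mult)
  have bl: "bounded_linear (scaleC c :: 'b \<Rightarrow> 'b)"
    by (rule bounded_linear_intro[where K = "cmod c"])
      (auto simp: scaleC_add_right norm_scaleC scaleC_scaleC simp flip: scaleC_of_real, simp add: mult.commute)
  show "inn DS h (lact DS (scaleC c 1) k) = scaleC c (inn DS h k)"
    using has_sum_bounded_linear[OF bl hk]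
    by (intro inn_direct_sum_eqI) (simp cong: has_sum_cong add: simps precorr.inn_lact_scalar)
  assume l: "l \<in> carr DS"
  show "inn DS h (add DS k l) = inn DS h k + inn DS h l"
    using has_sum_add[OF hk inn_has_sum[OF h l]]
    by (intro inn_direct_sum_eqI)
      (simp cong: has_sum_cong add: simps carr_component[OF l] precorr.inn_add)
next
  fix m and f :: "nat \<Rightarrow> 's \<Rightarrow> 'h"
  assume f: "\<And>i. i < m \<Longrightarrow> f i \<in> carr DS"
  show "gram_pos m (\<lambda>i k. inn DS (f i) (f k))"
  proof (rule gram_pos_limit)
    fix e :: real assume "e > 0"
    have "\<forall>\<^sub>F F in finite_subsets_at_top S. norm (inn (fprod F K) (f i) (f k) - inn DS (f i) (f k)) < e"
      if "i < m" "k < m" for i k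
      using inn_has_sum[OF f[OF that(1)] f[OF that(2)]] \<open>e > 0\<close>
      unfolding has_sum_def by (auto dest!: tendstoD simp: dist_norm fprod_def)
    then have "\<forall>\<^sub>F F in finite_subsets_at_top S. \<forall>i\<in>{..<m}. \<forall>k\<in>{..<m}.
        norm (inn (fprod F K) (f i) (f k) - inn DS (f i) (f k)) < e"
      by (intro eventually_ball_finite ballI finite_lessThan) auto
    then obtain F where F: "finite F" "F \<subseteq> S" "\<And>i k. i < m \<Longrightarrow> k < m \<Longrightarrow>
        norm (inn (fprod F K) (f i) (f k) - inn DS (f i) (f k)) < e"
      unfolding eventually_finite_subsets_at_top by (metis lessThan_iff order_refl)
    then show "\<exists>B. gram_pos m B \<and> (\<forall>i<m. \<forall>k<m. norm (inn DS (f i) (f k) - B i k) < e)"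
      using precorr.inn_gram[OF fprod[OF F(2)], of m f] f
      by (intro exI[of _ "\<lambda>i k. inn (fprod F K) (f i) (f k)"]) (auto simp: norm_minus_commute carr_fprod)
  qed
qed

lemma fnorm_tendsto:
  assumes "h \<in> carr DS"
  shows "((\<lambda>F. fnorm F h) \<longlongrightarrow> hnorm DS h) (finite_subsets_at_top S)"
  using inn_has_sum[OF assms assms] unfolding has_sum_def hnorm_def fprod_def corr.simps
  by (intro tendsto_intros) simp

lemma fnorm_le:
  assumes h: "h \<in> carr DS" and F: "F \<subseteq> S" "finite F"
  shows "fnorm F h \<le> hnorm DS h"
proof (rule tendsto_lowerbound[OF fnorm_tendsto[OF h]])
  show "\<forall>\<^sub>F F' in finite_subsets_at_top S. fnorm F h \<le> fnorm F' h"
    unfolding eventually_finite_subsets_at_top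
  proof (intro exI[of _ F] conjI F allI impI)
    fix F' assume F': "finite F' \<and> F \<subseteq> F' \<and> F' \<subseteq> S"
    have p: "pos (inn (K s) (h s) (h s))" if "s \<in> S" for s
      using that h by (intro precorr.pos_inn K' carr_component)
    have "(\<Sum>s\<in>F'. inn (K s) (h s) (h s)) - (\<Sum>s\<in>F. inn (K s) (h s) (h s)) =
        (\<Sum>s\<in>F' - F. inn (K s) (h s) (h s))"
      using F' by (simp add: sum_diff)
    then show "fnorm F h \<le> fnorm F' h"
      unfolding hnorm_def fprod_def corr.simps using F' F
      by (intro real_sqrt_le_mono pos_norm_mono) (auto intro!: pos_sum p)
  qed
qed simp

lemma hnorm_le:
  assumes h: "h \<in> carr DS" and le: "\<And>F. F \<subseteq> S \<Longrightarrow> finite F \<Longrightarrow> fnorm F h \<le> e"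
  shows "hnorm DS h \<le> e"
  by (rule tendsto_upperbound[OF fnorm_tendsto[OF h]])
    (auto simp: eventually_finite_subsets_at_top le intro!: exI[of _ "{}"])

lemma hnorm_component_le: "h \<in> carr DS \<Longrightarrow> s \<in> S \<Longrightarrow> hnorm (K s) (h s) \<le> hnorm DS h"
  using fnorm_le[of h "{s}"] by (simp add: hnorm_def fprod_def)

lemma direct_sum_finite_support:
  assumes "h \<in> (\<Pi>\<^sub>E s\<in>S. carr (K s))" "finite F0" "F0 \<subseteq> S" "\<And>s. s \<in> S - F0 \<Longrightarrow> h s = nul (K s)"
  shows "h \<in> carr DS"
proof -
  have "fnorm F h = 0" if "F \<subseteq> S" "F \<inter> F0 = {}" for F
  proof -
    have "fnorm F h = fnorm F (nul (fprod F K))"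
    proof (rule fnorm_cong)
      fix s assume "s \<in> F"
      then have "s \<in> S - F0" using that by blast
      then show "h s = nul (fprod F K) s" using assms(4) by (simp add: fprod_def)
    qed
    then show ?thesis using precorr.hnorm_nul[OF fprod[OF that(1)]] by simp
  qed
  then show ?thesis unfolding carr_direct_sum using assms(1-3) by (auto intro!: exI[of _ F0])
qed

lemma summand_closed: "s \<in> S \<Longrightarrow> v \<in> carr (K s) \<Longrightarrow> summand S K s v \<in> carr DS"
  by (rule direct_sum_finite_support[where ?F0.0 = "{s}"])
    (auto simp: summand_def precorr.nul_closed K')

lemma inn_summand:
  assumes "s \<in> S" "v \<in> carr (K s)" "h \<in> carr DS"
  shows "inn DS (summand S K s v) h = inn (K s) v (h s)"
proof (rule inn_direct_sum_eqI)
  have "((\<lambda>t. inn (K t) (summand S K s v t) (h t)) has_sum (\<Sum>t\<in>{s}. inn (K t) (summand S K s v t) (h t))) S"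
    using assms by (intro has_sum_finite_neutralI[where B = "{s}"])
      (auto simp: summand_def precorr.inn_nul_left K' carr_component)
  then show "((\<lambda>t. inn (K t) (summand S K s v t) (h t)) has_sum inn (K s) v (h s)) S"
    using assms by (simp add: summand_def)
qed

lemma hcorr_direct_sum: "hcorr DS"
proof -
  interpret p: precorr DS by (rule precorr_direct_sum)
  show ?thesis
  proof
    fix h k assume h: "h \<in> carr DS" and k: "k \<in> carr DS"
      and eq: "\<And>l. l \<in> carr DS \<Longrightarrow> inn DS l h = inn DS l k"
    show "h = k"
    proof (rule PiE_ext[of _ S "\<lambda>s. carr (K s)"])
      show "h \<in> (\<Pi>\<^sub>E s\<in>S. carr (K s))" "k \<in> (\<Pi>\<^sub>E s\<in>S. carr (K s))"
        using h k by (simp_all add: direct_sum_def)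
      fix s assume s: "s \<in> S"
      show "h s = k s"
        using eq[OF summand_closed[OF s]] s h k
        by (intro hcorr.separated[OF K[OF s]]) (simp_all add: carr_component inn_summand)
    qed
  next
    fix V assume V: "V \<in> cauchy_seqs DS"
    note Vc = p.cauchy_closed[OF V]
    have "(\<lambda>n. V n s) \<in> cauchy_seqs (K s)" if s: "s \<in> S" for s
    proof (rule p.cauchy_comparison[OF V, where K = 1])
      show "V n s \<in> carr (K s)" for n by (rule carr_component[OF Vc s])
      show "hnorm (K s) (sub (K s) (V m s) (V n s)) \<le> 1 * hnorm DS (sub DS (V m) (V n))" for m n
        using hnorm_component_le[OF p.sub_closed[OF Vc Vc] s, of m n] s by (simp add: direct_sum_apply)
    qed
    then have "\<forall>s\<in>S. \<exists>g. hlim (K s) (\<lambda>n. V n s) g" using hcorr.complete[OF K] by blast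
    then obtain g0 where g0: "\<And>s. s \<in> S \<Longrightarrow> hlim (K s) (\<lambda>n. V n s) (g0 s)" by metis
    define g where "g = (\<lambda>s\<in>S. g0 s)"
    have g: "\<And>s. s \<in> S \<Longrightarrow> hlim (K s) (\<lambda>n. V n s) (g s)" using g0 by (simp add: g_def)
    have gc: "g s \<in> carr (K s)" if "s \<in> S" for s using g[OF that] by (simp add: hlim_def)
    have gP: "g \<in> (\<Pi>\<^sub>E s\<in>S. carr (K s))" using gc by (auto simp: g_def)
    \<comment> \<open>The Cauchy estimate holds on every finite \<open>F\<close> with the same
      \<open>N\<close>; letting the second index tend to infinity there replaces it by the
      coordinatewise limit. Membership of \<open>g\<close> in the direct sum and convergence to
      \<open>g\<close> both follow from this uniformity.\<close>
    have close: "\<exists>N. \<forall>n\<ge>N. \<forall>F. finite F \<longrightarrow> F \<subseteq> S \<longrightarrow> fnorm F (sub (fprod F K) (V n) g) \<le> e"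
      if e: "e > 0" for e
    proof -
      obtain N where N: "\<And>m n. m \<ge> N \<Longrightarrow> n \<ge> N \<Longrightarrow> hnorm DS (sub DS (V m) (V n)) < e"
        using p.cauchyD[OF V e] by blast
      have "fnorm F (sub (fprod F K) (V n) g) \<le> e" if n: "n \<ge> N" and F: "finite F" "F \<subseteq> S" for n F
      proof -
        interpret f: precorr "fprod F K" by (rule fprod[OF F(2)])
        have gf: "g \<in> carr (fprod F K)" using gc F by (auto simp: fprod_def)
        note Vf = carr_fprod[OF Vc F(2)]
        have "(\<lambda>m. \<Sum>s\<in>F. (hnorm (K s) (sub (K s) (V m s) (g s)))\<^sup>2) \<longlonglongrightarrow> (\<Sum>s\<in>F. 0\<^sup>2)"
          using g F by (intro tendsto_intros) (auto simp: hlim_def)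
        then have z: "(\<lambda>m. sqrt (\<Sum>s\<in>F. (hnorm (K s) (sub (K s) (V m s) (g s)))\<^sup>2)) \<longlonglongrightarrow> 0"
          using tendsto_real_sqrt by fastforce
        have "fnorm F (sub (fprod F K) (V m) g) \<le> sqrt (\<Sum>s\<in>F. (hnorm (K s) (sub (K s) (V m s) (g s)))\<^sup>2)" for m
          unfolding hnorm_def[of "fprod F K"]
          by (rule real_sqrt_le_mono)
            (auto simp: fprod_def sub_def hnorm_def intro!: sum_norm_le)
        then have "(\<lambda>m. fnorm F (sub (fprod F K) (V m) g)) \<longlonglongrightarrow> 0"
          by (intro LIMSEQ_squeeze_0[OF z] f.hnorm_nonneg)
        then have lim: "(\<lambda>m. e + fnorm F (sub (fprod F K) (V m) g)) \<longlonglongrightarrow> e + 0"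
          by (intro tendsto_intros)
        have "fnorm F (sub (fprod F K) (V n) g) \<le> e + fnorm F (sub (fprod F K) (V m) g)" if "m \<ge> N" for m
        proof -
          have "fnorm F (sub (fprod F K) (V n) (V m)) = fnorm F (sub DS (V n) (V m))"
            by (rule fnorm_cong) (use F in \<open>auto simp: direct_sum_apply sub_fprod\<close>)
          also have "\<dots> \<le> hnorm DS (sub DS (V n) (V m))" by (intro fnorm_le F p.sub_closed Vc)
          also have "\<dots> < e" by (rule N[OF n that])
          finally show ?thesis using f.hnorm_sub_triangle[OF Vf Vf gf, of n m] by linarith
        qed
        then show ?thesis using LIMSEQ_le_const[OF lim] by auto
      qed
      then show ?thesis by blast
    qed
    have gcarr: "g \<in> carr DS"
      unfolding carr_direct_sum
    proof (intro conjI gP allI impI)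
      fix e :: real assume "e > 0"
      obtain N where N: "\<And>F. finite F \<Longrightarrow> F \<subseteq> S \<Longrightarrow> fnorm F (sub (fprod F K) (V N) g) \<le> e / 2"
        using close[of "e / 2"] \<open>e > 0\<close> by auto
      obtain F0 where F0: "finite F0" "F0 \<subseteq> S"
        "\<And>F. finite F \<Longrightarrow> F \<subseteq> S \<Longrightarrow> F \<inter> F0 = {} \<Longrightarrow> fnorm F (V N) < e / 2"
        using Vc[of N] half_gt_zero[OF \<open>e > 0\<close>] unfolding carr_direct_sum by blast
      have "fnorm F g < e" if F: "finite F" "F \<subseteq> S" "F \<inter> F0 = {}" for F
      proof -
        interpret f: precorr "fprod F K" by (rule fprod[OF F(2)])
        have gf: "g \<in> carr (fprod F K)" using gc F by (auto simp: fprod_def)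
        note Vf = carr_fprod[OF Vc F(2)]
        show ?thesis
          using f.hnorm_le_sub[OF gf Vf, of N] f.hnorm_sub_commute[OF gf Vf, of N] N[OF F(1,2)] F0(3)[OF F]
          by linarith
      qed
      then show "\<exists>F0. finite F0 \<and> F0 \<subseteq> S \<and> (\<forall>F. finite F \<longrightarrow> F \<subseteq> S \<longrightarrow> F \<inter> F0 = {} \<longrightarrow> fnorm F g < e)"
        using F0 by blast
    qed
    have "(\<lambda>n. hnorm DS (sub DS (V n) g)) \<longlonglongrightarrow> 0"
    proof (rule LIMSEQ_I)
      fix e :: real assume "e > 0"
      obtain N where N: "\<And>n F. n \<ge> N \<Longrightarrow> finite F \<Longrightarrow> F \<subseteq> S \<Longrightarrow> fnorm F (sub (fprod F K) (V n) g) \<le> e / 2"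
        using close[of "e / 2"] \<open>e > 0\<close> by auto
      have "hnorm DS (sub DS (V n) g) \<le> e / 2" if "n \<ge> N" for n
      proof (rule hnorm_le[OF p.sub_closed[OF Vc gcarr]])
        fix F assume F: "F \<subseteq> S" "finite F"
        have "fnorm F (sub DS (V n) g) = fnorm F (sub (fprod F K) (V n) g)"
          by (rule fnorm_cong) (use F in \<open>auto simp: direct_sum_apply sub_fprod\<close>)
        then show "fnorm F (sub DS (V n) g) \<le> e / 2" using N[OF that F(2,1)] by simp
      qed
      then show "\<exists>N. \<forall>n\<ge>N. norm (hnorm DS (sub DS (V n) g) - 0) < e"
        using \<open>e > 0\<close> p.hnorm_nonneg by (intro exI[of _ N]) fastforce
    qed
    then show "\<exists>g. hlim DS V g" using Vc gcarr by (auto simp: hlim_def)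
  qed
qed

lemma summand_nul: "s \<in> S \<Longrightarrow> summand S K s (nul (K s)) = nul DS"
  by (auto simp: summand_def direct_sum_def)

lemma summand_add:
  assumes "s \<in> S" "v \<in> carr (K s)" "w \<in> carr (K s)"
  shows "summand S K s (add (K s) v w) = add DS (summand S K s v) (summand S K s w)"
proof
  show "summand S K s (add (K s) v w) t = add DS (summand S K s v) (summand S K s w) t" for t
    using hcorr.add_nul[OF K[of t] precorr.nul_closed[OF K'[of t]]]
    by (cases "t \<in> S") (auto simp: summand_def direct_sum_def)
qed

lemma summand_ract: "summand S K s (ract (K s) v b) = ract DS (summand S K s v) b"
proof
  show "summand S K s (ract (K s) v b) t = ract DS (summand S K s v) b t" for t
    using hcorr.ract_nul[OF K[of t]] by (cases "t \<in> S") (auto simp: summand_def direct_sum_def)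
qed

definition cut :: "'s set \<Rightarrow> ('s \<Rightarrow> 'h) \<Rightarrow> 's \<Rightarrow> 'h" where
  "cut F h = (\<lambda>s\<in>S. if s \<in> F then h s else nul (K s))"

lemma cut_closed: "h \<in> carr DS \<Longrightarrow> finite F \<Longrightarrow> F \<subseteq> S \<Longrightarrow> cut F h \<in> carr DS"
  by (rule direct_sum_finite_support[where ?F0.0 = F])
    (auto simp: cut_def precorr.nul_closed K' carr_component)

lemma hnorm_summand: "s \<in> S \<Longrightarrow> v \<in> carr (K s) \<Longrightarrow> hnorm DS (summand S K s v) = hnorm (K s) v"
  by (simp add: hnorm_def inn_summand summand_closed) (simp add: summand_def)

text \<open>Truncation to finitely many coordinates leaves a small tail, and the remaining
  coordinates are approximated one at a time, each with half of the error still available.\<close>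

lemma hdense_direct_sum:
  assumes D: "D \<subseteq> carr DS" "nul DS \<in> D" "\<And>v w. v \<in> D \<Longrightarrow> w \<in> D \<Longrightarrow> add DS v w \<in> D"
    and slices: "\<And>s. s \<in> S \<Longrightarrow> hdense (K s) {v \<in> carr (K s). summand S K s v \<in> D}"
  shows "hdense DS D"
  unfolding hdense_def
proof (intro conjI ballI allI impI D(1))
  interpret p: hcorr DS by (rule hcorr_direct_sum)
  fix h and e :: real assume h: "h \<in> carr DS" and "e > 0"
  have approx: "\<exists>v\<in>D. hnorm DS (sub DS (cut F h) v) < e" if "finite F" "F \<subseteq> S" "e > 0" for F e
    using that
  proof (induction F arbitrary: e rule: finite_induct)
    case empty
    have "cut {} h = nul DS" by (auto simp: cut_def direct_sum_def)
    then show ?case using D(2) empty p.hnorm_sub_self[OF p.nul_closed] by (auto intro!: bexI[of _ "nul DS"])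
  next
    case (insert s F)
    then have s: "s \<in> S" and F: "F \<subseteq> S" by auto
    obtain v where v: "v \<in> D" "hnorm DS (sub DS (cut F h) v) < e / 2"
      using insert.IH[OF F, of "e / 2"] insert.prems by auto
    have hs: "h s \<in> carr (K s)" by (rule carr_component[OF h s])
    obtain w where w: "w \<in> carr (K s)" "summand S K s w \<in> D" "hnorm (K s) (sub (K s) (h s) w) < e / 2"
      using slices[OF s] hs half_gt_zero[OF insert.prems(2)] unfolding hdense_def by blast
    have eq: "cut (insert s F) h = add DS (cut F h) (summand S K s (h s))"
    proof
      fix t
      show "cut (insert s F) h t = add DS (cut F h) (summand S K s (h s)) t"
      proof (cases "t \<in> S")
        case True
        interpret k: hcorr "K t" by (rule K[OF True])
        have "h t \<in> carr (K t)" by (rule carr_component[OF h True])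
        then show ?thesis using True insert.hyps(2) hcorr.add_nul(2)[OF K[OF s] hs]
          by (cases "t = s") (auto simp: direct_sum_apply cut_def summand_def k.add_nul k.nul_closed)
      qed (simp add: cut_def direct_sum_def)
    qed
    have "sub DS (summand S K s (h s)) (summand S K s w) = summand S K s (sub (K s) (h s) w)"
      using s hs w(1) by (simp add: sub_def summand_add summand_ract precorr.ract_closed K')
    then have "hnorm DS (sub DS (summand S K s (h s)) (summand S K s w)) < e / 2"
      using w hs s by (simp add: hnorm_summand precorr.sub_closed[OF K'])
    moreover have "hnorm DS (sub DS (cut (insert s F) h) (add DS v (summand S K s w))) \<le>
        hnorm DS (sub DS (cut F h) v) + hnorm DS (sub DS (summand S K s (h s)) (summand S K s w))"
      unfolding eq using v w hs s F D(1) insert.hyps h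
      by (intro p.hnorm_sub_add cut_closed summand_closed) auto
    ultimately show ?case using D(3)[OF v(1) w(2)] v(2) by (intro bexI) auto
  qed
  obtain F0 where F0: "finite F0" "F0 \<subseteq> S"
    "\<And>F. finite F \<Longrightarrow> F \<subseteq> S \<Longrightarrow> F \<inter> F0 = {} \<Longrightarrow> fnorm F h < e / 2"
    using h half_gt_zero[OF \<open>e > 0\<close>] unfolding carr_direct_sum by blast
  note cc = cut_closed[OF h F0(1,2)]
  have "hnorm DS (sub DS h (cut F0 h)) \<le> e / 2"
  proof (rule hnorm_le[OF p.sub_closed[OF h cc]])
    fix F assume F: "F \<subseteq> S" "finite F"
    have *: "inn (K s) (sub DS h (cut F0 h) s) (sub DS h (cut F0 h) s) =
        (if s \<in> F0 then 0 else inn (K s) (h s) (h s))" if "s \<in> S" for s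
    proof -
      interpret k: hcorr "K s" by (rule K[OF that])
      show ?thesis using that carr_component[OF h that]
        by (simp add: direct_sum_apply cut_def k.inn_simps k.closed)
    qed
    have "(\<Sum>s\<in>F. inn (K s) (sub DS h (cut F0 h) s) (sub DS h (cut F0 h) s)) =
        (\<Sum>s\<in>F. if s \<in> F0 then 0 else inn (K s) (h s) (h s))"
      using * F by (intro sum.cong) auto
    also have "\<dots> = (\<Sum>s\<in>F - F0. inn (K s) (h s) (h s))"
      using F by (simp add: sum.If_cases Diff_eq Compl_eq)
    finally have "fnorm F (sub DS h (cut F0 h)) = fnorm (F - F0) h"
      by (simp add: hnorm_def fprod_def)
    also have "\<dots> < e / 2" using F by (intro F0(3)) auto
    finally show "fnorm F (sub DS h (cut F0 h)) \<le> e / 2" by simp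
  qed
  moreover obtain v where v: "v \<in> D" "hnorm DS (sub DS (cut F0 h) v) < e / 2"
    using approx[OF F0(1,2), of "e / 2"] \<open>e > 0\<close> by auto
  moreover have "v \<in> carr DS" using v D by auto
  ultimately show "\<exists>v\<in>D. hnorm DS (sub DS h v) < e"
    using p.hnorm_sub_triangle[OF h cc, of v] by (intro bexI[of _ v]) auto
qed

end

section \<open>The representations on a tree product\<close>

text \<open>The right-linear graph generated by prescribed pairs. A priori it need not be a
  function; the norm bound obtained in \<open>symmetric_extension\<close> makes it one.\<close>

inductive_set graph_span :: "('b::unital_cstar, 'h) corr \<Rightarrow> ('h \<times> 'h) set \<Rightarrow> ('h \<times> 'h) set"
  for H :: "('b::unital_cstar, 'h) corr" and R :: "('h \<times> 'h) set" where
  graph_span_nul: "(nul H, nul H) \<in> graph_span H R"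
| graph_span_step: "(v, w) \<in> R \<Longrightarrow> (p, q) \<in> graph_span H R \<Longrightarrow>
    (add H (ract H v b) p, add H (ract H w b) q) \<in> graph_span H R"

context hcorr
begin

lemma graph_span_carr:
  assumes "R \<subseteq> carr H \<times> carr H" "(v, w) \<in> graph_span H R"
  shows "v \<in> carr H \<and> w \<in> carr H"
  using assms(2) by (induction rule: graph_span.induct) (use assms(1) in \<open>auto simp: closed\<close>)

lemma graph_span_add:
  assumes R: "R \<subseteq> carr H \<times> carr H" and vw: "(v, w) \<in> graph_span H R" and vw': "(v', w') \<in> graph_span H R"
  shows "(add H v v', add H w w') \<in> graph_span H R"
  using vw
proof (induction rule: graph_span.induct)
  case graph_span_nul
  show ?case using vw' graph_span_carr[OF R vw'] by (simp add: add_nul)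
next
  case (graph_span_step v w p q b)
  have c: "v \<in> carr H" "w \<in> carr H" using R graph_span_step by auto
  then show ?case
    using graph_span.graph_span_step[OF graph_span_step(1,3), of b] graph_span_carr[OF R vw']
      graph_span_carr[OF R graph_span_step(2)]
    by (simp add: add_assoc closed)
qed

lemma graph_span_ract:
  assumes R: "R \<subseteq> carr H \<times> carr H" and vw: "(v, w) \<in> graph_span H R"
  shows "(ract H v b, ract H w b) \<in> graph_span H R"
  using vw
proof (induction rule: graph_span.induct)
  case graph_span_nul
  show ?case by (simp add: ract_nul graph_span.graph_span_nul)
next
  case (graph_span_step v w p q c)
  have "v \<in> carr H" "w \<in> carr H" using R graph_span_step by auto
  then show ?case
    using graph_span.graph_span_step[OF graph_span_step(1,3), of "c * b"]
      graph_span_carr[OF R graph_span_step(2)]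
    by (simp add: ract_add ract_ract closed)
qed

lemma graph_span_base:
  assumes "R \<subseteq> carr H \<times> carr H" "(v, w) \<in> R"
  shows "(v, w) \<in> graph_span H R"
proof -
  have "v \<in> carr H" "w \<in> carr H" using assms by auto
  then show ?thesis
    using graph_span_step[OF assms(2) graph_span_nul, of H 1] by (simp add: ract_one add_nul)
qed

text \<open>Symmetry and growth pass from the generators to their span. For growth it matters that
  \<open>K\<close> is common to all generators, while \<open>C\<close> may vary and adds up.\<close>

lemma symmetric_extension_span:
  assumes R: "R \<subseteq> carr H \<times> carr H"
    and Rsym: "\<And>v w v' w'. (v, w) \<in> R \<Longrightarrow> (v', w') \<in> R \<Longrightarrow> inn H w v' = inn H v w'"
    and dense: "\<And>D. D \<subseteq> carr H \<Longrightarrow> nul H \<in> D \<Longrightarrow> (\<And>v w. v \<in> D \<Longrightarrow> w \<in> D \<Longrightarrow> add H v w \<in> D) \<Longrightarrow>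
      (\<And>v w b. (v, w) \<in> R \<Longrightarrow> ract H v b \<in> D) \<Longrightarrow> hdense H D"
    and K: "K > 0"
    and growth: "\<And>v w. (v, w) \<in> R \<Longrightarrow> \<exists>C z. z 0 = v \<and> z 1 = w \<and>
      (\<forall>n. (z n, z (Suc n)) \<in> graph_span H R \<and> hnorm H (z n) \<le> C * K ^ n)"
  shows "\<exists>y. sym_op H y \<and> (\<forall>(v, w)\<in>R. y v = w)"
proof -
  let ?G = "graph_span H R"
  note G = graph_span_carr[OF R]
  have "\<exists>y. sym_op H y \<and> (\<forall>(v, w)\<in>?G. y v = w)"
  proof (rule symmetric_extension[OF _ _ _ _ _ K])
    show "?G \<subseteq> carr H \<times> carr H" using G by auto
    show "(add H v v', add H w w') \<in> ?G" if "(v, w) \<in> ?G" "(v', w') \<in> ?G" for v w v' w'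
      using graph_span_add[OF R] that by blast
    show "(ract H v b, ract H w b) \<in> ?G" if "(v, w) \<in> ?G" for v w b
      using graph_span_ract[OF R] that by blast
    show "inn H w v' = inn H v w'" if vw: "(v, w) \<in> ?G" and vw': "(v', w') \<in> ?G" for v w v' w'
      using vw
    proof (induction rule: graph_span.induct)
      case graph_span_nul
      show ?case using G[OF vw'] by (simp add: inn_simps)
    next
      case (graph_span_step v w p q b)
      note c = G[OF graph_span_step(2)]
      have c': "v \<in> carr H" "w \<in> carr H" using R graph_span_step by auto
      have "inn H w v' = inn H v w'"
        using vw'
      proof (induction rule: graph_span.induct)
        case graph_span_nul
        then show ?case using c' by (simp add: inn_simps)
      next
        case (graph_span_step v' w' p' q' b')
        have "v' \<in> carr H" "w' \<in> carr H" using R graph_span_step by auto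
        then show ?case
          using c' G[OF graph_span_step(2)] graph_span_step(3) Rsym[OF \<open>(v, w) \<in> R\<close> graph_span_step(1)]
          by (simp add: inn_simps closed)
      qed
      then show ?case using c c' G[OF vw'] graph_span_step(3) by (simp add: inn_simps closed)
    qed
    show "hdense H (Domain ?G)"
    proof (rule dense)
      show "Domain ?G \<subseteq> carr H" using G by auto
      show "nul H \<in> Domain ?G" using graph_span_nul by blast
      show "add H v w \<in> Domain ?G" if "v \<in> Domain ?G" "w \<in> Domain ?G" for v w
        using that graph_span_add[OF R] by blast
      show "ract H v b \<in> Domain ?G" if "(v, w) \<in> R" for v w b
        using graph_span_ract[OF R graph_span_base[OF R that]] by blast
    qed
    show "\<exists>C z. z 0 = v \<and> z 1 = w \<and> (\<forall>n. (z n, z (Suc n)) \<in> ?G \<and> hnorm H (z n) \<le> C * K ^ n)"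
      if "(v, w) \<in> ?G" for v w
      using that
    proof (induction rule: graph_span.induct)
      case graph_span_nul
      show ?case
        by (intro exI[of _ 0] exI[of _ "\<lambda>_. nul H"]) (simp add: graph_span.graph_span_nul hnorm_nul)
    next
      case (graph_span_step v w p q b)
      obtain C z where z: "z 0 = v" "z 1 = w" "\<And>n. (z n, z (Suc n)) \<in> ?G" "\<And>n. hnorm H (z n) \<le> C * K ^ n"
        using growth[OF graph_span_step(1)] by blast
      obtain D u where u: "u 0 = p" "u 1 = q" "\<And>n. (u n, u (Suc n)) \<in> ?G" "\<And>n. hnorm H (u n) \<le> D * K ^ n"
        using graph_span_step(3) by blast
      have "hnorm H (add H (ract H (z n) b) (u n)) \<le> (C * norm b + D) * K ^ n" for n
      proof -
        have "hnorm H (add H (ract H (z n) b) (u n)) \<le> hnorm H (z n) * norm b + hnorm H (u n)"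
          using hnorm_triangle[of "ract H (z n) b" "u n"] hnorm_ract[of "z n" b] G[OF z(3)] G[OF u(3)]
          by (smt (verit) ract_closed)
        also have "\<dots> \<le> C * K ^ n * norm b + D * K ^ n"
          using z(4) u(4) by (intro add_mono mult_right_mono) auto
        finally show ?thesis by (simp add: algebra_simps)
      qed
      then show ?case
        using z u by (intro exI[of _ "C * norm b + D"] exI[of _ "\<lambda>n. add H (ract H (z n) b) (u n)"])
          (auto intro!: graph_span_add[OF R] graph_span_ract[OF R])
    qed
  qed
  then show ?thesis using graph_span_base[OF R] by fastforce
qed

end

text \<open>Centrality enters in the closure under the left action: moving \<open>b\<close> across
  the pairing gives \<open>\<langle>b h, \<xi>\<rangle> = \<langle>h, \<xi>\<rangle> * cstar b =
  0\<close>.\<close>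

lemma precorr_centered:
  assumes H: "precorr H" and \<xi>: "\<xi> \<in> carr H"
    and central: "\<And>k b. k \<in> carr H \<Longrightarrow> inn H k (lact H b \<xi>) = inn H k \<xi> * b"
  shows "precorr (centered H \<xi>)"
proof -
  interpret precorr H by (rule H)
  have l: "inn H (lact H b h) \<xi> = 0" if "h \<in> carr H" "inn H h \<xi> = 0" for h b
    using inn_lact[of h \<xi> "cstar b"] central[of h "cstar b"] that \<xi> by (simp add: cstar_cstar)
  show ?thesis
    by unfold_locales (auto simp: centered_def closed inn_simps \<xi> l inn_star inn_lact_add
        inn_lact_mult inn_lact_scalar intro: inn_gram inn_lact)
qed

text \<open>Edges of the free tree prepend one letter, so connectedness with the root amounts to
  closure under suffixes; alternation is likewise expressed one letter at a time, which suits
  induction on strings.\<close>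

definition rooted_tree :: "nat set \<Rightarrow> nat list set \<Rightarrow> bool" where
  "rooted_tree J T \<longleftrightarrow> [] \<in> T \<and> (\<forall>s\<in>T. set s \<subseteq> J) \<and>
     (\<forall>j s. j # s \<in> T \<longrightarrow> s \<in> T \<and> (s = [] \<or> hd s \<noteq> j))"

section \<open>Attached vectors, and existence and uniqueness of the tree representations\<close>

locale tree_conv =
  fixes J :: "nat set" and T :: "nat list set" and H :: "nat \<Rightarrow> ('b::unital_cstar, 'h) corr"
    and \<xi> :: "nat \<Rightarrow> 'h"
  assumes tree: "rooted_tree J T"
    and H: "j \<in> J \<Longrightarrow> precorr (H j)"
    and \<xi>_closed: "j \<in> J \<Longrightarrow> \<xi> j \<in> carr (H j)"
    and \<xi>_unit: "j \<in> J \<Longrightarrow> inn (H j) (\<xi> j) (\<xi> j) = 1"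
    and \<xi>_central: "j \<in> J \<Longrightarrow> k \<in> carr (H j) \<Longrightarrow>
      inn (H j) k (lact (H j) b (\<xi> j)) = inn (H j) k (\<xi> j) * b"
begin

abbreviation "K \<equiv> centered_family H \<xi>"
abbreviation "HT \<equiv> tree_product T H \<xi>"
abbreviation "tv \<equiv> tree_vec T H \<xi>"
abbreviation "att \<equiv> attach T H \<xi>"
abbreviation "ctr j h \<equiv> sub (H j) h (ract (H j) (\<xi> j) (inn (H j) (\<xi> j) h))"

lemma tree_simps:
  "[] \<in> T" "s \<in> T \<Longrightarrow> j \<in> set s \<Longrightarrow> j \<in> J" "j # s \<in> T \<Longrightarrow> j \<in> J"
  "j # s \<in> T \<Longrightarrow> s \<in> T" "j # s \<in> T \<Longrightarrow> s = [] \<or> hd s \<noteq> j" "j # j # s \<notin> T"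
  using tree by (force simp: rooted_tree_def)+

lemma K_simps: "carr (K j) = {h \<in> carr (H j). inn (H j) h (\<xi> j) = 0}"
  "inn (K j) = inn (H j)" "lact (K j) = lact (H j)" "ract (K j) = ract (H j)" "add (K j) = add (H j)"
  by (simp_all add: centered_family_def centered_def)

lemma precorr_K: "j \<in> J \<Longrightarrow> precorr (K j)"
  unfolding centered_family_def by (intro precorr_centered H \<xi>_closed \<xi>_central)

lemma precorrs_K: "s \<in> T \<Longrightarrow> precorrs K s"
  by (simp add: precorrs_def precorr_K tree_simps)

lemma hcorr_tensor_K: "s \<in> T \<Longrightarrow> hcorr (tensor K s)"
  by (rule hcorr_tensor[OF precorrs_K])

sublocale ht: hcorr HT
  unfolding tree_product_def by (rule hcorr_direct_sum[OF hcorr_tensor_K])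

lemma tv_closed: "s \<in> T \<Longrightarrow> admissible K s w \<Longrightarrow> tv s w \<in> carr HT"
  unfolding tree_vec_def tree_product_def
  by (intro summand_closed hcorr_tensor_K simple_tensor_closed precorrs_K)

lemma inn_tv_lact:
  assumes "s \<in> T" "s' \<in> T" "admissible K s w" "admissible K s' w'"
  shows "inn HT (tv s w) (lact HT b (tv s' w')) = (if s = s' then tensor_inn K s b w w' else 0)"
proof -
  have c: "lact HT b (tv s' w') \<in> carr HT" using assms by (intro ht.closed tv_closed)
  have t: "simple_tensor K s w \<in> carr (tensor K s)" using assms by (intro simple_tensor_closed precorrs_K)
  have "inn HT (tv s w) (lact HT b (tv s' w')) =
      inn (tensor K s) (simple_tensor K s w) (lact HT b (tv s' w') s)"
    using inn_summand[where S = T and K = "tensor K", OF hcorr_tensor_K assms(1) t] c by (simp add: tree_vec_def tree_product_def)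
  also have "lact HT b (tv s' w') s = (if s = s' then lact (tensor K s) b (simple_tensor K s w') else nul (tensor K s))"
    using hcorr.lact_nul[OF hcorr_tensor_K[OF assms(1)]] assms
    by (auto simp: tree_vec_def tree_product_def summand_def direct_sum_def)
  also have "inn (tensor K s) (simple_tensor K s w) \<dots> = (if s = s' then tensor_inn K s b w w' else 0)"
    using assms t inn_lact_simple_tensor[OF precorrs_K[OF assms(1)]]
      precorr.inn_nul[OF hcorr.axioms(1)[OF hcorr_tensor_K[OF assms(1)]]] by auto
  finally show ?thesis .
qed

lemma inn_tv:
  assumes "s \<in> T" "s' \<in> T" "admissible K s w" "admissible K s' w'"
  shows "inn HT (tv s w) (tv s' w') = (if s = s' then tensor_inn K s 1 w w' else 0)"
  using inn_tv_lact[OF assms, of 1] assms by (simp add: ht.lact_one tv_closed)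

lemma tv_dense:
  assumes D: "D \<subseteq> carr HT" "nul HT \<in> D" "\<And>v w. v \<in> D \<Longrightarrow> w \<in> D \<Longrightarrow> add HT v w \<in> D"
    "\<And>s w b. s \<in> T \<Longrightarrow> admissible K s w \<Longrightarrow> ract HT (tv s w) b \<in> D"
  shows "hdense HT D"
  unfolding tree_product_def
proof (rule hdense_direct_sum[OF hcorr_tensor_K])
  show "hdense (tensor K s) {v \<in> carr (tensor K s). summand T (tensor K) s v \<in> D}" if s: "s \<in> T" for s
  proof (rule hdense_simple_tensors[OF precorrs_K[OF s]])
    interpret k: hcorr "tensor K s" by (rule hcorr_tensor_K[OF s])
    show "nul (tensor K s) \<in> {v \<in> carr (tensor K s). summand T (tensor K) s v \<in> D}"
      using D(2) summand_nul[where S = T and K = "tensor K", OF hcorr_tensor_K s] by (simp add: k.nul_closed tree_product_def)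
    show "add (tensor K s) v w \<in> {v \<in> carr (tensor K s). summand T (tensor K) s v \<in> D}"
      if "v \<in> {v \<in> carr (tensor K s). summand T (tensor K) s v \<in> D}"
        "w \<in> {v \<in> carr (tensor K s). summand T (tensor K) s v \<in> D}" for v w
      using that D(3) summand_add[where S = T and K = "tensor K", OF hcorr_tensor_K s] by (auto simp: k.add_closed tree_product_def)
    show "ract (tensor K s) (simple_tensor K s w) b \<in> {v \<in> carr (tensor K s). summand T (tensor K) s v \<in> D}"
      if "admissible K s w" for w b
      using that D(4)[OF s that, of b] summand_ract[where S = T and K = "tensor K", OF hcorr_tensor_K]
      by (simp add: k.ract_closed simple_tensor_closed[OF precorrs_K[OF s]] tree_product_def tree_vec_def)
  qed auto
qed (use D in \<open>auto simp: tree_product_def\<close>)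

lemma tv_eqI:
  assumes h: "h \<in> carr HT" and k: "k \<in> carr HT"
    and eq: "\<And>s w. s \<in> T \<Longrightarrow> admissible K s w \<Longrightarrow> inn HT (tv s w) h = inn HT (tv s w) k"
  shows "h = k"
proof (rule ht.hdense_eqI[of "{v \<in> carr HT. inn HT v h = inn HT v k}"])
  show "hdense HT {v \<in> carr HT. inn HT v h = inn HT v k}"
    using h k eq by (intro tv_dense) (auto simp: ht.inn_simps ht.closed tv_closed)
qed (use h k in auto)

lemma ctr_closed: "j \<in> J \<Longrightarrow> h \<in> carr (H j) \<Longrightarrow> ctr j h \<in> carr (K j)"
  by (auto simp: K_simps precorr.closed H \<xi>_closed precorr.inn_simps \<xi>_unit precorr.inn_star)

lemma ctr_closed_H: "j \<in> J \<Longrightarrow> h \<in> carr (H j) \<Longrightarrow> ctr j h \<in> carr (H j)"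
  using ctr_closed by (simp add: K_simps)

lemma inn_ctr: "j \<in> J \<Longrightarrow> k \<in> carr (K j) \<Longrightarrow> h \<in> carr (H j) \<Longrightarrow> inn (H j) k (ctr j h) = inn (H j) k h"
  by (auto simp: K_simps precorr.closed H \<xi>_closed precorr.inn_simps)

lemma att_closed:
  "j # s \<in> T \<Longrightarrow> h \<in> carr (H j) \<Longrightarrow> admissible K s w \<Longrightarrow> att j s h w \<in> carr HT"
  unfolding attach_def by (intro ht.closed tv_closed) (auto simp: tree_simps ctr_closed)

lemma inn_tv_att:
  assumes "j # s \<in> T" "h \<in> carr (H j)" "admissible K s w" "s0 \<in> T" "admissible K s0 w0"
  shows "inn HT (tv s0 w0) (att j s h w) = (if s0 = s then tensor_inn K s (inn (H j) (\<xi> j) h) w0 w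
    else if s0 = j # s then tensor_inn K (j # s) 1 w0 (ctr j h # w) else 0)"
proof -
  have c: "ctr j h \<in> carr (K j)" "s \<in> T" using assms(1,2) tree_simps(3,4) by (auto intro: ctr_closed)
  then show ?thesis unfolding attach_def using assms
    by (subst ht.inn_add) (auto simp: ht.closed tv_closed inn_tv_lact inn_tv)
qed

lemma tensor_inn_ctr:
  assumes "j # s \<in> T" "h \<in> carr (H j)" "h0 \<in> carr (K j)" "admissible K s w" "admissible K s w0"
  shows "tensor_inn K (j # s) b (h0 # w0) (ctr j h # w) = tensor_inn K s (inn (H j) h0 (lact (H j) b h)) w0 w"
proof -
  have j: "j \<in> J" using assms tree_simps by blast
  interpret h: precorr "H j" by (rule H[OF j])
  have "inn (H j) h0 (lact (H j) b (ctr j h)) = inn (H j) (lact (H j) (cstar b) h0) (ctr j h)"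
    using assms j by (intro h.inn_lact) (auto simp: K_simps ctr_closed_H)
  also have "\<dots> = inn (H j) (lact (H j) (cstar b) h0) h"
    using precorr.lact_closed[OF precorr_K[OF j] assms(3), of "cstar b"] assms(2)
    by (intro inn_ctr j) (auto simp: K_simps)
  also have "\<dots> = inn (H j) h0 (lact (H j) b h)"
    using assms by (intro h.inn_lact[symmetric]) (auto simp: K_simps)
  finally show ?thesis by (simp add: K_simps)
qed

text \<open>\<open>attach\<close> is isometric from the tensor product of \<open>H j\<close> with
  the component at \<open>s\<close>: the part of \<open>h\<close> along \<open>\<xi>\<close> is
  paired in the component at \<open>s\<close>, the centred part at \<open>j # s\<close>, and the two
  coefficients add up to \<open>\<langle>h, h'\<rangle>\<close>.\<close>

lemma inn_att_att:
  assumes js: "j # s \<in> T" and h: "h \<in> carr (H j)" "h' \<in> carr (H j)"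
    and w: "admissible K s w" "admissible K s w'"
  shows "inn HT (att j s h w) (att j s h' w') = tensor_inn K s (inn (H j) h h') w w'"
proof -
  have j: "j \<in> J" and s: "s \<in> T" using js tree_simps by blast+
  interpret h: precorr "H j" by (rule H[OF j])
  note c = ctr_closed[OF j h(1)] ctr_closed[OF j h(2)]
  define a where "a = inn (H j) (\<xi> j) h"
  have as: "cstar a = inn (H j) h (\<xi> j)" using h \<xi>_closed[OF j] by (simp add: a_def h.inn_star)
  note cl = tv_closed[OF s w(1)] tv_closed[OF s w(2)] att_closed[OF js h(2) w(2)]
  have cv: "tv (j # s) (ctr j h # w) \<in> carr HT" using js c w by (intro tv_closed) auto
  have "inn HT (att j s h w) (att j s h' w') =
      inn HT (lact HT a (tv s w)) (att j s h' w') + inn HT (tv (j # s) (ctr j h # w)) (att j s h' w')"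
    unfolding attach_def[of T H \<xi> j s h w] a_def using cl cv by (intro ht.inn_add_left) (auto simp: ht.closed)
  also have "inn HT (lact HT a (tv s w)) (att j s h' w') = tensor_inn K s (cstar a * inn (H j) (\<xi> j) h') w w'"
  proof -
    have "inn HT (lact HT a (tv s w)) (att j s h' w') = inn HT (tv s w) (lact HT (cstar a) (att j s h' w'))"
      using ht.inn_lact[OF cl(1) cl(3), of "cstar a"] by (simp add: cstar_cstar)
    also have "lact HT (cstar a) (att j s h' w') = add HT (lact HT (cstar a * inn (H j) (\<xi> j) h') (tv s w'))
        (lact HT (cstar a) (tv (j # s) (ctr j h' # w')))"
      unfolding attach_def using cl js c w
      by (subst ht.lact_add) (auto simp: ht.closed tv_closed ht.lact_mult)
    also have "inn HT (tv s w) \<dots> = tensor_inn K s (cstar a * inn (H j) (\<xi> j) h') w w'"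
      using cl js c w s by (subst ht.inn_add) (auto simp: ht.closed tv_closed inn_tv_lact)
    finally show ?thesis .
  qed
  also have "inn HT (tv (j # s) (ctr j h # w)) (att j s h' w') = tensor_inn K s (inn (H j) (ctr j h) h') w w'"
    using js c w h by (subst inn_tv_att) (auto simp: tensor_inn_ctr h.inn_lact_one K_simps simp del: tensor_inn.simps)
  also have "tensor_inn K s (cstar a * inn (H j) (\<xi> j) h') w w' + tensor_inn K s (inn (H j) (ctr j h) h') w w' =
      tensor_inn K s (cstar a * inn (H j) (\<xi> j) h' + inn (H j) (ctr j h) h') w w'"
    using w s by (simp add: tensor_inn_add precorrs_K)
  also have "cstar a * inn (H j) (\<xi> j) h' + inn (H j) (ctr j h) h' = inn (H j) h h'"
    using h \<xi>_closed[OF j] by (simp add: h.inn_simps h.closed a_def)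
  finally show ?thesis .
qed

text \<open>Neither string begins with \<open>j\<close>, so the components at \<open>s\<close>,
  \<open>j # s\<close> and those at \<open>s'\<close>, \<open>j # s'\<close> are disjoint. The
  pieces on which a representation acts separately are thus orthogonal.\<close>

lemma inn_att_orthogonal:
  assumes "j # s \<in> T" "h \<in> carr (H j)" "admissible K s w" "s' \<in> T" "s' = [] \<or> hd s' \<noteq> j" "admissible K s' w'" "s \<noteq> s'"
  shows "inn HT (att j s h w) (tv s' w') = 0" "inn HT (tv s' w') (att j s h w) = 0"
    and "j # s' \<in> T \<Longrightarrow> h' \<in> carr (H j) \<Longrightarrow> inn HT (att j s h w) (att j s' h' w') = 0"
proof -
  have st: "s \<in> T" "ctr j h \<in> carr (K j)"
    using assms(1,2) tree_simps(3,4) by (auto intro: ctr_closed)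
  show z: "inn HT (tv s' w') (att j s h w) = 0"
    using assms by (subst inn_tv_att) auto
  have cl: "att j s h w \<in> carr HT" "tv s' w' \<in> carr HT" using assms by (auto intro: att_closed tv_closed)
  then show z': "inn HT (att j s h w) (tv s' w') = 0"
    using z ht.inn_star[OF cl(2,1)] by (simp add: cstar_zero)
  assume js': "j # s' \<in> T" and h': "h' \<in> carr (H j)"
  have c: "ctr j h' \<in> carr (K j)" using js' h' by (auto intro: ctr_closed tree_simps)
  have cv: "tv (j # s') (ctr j h' # w') \<in> carr HT" using js' c assms by (intro tv_closed) auto
  have "inn HT (att j s h w) (lact HT a (tv s' w')) = 0" for a
  proof -
    have eq: "lact HT (cstar a) (att j s h w) = add HT (lact HT (cstar a * inn (H j) (\<xi> j) h) (tv s w))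
        (lact HT (cstar a) (tv (j # s) (ctr j h # w)))"
      unfolding attach_def using assms(1,3) st
      by (subst ht.lact_add) (auto simp: ht.closed tv_closed ht.lact_mult)
    have "s' \<noteq> j # s" using assms(5) by auto
    then have "inn HT (tv s' w') (lact HT (cstar a) (att j s h w)) = 0"
      unfolding eq using assms(1,3,4,6,7) st cl
      by (subst ht.inn_add) (simp_all add: ht.closed tv_closed inn_tv_lact del: tensor_inn.simps)
    then have "inn HT (lact HT (cstar a) (att j s h w)) (tv s' w') = 0"
      using ht.inn_star[OF cl(2) ht.lact_closed[OF cl(1)], of "cstar a"] by (simp add: cstar_zero)
    then show ?thesis using ht.inn_lact[OF cl(1,2), of a] by simp
  qed
  moreover have "inn HT (att j s h w) (tv (j # s') (ctr j h' # w')) = 0"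
  proof -
    have "inn HT (tv (j # s') (ctr j h' # w')) (att j s h w) = 0"
      using assms js' c tree_simps(5)[OF assms(1)] by (subst inn_tv_att) auto
    then show ?thesis using ht.inn_star[OF cv cl(1)] by (simp add: cstar_zero)
  qed
  ultimately show "inn HT (att j s h w) (att j s' h' w') = 0"
    unfolding attach_def[of T H \<xi> j s' h' w'] using cl cv by (subst ht.inn_add) (auto simp: ht.closed)
qed

text \<open>With \<open>tv_eq_att\<close> it presents a simple tensor as an attached vector, with
  head \<open>h\<close> if its string begins with \<open>j\<close> and with head
  \<open>\<xi>\<close> if \<open>j\<close> can be prepended. In the remaining case the specification
  prescribes 0, so the operator is fixed on all simple tensors.\<close>

lemma tv_eq_att_Cons:
  assumes "j # s \<in> T" "h \<in> carr (K j)" "admissible K s w"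
  shows "tv (j # s) (h # w) = att j s h w"
proof (rule tv_eqI)
  have h: "h \<in> carr (H j)" "j \<in> J" "s \<in> T" using assms(1,2) tree_simps(3,4) by (auto simp: K_simps)
  interpret h: precorr "H j" by (rule H[OF h(2)])
  have z: "inn (H j) (\<xi> j) h = 0"
    using assms(2) h.inn_star[OF h(1) \<xi>_closed[OF h(2)]] by (simp add: K_simps cstar_zero)
  have z': "tensor_inn K s 0 w0 w = 0" if "admissible K s w0" for w0
    using tensor_inn_scaleR[OF precorrs_K[OF h(3)] that assms(3), of 0 1] by simp
  show "tv (j # s) (h # w) \<in> carr HT" "att j s h w \<in> carr HT"
    using assms h by (auto intro: tv_closed att_closed)
  fix s0 w0 assume s0: "s0 \<in> T" "admissible K s0 w0"
  have "tensor_inn K (j # s) 1 w0 (ctr j h # w) = tensor_inn K (j # s) 1 w0 (h # w)" if "s0 = j # s"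
    using s0 that assms h
    by (auto elim!: admissible_ConsE simp: tensor_inn_ctr simp del: tensor_inn.simps) (simp add: K_simps)
  then show "inn HT (tv s0 w0) (tv (j # s) (h # w)) = inn HT (tv s0 w0) (att j s h w)"
    using s0 assms h z z' by (auto simp: inn_tv inn_tv_att simp del: tensor_inn.simps)
qed

lemma tv_eq_att:
  assumes "j # s \<in> T" "admissible K s w"
  shows "tv s w = att j s (\<xi> j) w"
proof (rule tv_eqI)
  have h: "j \<in> J" "s \<in> T" using assms tree_simps by auto
  interpret h: precorr "H j" by (rule H[OF h(1)])
  have z': "tensor_inn K s 0 w0 w = 0" if "admissible K s w0" for w0
    using tensor_inn_scaleR[OF precorrs_K[OF h(2)] that assms(2), of 0 1] by simp
  show "tv s w \<in> carr HT" "att j s (\<xi> j) w \<in> carr HT"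
    using assms h by (auto intro: tv_closed att_closed \<xi>_closed)
  fix s0 w0 assume s0: "s0 \<in> T" "admissible K s0 w0"
  have "tensor_inn K (j # s) 1 w0 (ctr j (\<xi> j) # w) = 0" if "s0 = j # s"
    using s0 that assms h \<xi>_closed[OF h(1)]
    by (auto elim!: admissible_ConsE simp: tensor_inn_ctr simp del: tensor_inn.simps)
      (simp add: K_simps \<xi>_central z')
  then show "inn HT (tv s0 w0) (tv s w) = inn HT (tv s0 w0) (att j s (\<xi> j) w)"
    using s0 assms h \<xi>_closed[OF h(1)] by (auto simp: inn_tv inn_tv_att \<xi>_unit simp del: tensor_inn.simps)
qed

definition tree_rep_spec :: "nat \<Rightarrow> ('h \<Rightarrow> 'h) \<Rightarrow> (_ \<Rightarrow> _) \<Rightarrow> bool" where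
  "tree_rep_spec j x y \<longleftrightarrow>
     (\<forall>s\<in>T. \<forall>w. (s = [] \<or> hd s \<noteq> j) \<longrightarrow> admissible K s w \<longrightarrow>
        (if j # s \<in> T then \<forall>h\<in>carr (H j). y (att j s h w) = att j s (x h) w
         else y (tv s w) = nul HT))"

lemma tree_rep_unique:
  assumes "y \<in> adjointable HT" "y' \<in> adjointable HT" "tree_rep_spec j x y" "tree_rep_spec j x y'" "j \<in> J"
  shows "y = y'"
proof (rule ht.adjointable_eqI[OF assms(1,2)])
  have agree: "y (tv s w) = y' (tv s w)" if s: "s \<in> T" "admissible K s w" for s w
  proof (cases "s = [] \<or> hd s \<noteq> j")
    case True
    show ?thesis
    proof (cases "j # s \<in> T")
      case js: True
      have "z (att j s (\<xi> j) w) = att j s (x (\<xi> j)) w" if "tree_rep_spec j x z" for z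
        using that s True js \<xi>_closed[OF assms(5)] by (auto simp: tree_rep_spec_def)
      then show ?thesis using tv_eq_att[OF js s(2)] assms(3,4) by simp
    next
      case js: False
      have "z (tv s w) = nul HT" if "tree_rep_spec j x z" for z
        using that s True js by (auto simp: tree_rep_spec_def)
      then show ?thesis using assms(3,4) by simp
    qed
  next
    case False
    then obtain s' where s': "s = j # s'" by (cases s) auto
    then obtain h w' where w: "w = h # w'" "h \<in> carr (K j)" "admissible K s' w'"
      using s(2) by (auto elim: admissible_ConsE)
    have js: "j # s' \<in> T" using s s' by simp
    have "z (att j s' h w') = att j s' (x h) w'" if "tree_rep_spec j x z" for z
      using that js tree_simps(4,5)[OF js] w by (auto simp: tree_rep_spec_def K_simps)
    then show ?thesis using tv_eq_att_Cons[OF js w(2,3)] assms(3,4) s' w by simp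
  qed
  have z: "h \<in> carr HT \<Longrightarrow> z (ract HT h b) = ract HT (z h) b"
    "h \<in> carr HT \<Longrightarrow> k \<in> carr HT \<Longrightarrow> z (add HT h k) = add HT (z h) (z k)"
    if "z \<in> adjointable HT" for z h k b
    using that by (auto simp: adjointable_def)
  \<comment> \<open>As a right multiple of the vacuum tensor, 0 inherits agreement of the two
    operators by modularity.\<close>
  have n: "nul HT = ract HT (tv [] []) 0"
    by (rule ht.separated) (auto simp: ht.closed ht.inn_simps tv_closed tree_simps)
  show "hdense HT {h \<in> carr HT. y h = y' h}"
    using z[OF assms(1)] z[OF assms(2)] agree
    by (intro tv_dense) (auto simp: ht.closed tv_closed n tree_simps)
qed

lemma tree_rep_exists:
  assumes j: "j \<in> J" and x: "sym_op (H j) x"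
  shows "\<exists>y. sym_op HT y \<and> tree_rep_spec j x y"
proof -
  interpret h: precorr "H j" by (rule H[OF j])
  \<comment> \<open>The prescribed graph: attached vectors, and simple tensors to which
    \<open>j\<close> cannot be prepended. Its symmetry over one string holds because
    \<open>attach\<close> is isometric and \<open>x\<close> symmetric, and over different strings by
    orthogonality.\<close>
  define R where "R = {(att j s h w, att j s (x h) w) | s h w. j # s \<in> T \<and> h \<in> carr (H j) \<and> admissible K s w}
    \<union> {(tv s w, nul HT) | s w. s \<in> T \<and> (s = [] \<or> hd s \<noteq> j) \<and> j # s \<notin> T \<and> admissible K s w}"
  note xc = sym_op_closed[OF x]
  have R: "R \<subseteq> carr HT \<times> carr HT"
    unfolding R_def by (auto intro: att_closed tv_closed ht.closed xc)
  have "\<exists>K. \<forall>h\<in>carr (H j). hnorm (H j) (x h) \<le> K * hnorm (H j) h" using x by (simp add: sym_op_def)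
  then obtain M where M: "M > 0" "\<And>h. h \<in> carr (H j) \<Longrightarrow> hnorm (H j) (x h) \<le> M * hnorm (H j) h"
    by (rule bounded_constant) (auto simp: h.hnorm_nonneg)
  have "\<exists>y. sym_op HT y \<and> (\<forall>(v, w)\<in>R. y v = w)"
  proof (rule ht.symmetric_extension_span[OF R _ _ M(1)])
    show "inn HT w v' = inn HT v w'" if "(v, w) \<in> R" "(v', w') \<in> R" for v w v' w'
      using that unfolding R_def
    proof (elim UnE CollectE exE conjE Pair_inject; hypsubst)
      fix s h w s' h' w'
      assume a: "j # s \<in> T" "h \<in> carr (H j)" "admissible K s w" "j # s' \<in> T" "h' \<in> carr (H j)" "admissible K s' w'"
      show "inn HT (att j s (x h) w) (att j s' h' w') = inn HT (att j s h w) (att j s' (x h') w')"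
        using a xc tree_simps(4,5)[OF a(4)] sym_op_inn[OF x]
        by (cases "s = s'") (simp_all add: inn_att_att inn_att_orthogonal(3))
    next
      fix s h w s' w'
      assume "j # s \<in> T" "h \<in> carr (H j)" "admissible K s w" "s' \<in> T" "s' = [] \<or> hd s' \<noteq> j" "j # s' \<notin> T" "admissible K s' w'"
      moreover from this have "s \<noteq> s'" by auto
      ultimately show "inn HT (att j s (x h) w) (tv s' w') = inn HT (att j s h w) (nul HT)"
        using xc by (simp add: inn_att_orthogonal(1) ht.inn_nul att_closed)
    next
      fix s h w s' w'
      assume "j # s \<in> T" "h \<in> carr (H j)" "admissible K s w" "s' \<in> T" "s' = [] \<or> hd s' \<noteq> j" "j # s' \<notin> T" "admissible K s' w'"
      moreover from this have "s \<noteq> s'" by auto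
      ultimately show "inn HT (nul HT) (att j s h w) = inn HT (tv s' w') (att j s (x h) w)"
        using xc by (simp add: inn_att_orthogonal(2) ht.inn_nul_left att_closed)
    qed (simp add: ht.inn_simps tv_closed)
  next
    fix D assume D: "D \<subseteq> carr HT" "nul HT \<in> D" "\<And>v w. v \<in> D \<Longrightarrow> w \<in> D \<Longrightarrow> add HT v w \<in> D"
      "\<And>v w b. (v, w) \<in> R \<Longrightarrow> ract HT v b \<in> D"
    show "hdense HT D"
    proof (rule tv_dense[OF D(1-3)])
      fix s w b assume s: "s \<in> T" "admissible K s w"
      have "\<exists>u. (tv s w, u) \<in> R"
      proof (cases "s = [] \<or> hd s \<noteq> j")
        case True
        show ?thesis
        proof (cases "j # s \<in> T")
          case js: True
          then have "(tv s w, att j s (x (\<xi> j)) w) \<in> R"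
            unfolding tv_eq_att[OF js s(2)] R_def using s \<xi>_closed[OF j] by blast
          then show ?thesis by blast
        next
          case False
          then have "(tv s w, nul HT) \<in> R" unfolding R_def using s True by blast
          then show ?thesis by blast
        qed
      next
        case False
        then obtain s' where s': "s = j # s'" by (cases s) auto
        then obtain h w' where w: "w = h # w'" "h \<in> carr (K j)" "admissible K s' w'"
          using s(2) by (auto elim: admissible_ConsE)
        have js: "j # s' \<in> T" using s s' by simp
        show ?thesis
          unfolding s' w(1) tv_eq_att_Cons[OF js w(2,3)] R_def using js w by (auto simp: K_simps)
      qed
      then show "ract HT (tv s w) b \<in> D" using D(4) by blast
    qed
  next
    fix v u assume "(v, u) \<in> R"
    then consider s h w where "j # s \<in> T" "h \<in> carr (H j)" "admissible K s w" "v = att j s h w" "u = att j s (x h) w"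
      | "(v, nul HT) \<in> R" "u = nul HT"
      unfolding R_def by blast
    then show "\<exists>C z. z 0 = v \<and> z 1 = u \<and>
      (\<forall>n. (z n, z (Suc n)) \<in> graph_span HT R \<and> hnorm HT (z n) \<le> C * M ^ n)"
    proof cases
      \<comment> \<open>Iterating \<open>x\<close> on the head gives the required sequence: the
        bound \<open>M\<close> of \<open>x\<close> is the growth rate, and the other tensor factors
        contribute a constant.\<close>
      case (1 s h w)
      have xn: "(x ^^ n) h \<in> carr (H j)" for n by (induction n) (auto simp: 1 xc)
      have xb: "hnorm (H j) ((x ^^ n) h) \<le> M ^ n * hnorm (H j) h" for n
      proof (induction n)
        case (Suc n)
        have "hnorm (H j) ((x ^^ Suc n) h) \<le> M * hnorm (H j) ((x ^^ n) h)" using M(2)[OF xn] by simp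
        also have "\<dots> \<le> M * (M ^ n * hnorm (H j) h)" using Suc M(1) by simp
        finally show ?case by simp
      qed simp
      obtain C where C: "C \<ge> 0" "\<And>b. norm (tensor_inn K s b w w) \<le> C * norm b"
        using tensor_inn_bounded[OF precorrs_K 1(3,3)] tree_simps 1 by blast
      have "hnorm HT (att j s ((x ^^ n) h) w) \<le> sqrt C * hnorm (H j) h * M ^ n" for n
      proof -
        have "hnorm HT (att j s ((x ^^ n) h) w) \<le> sqrt (C * norm (inn (H j) ((x ^^ n) h) ((x ^^ n) h)))"
          unfolding hnorm_def using 1 xn C(2) by (simp add: inn_att_att)
        also have "\<dots> = sqrt C * hnorm (H j) ((x ^^ n) h)" by (simp add: real_sqrt_mult hnorm_def)
        also have "\<dots> \<le> sqrt C * (M ^ n * hnorm (H j) h)" using xb C(1) by (intro mult_left_mono) auto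
        finally show ?thesis by (simp add: mult_ac)
      qed
      moreover have "(att j s ((x ^^ n) h) w, att j s ((x ^^ Suc n) h) w) \<in> graph_span HT R" for n
        using 1 xn[of n] by (intro ht.graph_span_base[OF R]) (auto simp: R_def)
      ultimately show ?thesis using 1
        by (intro exI[of _ "sqrt C * hnorm (H j) h"] exI[of _ "\<lambda>n. att j s ((x ^^ n) h) w"]) auto
    next
      case 2
      define z where "z = (\<lambda>n. if n = (0::nat) then v else nul HT)"
      have z0: "z 0 = v" and z1: "z (Suc n) = nul HT" for n by (simp_all add: z_def)
      have "(z n, z (Suc n)) \<in> graph_span HT R" for n
        using ht.graph_span_base[OF R 2(1)] graph_span_nul[of HT R] by (cases n) (simp_all only: z0 z1)
      moreover have "hnorm HT (z n) \<le> hnorm HT v * M ^ n" for n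
      proof (cases n)
        case (Suc m)
        have "0 \<le> hnorm HT v * M ^ n" using M(1) ht.hnorm_nonneg by simp
        then show ?thesis by (simp only: Suc z1 ht.hnorm_nul)
      qed (simp add: z0)
      moreover have "z 1 = u" using z1[of 0] 2(2) by simp
      ultimately show ?thesis using z0 by blast
    qed
  qed
  then obtain y where y: "sym_op HT y" and "\<forall>(v, w)\<in>R. y v = w" by (elim exE conjE)
  then have yR: "y v = w" if "(v, w) \<in> R" for v w using that by fast
  have "(att j s h w, att j s (x h) w) \<in> R" if "j # s \<in> T" "h \<in> carr (H j)" "admissible K s w" for s h w
    using that unfolding R_def by blast
  moreover have "(tv s w, nul HT) \<in> R" if "s \<in> T" "s = [] \<or> hd s \<noteq> j" "j # s \<notin> T" "admissible K s w" for s w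
    using that unfolding R_def by blast
  ultimately have "tree_rep_spec j x y"
    unfolding tree_rep_spec_def using yR by presburger
  then show ?thesis using y by blast
qed

text \<open>Existence and uniqueness resolve the definite description, which ranges over all
  adjointable operators; the operator found is symmetric in addition.\<close>

lemma tree_rep_props:
  assumes j: "j \<in> J" and x: "sym_op (H j) x"
  shows "sym_op HT (tree_rep T H \<xi> j x)" "tree_rep_spec j x (tree_rep T H \<xi> j x)"
proof -
  obtain y where y: "sym_op HT y" "tree_rep_spec j x y" using tree_rep_exists[OF j x] by blast
  have "tree_rep T H \<xi> j x = y"
    unfolding tree_rep_def
    using y ht.sym_op_adjointable[OF y(1)] tree_rep_unique[OF _ _ _ _ j]
    by (intro the_equality) (auto simp: tree_rep_spec_def[unfolded admissible_def])
  then show "sym_op HT (tree_rep T H \<xi> j x)" "tree_rep_spec j x (tree_rep T H \<xi> j x)" using y by auto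
qed

end

section \<open>Laws of symmetric operators\<close>

lemma abs_bpoly_simps:
  "abs_bpoly (Coef b) = coef b" "abs_bpoly Indet = indet"
  "abs_bpoly (Plus s t) = abs_bpoly s + abs_bpoly t" "abs_bpoly (Times s t) = abs_bpoly s * abs_bpoly t"
  by (simp_all add: coef.abs_eq indet.abs_eq plus_bpoly.abs_eq times_bpoly.abs_eq)

lemma abs_bpoly_eq_iff: "abs_bpoly s = abs_bpoly t \<longleftrightarrow> bterm_eq s t"
  using Quotient_bpoly Quotient_rel bpoly.abs_eq_iff by metis

lemma bterm_eq_rep_abs: "bterm_eq (rep_bpoly (abs_bpoly t)) t"
  by (metis Quotient_bpoly Quotient_abs_rep abs_bpoly_eq_iff)

lemma abs_rep_bpoly: "abs_bpoly (rep_bpoly p) = p"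
  using Quotient_bpoly Quotient_abs_rep by fastforce

lemma coef_simps: "coef 1 = 1" "coef 0 = 0" "coef (a + b) = coef a + coef b" "coef (a * b) = coef a * coef b"
  by (transfer, blast intro: bterm_eq.intros)+

lemma coef_scalar_central: "coef (scaleC c 1) * p = p * coef (scaleC c 1)"
  by transfer (rule bterm_eq.scalar_central)

lemma pstar_simps: "pstar (coef b) = coef (cstar b)" "pstar indet = indet"
  "pstar (p + q) = pstar p + pstar q" "pstar (p * q) = pstar q * pstar p"
  by (transfer, simp add: bterm_eq.refl)+

lemma bterm_star_star: "bterm_star (bterm_star t) = t"
  by (induction t) (simp_all add: cstar_cstar)

lemma pstar_0: "pstar 0 = 0" and pstar_1: "pstar 1 = 1"
  using pstar_simps(1)[of 0] pstar_simps(1)[of 1] by (simp_all add: coef_simps cstar_zero cstar_one)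

lemma L2_pre_simps: "carr (L2_pre \<mu>) = UNIV" "nul (L2_pre \<mu>) = 0" "add (L2_pre \<mu>) = (+)"
  "lact (L2_pre \<mu>) = (\<lambda>b p. coef b * p)" "ract (L2_pre \<mu>) = (\<lambda>p b. p * coef b)"
  "inn (L2_pre \<mu>) = (\<lambda>p q. \<mu> (pstar p * q))"
  by (simp_all add: L2_pre_def)

text \<open>The part of \<open>is_law\<close> that is used; unlike matrix positivity in the sense of \<open>mat_pos\<close>, it is
  easily seen to be inherited by tree convolutions.\<close>

locale weak_law =
  fixes \<mu> :: "'b::unital_cstar law"
  assumes precorr_pre: "precorr (L2_pre \<mu>)"
    and law_one: "\<mu> 1 = 1"
    and indet_bounded: "\<exists>K. \<forall>p. hnorm (L2_pre \<mu>) (indet * p) \<le> K * hnorm (L2_pre \<mu>) p"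
begin

sublocale pre: precorr "L2_pre \<mu>"
  by (rule precorr_pre)

sublocale l2: hcorr "L2 \<mu>"
  unfolding L2_def by (rule pre.hcorr_completion)

lemma law_add: "\<mu> (p + q) = \<mu> p + \<mu> q"
  using pre.inn_add[of 1 p q] by (simp add: L2_pre_simps pstar_1)

lemma law_right: "\<mu> (p * coef b) = \<mu> p * b"
  using pre.inn_ract[of 1 p b] by (simp add: L2_pre_simps pstar_1)

lemma law_left: "\<mu> (coef b * p) = b * \<mu> p"
proof -
  have "\<mu> (coef b * p) = \<mu> (pstar (1 * coef (cstar b)) * p)"
    by (simp add: pstar_simps cstar_cstar)
  also have "\<dots> = b * \<mu> p"
    using pre.inn_ract_left[of 1 p "cstar b"] by (simp add: L2_pre_simps pstar_1 cstar_cstar)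
  finally show ?thesis .
qed

lemma law_coef: "\<mu> (coef b) = b"
  using law_left[of b 1] by (simp add: law_one)

abbreviation "cls \<equiv> embed (L2_pre \<mu>)"

lemma cls_closed: "cls p \<in> carr (L2 \<mu>)"
  unfolding L2_def by (rule pre.embed_closed) (simp add: L2_pre_simps)

lemma cls_simps: "add (L2 \<mu>) (cls p) (cls q) = cls (p + q)" "lact (L2 \<mu>) b (cls p) = cls (coef b * p)"
  "ract (L2 \<mu>) (cls p) b = cls (p * coef b)" "inn (L2 \<mu>) (cls p) (cls q) = \<mu> (pstar p * q)"
  "L2_one \<mu> = cls 1"
  using pre.embed_add[of p q] pre.embed_lact[of p b] pre.embed_ract[of p b] pre.inn_embed[of p q]
  by (simp_all add: L2_def L2_pre_simps L2_one_def)

lemma cls_sub: "sub (L2 \<mu>) (cls p) (cls q) = cls (p - q)"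
proof -
  have "coef (- 1) = (- 1 :: 'b bpoly)"
    using coef_simps(3)[of "- 1" 1] by (simp add: coef_simps eq_neg_iff_add_eq_0)
  then show ?thesis by (simp add: sub_def cls_simps)
qed

lemma L2_mult_bound:
  obtains K where "K > 0" "\<And>p. hnorm (L2_pre \<mu>) (indet * p) \<le> K * hnorm (L2_pre \<mu>) p"
proof -
  have "\<exists>K. \<forall>p\<in>UNIV. hnorm (L2_pre \<mu>) (indet * p) \<le> K * hnorm (L2_pre \<mu>) p"
    using indet_bounded by simp
  then obtain K where "K > 0" "\<And>p. p \<in> UNIV \<Longrightarrow> hnorm (L2_pre \<mu>) (indet * p) \<le> K * hnorm (L2_pre \<mu>) p"
    by (rule bounded_constant) (auto simp: pre.hnorm_nonneg)
  then show ?thesis using that by blast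
qed

lemma L2_mult_cl:
  assumes "u \<in> cauchy_seqs (L2_pre \<mu>)"
  shows "L2_mult \<mu> (pre.cl u) = pre.cl (\<lambda>n. indet * u n)" "(\<lambda>n. indet * u n) \<in> cauchy_seqs (L2_pre \<mu>)"
proof -
  obtain K where K: "K > 0" "\<And>p. hnorm (L2_pre \<mu>) (indet * p) \<le> K * hnorm (L2_pre \<mu>) p"
    by (rule L2_mult_bound) blast
  have lip: "hnorm (L2_pre \<mu>) (sub (L2_pre \<mu>) (indet * p) (indet * q)) \<le> K * hnorm (L2_pre \<mu>) (sub (L2_pre \<mu>) p q)" for p q
    using K(2)[of "sub (L2_pre \<mu>) p q"] by (simp add: sub_def L2_pre_simps ring_distribs mult.assoc)
  note l = pre.completion_lift[OF assms, of "\<lambda>p. indet * p" K, OF _ lip]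
  show "L2_mult \<mu> (pre.cl u) = pre.cl (\<lambda>n. indet * u n)"
    using l(1) assms by (auto simp: L2_mult_def L2_def pre.carr_completion L2_pre_simps)
  show "(\<lambda>n. indet * u n) \<in> cauchy_seqs (L2_pre \<mu>)" using l(2) by (simp add: L2_pre_simps)
qed

lemma L2_mult_cls: "L2_mult \<mu> (cls p) = cls (indet * p)"
  unfolding pre.embed_eq_cl by (rule L2_mult_cl) (simp add: pre.cauchy_const L2_pre_simps)

lemma sym_op_L2_mult: "sym_op (L2 \<mu>) (L2_mult \<mu>)"
proof -
  obtain K where K: "K > 0" "\<And>p. hnorm (L2_pre \<mu>) (indet * p) \<le> K * hnorm (L2_pre \<mu>) p"
    by (rule L2_mult_bound) blast
  have c: "L2_mult \<mu> C \<in> carr (L2 \<mu>)" if "C \<in> carr (L2 \<mu>)" for C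
    using that L2_mult_cl by (fastforce simp: L2_def pre.carr_completion)
  show ?thesis
    unfolding sym_op_def
  proof (intro conjI ballI exI[of _ K])
    show "L2_mult \<mu> \<in> carr (L2 \<mu>) \<rightarrow>\<^sub>E carr (L2 \<mu>)"
      using c by (simp add: PiE_iff) (simp add: L2_mult_def)
  next
    fix C assume "C \<in> carr (L2 \<mu>)"
    then obtain u where u: "u \<in> cauchy_seqs (L2_pre \<mu>)" "C = pre.cl u"
      by (auto simp: L2_def pre.carr_completion)
    show "hnorm (L2 \<mu>) (L2_mult \<mu> C) \<le> K * hnorm (L2 \<mu>) C"
      unfolding u L2_mult_cl(1)[OF u(1)] unfolding L2_def
    proof (rule tendsto_le[OF sequentially_bot])
      show "(\<lambda>n. K * hnorm (L2_pre \<mu>) (u n)) \<longlonglongrightarrow> K * hnorm (completion (L2_pre \<mu>)) (pre.cl u)"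
        by (intro tendsto_intros pre.hnorm_completion u)
      show "(\<lambda>n. hnorm (L2_pre \<mu>) (indet * u n)) \<longlonglongrightarrow> hnorm (completion (L2_pre \<mu>)) (pre.cl (\<lambda>n. indet * u n))"
        by (intro pre.hnorm_completion L2_mult_cl u)
    qed (simp add: K)
  next
    fix C D assume "C \<in> carr (L2 \<mu>)" "D \<in> carr (L2 \<mu>)"
    then obtain u v where u: "u \<in> cauchy_seqs (L2_pre \<mu>)" "C = pre.cl u"
      and v: "v \<in> cauchy_seqs (L2_pre \<mu>)" "D = pre.cl v"
      by (auto simp: L2_def pre.carr_completion)
    have eq: "inn (L2_pre \<mu>) (indet * p) q = inn (L2_pre \<mu>) p (indet * q)" for p q
      by (simp add: L2_pre_simps pstar_simps mult.assoc)
    show "inn (L2 \<mu>) (L2_mult \<mu> C) D = inn (L2 \<mu>) C (L2_mult \<mu> D)"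
      using pre.inn_completion[OF L2_mult_cl(2)[OF u(1)] v(1)]
        pre.inn_completion[OF u(1) L2_mult_cl(2)[OF v(1)]]
      unfolding u(2) v(2) L2_mult_cl(1)[OF u(1)] L2_mult_cl(1)[OF v(1)] L2_def eq
      by (rule LIMSEQ_unique)
  qed
qed

lemma inn_one_cls: "inn (L2 \<mu>) (L2_one \<mu>) (cls p) = \<mu> p"
  by (simp add: cls_simps pstar_1)

lemma L2_one_props: "L2_one \<mu> \<in> carr (L2 \<mu>)" "inn (L2 \<mu>) (L2_one \<mu>) (L2_one \<mu>) = 1"
  "k \<in> carr (L2 \<mu>) \<Longrightarrow> inn (L2 \<mu>) k (lact (L2 \<mu>) b (L2_one \<mu>)) = inn (L2 \<mu>) k (L2_one \<mu>) * b"
proof -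
  show "L2_one \<mu> \<in> carr (L2 \<mu>)" "inn (L2 \<mu>) (L2_one \<mu>) (L2_one \<mu>) = 1"
    by (simp_all add: cls_simps cls_closed pstar_1 law_one)
  have "lact (L2 \<mu>) b (L2_one \<mu>) = ract (L2 \<mu>) (L2_one \<mu>) b" by (simp add: cls_simps)
  then show "k \<in> carr (L2 \<mu>) \<Longrightarrow> inn (L2 \<mu>) k (lact (L2 \<mu>) b (L2_one \<mu>)) = inn (L2 \<mu>) k (L2_one \<mu>) * b"
    by (simp add: l2.inn_ract cls_simps(5) cls_closed)
qed

end


subsection \<open>Completely positive exponentially bounded maps\<close>

lemma monomial_alt: "monomial b0 bs = coef b0 * prod_list (map (\<lambda>b. indet * coef b) bs)"
  unfolding monomial_def
  by (induction bs rule: rev_induct) (simp_all add: mult.assoc)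

text \<open>The exponential bound speaks of monomials only; this additive span carries estimates
  over to all polynomials.\<close>

inductive_set monomial_sums :: "'b::unital_cstar bpoly set" where
  monomial: "monomial b bs \<in> monomial_sums"
| sum: "p \<in> monomial_sums \<Longrightarrow> q \<in> monomial_sums \<Longrightarrow> p + q \<in> monomial_sums"

lemma monomial_sums_coef: "q \<in> monomial_sums \<Longrightarrow> coef a * q \<in> monomial_sums"
proof (induction rule: monomial_sums.induct)
  case (monomial b bs)
  have "coef a * monomial b bs = monomial (a * b) bs" by (simp add: monomial_alt coef_simps mult.assoc)
  then show ?case by (simp add: monomial_sums.monomial)
qed (simp add: ring_distribs monomial_sums.sum)

lemma monomial_sums_indet: "q \<in> monomial_sums \<Longrightarrow> indet * q \<in> monomial_sums"
proof (induction rule: monomial_sums.induct)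
  case (monomial b bs)
  have "indet * monomial b bs = monomial 1 (b # bs)" by (simp add: monomial_alt coef_simps mult.assoc)
  then show ?case by (simp add: monomial_sums.monomial)
qed (simp add: ring_distribs monomial_sums.sum)

text \<open>Induction on a representing term, strengthened by a factor \<open>q\<close> on the right
  so that products are handled one factor at a time.\<close>

lemma monomial_sums_UNIV: "p \<in> monomial_sums"
proof -
  have "q \<in> monomial_sums \<Longrightarrow> abs_bpoly t * q \<in> monomial_sums" for t q
    by (induction t arbitrary: q)
      (simp_all add: abs_bpoly_simps monomial_sums_coef monomial_sums_indet ring_distribs
        monomial_sums.sum mult.assoc)
  from this[of "monomial 1 []" "rep_bpoly p"] show ?thesis
    by (simp add: monomial_sums.monomial abs_rep_bpoly) (simp add: monomial_alt coef_simps)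
qed

text \<open>Between fixed polynomials, \<open>indet ^ n\<close> inserts letters whose new
  coefficients are 1 and hence of norm at most 1, so only the factor \<open>R ^ n\<close> depends on
  \<open>n\<close>.\<close>

lemma is_law_growth:
  assumes add: "\<And>p q. \<mu> (p + q) = \<mu> p + \<mu> q" and R: "R > 0" and M: "M > 0"
    and bound: "\<And>b0 bs. norm (\<mu> (monomial b0 bs)) \<le> M * R ^ length bs * norm b0 * prod_list (map norm bs)"
  shows "\<exists>C. \<forall>n. norm (\<mu> (r * indet ^ n * q)) \<le> C * R ^ n"
proof -
  have mono: "\<exists>C. \<forall>n. norm (\<mu> (monomial b bs * indet ^ n * monomial c cs)) \<le> C * R ^ n" for b c and bs cs :: "'a list"
  proof -
    define C where "C = M * R ^ (length bs + length cs) * norm b * prod_list (map norm bs) * norm c * prod_list (map norm cs)"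
    have nn: "prod_list (map norm (xs :: 'a list)) \<ge> 0" for xs by (induction xs) auto
    have C: "C \<ge> 0" unfolding C_def using R M nn by (intro mult_nonneg_nonneg) auto
    have "norm (\<mu> (monomial b bs * indet ^ Suc n * monomial c cs)) \<le> C * R ^ Suc n" for n
    proof -
      \<comment> \<open>A positive power inserts the coefficients 1, ..., 1, \<open>c\<close>. At
        power 0 the adjacent coefficients of the two monomials merge instead, so that value is added
        to the constant afterwards.\<close>
      define ys where "ys = replicate n 1 @ [c]"
      have ys: "prod_list (map (\<lambda>b. indet * coef b) ys) = indet ^ Suc n * coef c"
        by (simp add: ys_def coef_simps(1) power_Suc2 prod_list_replicate mult.assoc del: power_Suc)
      have "monomial b bs * indet ^ Suc n * monomial c cs = monomial b (bs @ ys @ cs)"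
        by (simp only: monomial_alt map_append prod_list.append ys mult.assoc)
      then have "norm (\<mu> (monomial b bs * indet ^ Suc n * monomial c cs)) \<le>
          M * R ^ length (bs @ ys @ cs) * norm b * prod_list (map norm (bs @ ys @ cs))"
        using bound[of b "bs @ ys @ cs"] by (simp del: power_Suc)
      also have "\<dots> = C * R ^ Suc n * norm (1::'a) ^ n"
        by (simp add: C_def ys_def power_add prod_list_replicate mult_ac)
      also have "\<dots> \<le> C * R ^ Suc n"
        using C R norm_one_le[where 'b = 'a] by (intro mult_left_le power_le_one mult_nonneg_nonneg) auto
      finally show ?thesis .
    qed
    then have "norm (\<mu> (monomial b bs * indet ^ n * monomial c cs)) \<le>
        (C + norm (\<mu> (monomial b bs * monomial c cs))) * R ^ n" for n
    proof (cases n)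
      case (Suc m)
      have "C * R ^ n \<le> (C + norm (\<mu> (monomial b bs * monomial c cs))) * R ^ n"
        using R by (intro mult_right_mono) auto
      then show ?thesis using \<open>\<And>n. norm (\<mu> (monomial b bs * indet ^ Suc n * monomial c cs)) \<le> C * R ^ Suc n\<close>[of m]
        unfolding Suc by (rule order_trans[rotated])
    qed (use C in simp)
    then show ?thesis by blast
  qed
  have add': "\<exists>C. \<forall>n. norm (\<mu> (p n + p' n)) \<le> C * R ^ n"
    if "\<exists>C. \<forall>n. norm (\<mu> (p n)) \<le> C * R ^ n" "\<exists>C. \<forall>n. norm (\<mu> (p' n)) \<le> C * R ^ n" for p p'
  proof -
    obtain C D where "\<And>n. norm (\<mu> (p n)) \<le> C * R ^ n" "\<And>n. norm (\<mu> (p' n)) \<le> D * R ^ n"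
      using \<open>\<exists>C. \<forall>n. norm (\<mu> (p n)) \<le> C * R ^ n\<close> \<open>\<exists>C. \<forall>n. norm (\<mu> (p' n)) \<le> C * R ^ n\<close> by blast
    then have "norm (\<mu> (p n + p' n)) \<le> (C + D) * R ^ n" for n
      unfolding add ring_distribs by (rule norm_triangle_mono)
    then show ?thesis by blast
  qed
  have "\<exists>C. \<forall>n. norm (\<mu> (monomial b bs * indet ^ n * q)) \<le> C * R ^ n" for b bs
    using monomial_sums_UNIV[of q]
  proof (induction rule: monomial_sums.induct)
    case (sum p q)
    then show ?case using add'[OF sum.IH] by (simp add: ring_distribs)
  qed (rule mono)
  with monomial_sums_UNIV[of r] show ?thesis
  proof (induction rule: monomial_sums.induct)
    case (sum p p')
    then show ?case using add' by (simp add: ring_distribs)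
  qed blast
qed

lemma mat_pos_imp_gram_pos: "mat_pos m A \<Longrightarrow> gram_pos m A"
  unfolding mat_pos_def by (auto intro: gram_posI)

lemma is_law_imp_weak_law:
  assumes "is_law \<mu>"
  shows "weak_law \<mu>"
proof -
  have one: "\<mu> 1 = 1" and add: "\<And>p q. \<mu> (p + q) = \<mu> p + \<mu> q"
    and bimod: "\<And>a p b. \<mu> (coef a * p * coef b) = a * \<mu> p * b"
    and pos: "\<And>m P. mat_pos m (\<lambda>i k. \<mu> (\<Sum>l<m. pstar (P l i) * P l k))"
    using assms by (auto simp: is_law_def)
  obtain M R where MR: "M > 0" "R > 0"
    "\<And>b0 bs. norm (\<mu> (monomial b0 bs)) \<le> M * R ^ length bs * norm b0 * prod_list (map norm bs)"
    using assms unfolding is_law_def by blast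
  have right: "\<mu> (p * coef b) = \<mu> p * b" for p b using bimod[of 1 p b] by (simp add: coef_simps)
  have zero: "\<mu> 0 = 0" using add[of 0 0] by simp
  have mat: "mat_pos m (\<lambda>i k. \<mu> (pstar (f i) * f k))" for m and f :: "nat \<Rightarrow> 'a bpoly"
  proof (cases m)
    case (Suc n)
    \<comment> \<open>Positivity is assumed for square matrices of polynomials; a single nonzero row
      \<open>f\<close> reduces the product to the matrix of the
      \<open>pstar (f i) * f k\<close>.\<close>
    define P where "P = (\<lambda>l i. if l = (0::nat) then f i else 0)"
    have "(\<Sum>l<m. pstar (P l i) * P l k) = pstar (f i) * f k" for i k
      unfolding Suc lessThan_Suc_eq_insert_0 P_def by (simp add: pstar_0 sum.reindex)
    then show ?thesis using pos[of m P] by simp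
  qed (simp add: mat_pos_def)
  have herm: "cstar (\<mu> (pstar p * q)) = \<mu> (pstar q * p)" for p q
  proof -
    \<comment> \<open>Hermitian symmetry of the law is read off from the off-diagonal entries of a
      positive 2 by 2 matrix.\<close>
    define f where "f = (\<lambda>i. if i = (0::nat) then p else q)"
    obtain C where C: "\<forall>i<2. \<forall>k<2. \<mu> (pstar (f i) * f k) = (\<Sum>l<(2::nat). cstar (C l i) * C l k)"
      using mat[of 2 f] unfolding mat_pos_def by (elim exE)
    show ?thesis using C[rule_format, of 0 1] C[rule_format, of 1 0]
      by (simp add: f_def cstar_sum cstar_mult cstar_cstar)
  qed
  have pre: "precorr (L2_pre \<mu>)"
  proof
    show "gram_pos m (\<lambda>i k. inn (L2_pre \<mu>) (f i) (f k))" for m f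
      unfolding L2_pre_simps by (intro mat_pos_imp_gram_pos mat)
    fix h k l :: "'a bpoly" and a b c
    show "inn (L2_pre \<mu>) h (nul (L2_pre \<mu>)) = 0" by (simp add: L2_pre_simps zero)
    show "inn (L2_pre \<mu>) h (add (L2_pre \<mu>) k l) = inn (L2_pre \<mu>) h k + inn (L2_pre \<mu>) h l"
      by (simp add: L2_pre_simps ring_distribs add)
    show "inn (L2_pre \<mu>) h (ract (L2_pre \<mu>) k b) = inn (L2_pre \<mu>) h k * b"
      using right[of "pstar h * k" b] by (simp add: L2_pre_simps mult.assoc)
    show "cstar (inn (L2_pre \<mu>) h k) = inn (L2_pre \<mu>) k h" by (simp add: L2_pre_simps herm)
    show "inn (L2_pre \<mu>) h (lact (L2_pre \<mu>) b k) = inn (L2_pre \<mu>) (lact (L2_pre \<mu>) (cstar b) h) k"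
      by (simp add: L2_pre_simps pstar_simps cstar_cstar mult.assoc)
    show "inn (L2_pre \<mu>) h (lact (L2_pre \<mu>) (a + b) k) =
        inn (L2_pre \<mu>) h (lact (L2_pre \<mu>) a k) + inn (L2_pre \<mu>) h (lact (L2_pre \<mu>) b k)"
      by (simp add: L2_pre_simps coef_simps ring_distribs add)
    show "inn (L2_pre \<mu>) h (lact (L2_pre \<mu>) (a * b) k) =
        inn (L2_pre \<mu>) h (lact (L2_pre \<mu>) a (lact (L2_pre \<mu>) b k))"
      by (simp add: L2_pre_simps coef_simps mult.assoc)
    show "inn (L2_pre \<mu>) h (lact (L2_pre \<mu>) (scaleC c 1) k) = scaleC c (inn (L2_pre \<mu>) h k)"
      using right[of "pstar h * k" "scaleC c 1"]
      by (simp add: L2_pre_simps coef_scalar_central mult_scaleC_right mult.assoc)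
  qed (simp_all add: L2_pre_simps)
  interpret precorr "L2_pre \<mu>" by (rule pre)
  have "hnorm (L2_pre \<mu>) (indet * p) \<le> R * hnorm (L2_pre \<mu>) p" for p
  proof -
    obtain C where C: "\<And>n. norm (\<mu> (pstar p * indet ^ n * p)) \<le> C * R ^ n"
      using is_law_growth[OF add MR(2,1,3)] by blast
    \<comment> \<open>Multiplication by \<open>indet\<close> is symmetric, so these norms are
      logarithmically convex; the exponential bound limits their growth rate to \<open>R\<close>,
      and hence also the first ratio.\<close>
    define a where "a = (\<lambda>n. hnorm (L2_pre \<mu>) (indet ^ n * p))"
    have ps: "pstar (indet ^ n) = (indet :: 'a bpoly) ^ n" for n
      by (induction n) (simp_all add: pstar_1 pstar_simps power_commutes)
    have i: "inn (L2_pre \<mu>) (indet ^ m * p) (indet ^ n * p) = \<mu> (pstar p * indet ^ (m + n) * p)" for m n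
      by (simp add: L2_pre_simps pstar_simps ps power_add mult.assoc)
    have "a 1 \<le> R * a 0"
    proof (rule log_convex_growth[OF _ _ _ MR(2)])
      show "a n \<ge> 0" for n by (simp add: a_def hnorm_nonneg)
      show "(a (Suc n))\<^sup>2 \<le> a n * a (Suc (Suc n))" for n
        using cauchy_schwarz[of "indet ^ n * p" "indet ^ Suc (Suc n) * p"]
        unfolding a_def hnorm_square i by (simp add: L2_pre_simps)
      show "a n \<le> sqrt C * R ^ n" for n
      proof -
        have "a n \<le> sqrt (C * R ^ (n + n))"
          unfolding a_def hnorm_def i by (intro real_sqrt_le_mono C)
        also have "\<dots> = sqrt C * R ^ n"
          using MR(2) by (simp add: real_sqrt_mult power_add)
        finally show ?thesis .
      qed
    qed
    then show ?thesis by (simp add: a_def)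
  qed
  then show ?thesis unfolding weak_law_def using pre one by blast
qed


subsection \<open>The law of a symmetric operator\<close>

locale law_data = hcorr H for H :: "('b::unital_cstar, 'h) corr" +
  fixes \<xi> :: 'h and x :: "'h \<Rightarrow> 'h"
  assumes \<xi>_closed: "\<xi> \<in> carr H" and \<xi>_unit: "inn H \<xi> \<xi> = 1"
    and \<xi>_central: "lact H b \<xi> = ract H \<xi> b" and x: "sym_op H x"
begin

abbreviation "E \<equiv> bterm_eval H x"

lemma E_closed: "h \<in> carr H \<Longrightarrow> E t h \<in> carr H"
  by (induction t arbitrary: h) (simp_all add: closed sym_op_closed[OF x] op_add_def)

lemma E_simps: "h \<in> carr H \<Longrightarrow> E (Coef b) h = lact H b h" "E Indet h = x h"
  "h \<in> carr H \<Longrightarrow> E (Plus s t) h = add H (E s h) (E t h)"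
  "h \<in> carr H \<Longrightarrow> E (Times s t) h = E s (E t h)"
  by (simp_all add: op_add_def)

lemma E_adjoint: "h \<in> carr H \<Longrightarrow> k \<in> carr H \<Longrightarrow> inn H h (E t k) = inn H (E (bterm_star t) h) k"
proof (induction t arbitrary: h k)
  case (Times s t)
  then show ?case by (simp add: E_closed)
qed (simp_all add: inn_lact sym_op_inn[OF x] inn_simps E_closed op_add_def)

lemma E_add: "h \<in> carr H \<Longrightarrow> k \<in> carr H \<Longrightarrow> E t (add H h k) = add H (E t h) (E t k)"
  by (rule separated) (simp_all add: closed E_closed inn_simps E_adjoint)

lemma E_ract: "h \<in> carr H \<Longrightarrow> E t (ract H h b) = ract H (E t h) b"
  by (rule separated) (simp_all add: closed E_closed inn_simps E_adjoint)

text \<open>Makes \<open>law_of\<close> independent of the representing term. Distributivity from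
  the left needs additivity of evaluated operators; central scalars need their modularity and the
  agreement of left and right scalar multiplication.\<close>

lemma E_cong: "bterm_eq s t \<Longrightarrow> h \<in> carr H \<Longrightarrow> E s h = E t h"
proof (induction arbitrary: h rule: bterm_eq.induct)
  case (Plus_neg p)
  have "add H (lact H (- 1) (E p h)) (E p h) = lact H (- 1 + 1) (E p h)"
    using Plus_neg by (simp only: lact_plus E_closed lact_one)
  then show ?case using Plus_neg by (simp add: op_add_def E_closed lact_zero)
next
  case (Plus_comm p q)
  then show ?case by (simp add: op_add_def E_closed add_commute)
next
  case (Plus_zero p)
  then show ?case by (simp add: op_add_def E_closed lact_zero add_nul)
next
  case (distrib_left p q r)
  then show ?case by (simp add: op_add_def E_closed E_add)
next
  case (scalar_central c p)
  then show ?case by (simp add: E_closed lact_scalar E_ract)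
qed (simp_all add: op_add_def E_closed closed add_assoc lact_one lact_plus lact_mult)

text \<open>The vector \<open>p(x) \<xi>\<close>. Sending \<open>p\<close> to it preserves pairings,
  and by this map the law of \<open>x\<close> inherits its properties.\<close>

definition vec :: "'b bpoly \<Rightarrow> 'h" where
  "vec p = E (rep_bpoly p) \<xi>"

lemma vec_abs: "vec (abs_bpoly t) = E t \<xi>"
  unfolding vec_def by (rule E_cong[OF bterm_eq_rep_abs \<xi>_closed])

lemma vec_closed: "vec p \<in> carr H"
  by (simp add: vec_def E_closed \<xi>_closed)

lemma vec_simps: "vec (p + q) = add H (vec p) (vec q)" "vec (coef b * p) = lact H b (vec p)"
  "vec (p * coef b) = ract H (vec p) b" "vec 0 = nul H" "vec (indet * p) = x (vec p)" "vec 1 = \<xi>"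
proof -
  obtain s where s: "p = abs_bpoly s" by (metis abs_rep_bpoly)
  obtain t where t: "q = abs_bpoly t" by (metis abs_rep_bpoly)
  show "vec (p + q) = add H (vec p) (vec q)"
    unfolding s t abs_bpoly_simps[symmetric] vec_abs by (simp add: op_add_def \<xi>_closed)
  show "vec (coef b * p) = lact H b (vec p)"
    unfolding s t abs_bpoly_simps[symmetric] vec_abs by (simp add: E_simps \<xi>_closed E_closed)
  show "vec (p * coef b) = ract H (vec p) b"
    unfolding s t abs_bpoly_simps[symmetric] vec_abs by (simp add: E_simps \<xi>_closed \<xi>_central E_ract)
  show "vec (indet * p) = x (vec p)"
    unfolding s t abs_bpoly_simps[symmetric] vec_abs by (simp add: E_simps \<xi>_closed)
  show "vec 0 = nul H"
    unfolding coef_simps(2)[symmetric] abs_bpoly_simps[symmetric] vec_abs by (simp add: \<xi>_closed lact_zero)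
  show "vec 1 = \<xi>"
    unfolding coef_simps(1)[symmetric] abs_bpoly_simps[symmetric] vec_abs by (simp add: \<xi>_closed lact_one)
qed

lemma law_of_vec: "law_of H \<xi> x p = inn H \<xi> (vec p)"
  by (simp add: law_of_def vec_def)

lemma inn_L2_pre_law_of: "inn (L2_pre (law_of H \<xi> x)) p q = inn H (vec p) (vec q)"
proof -
  obtain s where s: "p = abs_bpoly s" by (metis abs_rep_bpoly)
  obtain t where t: "q = abs_bpoly t" by (metis abs_rep_bpoly)
  have "pstar p = abs_bpoly (bterm_star s)" by (simp add: s pstar.abs_eq)
  then have "inn (L2_pre (law_of H \<xi> x)) p q = inn H \<xi> (E (Times (bterm_star s) t) \<xi>)"
    by (simp add: L2_pre_simps law_of_vec t vec_abs flip: abs_bpoly_simps)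
  then show ?thesis
    by (simp add: E_simps \<xi>_closed E_adjoint E_closed bterm_star_star s t vec_abs del: bterm_eval.simps)
qed

lemma hnorm_L2_pre_law_of: "hnorm (L2_pre (law_of H \<xi> x)) p = hnorm H (vec p)"
  by (simp add: hnorm_def inn_L2_pre_law_of)

text \<open>All conditions are pulled back along \<open>vec\<close>; boundedness of
  \<open>indet\<close> is boundedness of \<open>x\<close>.\<close>

lemma weak_law_law_of: "weak_law (law_of H \<xi> x)"
proof -
  let ?P = "L2_pre (law_of H \<xi> x)"
  have v: "vec (nul ?P) = nul H" "vec (add ?P p q) = add H (vec p) (vec q)"
    "vec (lact ?P b p) = lact H b (vec p)" "vec (ract ?P p b) = ract H (vec p) b" for p q b
    by (simp_all add: L2_pre_simps vec_simps)
  have "precorr ?P"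
  proof
    show "gram_pos m (\<lambda>i k. inn ?P (f i) (f k))" for m f
      unfolding inn_L2_pre_law_of by (intro inn_gram vec_closed)
  qed (simp_all add: inn_L2_pre_law_of v inn_simps vec_closed inn_star inn_lact_add inn_lact_mult
      inn_lact_scalar closed, simp_all add: L2_pre_simps inn_lact vec_closed)
  moreover obtain K where "\<forall>h\<in>carr H. hnorm H (x h) \<le> K * hnorm H h"
    using x by (auto simp: sym_op_def)
  then have "\<forall>p. hnorm ?P (indet * p) \<le> K * hnorm ?P p"
    by (simp add: hnorm_L2_pre_law_of vec_simps vec_closed)
  moreover have "law_of H \<xi> x 1 = 1" by (simp add: law_of_vec vec_simps \<xi>_unit)
  ultimately show ?thesis unfolding weak_law_def by blast
qed

end

text \<open>Induction on terms needs only a relation stable under the operations, so the vectors on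
  one side do not have to determine those on the other.\<close>

lemma law_of_eqI:
  assumes R: "R \<subseteq> carr H \<times> carr H'" "(\<xi>, \<xi>') \<in> R"
    and add: "\<And>h h' k k'. (h, h') \<in> R \<Longrightarrow> (k, k') \<in> R \<Longrightarrow> (add H h k, add H' h' k') \<in> R"
    and lact: "\<And>h h' b. (h, h') \<in> R \<Longrightarrow> (lact H b h, lact H' b h') \<in> R"
    and x: "\<And>h h'. (h, h') \<in> R \<Longrightarrow> (x h, x' h') \<in> R"
    and inn: "\<And>h h'. (h, h') \<in> R \<Longrightarrow> inn H \<xi> h = inn H' \<xi>' h'"
  shows "law_of H \<xi> x = law_of H' \<xi>' x'"
proof
  fix p
  have "(h, h') \<in> R \<Longrightarrow> (bterm_eval H x t h, bterm_eval H' x' t h') \<in> R" for t h h'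
  proof (induction t arbitrary: h h')
    case (Times s t)
    then show ?case using R(1) by auto
  qed (use R(1) in \<open>auto simp: op_add_def intro: add lact x\<close>)
  then show "law_of H \<xi> x p = law_of H' \<xi>' x' p"
    unfolding law_of_def using R(2) inn by blast
qed

section \<open>The action on simple tensors of polynomials\<close>

context hcorr
begin

definition vsum where
  "vsum vs = foldr (add H) vs (nul H)"

lemma vsum_simps [simp]: "vsum [] = nul H" "vsum (v # vs) = add H v (vsum vs)"
  by (simp_all add: vsum_def)

lemma vsum_closed: "set vs \<subseteq> carr H \<Longrightarrow> vsum vs \<in> carr H"
  by (induction vs) (auto simp: closed)

lemma vsum_append:
  "set vs \<subseteq> carr H \<Longrightarrow> set ws \<subseteq> carr H \<Longrightarrow> vsum (vs @ ws) = add H (vsum vs) (vsum ws)"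
  by (induction vs) (auto simp: add_nul add_assoc vsum_closed)

lemma vsum_map_add:
  "(\<And>a. a \<in> set as \<Longrightarrow> f a \<in> carr H \<and> g a \<in> carr H) \<Longrightarrow>
    vsum (map (\<lambda>a. add H (f a) (g a)) as) = add H (vsum (map f as)) (vsum (map g as))"
proof (induction as)
  case (Cons a as)
  then have "vsum (map f as) \<in> carr H" "vsum (map g as) \<in> carr H" by (auto intro!: vsum_closed)
  then show ?case using Cons by (simp add: add_swap)
qed (simp add: add_nul closed)

lemma vsum_concat:
  "(\<And>a. a \<in> set as \<Longrightarrow> set (f a) \<subseteq> carr H) \<Longrightarrow>
    vsum (concat (map f as)) = vsum (map (\<lambda>a. vsum (f a)) as)"
proof (induction as)
  case (Cons a as)
  then show ?case by (subst list.map, subst concat.simps, subst vsum_append) auto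
qed simp

lemma sym_op_vsum:
  "sym_op H x \<Longrightarrow> set vs \<subseteq> carr H \<Longrightarrow> x (vsum vs) = vsum (map x vs)"
  by (induction vs) (auto simp: sym_op_nul sym_op_add vsum_closed)

lemma lact_vsum: "set vs \<subseteq> carr H \<Longrightarrow> lact H b (vsum vs) = vsum (map (lact H b) vs)"
  by (induction vs) (auto simp: lact_nul lact_add vsum_closed)

lemma inn_vsum: "h \<in> carr H \<Longrightarrow> set vs \<subseteq> carr H \<Longrightarrow> inn H h (vsum vs) = sum_list (map (inn H h) vs)"
  by (induction vs) (auto simp: inn_nul inn_add vsum_closed)

lemma sym_op_op_zero: "sym_op H (op_zero H)"
  by (auto simp: sym_op_def op_zero_def closed hnorm_nul inn_simps intro!: exI[of _ 0])

lemma sym_op_op_add: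
  assumes x: "sym_op H x" and y: "sym_op H y"
  shows "sym_op H (op_add H x y)"
proof -
  obtain A where A: "\<forall>h\<in>carr H. hnorm H (x h) \<le> A * hnorm H h" using x by (auto simp: sym_op_def)
  obtain B where B: "\<forall>h\<in>carr H. hnorm H (y h) \<le> B * hnorm H h" using y by (auto simp: sym_op_def)
  have "hnorm H (op_add H x y h) \<le> (A + B) * hnorm H h" if "h \<in> carr H" for h
  proof -
    have "hnorm H (add H (x h) (y h)) \<le> hnorm H (x h) + hnorm H (y h)"
      using that by (intro hnorm_triangle sym_op_closed[OF x] sym_op_closed[OF y])
    also have "\<dots> \<le> A * hnorm H h + B * hnorm H h" using A B that by (intro add_mono) auto
    finally show ?thesis using that by (simp add: op_add_def algebra_simps)
  qed
  then show ?thesis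
    unfolding sym_op_def[of H "op_add H x y"]
    by (auto simp: op_add_def closed sym_op_closed[OF x] sym_op_closed[OF y] inn_simps
        sym_op_inn[OF x] sym_op_inn[OF y])
qed

definition opsum where
  "opsum y js = foldr (\<lambda>j. op_add H (y j)) js (op_zero H)"

lemma sym_op_opsum: "(\<And>j. j \<in> set js \<Longrightarrow> sym_op H (y j)) \<Longrightarrow> sym_op H (opsum y js)"
  unfolding opsum_def by (induction js) (auto simp: sym_op_op_zero sym_op_op_add)

lemma opsum_apply: "h \<in> carr H \<Longrightarrow> opsum y js h = vsum (map (\<lambda>j. y j h) js)"
  unfolding opsum_def by (induction js) (auto simp: op_zero_def op_add_def)

end

text \<open>A triple \<open>(s, qs, b)\<close> stands for the simple tensor \<open>q\<^sub>1\<^sup>\<circ> \<otimes> \<dots> \<otimes> q\<^sub>m\<^sup>\<circ> b\<close> in the component at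
  \<open>s\<close>, where \<open>q\<^sup>\<circ> = q - \<mu> q\<close>; lists of such triples stand for their sums.\<close>

type_synonym 'b gen = "nat list \<times> 'b bpoly list \<times> 'b"

definition gvec :: "nat list set \<Rightarrow> (nat \<Rightarrow> 'b::unital_cstar law) \<Rightarrow> 'b gen \<Rightarrow>
    nat list \<Rightarrow> (nat \<Rightarrow> (nat \<Rightarrow> 'b bpoly) set list \<Rightarrow>\<^sub>0 'b) set" where
  "gvec T \<mu> = (\<lambda>(s, qs, b). ract (tree_product T (\<lambda>j. L2 (\<mu> j)) (\<lambda>j. L2_one (\<mu> j)))
     (tree_vec T (\<lambda>j. L2 (\<mu> j)) (\<lambda>j. L2_one (\<mu> j)) s
       (map2 (\<lambda>i q. embed (L2_pre (\<mu> i)) (q - coef (\<mu> i q))) s qs)) b)"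

text \<open>Left multiplication enters the first factor: \<open>coef a * q\<close> centres to
  \<open>a\<close> times the centred \<open>q\<close>, as \<open>\<mu>\<close> is left modular. On
  the empty tensor it acts on the coefficient.\<close>

definition lgen :: "'b::unital_cstar \<Rightarrow> 'b gen \<Rightarrow> 'b gen" where
  "lgen a = (\<lambda>(s, qs, b). case qs of [] \<Rightarrow> (s, [], a * b) | q # qs' \<Rightarrow> (s, coef a * q # qs', b))"

text \<open>The variable of letter \<open>j\<close> on a simple tensor. If the string begins with
  \<open>j\<close>, \<open>indet\<close> multiplies the centred first factor, and the product splits
  into its value under \<open>\<mu> j\<close>, which acts on the rest, and its centred part. If
  \<open>j\<close> can be prepended, the tensor is first read with the extra factor
  \<open>\<xi>\<close>, the class of 1.\<close>

definition actg :: "nat list set \<Rightarrow> (nat \<Rightarrow> 'b::unital_cstar law) \<Rightarrow> nat \<Rightarrow> 'b gen \<Rightarrow> 'b gen list" where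
  "actg T \<mu> j = (\<lambda>(s, qs, b).
     if s \<noteq> [] \<and> hd s = j then
       let q = indet * (hd qs - coef (\<mu> j (hd qs)))
       in [lgen (\<mu> j q) (tl s, tl qs, b), (s, q # tl qs, b)]
     else if j # s \<in> T then [lgen (\<mu> j indet) (s, qs, b), (j # s, indet # qs, b)]
     else [])"

definition actl :: "nat list set \<Rightarrow> (nat \<Rightarrow> 'b::unital_cstar law) \<Rightarrow> nat list \<Rightarrow> 'b gen list \<Rightarrow> 'b gen list" where
  "actl T \<mu> js L = concat (map (\<lambda>j. concat (map (actg T \<mu> j) L)) js)"

primrec evl :: "nat list set \<Rightarrow> (nat \<Rightarrow> 'b::unital_cstar law) \<Rightarrow> nat list \<Rightarrow> 'b bterm \<Rightarrow>
    'b gen list \<Rightarrow> 'b gen list" where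
  "evl T \<mu> js (Coef b) L = map (lgen b) L"
| "evl T \<mu> js Indet L = actl T \<mu> js L"
| "evl T \<mu> js (Plus s t) L = evl T \<mu> js s L @ evl T \<mu> js t L"
| "evl T \<mu> js (Times s t) L = evl T \<mu> js s (evl T \<mu> js t L)"

text \<open>The inner product with the vacuum vector, computed on lists.\<close>

definition vacs :: "'b::unital_cstar gen list \<Rightarrow> 'b" where
  "vacs L = (\<Sum>(s, qs, b)\<leftarrow>L. if s = [] then b else 0)"

lemma vacs_simps [simp]: "vacs [] = 0" "vacs ((s, qs, b) # L) = (if s = [] then b else 0) + vacs L"
  "vacs (L @ L') = vacs L + vacs L'"
  by (simp_all add: vacs_def)

definition gvalid :: "nat list set \<Rightarrow> 'b gen \<Rightarrow> bool" where
  "gvalid T = (\<lambda>(s, qs, b). s \<in> T \<and> length qs = length s)"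

lemma gvalid_lgen: "gvalid T (lgen a g) = gvalid T g"
  by (cases g) (auto simp: gvalid_def lgen_def split: list.split)

lemma fst_lgen: "fst (lgen a g) = fst g"
  by (cases g) (auto simp: lgen_def split: list.split)

lemma lgen_lgen: "lgen a (lgen b g) = lgen (a * b) g"
  by (cases g) (auto simp: lgen_def coef_simps mult.assoc split: list.split)

lemma lgen_one: "lgen 1 g = g"
  by (cases g) (auto simp: lgen_def coef_simps split: list.split)

section \<open>Sums of centred polynomial tensors and the variables acting on them\<close>

locale tree_laws =
  fixes J :: "nat set" and T :: "nat list set" and \<mu> :: "nat \<Rightarrow> 'b::unital_cstar law"
  assumes rooted: "rooted_tree J T" and laws: "j \<in> J \<Longrightarrow> weak_law (\<mu> j)"
begin

sublocale tree_conv J T "\<lambda>j. L2 (\<mu> j)" "\<lambda>j. L2_one (\<mu> j)"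
proof (rule tree_conv.intro)
  show "rooted_tree J T" by (rule rooted)
  show "precorr (L2 (\<mu> j))" if "j \<in> J" for j
  proof -
    interpret weak_law "\<mu> j" by (rule laws[OF that])
    show ?thesis by (rule l2.precorr_axioms)
  qed
qed (use weak_law.L2_one_props laws in blast)+

abbreviation "cl j q \<equiv> embed (L2_pre (\<mu> j)) q"
abbreviation "cc j q \<equiv> cl j (q - coef (\<mu> j q))"
abbreviation "\<Lambda> j \<equiv> tree_rep T (\<lambda>j. L2 (\<mu> j)) (\<lambda>j. L2_one (\<mu> j)) j (L2_mult (\<mu> j))"
abbreviation "gv \<equiv> gvec T \<mu>"

lemma actg_gvalid:
  assumes "gvalid T g" "g' \<in> set (actg T \<mu> j g)"
  shows "gvalid T g'"
proof -
  obtain s qs b where g: "g = (s, qs, b)" "s \<in> T" "length qs = length s"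
    using assms(1) by (cases g) (auto simp: gvalid_def)
  show ?thesis
  proof (cases "s \<noteq> [] \<and> hd s = j")
    case True
    then obtain s' q qs' where s: "s = j # s'" "qs = q # qs'" using g by (cases s; cases qs) auto
    then have "s' \<in> T" using g(2) tree_simps(4) by blast
    then have v: "gvalid T (s', qs', b)" "gvalid T (s, q' # qs', b)" for q'
      using g s by (simp_all add: gvalid_def)
    have "g' = lgen (\<mu> j (indet * (q - coef (\<mu> j q)))) (s', qs', b) \<or>
        g' = (s, indet * (q - coef (\<mu> j q)) # qs', b)"
      using assms(2) by (simp add: g(1) s actg_def Let_def)
    then show ?thesis using v gvalid_lgen by metis
  next
    case False
    then have "j # s \<in> T \<and> (g' = lgen (\<mu> j indet) g \<or> g' = (j # s, indet # qs, b))"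
      using assms(2) by (auto simp: g(1) actg_def split: if_splits)
    moreover from this have "gvalid T (j # s, indet # qs, b)" using g by (simp add: gvalid_def)
    ultimately show ?thesis using assms(1) gvalid_lgen by metis
  qed
qed

lemma actl_gvalid: "(\<And>g. g \<in> set L \<Longrightarrow> gvalid T g) \<Longrightarrow> g' \<in> set (actl T \<mu> js L) \<Longrightarrow> gvalid T g'"
  by (auto simp: actl_def intro: actg_gvalid)

lemma evl_gvalid:
  assumes "\<And>g. g \<in> set L \<Longrightarrow> gvalid T g" "g' \<in> set (evl T \<mu> js t L)"
  shows "gvalid T g'"
proof -
  have "\<forall>g\<in>set L. gvalid T g \<Longrightarrow> \<forall>g\<in>set (evl T \<mu> js t L). gvalid T g" for L
  proof (induction t arbitrary: L)
    case (Coef b)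
    then show ?case by (simp add: gvalid_lgen)
  next
    case Indet
    then have "gvalid T g" if "g \<in> set (actl T \<mu> js L)" for g
      by (intro actl_gvalid[OF _ that]) simp
    then show ?case unfolding evl.simps by (rule ballI)
  next
    case (Plus s t)
    show ?case using Plus.IH[OF Plus.prems] by (simp only: evl.simps set_append ball_Un simp_thms)
  next
    case (Times s t)
    show ?case unfolding evl.simps by (intro Times.IH Times.prems)
  qed
  then show ?thesis using assms by blast
qed

lemma cc_closed: "j \<in> J \<Longrightarrow> cc j q \<in> carr (K j)"
proof -
  assume j: "j \<in> J"
  interpret weak_law "\<mu> j" by (rule laws[OF j])
  have "\<mu> j (q - coef (\<mu> j q)) = 0"
    using law_add[of "q - coef (\<mu> j q)" "coef (\<mu> j q)"] by (simp add: law_coef)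
  then have "inn (L2 (\<mu> j)) (L2_one (\<mu> j)) (cc j q) = 0" by (simp add: inn_one_cls)
  then have "inn (L2 (\<mu> j)) (cc j q) (L2_one (\<mu> j)) = 0"
    using l2.inn_star[OF L2_one_props(1) cls_closed, of "q - coef (\<mu> j q)"]
    by (simp only: cstar_zero)
  then show ?thesis by (simp add: K_simps cls_closed)
qed

lemma adm_cc: "set s \<subseteq> J \<Longrightarrow> length qs = length s \<Longrightarrow> admissible K s (map2 cc s qs)"
  by (induction s arbitrary: qs) (auto simp: length_Suc_conv cc_closed)

lemma T_subset: "s \<in> T \<Longrightarrow> set s \<subseteq> J"
  using tree_simps(2) by blast

lemma gv_closed: "gvalid T g \<Longrightarrow> gv g \<in> carr HT"
  by (auto simp: gvec_def gvalid_def intro!: ht.ract_closed tv_closed adm_cc dest: T_subset)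

lemma att_cl:
  assumes js: "j # s \<in> T" and w: "admissible K s w"
  shows "att j s (cl j r) w = add HT (lact HT (\<mu> j r) (tv s w)) (tv (j # s) (cc j r # w))"
proof -
  interpret weak_law "\<mu> j" by (rule laws) (use js tree_simps in blast)
  show ?thesis unfolding attach_def inn_one_cls by (simp add: cls_simps(3,5) cls_sub)
qed

lemma \<Lambda>_att:
  assumes js: "j # s \<in> T" and w: "admissible K s w"
  shows "\<Lambda> j (att j s (cl j r) w) = att j s (cl j (indet * r)) w"
proof -
  have j: "j \<in> J" using js tree_simps by blast
  interpret weak_law "\<mu> j" by (rule laws[OF j])
  show ?thesis
    using tree_rep_props(2)[OF j sym_op_L2_mult] js w tree_simps(4,5)[OF js]
    by (auto simp: tree_rep_spec_def L2_mult_cls cls_closed)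
qed

lemma \<Lambda>_zero:
  assumes "j \<in> J" "s \<in> T" "s = [] \<or> hd s \<noteq> j" "j # s \<notin> T" "admissible K s w"
  shows "\<Lambda> j (tv s w) = nul HT"
proof -
  interpret weak_law "\<mu> j" by (rule laws[OF assms(1)])
  show ?thesis
    using tree_rep_props(2)[OF assms(1) sym_op_L2_mult] assms by (auto simp: tree_rep_spec_def)
qed

lemma sym_op_\<Lambda>: "j \<in> J \<Longrightarrow> sym_op HT (\<Lambda> j)"
  using tree_rep_props(1) weak_law.sym_op_L2_mult[OF laws] by blast

lemma vacuum_central: "lact HT b (tv [] []) = ract HT (tv [] []) b"
proof (rule tv_eqI)
  fix s w assume "s \<in> T" "admissible K s w"
  then show "inn HT (tv s w) (lact HT b (tv [] [])) = inn HT (tv s w) (ract HT (tv [] []) b)"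
    using tree_simps(1) by (auto simp: inn_tv_lact ht.inn_ract tv_closed inn_tv)
qed (use tree_simps(1) in \<open>auto simp: ht.closed tv_closed\<close>)

lemma vacuum_unit: "inn HT (tv [] []) (tv [] []) = 1"
  using tree_simps(1) by (simp add: inn_tv)

lemma tv_lact_head:
  assumes js: "j # s \<in> T" and h: "h \<in> carr (K j)" and w: "admissible K s w"
  shows "tv (j # s) (lact (K j) b h # w) = lact HT b (tv (j # s) (h # w))"
proof -
  have j: "j \<in> J" "s \<in> T" using js tree_simps by blast+
  have c: "lact (K j) b h \<in> carr (K j)" using precorr.lact_closed[OF precorr_K[OF j(1)] h] .
  show ?thesis
  proof (rule tv_eqI)
    fix s0 w0 assume s0: "s0 \<in> T" "admissible K s0 w0"
    have "tensor_inn K (j # s) 1 w0 (lact (K j) b h # w) = tensor_inn K (j # s) b w0 (h # w)" if "s0 = j # s"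
      using s0 that tensor_inn_lact(1)[OF precorr_K[OF j(1)] precorrs_K[OF j(2)] _ h, of _ 1 _ b w]
      by (auto elim!: admissible_ConsE simp del: tensor_inn.simps)
    then show "inn HT (tv s0 w0) (tv (j # s) (lact (K j) b h # w)) = inn HT (tv s0 w0) (lact HT b (tv (j # s) (h # w)))"
      using s0 js h w c by (simp add: inn_tv_lact inn_tv del: tensor_inn.simps)
  qed (use js h w c in \<open>auto intro!: tv_closed ht.closed\<close>)
qed

lemma gv_lgen:
  assumes "gvalid T g"
  shows "gv (lgen a g) = lact HT a (gv g)"
proof -
  obtain s qs b where g: "g = (s, qs, b)" by (cases g)
  show ?thesis
  proof (cases qs)
    case Nil
    then have "s = []" using assms g by (simp add: gvalid_def)
    then show ?thesis using Nil tree_simps(1)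
      by (simp add: g gvec_def lgen_def ht.lact_ract vacuum_central ht.ract_ract tv_closed)
  next
    case (Cons q qs')
    then obtain j s' where s: "s = j # s'" "length qs' = length s'" "j # s' \<in> T"
      using assms g by (cases s) (auto simp: gvalid_def)
    have j: "j \<in> J" "s' \<in> T" using s tree_simps by blast+
    interpret weak_law "\<mu> j" by (rule laws[OF j(1)])
    have w: "admissible K s' (map2 cc s' qs')" using s j by (intro adm_cc T_subset)
    have "cc j (coef a * q) = lact (K j) a (cc j q)"
      by (simp add: K_simps cls_simps law_left coef_simps ring_distribs right_diff_distrib)
    then show ?thesis using w s
      by (simp add: g Cons gvec_def lgen_def tv_lact_head[OF s(3) cc_closed[OF j(1)] w] ht.lact_ract
          tv_closed cc_closed[OF j(1)])
  qed
qed

lemma \<Lambda>_gv: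
  assumes g: "gvalid T g" and j: "j \<in> J"
  shows "\<Lambda> j (gv g) = ht.vsum (map gv (actg T \<mu> j g))"
proof -
  obtain s qs b where gs: "g = (s, qs, b)" by (cases g)
  have s: "s \<in> T" "length qs = length s" using g by (auto simp: gs gvalid_def)
  note sy = sym_op_\<Lambda>[OF j]
  interpret weak_law "\<mu> j" by (rule laws[OF j])
  \<comment> \<open>Both nonzero cases of \<open>actg\<close> are instances: \<open>r\<close> is the
    centred first factor if the string begins with \<open>j\<close>, and 1 if \<open>j\<close> is
    prepended.\<close>
  have main: "\<Lambda> j (ract HT (att j s' (cl j r) w) b) =
      ht.vsum (map gv [lgen (\<mu> j (indet * r)) (s', qs', b), (j # s', indet * r # qs', b)])"
    if js: "j # s' \<in> T" and l: "length qs' = length s'" and w: "w = map2 cc s' qs'" for s' qs' r w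
  proof -
    have s': "s' \<in> T" using js tree_simps by blast
    have a: "admissible K s' w" unfolding w using s' l by (intro adm_cc T_subset)
    have v: "gvalid T (s', qs', b)" "gvalid T (j # s', indet * r # qs', b)"
      using js l s' by (auto simp: gvalid_def)
    have "\<Lambda> j (ract HT (att j s' (cl j r) w) b) = ract HT (att j s' (cl j (indet * r)) w) b"
      using ht.sym_op_ract[OF sy att_closed[OF js cls_closed a]] \<Lambda>_att[OF js a] by simp
    also have "\<dots> = add HT (lact HT (\<mu> j (indet * r)) (gv (s', qs', b))) (gv (j # s', indet * r # qs', b))"
      unfolding att_cl[OF js a] gvec_def using a js s' cc_closed[OF j]
      by (simp add: w ht.ract_add ht.lact_ract ht.closed tv_closed)
    finally show ?thesis
      using gv_closed[OF v(2)] by (simp add: gv_lgen[OF v(1)] ht.add_nul)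
  qed
  show ?thesis
  proof (cases "s \<noteq> [] \<and> hd s = j")
    case True
    then obtain s' q qs' where s': "s = j # s'" "qs = q # qs'" "length qs' = length s'"
      using s by (cases s; cases qs) auto
    have js: "j # s' \<in> T" using s s' by simp
    have "admissible K s' (map2 cc s' qs')" using js s' tree_simps(4) by (intro adm_cc T_subset)
    then have "gv g = ract HT (att j s' (cc j q) (map2 cc s' qs')) b"
      using tv_eq_att_Cons[OF js cc_closed[OF j]] by (simp add: gs s' gvec_def)
    then show ?thesis
      using main[OF js s'(3) HOL.refl, of "q - coef (\<mu> j q)"]
      by (simp add: gs s' actg_def Let_def)
  next
    case False
    then have nj: "s = [] \<or> hd s \<noteq> j" by blast
    have a: "admissible K s (map2 cc s qs)" using s by (intro adm_cc T_subset)
    show ?thesis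
    proof (cases "j # s \<in> T")
      case True
      have "gv g = ract HT (att j s (cl j 1) (map2 cc s qs)) b"
        using tv_eq_att[OF True a] by (simp add: gs gvec_def cls_simps(5))
      moreover have "actg T \<mu> j g = [lgen (\<mu> j indet) (s, qs, b), (j # s, indet # qs, b)]"
        using False True by (auto simp: gs actg_def)
      ultimately show ?thesis using main[OF True s(2) HOL.refl, of 1] by simp
    next
      case js: False
      have "\<Lambda> j (gv g) = ract HT (\<Lambda> j (tv s (map2 cc s qs))) b"
        using ht.sym_op_ract[OF sy tv_closed[OF s(1) a]] by (simp add: gs gvec_def)
      also have "\<dots> = nul HT" using \<Lambda>_zero[OF j s(1) nj js a] by (simp add: ht.ract_nul)
      moreover have "actg T \<mu> j g = []" using False js by (auto simp: gs actg_def)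
      ultimately show ?thesis by simp
    qed
  qed
qed

abbreviation "gvs L \<equiv> ht.vsum (map gv L)"
abbreviation "Xs js \<equiv> ht.opsum \<Lambda> js"

lemma gvs_closed: "(\<And>g. g \<in> set L \<Longrightarrow> gvalid T g) \<Longrightarrow> gvs L \<in> carr HT"
  by (intro ht.vsum_closed) (auto intro: gv_closed)

lemma gvs_concat: "(\<And>a g. a \<in> set as \<Longrightarrow> g \<in> set (f a) \<Longrightarrow> gvalid T g) \<Longrightarrow>
    gvs (concat (map f as)) = ht.vsum (map (\<lambda>a. gvs (f a)) as)"
  unfolding map_concat by (simp, subst ht.vsum_concat) (auto intro: gv_closed simp: comp_def)

lemma sym_op_Xs: "set js \<subseteq> J \<Longrightarrow> sym_op HT (Xs js)"
  by (rule ht.sym_op_opsum) (auto intro: sym_op_\<Lambda>)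

lemma Xs_gvs:
  assumes L: "\<And>g. g \<in> set L \<Longrightarrow> gvalid T g" and js: "set js \<subseteq> J"
  shows "Xs js (gvs L) = gvs (actl T \<mu> js L)"
proof -
  have "\<Lambda> j (gvs L) = gvs (concat (map (actg T \<mu> j) L))" if "j \<in> set js" for j
  proof -
    have j: "j \<in> J" using that js by blast
    have "\<Lambda> j (gvs L) = ht.vsum (map (\<lambda>g. \<Lambda> j (gv g)) L)"
      using L by (subst ht.sym_op_vsum[OF sym_op_\<Lambda>[OF j]]) (auto intro: gv_closed simp: comp_def)
    also have "map (\<lambda>g. \<Lambda> j (gv g)) L = map (\<lambda>g. gvs (actg T \<mu> j g)) L"
      using L j by (simp add: \<Lambda>_gv)
    finally show ?thesis using L by (subst gvs_concat) (auto intro: actg_gvalid)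
  qed
  then have eq: "map (\<lambda>j. \<Lambda> j (gvs L)) js = map (\<lambda>j. gvs (concat (map (actg T \<mu> j) L))) js" by simp
  have v: "gvalid T g" if "g \<in> set (concat (map (actg T \<mu> j) L))" for g j
    using that L actg_gvalid by (simp only: set_concat set_map) blast
  have "Xs js (gvs L) = ht.vsum (map (\<lambda>j. \<Lambda> j (gvs L)) js)"
    using L by (intro ht.opsum_apply gvs_closed)
  also have "\<dots> = gvs (actl T \<mu> js L)"
    unfolding actl_def eq by (rule gvs_concat[symmetric]) (rule v)
  finally show ?thesis .
qed

lemma eval_gvs:
  assumes "set js \<subseteq> J" "\<And>g. g \<in> set L \<Longrightarrow> gvalid T g"
  shows "bterm_eval HT (Xs js) t (gvs L) = gvs (evl T \<mu> js t L)"
  using assms(2)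
proof (induction t arbitrary: L)
  case (Coef b)
  have "map (lact HT b) (map gv L) = map gv (map (lgen b) L)" using Coef by (simp add: gv_lgen)
  moreover have "lact HT b (gvs L) = ht.vsum (map (lact HT b) (map gv L))"
    using Coef by (intro ht.lact_vsum) (auto simp: gv_closed)
  ultimately have "lact HT b (gvs L) = gvs (map (lgen b) L)" by (simp only:)
  then show ?case using gvs_closed[OF Coef] by simp
next
  case Indet
  then show ?case using Xs_gvs[OF Indet assms(1)] by simp
next
  case (Plus s t)
  have c: "set (map gv (evl T \<mu> js u L)) \<subseteq> carr HT" for u
    using gv_closed evl_gvalid[OF Plus.prems] by (simp only: set_map) blast
  show ?case
    using Plus.IH[OF Plus.prems] gvs_closed[OF Plus.prems] ht.vsum_append[OF c c]
    by (simp only: bterm_eval.simps evl.simps op_add_def restrict_apply' map_append)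
next
  case (Times s t)
  have "gvs L \<in> carr HT" using gvs_closed Times.prems by blast
  then show ?case
    using Times.IH(2)[OF Times.prems] Times.IH(1)[of "evl T \<mu> js t L"] evl_gvalid[OF Times.prems] by simp
qed

abbreviation "\<Omega> \<equiv> vacuum T (\<lambda>j. L2 (\<mu> j)) (\<lambda>j. L2_one (\<mu> j))"

lemma vacuum_gvs: "\<Omega> = gvs [([], [], 1)]"
  using tree_simps(1) by (simp add: vacuum_def gvec_def ht.ract_one tv_closed ht.add_nul)

lemma inn_vacuum_gvs:
  assumes "\<And>g. g \<in> set L \<Longrightarrow> gvalid T g"
  shows "inn HT \<Omega> (gvs L) = vacs L"
proof -
  have "inn HT \<Omega> (gv (s, qs, b)) = (if s = [] then b else 0)" if "gvalid T (s, qs, b)" for s qs b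
    using that adm_cc[OF T_subset[of s], of qs] tree_simps(1)
    by (simp add: gvalid_def vacuum_def gvec_def ht.inn_ract tv_closed inn_tv)
  then have "map (inn HT \<Omega>) (map gv L) = map (\<lambda>(s, qs, b). if s = [] then b else 0) L"
    using assms by auto
  moreover have "inn HT \<Omega> (gvs L) = sum_list (map (inn HT \<Omega>) (map gv L))"
    using assms tree_simps(1) by (intro ht.inn_vsum) (auto simp: vacuum_def tv_closed gv_closed)
  ultimately show ?thesis unfolding vacs_def by metis
qed

lemma law_data_Xs:
  assumes "set js \<subseteq> J"
  shows "law_data HT \<Omega> (Xs js)"
  unfolding law_data_def law_data_axioms_def vacuum_def
  using tree_simps(1)
  by (intro conjI allI ht.hcorr_axioms tv_closed vacuum_unit vacuum_central sym_op_Xs assms) auto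

text \<open>The law of the convolution is thereby a finite computation with lists of triples, in
  which no completion occurs.\<close>

lemma law_of_Xs:
  assumes "set js \<subseteq> J"
  shows "law_of HT \<Omega> (Xs js) (abs_bpoly t) = vacs (evl T \<mu> js t [([], [], 1)])"
proof -
  interpret law_data HT \<Omega> "Xs js" by (rule law_data_Xs[OF assms])
  have v: "gvalid T g" if "g \<in> set [([], [], 1)]" for g :: "'b gen"
    using that tree_simps(1) by (simp add: gvalid_def)
  have "law_of HT \<Omega> (Xs js) (abs_bpoly t) = inn HT \<Omega> (bterm_eval HT (Xs js) t (gvs [([], [], 1)]))"
    unfolding law_of_vec vec_abs using vacuum_gvs by metis
  also have "\<dots> = vacs (evl T \<mu> js t [([], [], 1)])"
    by (subst eval_gvs[OF assms v]) (auto intro: inn_vacuum_gvs evl_gvalid v)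
  finally show ?thesis .
qed

end

lemma boxplus_eq:
  assumes "tree_laws {1..length \<mu>s} T (\<lambda>j. \<mu>s ! (j - 1))"
  shows "boxplus T \<mu>s = (let H = (\<lambda>j. L2 (\<mu>s ! (j - 1))); \<xi> = (\<lambda>j. L2_one (\<mu>s ! (j - 1)))
    in law_of (tree_product T H \<xi>) (vacuum T H \<xi>)
      (hcorr.opsum (tree_product T H \<xi>) (\<lambda>j. tree_rep T H \<xi> j (L2_mult (\<mu>s ! (j - 1)))) [1..<Suc (length \<mu>s)]))"
proof -
  interpret tree_laws "{1..length \<mu>s}" T "\<lambda>j. \<mu>s ! (j - 1)" by (rule assms)
  show ?thesis by (simp only: boxplus_def Let_def ht.opsum_def)
qed

section \<open>Composition of trees\<close>

text \<open>Edges change a string by one leading letter, so a path from the root to a string passes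
  through all its suffixes.\<close>

lemma Tree_suffix_closed:
  assumes "T \<in> Tree N" "j # s \<in> T"
  shows "s \<in> T"
proof -
  \<comment> \<open>Generalized to all vertices that have \<open>j # s\<close> as a suffix, because
    a path may climb above \<open>j # s\<close> and return. The suffix first appears in a step that
    prepends \<open>j\<close>, and the source of that step is \<open>s\<close>.\<close>
  have "\<exists>u. y = u @ j # s \<Longrightarrow> s \<in> T" if "([], y) \<in> (tree_edges N \<inter> T \<times> T)\<^sup>*" for y
    using that
  proof (induction rule: rtrancl_induct)
    case (step y z)
    then obtain u where u: "z = u @ j # s" by blast
    have T: "y \<in> T" and e: "(\<exists>l. z = l # y) \<or> (\<exists>l. y = l # z)"
      using step(2) by (auto simp: tree_edges_def)
    from e show ?case
    proof
      assume "\<exists>l. z = l # y"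
      then show ?thesis using u T step.IH by (cases u) auto
    next
      assume "\<exists>l. y = l # z"
      then obtain l where "y = (l # u) @ j # s" using u by auto
      then show ?thesis using step.IH by blast
    qed
  qed simp
  then show ?thesis using assms unfolding Tree_def by blast
qed

lemma rooted_tree_Tree:
  assumes "T \<in> Tree N"
  shows "rooted_tree {1..N} T"
  unfolding rooted_tree_def
proof (intro conjI ballI allI impI)
  show "[] \<in> T" "s \<in> T \<Longrightarrow> set s \<subseteq> {1..N}" for s
    using assms by (auto simp: Tree_def alternating_def)
  fix j s assume js: "j # s \<in> T"
  show "s \<in> T" by (rule Tree_suffix_closed[OF assms js])
  have "\<forall>i. Suc i < length (j # s) \<longrightarrow> (j # s) ! i \<noteq> (j # s) ! Suc i"
    using assms js unfolding Tree_def alternating_def by blast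
  then have "s \<noteq> [] \<Longrightarrow> hd s \<noteq> j" by (cases s) (auto dest: spec[where x = 0])
  then show "s = [] \<or> hd s \<noteq> j" by blast
qed

definition decode :: "nat list \<Rightarrow> nat list \<Rightarrow> nat list list \<Rightarrow> nat list" where
  "decode ns js ss = concat (map2 (\<lambda>j s. map (shift ns j) s) js ss)"

lemma decode_simps [simp]: "decode ns [] ss = []" "decode ns js [] = []"
  "decode ns (j # js) (s # ss) = map (shift ns j) s @ decode ns js ss"
  by (simp_all add: decode_def)

section \<open>Strings of the composed tree and their decoding into blocks\<close>

locale composition =
  fixes k :: nat and T :: "nat list set" and ns :: "nat list" and Ts :: "nat list set list"
  assumes T: "rooted_tree {1..k} T" and len: "length ns = k" "length Ts = k"
    and Ts: "j \<in> {1..k} \<Longrightarrow> rooted_tree {1..ns ! (j - 1)} (Ts ! (j - 1))"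
begin

abbreviation "\<iota> \<equiv> shift ns"
abbreviation "N \<equiv> sum_list ns"
abbreviation "T' \<equiv> tree_compose ns T Ts"
abbreviation "pieces \<equiv> list_all2 (\<lambda>j s. s \<in> Ts ! (j - 1) - {[]})"

lemma sum_take_mono: "a \<le> b \<Longrightarrow> sum_list (take a ns) \<le> sum_list (take b ns)"
proof -
  assume "a \<le> b"
  then have "take b ns = take a ns @ take (b - a) (drop a ns)"
    by (metis le_add_diff_inverse take_add)
  then show ?thesis by simp
qed

lemma \<iota>_bounds:
  assumes "j \<in> {1..k}" "i \<in> {1..ns ! (j - 1)}"
  shows "sum_list (take (j - 1) ns) < \<iota> j i" "\<iota> j i \<le> sum_list (take j ns)"
proof -
  obtain j0 where "j = Suc j0" "j0 < length ns" using assms len by (cases j) auto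
  then have "take j ns = take (j - 1) ns @ [ns ! (j - 1)]"
    by (simp add: take_Suc_conv_app_nth)
  then show "sum_list (take (j - 1) ns) < \<iota> j i" "\<iota> j i \<le> sum_list (take j ns)"
    using assms by (simp_all add: shift_def)
qed

lemma \<iota>_range: "j \<in> {1..k} \<Longrightarrow> i \<in> {1..ns ! (j - 1)} \<Longrightarrow> \<iota> j i \<in> {1..N}"
  using \<iota>_bounds[of j i] sum_take_mono[of j k] len by force

lemma \<iota>_inj:
  assumes "j \<in> {1..k}" "i \<in> {1..ns ! (j - 1)}" "j' \<in> {1..k}" "i' \<in> {1..ns ! (j' - 1)}" "\<iota> j i = \<iota> j' i'"
  shows "j = j'" "i = i'"
proof -
  have *: "\<iota> j i < \<iota> j' i'" if "j < j'" "j \<in> {1..k}" "i \<in> {1..ns ! (j - 1)}" "j' \<in> {1..k}" "i' \<in> {1..ns ! (j' - 1)}"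
    for j i j' i'
  proof -
    have "\<iota> j i \<le> sum_list (take j ns)" using \<iota>_bounds that by blast
    also have "\<dots> \<le> sum_list (take (j' - 1) ns)" using that by (intro sum_take_mono) simp
    also have "\<dots> < \<iota> j' i'" using \<iota>_bounds that by blast
    finally show ?thesis .
  qed
  show "j = j'" using *[OF _ assms(1-4)] *[OF _ assms(3,4,1,2)] assms(5) by (metis less_irrefl linorder_neqE_nat)
  then show "i = i'" using assms(5) by (simp add: shift_def)
qed

lemma inj_\<iota>: "inj (\<iota> j)"
  by (simp add: inj_def shift_def)

text \<open>The choice is unique for letters in the range of a shift, by injectivity of the
  numbering; only such letters are ever looked up with a known value.\<close>

definition block :: "nat \<Rightarrow> nat" where
  "block m = (SOME j. j \<in> {1..k} \<and> (\<exists>i\<in>{1..ns ! (j - 1)}. m = \<iota> j i))"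

lemma block_\<iota>:
  assumes "j \<in> {1..k}" "i \<in> {1..ns ! (j - 1)}"
  shows "block (\<iota> j i) = j"
proof -
  have "\<exists>j'. j' \<in> {1..k} \<and> (\<exists>i'\<in>{1..ns ! (j' - 1)}. \<iota> j i = \<iota> j' i')" using assms by blast
  from someI_ex[OF this] show ?thesis
    unfolding block_def[symmetric] using \<iota>_inj(1)[OF assms] by metis
qed

lemma T_simps:
  "[] \<in> T" "j # js \<in> T \<Longrightarrow> j \<in> {1..k}" "j # js \<in> T \<Longrightarrow> js \<in> T" "j # js \<in> T \<Longrightarrow> js = [] \<or> hd js \<noteq> j"
  using T by (force simp: rooted_tree_def)+

lemma Ts_simps:
  assumes "j \<in> {1..k}"
  shows "[] \<in> Ts ! (j - 1)" "s \<in> Ts ! (j - 1) \<Longrightarrow> set s \<subseteq> {1..ns ! (j - 1)}"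
    "i # s \<in> Ts ! (j - 1) \<Longrightarrow> s \<in> Ts ! (j - 1)" "i # s \<in> Ts ! (j - 1) \<Longrightarrow> s = [] \<or> hd s \<noteq> i"
  using Ts[OF assms] by (auto simp: rooted_tree_def)

lemma decode_head:
  assumes "j # js \<in> T" "pieces (j # js) ss"
  obtains i s ss' where "ss = (i # s) # ss'" "i # s \<in> Ts ! (j - 1)" "i \<in> {1..ns ! (j - 1)}" "pieces js ss'"
    "hd (decode ns (j # js) ss) = \<iota> j i" "block (\<iota> j i) = j"
proof -
  have j: "j \<in> {1..k}" using assms(1) by (rule T_simps)
  obtain u ss' where u: "ss = u # ss'" "u \<in> Ts ! (j - 1)" "u \<noteq> []" "pieces js ss'"
    using assms(2) by (auto simp: list_all2_Cons1)
  then obtain i s where "u = i # s" by (cases u) auto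
  moreover from this have "i \<in> {1..ns ! (j - 1)}" using Ts_simps(2)[OF j] u(2) by force
  ultimately show ?thesis using that u block_\<iota>[OF j] by simp
qed

text \<open>The string \<open>js\<close> does not begin with \<open>j\<close>, so what follows the
  segment \<open>s\<close> begins in another block. The segment is therefore recovered as the
  longest prefix in block \<open>j\<close>.\<close>

lemma decode_split:
  assumes j: "j \<in> {1..k}" and s: "set s \<subseteq> {1..ns ! (j - 1)}"
    and js: "js \<in> T" "js = [] \<or> hd js \<noteq> j" and ss: "pieces js ss"
  shows "takeWhile (\<lambda>m. block m = j) (map (\<iota> j) s @ decode ns js ss) = map (\<iota> j) s"
    and "dropWhile (\<lambda>m. block m = j) (map (\<iota> j) s @ decode ns js ss) = decode ns js ss"
proof -
  have a: "\<And>m. m \<in> set (map (\<iota> j) s) \<Longrightarrow> block m = j" using s block_\<iota>[OF j] by auto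
  have "decode ns js ss = [] \<or> block (hd (decode ns js ss)) \<noteq> j"
  proof (cases js)
    case (Cons j' js')
    then show ?thesis using js ss by (metis decode_head list.sel(1) neq_Nil_conv)
  qed simp
  then have "takeWhile (\<lambda>m. block m = j) (decode ns js ss) = []"
    "dropWhile (\<lambda>m. block m = j) (decode ns js ss) = decode ns js ss"
    by (cases "decode ns js ss"; simp)+
  then show "takeWhile (\<lambda>m. block m = j) (map (\<iota> j) s @ decode ns js ss) = map (\<iota> j) s"
    "dropWhile (\<lambda>m. block m = j) (map (\<iota> j) s @ decode ns js ss) = decode ns js ss"
    using takeWhile_append2[of "map (\<iota> j) s" "\<lambda>m. block m = j" "decode ns js ss", OF a]
      dropWhile_append2[of "map (\<iota> j) s" "\<lambda>m. block m = j" "decode ns js ss", OF a] by simp_all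
qed

lemma decode_Nil: "js \<in> T \<Longrightarrow> pieces js ss \<Longrightarrow> decode ns js ss = [] \<Longrightarrow> js = []"
  by (cases js; cases ss) auto

lemma decode_Cons_split:
  assumes "j # js \<in> T" "pieces (j # js) (s # ss)"
  shows "takeWhile (\<lambda>m. block m = j) (decode ns (j # js) (s # ss)) = map (\<iota> j) s"
    and "dropWhile (\<lambda>m. block m = j) (decode ns (j # js) (s # ss)) = decode ns js ss"
  using decode_split[OF T_simps(2)[OF assms(1)] _ T_simps(3,4)[OF assms(1)], of s ss]
    Ts_simps(2)[OF T_simps(2)[OF assms(1)]] assms(2) by auto

text \<open>The block of the first letter gives the first entry of \<open>js\<close>, and stripping
  the leading segment leads to the tail. Pieces are nonempty, so each entry of \<open>js\<close>
  leaves a trace in the string.\<close>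

lemma decode_unique:
  "js \<in> T \<Longrightarrow> js' \<in> T \<Longrightarrow> pieces js ss \<Longrightarrow> pieces js' ss' \<Longrightarrow> decode ns js ss = decode ns js' ss' \<Longrightarrow> js = js'"
proof (induction js arbitrary: ss js' ss')
  case Nil
  then show ?case using decode_Nil[of js' ss'] by simp
next
  case (Cons j js)
  obtain s ss1 where s: "ss = s # ss1" "pieces js ss1" using Cons.prems(3) by (auto simp: list_all2_Cons1)
  have "js' \<noteq> []" using Cons.prems decode_Nil[of "j # js" ss] by auto
  then obtain j' js1 where js': "js' = j' # js1" by (cases js') auto
  obtain s' ss1' where s': "ss' = s' # ss1'" "pieces js1 ss1'"
    using Cons.prems(4) js' by (auto simp: list_all2_Cons1)
  have "j = block (hd (decode ns (j # js) ss))"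
    using decode_head[OF Cons.prems(1,3)] by metis
  also have "\<dots> = block (hd (decode ns (j' # js1) ss'))" using Cons.prems(5) js' by simp
  also have "\<dots> = j'"
    using Cons.prems(2,4) unfolding js' by (metis decode_head)
  finally have "j = j'" .
  then have "decode ns js ss1 = decode ns js1 ss1'"
    using decode_Cons_split(2)[OF Cons.prems(1), of s ss1] decode_Cons_split(2)[of j' js1 s' ss1'] Cons.prems
    by (simp add: s s' js' del: decode_simps)
  then have "js = js1"
    using Cons.IH[OF T_simps(3)[OF Cons.prems(1)] T_simps(3) s(2) s'(2)] Cons.prems(2) js' by blast
  then show ?case using \<open>j = j'\<close> js' by simp
qed

lemma in_T': "s \<in> T' \<longleftrightarrow> (\<exists>js ss. js \<in> T \<and> pieces js ss \<and> s = decode ns js ss)"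
  by (auto simp: tree_compose_def decode_def)

lemma Cons_in_T'E:
  assumes "m # s \<in> T'"
  obtains j i js s1 ss where "j # js \<in> T" "i # s1 \<in> Ts ! (j - 1)" "i \<in> {1..ns ! (j - 1)}" "pieces js ss"
    "pieces (j # js) ((i # s1) # ss)" "m = \<iota> j i" "s = map (\<iota> j) s1 @ decode ns js ss" "block m = j"
proof -
  obtain js ss where js: "js \<in> T" "pieces js ss" "m # s = decode ns js ss" using assms in_T' by blast
  then obtain j js' where j: "js = j # js'" by (cases js) auto
  obtain i s1 ss' where i: "ss = (i # s1) # ss'" "i # s1 \<in> Ts ! (j - 1)" "i \<in> {1..ns ! (j - 1)}"
    "pieces js' ss'" "block (\<iota> j i) = j"
    using decode_head[OF js(1,2)[unfolded j]] by metis
  have "m = \<iota> j i" "s = map (\<iota> j) s1 @ decode ns js' ss'" using js(3) by (simp_all add: j i(1))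
  then show ?thesis using js j i by (intro that[of j js' i s1 ss']) auto
qed

lemma rooted_T': "rooted_tree {1..N} T'"
  unfolding rooted_tree_def
proof (intro conjI ballI allI impI)
  show "[] \<in> T'" using T_simps(1) by (auto simp: in_T' intro!: exI[of _ "[]"])
  show "set s \<subseteq> {1..N}" if s: "s \<in> T'" for s
  proof -
    obtain js ss where "js \<in> T" "pieces js ss" "s = decode ns js ss" using s in_T' by blast
    then show ?thesis
    proof (induction js arbitrary: ss s)
      case (Cons j js)
      then obtain u ss' where u: "ss = u # ss'" "u \<in> Ts ! (j - 1)" "pieces js ss'"
        by (auto simp: list_all2_Cons1)
      have j: "j \<in> {1..k}" using Cons.prems(1) by (rule T_simps)
      have "\<iota> j ` set u \<subseteq> {1..N}" using Ts_simps(2)[OF j u(2)] \<iota>_range[OF j] by blast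
      then show ?case
        using Cons.IH[OF T_simps(3)[OF Cons.prems(1)] u(3) HOL.refl] Cons.prems(3) u(1) by simp
    qed simp
  qed
  fix m s assume "m # s \<in> T'"
  then obtain j i js s1 ss where d: "j # js \<in> T" "i # s1 \<in> Ts ! (j - 1)" "i \<in> {1..ns ! (j - 1)}" "pieces js ss"
    "m = \<iota> j i" "s = map (\<iota> j) s1 @ decode ns js ss" "block m = j" by (rule Cons_in_T'E)
  have j: "j \<in> {1..k}" using d(1) by (rule T_simps)
  have s1: "s1 \<in> Ts ! (j - 1)" "s1 = [] \<or> hd s1 \<noteq> i" using Ts_simps[OF j] d(2) by blast+
  show "s \<in> T'"
  \<comment> \<open>If the removed letter was the only one of its piece, \<open>js\<close> loses its
    first entry too and suffix closure of \<open>T\<close> is used; otherwise the piece is shortened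
    within its own tree.\<close>
  proof (cases "s1 = []")
    case True
    then show ?thesis using d(4,6) T_simps(3)[OF d(1)] by (auto simp: in_T')
  next
    case False
    then have "pieces (j # js) (s1 # ss)" using s1 d(4) by simp
    moreover have "s = decode ns (j # js) (s1 # ss)" using d(6) by simp
    ultimately show ?thesis using d(1) in_T' by blast
  qed
  show "s = [] \<or> hd s \<noteq> m"
  \<comment> \<open>The next letter lies in the same piece, where alternation comes from the tree of
    the block, or it starts another piece, whose block differs.\<close>
  proof (cases s1)
    case (Cons i' s2)
    then show ?thesis using s1 d(5,6) inj_\<iota>[of j] by (auto simp: inj_def)
  next
    case Nil
    then have s: "s = decode ns js ss" using d(6) by simp
    show ?thesis
    proof (cases js)
      case (Cons j' js')
      then have "block (hd s) = j'" using decode_head[of j' js' ss] T_simps(3)[OF d(1)] d(4) s by metis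
      then show ?thesis using T_simps(4)[OF d(1)] d(7) Cons by auto
    qed (simp add: s)
  qed
qed

text \<open>On top of a fixed remainder the composed tree looks like the tree of block
  \<open>j\<close>. An empty \<open>s\<close> is allowed: then a new segment is opened, for which
  \<open>j # js \<in> T\<close> is needed.\<close>

lemma in_T'_iff:
  assumes "j # js \<in> T" "pieces js ss" "s \<in> Ts ! (j - 1)" "i \<in> {1..ns ! (j - 1)}"
  shows "\<iota> j i # map (\<iota> j) s @ decode ns js ss \<in> T' \<longleftrightarrow> i # s \<in> Ts ! (j - 1)"
proof
  have j: "j \<in> {1..k}" using assms(1) by (rule T_simps)
  assume "\<iota> j i # map (\<iota> j) s @ decode ns js ss \<in> T'"
  then obtain j' i' js' s1 ss' where d: "j' # js' \<in> T" "i' # s1 \<in> Ts ! (j' - 1)" "i' \<in> {1..ns ! (j' - 1)}"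
    "pieces js' ss'" "pieces (j' # js') ((i' # s1) # ss')" "\<iota> j i = \<iota> j' i'"
    "map (\<iota> j) s @ decode ns js ss = map (\<iota> j') s1 @ decode ns js' ss'" "block (\<iota> j i) = j'" by (rule Cons_in_T'E)
  have j': "j' = j" using d(8) block_\<iota>[OF j assms(4)] by simp
  have "takeWhile (\<lambda>m. block m = j) (map (\<iota> j) (i # s) @ decode ns js ss) = map (\<iota> j) (i # s)"
    using assms Ts_simps(2)[OF j assms(3)] by (intro decode_split j T_simps(3,4)[OF assms(1)]) auto
  moreover have "map (\<iota> j) (i # s) @ decode ns js ss = decode ns (j # js') ((i' # s1) # ss')"
    using d(6,7) j' by simp
  ultimately have "map (\<iota> j) (i # s) = map (\<iota> j) (i' # s1)"
    using decode_Cons_split(1)[OF d(1,5)] j' by (simp del: decode_simps list.simps)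
  then have "i # s = i' # s1" using inj_map_eq_map[OF inj_\<iota>] by blast
  then show "i # s \<in> Ts ! (j - 1)" using d(2) j' by simp
next
  assume "i # s \<in> Ts ! (j - 1)"
  then have "pieces (j # js) ((i # s) # ss)" using assms by simp
  moreover have "\<iota> j i # map (\<iota> j) s @ decode ns js ss = decode ns (j # js) ((i # s) # ss)" by simp
  ultimately show "\<iota> j i # map (\<iota> j) s @ decode ns js ss \<in> T'" using assms(1) in_T' by blast
qed

text \<open>The case in which the outer representation of \<open>j\<close> vanishes. By uniqueness
  of decoding, opening a segment in block \<open>j\<close> would put \<open>j # js\<close> into
  \<open>T\<close>.\<close>

lemma not_in_T':
  assumes "js \<in> T" "pieces js ss" "j \<in> {1..k}" "i \<in> {1..ns ! (j - 1)}" "js = [] \<or> hd js \<noteq> j" "j # js \<notin> T"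
  shows "\<iota> j i # decode ns js ss \<notin> T'"
proof
  assume "\<iota> j i # decode ns js ss \<in> T'"
  then obtain j' i' js' s1 ss' where d: "j' # js' \<in> T" "i' # s1 \<in> Ts ! (j' - 1)" "i' \<in> {1..ns ! (j' - 1)}"
    "pieces js' ss'" "pieces (j' # js') ((i' # s1) # ss')" "\<iota> j i = \<iota> j' i'"
    "decode ns js ss = map (\<iota> j') s1 @ decode ns js' ss'" "block (\<iota> j i) = j'" by (rule Cons_in_T'E)
  have j': "j' = j" using d(8) block_\<iota>[OF assms(3,4)] by simp
  have si: "set [i] \<subseteq> {1..ns ! (j - 1)}" using assms(4) by simp
  have "map (\<iota> j) [i] @ decode ns js ss = decode ns (j # js') ((i' # s1) # ss')"
    using d(6,7) j' by simp
  then have "decode ns js ss = decode ns js' ss'"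
    using decode_split(2)[OF assms(3) si assms(1,5,2)] decode_Cons_split(2)[OF d(1,5)] j'
    by (simp del: decode_simps list.simps)
  then have "js = js'" using decode_unique[OF assms(1) T_simps(3)[OF d(1)] assms(2) d(4)] by simp
  then show False using d(1) j' assms(6) by simp
qed

lemma hd_decode:
  assumes "js \<in> T" "pieces js ss" "j \<in> {1..k}" "i \<in> {1..ns ! (j - 1)}" "js = [] \<or> hd js \<noteq> j"
  shows "decode ns js ss = [] \<or> hd (decode ns js ss) \<noteq> \<iota> j i"
proof (cases js)
  case (Cons j' js')
  then have "block (hd (decode ns js ss)) = j'" using assms by (metis decode_head)
  then show ?thesis using assms(5) Cons block_\<iota>[OF assms(3,4)] by auto
qed simp

end

text \<open>Enumerates the letters of the composed tree block by block, which groups the sum of all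
  variables into one sum per block.\<close>

lemma upt_blocks:
  "[1..<Suc (sum_list ns)] = concat (map (\<lambda>j. map (shift ns j) [1..<Suc (ns ! (j - 1))]) [1..<Suc (length ns)])"
proof (induction ns rule: rev_induct)
  case (snoc n ns)
  have "map (shift (ns @ [n]) j) [1..<Suc ((ns @ [n]) ! (j - 1))] = map (shift ns j) [1..<Suc (ns ! (j - 1))]"
    if "j \<in> set [1..<Suc (length ns)]" for j
    using that by (auto simp: shift_def nth_append)
  then have "map (\<lambda>j. map (shift (ns @ [n]) j) [1..<Suc ((ns @ [n]) ! (j - 1))]) [1..<Suc (length ns)]
      = map (\<lambda>j. map (shift ns j) [1..<Suc (ns ! (j - 1))]) [1..<Suc (length ns)]"
    by (rule map_cong[OF HOL.refl])
  then have "concat (map (\<lambda>j. map (shift (ns @ [n]) j) [1..<Suc ((ns @ [n]) ! (j - 1))]) [1..<Suc (length ns)])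
      = [1..<Suc (sum_list ns)]"
    using snoc by (simp only:)
  moreover have "map (shift (ns @ [n]) (Suc (length ns))) [1..<Suc n] = [Suc (sum_list ns)..<Suc (sum_list ns + n)]"
    by (rule nth_equalityI) (auto simp: shift_def simp del: upt_Suc)
  moreover have "[1..<Suc (sum_list ns + n)] = [1..<Suc (sum_list ns)] @ [Suc (sum_list ns)..<Suc (sum_list ns + n)]"
    using upt_add_eq_append[of 1 "Suc (sum_list ns)" n] by simp
  moreover have "[1..<Suc (length (ns @ [n]))] = [1..<Suc (length ns)] @ [Suc (length ns)]" by simp
  ultimately show ?case
    by (simp only: map_append concat_append sum_list.append) (simp del: upt_Suc)
qed simp

text \<open>\<open>shift\<close> numbers letters as concatenation numbers the laws. Letters count
  from 1 and list positions from 0, hence the subtractions.\<close>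

lemma concat_nth_shift:
  "j \<in> {1..length xss} \<Longrightarrow> i \<in> {1..length (xss ! (j - 1))} \<Longrightarrow>
    concat xss ! (shift (map length xss) j i - 1) = xss ! (j - 1) ! (i - 1)"
proof (induction xss arbitrary: j)
  case (Cons xs xss)
  show ?case
  proof (cases "j = 1")
    case True
    then show ?thesis using Cons.prems by (auto simp: shift_def nth_append)
  next
    case False
    then obtain j' where j': "j = Suc (Suc j')" using Cons.prems by (cases j; cases "j - 1") auto
    then have "concat xss ! (shift (map length xss) (Suc j') i - 1) = xss ! j' ! (i - 1)"
      using Cons.IH[of "Suc j'"] Cons.prems by simp
    moreover have "shift (map length (xs # xss)) j i - 1 = length xs + (shift (map length xss) (Suc j') i - 1)"
      using j' Cons.prems by (simp add: shift_def)
    ultimately show ?thesis using j' by (simp only: concat.simps nth_append_length_plus) simp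
  qed
qed simp


section \<open>Composition of convolutions\<close>

text \<open>The first part lets block convolutions serve as inputs of another convolution; the
  second is the list formula that later identifies the scalar split off by the outer
  convolution.\<close>

lemma boxplus_law:
  assumes "tree_laws {1..length \<mu>s} T (\<lambda>j. \<mu>s ! (j - 1))"
  shows "weak_law (boxplus T \<mu>s)"
    and "boxplus T \<mu>s (abs_bpoly t) = vacs (evl T (\<lambda>j. \<mu>s ! (j - 1)) [1..<Suc (length \<mu>s)] t [([], [], 1)])"
proof -
  interpret tree_laws "{1..length \<mu>s}" T "\<lambda>j. \<mu>s ! (j - 1)" by (rule assms)
  have s: "set [1..<Suc (length \<mu>s)] \<subseteq> {1..length \<mu>s}" by auto
  show "weak_law (boxplus T \<mu>s)"
    using law_data.weak_law_law_of[OF law_data_Xs[OF s]] by (simp only: boxplus_eq[OF assms] Let_def)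
  show "boxplus T \<mu>s (abs_bpoly t) = vacs (evl T (\<lambda>j. \<mu>s ! (j - 1)) [1..<Suc (length \<mu>s)] t [([], [], 1)])"
    using law_of_Xs[OF s, of t] by (simp only: boxplus_eq[OF assms] Let_def)
qed

text \<open>A triple over the one-letter tree is a scalar or a single centred polynomial, so it can be read back
  as an element of \<open>\<B>\<langle>X\<rangle>\<close>, where \<open>actg\<close> becomes multiplication by \<open>X\<close>.\<close>

lemma boxplus_identity:
  fixes \<mu> :: "'b::unital_cstar law"
  assumes "weak_law \<mu>"
  shows "boxplus {[], [1]} [\<mu>] = \<mu>"
proof
  fix p :: "'b bpoly"
  obtain t where p: "p = abs_bpoly t" by (metis abs_rep_bpoly)
  interpret weak_law \<mu> by (rule assms)
  let ?T = "{[], [1 :: nat]}" and ?\<mu> = "\<lambda>j. [\<mu>] ! (j - 1)"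
  interpret tl: tree_laws "{1..length [\<mu>]}" ?T ?\<mu>
    by (rule tree_laws.intro) (auto simp: rooted_tree_def assms)
  define V where "V = (\<lambda>(s :: nat list, qs, b). case qs of [] \<Rightarrow> coef b | q # _ \<Rightarrow> (q - coef (\<mu> q)) * coef b)"
  define VL where "VL = (\<lambda>L. sum_list (map V L))"
  have VL: "VL [] = 0" "VL (g # L) = V g + VL L" "VL (L @ L') = VL L + VL L'" for g L L'
    by (simp_all add: VL_def)
  have lg: "V (lgen a g) = coef a * V g" for a g
    by (cases g) (auto simp: V_def lgen_def coef_simps law_left left_diff_distrib right_diff_distrib mult.assoc split: list.split)
  have ac: "VL (actg ?T ?\<mu> 1 g) = indet * V g" if "gvalid ?T g" for g
  proof -
    obtain s qs b where g: "g = (s, qs, b)" by (cases g)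
    show ?thesis
      using that by (auto simp: g gvalid_def actg_def length_Suc_conv Let_def VL lg)
        (auto simp: V_def ring_distribs coef_simps left_diff_distrib mult.assoc)
  qed
  have al: "VL (actl ?T ?\<mu> [1] L) = indet * VL L" if "\<forall>g\<in>set L. gvalid ?T g" for L
    using that by (induction L) (simp_all add: actl_def VL ac[simplified] ring_distribs)
  have ev: "\<forall>g\<in>set L. gvalid ?T g \<Longrightarrow> VL (evl ?T ?\<mu> [1] t L) = abs_bpoly t * VL L" for t L
  proof (induction t arbitrary: L)
    case (Coef b)
    have "VL (map (lgen b) L) = coef b * VL L" by (induction L) (simp_all add: VL lg ring_distribs)
    then show ?case by (simp add: abs_bpoly_simps)
  next
    case (Times s t)
    have "\<forall>g\<in>set (evl ?T ?\<mu> [1] t L). gvalid ?T g" using tl.evl_gvalid Times.prems by blast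
    then show ?case using Times by (simp add: abs_bpoly_simps mult.assoc)
  qed (simp_all add: abs_bpoly_simps al[simplified] VL ring_distribs)
  have vac: "\<mu> (VL L) = vacs L" if "\<forall>g\<in>set L. gvalid ?T g" for L
    using that
  proof (induction L)
    case Nil
    then show ?case using law_coef[of 0] by (simp add: VL coef_simps)
  next
    case (Cons g L)
    obtain s qs b where g: "g = (s, qs, b)" by (cases g)
    have c: "\<mu> (q - coef (\<mu> q)) = 0" for q
      using law_add[of "q - coef (\<mu> q)" "coef (\<mu> q)"] by (simp add: law_coef)
    have "\<mu> (V g) = (if s = [] then b else 0)"
      using Cons.prems by (auto simp: g gvalid_def V_def length_Suc_conv law_coef law_right c)
    then show ?case using Cons by (simp add: VL law_add) (simp add: g)
  qed
  have v: "\<forall>g\<in>set [([], [], 1)]. gvalid ?T g" by (simp add: gvalid_def)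
  have v': "\<forall>g\<in>set (evl ?T ?\<mu> [1] t [([], [], 1)]). gvalid ?T g" using tl.evl_gvalid v by blast
  have "boxplus ?T [\<mu>] p = vacs (evl ?T ?\<mu> [1] t [([], [], 1)])"
    unfolding p using boxplus_law(2)[OF tl.tree_laws_axioms, of t] by (simp add: upt_rec)
  also have "\<dots> = \<mu> (VL (evl ?T ?\<mu> [1] t [([], [], 1)]))" using vac[OF v'] by simp
  also have "VL (evl ?T ?\<mu> [1] t [([], [], 1)]) = p"
    using ev[OF v, of t] by (simp add: p VL V_def coef_simps)
  finally show "boxplus ?T [\<mu>] p = \<mu> p" .
qed

text \<open>The right coefficient of the first tensor is moved across the tensor sign, where it acts from
  the left.\<close>

definition gprod :: "(nat \<Rightarrow> nat) \<Rightarrow> 'b::unital_cstar gen \<Rightarrow> 'b gen \<Rightarrow> 'b gen" where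
  "gprod f = (\<lambda>(s, qs, b) g. case lgen b g of (s', qs', b') \<Rightarrow> (map f s @ s', qs @ qs', b'))"

lemma fst_gprod: "fst (gprod f g g') = map f (fst g) @ fst g'"
  using fst_lgen[of "snd (snd g)" g'] by (auto simp: gprod_def split: prod.split)

lemma gprod_vacuum: "gprod f ([], [], b) g = lgen b g"
  by (simp add: gprod_def split: prod.split)

lemma gprod_lgen:
  assumes "length (fst (snd g)) = length (fst g)"
  shows "gprod f (lgen a g) g' = lgen a (gprod f g g')"
proof -
  obtain s qs b where g: "g = (s, qs, b)" by (cases g)
  show ?thesis
  proof (cases qs)
    case Nil
    then have "s = []" using assms g by simp
    moreover have "lgen a ([], [], b) = ([], [], a * b)" by (simp add: lgen_def)
    ultimately show ?thesis using Nil by (simp add: g gprod_vacuum lgen_lgen)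
  next
    case (Cons q qs')
    then show ?thesis by (simp add: g gprod_def lgen_def[of a] split: prod.split)
  qed
qed

lemma gvalid_gprod:
  assumes "gvalid T1 g" "length (fst (snd g')) = length (fst g')" "map f (fst g) @ fst g' \<in> T"
  shows "gvalid T (gprod f g g')"
proof -
  obtain s qs b where g: "g = (s, qs, b)" by (cases g)
  obtain s' qs' b' where l: "lgen b g' = (s', qs', b')" by (cases "lgen b g'")
  have "s' = fst g'" "length qs' = length s'"
    using l assms(2) gvalid_lgen[of UNIV b g'] fst_lgen[of b g'] by (auto simp: gvalid_def)
  then show ?thesis using assms by (simp add: g l gprod_def gvalid_def)
qed

text \<open>A letter of the block sees only the first tensor \<open>g\<close>. By
  \<open>mem\<close>, prepending is possible in one tree exactly when it is in the other, and
  \<open>hd\<close> keeps the letter from hitting \<open>g'\<close> when the string of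
  \<open>g\<close> is empty.\<close>

lemma actg_gprod:
  assumes f: "inj f" and \<mu>: "\<mu>' (f i) = \<mu> i" and g: "length (fst (snd g)) = length (fst g)"
    and mem: "f i # map f (fst g) @ fst g' \<in> T' \<longleftrightarrow> i # fst g \<in> T"
    and hd: "fst g' = [] \<or> hd (fst g') \<noteq> f i"
  shows "actg T' \<mu>' (f i) (gprod f g g') = map (\<lambda>\<gamma>. gprod f \<gamma> g') (actg T \<mu> i g)"
proof -
  obtain s qs b where gs: "g = (s, qs, b)" by (cases g)
  obtain s' qs' b' where l: "lgen b g' = (s', qs', b')" by (cases "lgen b g'")
  have s': "fst g' = s'" using fst_lgen[of b g'] l by simp
  have p: "gprod f g g' = (map f s @ s', qs @ qs', b')" by (simp add: gs gprod_def l)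
  show ?thesis
  proof (cases "s \<noteq> [] \<and> hd s = i")
    case True
    then obtain s1 q qs1 where s: "s = i # s1" "qs = q # qs1" using g gs by (cases s; cases qs) auto
    define q' where "q' = indet * (q - coef (\<mu> i q))"
    have "(map f s1 @ s', qs1 @ qs', b') = gprod f (s1, qs1, b) g'" by (simp add: gprod_def l)
    moreover have "lgen (\<mu> i q') (gprod f (s1, qs1, b) g') = gprod f (lgen (\<mu> i q') (s1, qs1, b)) g'"
      using g by (intro gprod_lgen[symmetric]) (simp add: gs s)
    moreover have "(map f s @ s', q' # qs1 @ qs', b') = gprod f (s, q' # qs1, b) g'" by (simp add: gprod_def l)
    ultimately show ?thesis
      unfolding p by (simp add: gs s actg_def \<mu> Let_def flip: q'_def)
  next
    case False
    have nh: "\<not> (map f s @ s' \<noteq> [] \<and> hd (map f s @ s') = f i)"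
      using False hd f s' by (cases s) (auto simp: inj_def)
    show ?thesis
    proof (cases "i # s \<in> T")
      case True
      then have "f i # map f s @ s' \<in> T'" using mem gs s' by simp
      then have "actg T' \<mu>' (f i) (gprod f g g') =
          [lgen (\<mu> i indet) (gprod f g g'), (f i # map f s @ s', indet # qs @ qs', b')]"
        unfolding p using nh \<mu> by (auto simp: actg_def)
      moreover have "actg T \<mu> i g = [lgen (\<mu> i indet) g, (i # s, indet # qs, b)]"
        using False True by (auto simp: gs actg_def)
      ultimately show ?thesis using gprod_lgen[OF g, of f "\<mu> i indet" g'] by (simp add: gprod_def l)
    next
      case js: False
      then have "f i # map f s @ s' \<notin> T'" using mem gs s' by simp
      then have "actg T' \<mu>' (f i) (gprod f g g') = []" unfolding p using nh by (auto simp: actg_def)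
      moreover have "actg T \<mu> i g = []" using False js by (auto simp: gs actg_def)
      ultimately show ?thesis by simp
    qed
  qed
qed

text \<open>The loop over \<open>P\<close> is the outer one because the operators of a block act on
  the whole list \<open>V\<close> while the remainder \<open>g'\<close> stays fixed.\<close>

definition gprods :: "(nat \<Rightarrow> nat) \<Rightarrow> 'b::unital_cstar gen list \<Rightarrow> 'b gen list \<Rightarrow> 'b gen list" where
  "gprods f V P = concat (map (\<lambda>g'. map (\<lambda>g. gprod f g g') V) P)"

abbreviation nonvac :: "'b gen list \<Rightarrow> 'b gen list" where
  "nonvac \<equiv> filter (\<lambda>g. fst g \<noteq> [])"

section \<open>The iterated convolution compared with the convolution along the composed
  tree\<close>

locale law_composition = composition +
  fixes \<mu>ss :: "'b::unital_cstar law list list"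
  assumes len_\<mu>ss: "length \<mu>ss = k" and len_\<mu>s: "j < k \<Longrightarrow> length (\<mu>ss ! j) = ns ! j"
    and laws: "j < k \<Longrightarrow> i < ns ! j \<Longrightarrow> weak_law (\<mu>ss ! j ! i)"
begin

declare One_nat_def [simp del]

abbreviation "\<mu>' \<equiv> \<lambda>i. concat \<mu>ss ! (i - 1)"
abbreviation "\<mu>j j \<equiv> \<lambda>i. \<mu>ss ! (j - 1) ! (i - 1)"
abbreviation "\<nu> \<equiv> \<lambda>j. map2 boxplus Ts \<mu>ss ! (j - 1)"
abbreviation "blk j \<equiv> [1..<Suc (ns ! (j - 1))]"

lemma ns_eq: "ns = map length \<mu>ss"
  by (rule nth_equalityI) (simp_all add: len len_\<mu>ss len_\<mu>s)

lemma \<mu>'_\<iota>: "j \<in> {1..k} \<Longrightarrow> i \<in> {1..ns ! (j - 1)} \<Longrightarrow> \<mu>' (\<iota> j i) = \<mu>j j i"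
  unfolding ns_eq by (rule concat_nth_shift) (auto simp: len_\<mu>ss)

lemma tree_laws_block:
  assumes "j \<in> {1..k}"
  shows "tree_laws {1..length (\<mu>ss ! (j - 1))} (Ts ! (j - 1)) (\<mu>j j)"
proof (rule tree_laws.intro)
  have j: "j - 1 < k" using assms by auto
  show "rooted_tree {1..length (\<mu>ss ! (j - 1))} (Ts ! (j - 1))" using Ts[OF assms] len_\<mu>s[OF j] by simp
  show "weak_law (\<mu>j j i)" if "i \<in> {1..length (\<mu>ss ! (j - 1))}" for i
    using that len_\<mu>s[OF j] by (intro laws j) auto
qed

lemma len_block: "j \<in> {1..k} \<Longrightarrow> length (\<mu>ss ! (j - 1)) = ns ! (j - 1)"
  by (rule len_\<mu>s) auto

lemma \<nu>_eq: "j \<in> {1..k} \<Longrightarrow> \<nu> j = boxplus (Ts ! (j - 1)) (\<mu>ss ! (j - 1))"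
  using len len_\<mu>ss by auto

text \<open>A list for the vector \<open>p(X) \<xi>\<close> in the convolution of block
  \<open>j\<close>, where \<open>p\<close> is the polynomial of \<open>t\<close>.\<close>

definition E :: "nat \<Rightarrow> 'b bterm \<Rightarrow> 'b gen list" where
  "E j t = evl (Ts ! (j - 1)) (\<mu>j j) (blk j) t [([], [], 1)]"

lemma \<nu>_E: "j \<in> {1..k} \<Longrightarrow> \<nu> j (abs_bpoly t) = vacs (E j t)"
  unfolding \<nu>_eq E_def using boxplus_law(2)[OF tree_laws_block] len_block by simp

lemma E_gvalid: "j \<in> {1..k} \<Longrightarrow> g \<in> set (E j t) \<Longrightarrow> gvalid (Ts ! (j - 1)) g"
  unfolding E_def
  by (rule tree_laws.evl_gvalid[OF tree_laws_block, where L = "[([], [], 1)]"])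
    (auto simp: gvalid_def Ts_simps(1))

sublocale outer: tree_laws "{1..k}" T \<nu>
proof (rule tree_laws.intro)
  show "weak_law (\<nu> j)" if "j \<in> {1..k}" for j
    unfolding \<nu>_eq[OF that] by (rule boxplus_law[OF tree_laws_block[OF that]])
qed (rule T)

sublocale composed: tree_laws "{1..N}" T' \<mu>'
proof (rule tree_laws.intro)
  show "weak_law (\<mu>' m)" if "m \<in> {1..N}" for m
  proof -
    have "m \<in> set [1..<Suc N]" using that by auto
    then obtain j i where "j \<in> {1..k}" "i \<in> {1..ns ! (j - 1)}" "m = \<iota> j i"
      unfolding upt_blocks using len by (fastforce simp del: upt_Suc)
    then show ?thesis using \<mu>'_\<iota>[of j i] laws[of "j - 1" "i - 1"] by (auto simp: Suc_le_eq)
  qed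
qed (rule rooted_T')

text \<open>With \<open>p\<^sub>i\<close> the polynomial of the term \<open>t\<^sub>i\<close>, the triple \<open>(js, ts, b)\<close> encodes the vector
  \<open>p\<^sub>1\<^sup>\<circ> \<otimes> \<dots> \<otimes> p\<^sub>m\<^sup>\<circ> b\<close> of the iterated convolution. \<open>Phi js ts b\<close> represents the corresponding
  vector for the composed tree: \<open>p\<^sub>i\<^sup>\<circ>\<close> is replaced by the part of \<open>p\<^sub>i(X) \<xi>\<close> orthogonal to \<open>\<xi>\<close>.\<close>

fun Phi :: "nat list \<Rightarrow> 'b bterm list \<Rightarrow> 'b \<Rightarrow> 'b gen list" where
  "Phi (j # js) (t # ts) b = gprods (\<iota> j) (nonvac (E j t)) (Phi js ts b)"
| "Phi _ _ b = [([], [], b)]"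

definition tgen :: "nat list \<times> 'b bterm list \<times> 'b \<Rightarrow> 'b gen" where
  "tgen = (\<lambda>(js, ts, b). (js, map abs_bpoly ts, b))"

definition tvalid :: "nat list \<times> 'b bterm list \<times> 'b \<Rightarrow> bool" where
  "tvalid = (\<lambda>(js, ts, b). js \<in> T \<and> length ts = length js)"

definition tlact :: "'b \<Rightarrow> nat list \<times> 'b bterm list \<times> 'b \<Rightarrow> nat list \<times> 'b bterm list \<times> 'b" where
  "tlact a = (\<lambda>(js, ts, b). case ts of [] \<Rightarrow> (js, [], a * b) | t # ts' \<Rightarrow> (js, Times (Coef a) t # ts', b))"

definition Psi :: "nat list \<times> 'b bterm list \<times> 'b \<Rightarrow> 'b gen list" where
  "Psi = (\<lambda>(js, ts, b). Phi js ts b)"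

lemma gvalid_tgen: "tvalid \<kappa> \<Longrightarrow> gvalid T (tgen \<kappa>)"
  by (cases \<kappa>) (simp add: tvalid_def gvalid_def tgen_def)

lemma tvalid_tlact: "tvalid (tlact a \<kappa>) = tvalid \<kappa>"
  by (cases \<kappa>) (auto simp: tvalid_def tlact_def split: list.split)

lemma tgen_tlact: "tgen (tlact a \<kappa>) = lgen a (tgen \<kappa>)"
  by (cases \<kappa>) (auto simp: tgen_def tlact_def lgen_def abs_bpoly_simps split: list.split)

lemma Psi_tlact: "tvalid \<kappa> \<Longrightarrow> Psi (tlact a \<kappa>) = map (lgen a) (Psi \<kappa>)"
proof -
  assume v: "tvalid \<kappa>"
  obtain js ts b where \<kappa>: "\<kappa> = (js, ts, b)" by (cases \<kappa>)
  show ?thesis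
  proof (cases ts)
    case Nil
    then show ?thesis by (cases js) (simp_all add: \<kappa> tlact_def Psi_def lgen_def)
  next
    case (Cons t ts')
    then obtain j js' where js: "js = j # js'" using v \<kappa> by (cases js) (auto simp: tvalid_def)
    have j: "j \<in> {1..k}" using v js \<kappa> T_simps(2)[of j js'] by (simp add: tvalid_def)
    have "nonvac (E j (Times (Coef a) t)) = map (lgen a) (nonvac (E j t))"
      by (simp add: E_def filter_map comp_def fst_lgen)
    moreover have "gprod (\<iota> j) (lgen a g) g' = lgen a (gprod (\<iota> j) g g')" if "g \<in> set (nonvac (E j t))" for g g'
      using E_gvalid[OF j, of g t] that by (intro gprod_lgen) (auto simp: gvalid_def)
    then have m: "map (\<lambda>g. gprod (\<iota> j) (lgen a g) g') (nonvac (E j t)) =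
        map (\<lambda>g. lgen a (gprod (\<iota> j) g g')) (nonvac (E j t))" for g'
      by (intro map_cong HOL.refl)
    ultimately have "Psi (tlact a \<kappa>) = gprods (\<iota> j) (map (lgen a) (nonvac (E j t))) (Phi js' ts' b)"
      by (simp add: \<kappa> Cons js tlact_def Psi_def)
    also have "\<dots> = map (lgen a) (gprods (\<iota> j) (nonvac (E j t)) (Phi js' ts' b))"
      unfolding gprods_def map_concat map_map comp_def m ..
    finally show ?thesis by (simp add: \<kappa> Cons js Psi_def)
  qed
qed

text \<open>Filtering by \<open>nonvac\<close> is what makes the pieces nonempty, so that the words
  of \<open>Phi js ts b\<close> decode over \<open>js\<close>.\<close>

lemma Phi_pieces:
  "js \<in> T \<Longrightarrow> length ts = length js \<Longrightarrow> g \<in> set (Phi js ts b) \<Longrightarrow>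
    \<exists>ss. pieces js ss \<and> fst g = decode ns js ss \<and> length (fst (snd g)) = length (fst g)"
proof (induction js arbitrary: ts g)
  case (Cons j js)
  obtain t ts' where ts: "ts = t # ts'" "length ts' = length js" using Cons.prems(2) by (cases ts) auto
  have j: "j \<in> {1..k}" using Cons.prems(1) by (rule T_simps)
  obtain g1 g' where g: "g1 \<in> set (E j t)" "fst g1 \<noteq> []" "g' \<in> set (Phi js ts' b)" "g = gprod (\<iota> j) g1 g'"
    using Cons.prems(3) by (auto simp: ts gprods_def)
  obtain ss where ss: "pieces js ss" "fst g' = decode ns js ss" "length (fst (snd g')) = length (fst g')"
    using Cons.IH[OF T_simps(3)[OF Cons.prems(1)] ts(2) g(3)] by blast
  have v: "gvalid (Ts ! (j - 1)) g1" by (rule E_gvalid[OF j g(1)])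
  then have "fst g1 \<in> Ts ! (j - 1)" by (auto simp: gvalid_def)
  then have "pieces (j # js) (fst g1 # ss)" using g(2) ss(1) by simp
  moreover have "fst g = decode ns (j # js) (fst g1 # ss)" by (simp add: g(4) fst_gprod ss(2))
  moreover have "gvalid UNIV g" unfolding g(4) by (rule gvalid_gprod[OF v ss(3)]) simp
  then have "length (fst (snd g)) = length (fst g)" by (auto simp: gvalid_def)
  ultimately show ?case by blast
qed (auto intro: exI[of _ "[]"])

lemma Psi_gvalid:
  assumes "tvalid \<kappa>" "g \<in> set (Psi \<kappa>)"
  shows "gvalid T' g"
proof -
  obtain js ts b where \<kappa>: "\<kappa> = (js, ts, b)" by (cases \<kappa>)
  obtain ss where "pieces js ss" "fst g = decode ns js ss" "length (fst (snd g)) = length (fst g)"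
    using Phi_pieces[of js ts g b] assms by (auto simp: \<kappa> tvalid_def Psi_def)
  then show ?thesis using assms(1) in_T' by (cases g) (auto simp: \<kappa> tvalid_def gvalid_def)
qed

text \<open>Supplies the equality of vacuum components of related vectors: for nonempty
  \<open>js\<close> every word of \<open>Psi\<close> contains a nonempty first piece.\<close>

lemma vacs_Psi:
  assumes "tvalid (js, ts, b)"
  shows "vacs (Psi (js, ts, b)) = (if js = [] then b else 0)"
proof (cases js)
  case (Cons j js')
  then obtain t ts' where ts: "ts = t # ts'" using assms by (cases ts) (auto simp: tvalid_def)
  have "fst g \<noteq> []" if "g \<in> set (Psi (js, ts, b))" for g
    using that by (auto simp: Psi_def Cons ts gprods_def fst_gprod)
  moreover have "(\<forall>g\<in>set L. fst g \<noteq> []) \<Longrightarrow> vacs L = 0" for L :: "'b gen list"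
    by (induction L) auto
  ultimately show ?thesis using Cons by simp
qed (simp add: Psi_def)

abbreviation "gvs \<equiv> composed.gvs"
abbreviation "Y j \<equiv> composed.Xs (map (\<iota> j) (blk j))"

lemma blk_subset: "j \<in> {1..k} \<Longrightarrow> set (map (\<iota> j) (blk j)) \<subseteq> {1..N}"
  using \<iota>_range[of j] by (auto simp del: upt_Suc)

text \<open>The remainders on which a segment of block \<open>j\<close>, possibly empty, may be
  placed without leaving the composed tree.\<close>

definition attachable :: "nat \<Rightarrow> 'b gen \<Rightarrow> bool" where
  "attachable j g \<longleftrightarrow> length (fst (snd g)) = length (fst g) \<and>
     (\<exists>js ss. j # js \<in> T \<and> pieces js ss \<and> fst g = decode ns js ss)"

lemma attachable_gvalid:
  assumes "attachable j g'"
  shows "gvalid T' g'" and "gvalid (Ts ! (j - 1)) g \<Longrightarrow> gvalid T' (gprod (\<iota> j) g g')"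
proof -
  obtain js ss where js: "j # js \<in> T" "pieces js ss" "fst g' = decode ns js ss"
    and l: "length (fst (snd g')) = length (fst g')"
    using assms by (auto simp: attachable_def)
  have d: "decode ns js ss \<in> T'" using js(2) T_simps(3)[OF js(1)] in_T' by blast
  then show "gvalid T' g'" using js(3) l by (cases g') (simp add: gvalid_def)
  assume g: "gvalid (Ts ! (j - 1)) g"
  have "map (\<iota> j) (fst g) @ decode ns js ss \<in> T'"
  proof (cases "fst g = []")
    case False
    have "fst g \<in> Ts ! (j - 1)" using g by (auto simp: gvalid_def)
    then have "pieces (j # js) (fst g # ss)" using js(2) False by simp
    then have "decode ns (j # js) (fst g # ss) \<in> T'" using js(1) in_T' by blast
    then show ?thesis by simp
  qed (simp add: d)
  then show "gvalid T' (gprod (\<iota> j) g g')" using gvalid_gprod[OF g l] js(3) by simp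
qed

lemma actl_gprod:
  assumes g': "attachable j g'" and V: "\<And>g. g \<in> set V \<Longrightarrow> gvalid (Ts ! (j - 1)) g"
  shows "actl T' \<mu>' (map (\<iota> j) (blk j)) (map (\<lambda>g. gprod (\<iota> j) g g') V) =
    map (\<lambda>g. gprod (\<iota> j) g g') (actl (Ts ! (j - 1)) (\<mu>j j) (blk j) V)"
proof -
  obtain js ss where js: "j # js \<in> T" "pieces js ss" "fst g' = decode ns js ss"
    using g' by (auto simp: attachable_def)
  have j: "j \<in> {1..k}" using js(1) by (rule T_simps)
  have act: "actg T' \<mu>' (\<iota> j i) (gprod (\<iota> j) g g') = map (\<lambda>\<gamma>. gprod (\<iota> j) \<gamma> g') (actg (Ts ! (j - 1)) (\<mu>j j) i g)"
    if i: "i \<in> set (blk j)" and g: "g \<in> set V" for i g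
  proof (rule actg_gprod)
    have i: "i \<in> {1..ns ! (j - 1)}" using i by auto
    have v: "fst g \<in> Ts ! (j - 1)" "length (fst (snd g)) = length (fst g)"
      using V[OF g] by (auto simp: gvalid_def)
    show "\<mu>' (\<iota> j i) = \<mu>j j i" by (rule \<mu>'_\<iota>[OF j i])
    show "length (fst (snd g)) = length (fst g)" by (rule v)
    show "\<iota> j i # map (\<iota> j) (fst g) @ fst g' \<in> T' \<longleftrightarrow> i # fst g \<in> Ts ! (j - 1)"
      unfolding js(3) by (rule in_T'_iff[OF js(1,2) v(1) i])
    show "fst g' = [] \<or> hd (fst g') \<noteq> \<iota> j i"
      unfolding js(3) by (rule hd_decode[OF T_simps(3)[OF js(1)] js(2) j i T_simps(4)[OF js(1)]])
  qed (rule inj_\<iota>)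
  have "concat (map (actg T' \<mu>' (\<iota> j i)) (map (\<lambda>g. gprod (\<iota> j) g g') V)) =
      map (\<lambda>g. gprod (\<iota> j) g g') (concat (map (actg (Ts ! (j - 1)) (\<mu>j j) i) V))" if "i \<in> set (blk j)" for i
    using act[OF that] by (simp add: map_concat comp_def cong: map_cong)
  then have "map (\<lambda>i. concat (map (actg T' \<mu>' (\<iota> j i)) (map (\<lambda>g. gprod (\<iota> j) g g') V))) (blk j) =
      map (\<lambda>i. map (\<lambda>g. gprod (\<iota> j) g g') (concat (map (actg (Ts ! (j - 1)) (\<mu>j j) i) V))) (blk j)"
    by (rule map_cong[OF HOL.refl])
  then show ?thesis
    unfolding actl_def map_map[of _ "\<iota> j"] comp_def map_concat[of _ "map _ (blk j)"] map_map[of "map _"]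
    by (simp only: map_map comp_def)
qed

text \<open>The core of the comparison: the variables of block \<open>j\<close> together act on
  leading segments as the variable of the block convolution, with the remainders untouched.\<close>

lemma Y_gprods:
  assumes j: "j \<in> {1..k}" and P: "\<And>g'. g' \<in> set P \<Longrightarrow> attachable j g'"
    and V: "\<And>g. g \<in> set V \<Longrightarrow> gvalid (Ts ! (j - 1)) g"
  shows "Y j (gvs (gprods (\<iota> j) V P)) = gvs (gprods (\<iota> j) (actl (Ts ! (j - 1)) (\<mu>j j) (blk j) V) P)"
proof -
  let ?V' = "actl (Ts ! (j - 1)) (\<mu>j j) (blk j) V"
  have V': "gvalid (Ts ! (j - 1)) g" if "g \<in> set ?V'" for g
    by (rule tree_laws.actl_gvalid[OF tree_laws_block[OF j] V that])
  note sy = composed.sym_op_Xs[OF blk_subset[OF j]]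
  have val: "gvalid T' g" if "g' \<in> set P" "g \<in> set (map (\<lambda>g. gprod (\<iota> j) g g') V)" for g g'
    using that V attachable_gvalid(2)[OF P] by (simp only: set_map set_filter) blast
  have val': "gvalid T' g" if "g' \<in> set P" "g \<in> set (map (\<lambda>g. gprod (\<iota> j) g g') ?V')" for g g'
    using that V' attachable_gvalid(2)[OF P] by (simp only: set_map) blast
  have vc: "\<forall>g'\<in>set P. gvs (map (\<lambda>g. gprod (\<iota> j) g g') V) \<in> carr composed.HT"
    by (intro ballI composed.gvs_closed) (rule val)
  have vc': "set (map (\<lambda>g'. gvs (map (\<lambda>g. gprod (\<iota> j) g g') V)) P) \<subseteq> carr composed.HT"
    using vc by (simp only: set_map image_subset_iff)
  have "Y j (gvs (gprods (\<iota> j) V P)) = Y j (composed.ht.vsum (map (\<lambda>g'. gvs (map (\<lambda>g. gprod (\<iota> j) g g') V)) P))"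
    unfolding gprods_def by (subst composed.gvs_concat) (use val in blast)+
  also have "\<dots> = composed.ht.vsum (map (Y j) (map (\<lambda>g'. gvs (map (\<lambda>g. gprod (\<iota> j) g g') V)) P))"
    by (rule composed.ht.sym_op_vsum[OF sy vc'])
  also have "map (Y j) (map (\<lambda>g'. gvs (map (\<lambda>g. gprod (\<iota> j) g g') V)) P) =
      map (\<lambda>g'. gvs (map (\<lambda>g. gprod (\<iota> j) g g') ?V')) P"
    unfolding map_map[of "Y j"]
  proof (rule map_cong[OF HOL.refl])
    fix g' assume g': "g' \<in> set P"
    have "Y j (gvs (map (\<lambda>g. gprod (\<iota> j) g g') V)) =
        gvs (actl T' \<mu>' (map (\<iota> j) (blk j)) (map (\<lambda>g. gprod (\<iota> j) g g') V))"
      by (rule composed.Xs_gvs[OF val[OF g'] blk_subset[OF j]])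
    also have "actl T' \<mu>' (map (\<iota> j) (blk j)) (map (\<lambda>g. gprod (\<iota> j) g g') V) = map (\<lambda>g. gprod (\<iota> j) g g') ?V'"
      by (rule actl_gprod[OF P[OF g'] V])
    finally show "(Y j \<circ> (\<lambda>g'. gvs (map (\<lambda>g. gprod (\<iota> j) g g') V))) g' = gvs (map (\<lambda>g. gprod (\<iota> j) g g') ?V')"
      by (simp only: comp_def)
  qed
  also have "composed.ht.vsum \<dots> = gvs (gprods (\<iota> j) ?V' P)"
    unfolding gprods_def by (subst composed.gvs_concat) (use val' in blast)+
  finally show ?thesis .
qed

text \<open>The vacuum part of \<open>V\<close> is a scalar, and multiplied onto a remainder it
  becomes a left action. For a list of \<open>p(X) \<xi>\<close> this scalar is
  \<open>\<nu> p\<close>, which the outer convolution splits off as well.\<close>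

lemma gvs_gprods_split:
  assumes P: "\<And>g'. g' \<in> set P \<Longrightarrow> attachable j g'"
    and V: "\<And>g. g \<in> set V \<Longrightarrow> gvalid (Ts ! (j - 1)) g"
  shows "gvs (gprods (\<iota> j) V P) = add composed.HT (lact composed.HT (vacs V) (gvs P)) (gvs (gprods (\<iota> j) (nonvac V) P))"
proof -
  let ?H = "composed.HT"
  have one: "gvs (map (\<lambda>g. gprod (\<iota> j) g g') V) =
      add ?H (lact ?H (vacs V) (composed.gv g')) (gvs (map (\<lambda>g. gprod (\<iota> j) g g') (nonvac V)))"
    if g': "g' \<in> set P" for g'
    using V
  proof (induction V)
    case Nil
    show ?case using composed.gv_closed[OF attachable_gvalid(1)[OF P[OF g']]]
      by (simp add: composed.ht.lact_zero composed.ht.add_nul composed.ht.closed)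
  next
    case (Cons g V)
    note c = composed.gv_closed[OF attachable_gvalid(1)[OF P[OF g']]]
    have gc: "composed.gv (gprod (\<iota> j) g g') \<in> carr ?H"
      using Cons.prems by (intro composed.gv_closed attachable_gvalid(2)[OF P[OF g']]) simp
    have nc: "gvs (map (\<lambda>g. gprod (\<iota> j) g g') (nonvac V)) \<in> carr ?H"
      using Cons.prems attachable_gvalid(2)[OF P[OF g']] by (intro composed.gvs_closed) auto
    note IH = Cons.IH[OF Cons.prems, OF list.set_intros(2)]
    obtain s qs b where g: "g = (s, qs, b)" by (cases g)
    show ?case
    proof (cases "s = []")
      case True
      then have "qs = []" using Cons.prems[of g] g by (simp add: gvalid_def)
      then have "composed.gv (gprod (\<iota> j) g g') = lact ?H b (composed.gv g')"
        using composed.gv_lgen[OF attachable_gvalid(1)[OF P[OF g']]] True by (simp add: g gprod_vacuum)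
      then show ?thesis using True c nc
        by (simp add: g IH composed.ht.lact_plus composed.ht.add_assoc composed.ht.closed del: map_map)
    next
      case False
      have "add ?H (composed.gv (gprod (\<iota> j) g g')) (add ?H (lact ?H (vacs V) (composed.gv g')) N') =
          add ?H (lact ?H (vacs V) (composed.gv g')) (add ?H (composed.gv (gprod (\<iota> j) g g')) N')"
        if "N' \<in> carr ?H" for N'
        using that gc c
        by (intro composed.ht.separated) (simp_all add: composed.ht.closed composed.ht.inn_add)
      then show ?thesis using False nc by (simp add: g IH del: map_map)
    qed
  qed
  have val: "gvalid T' g" if "g' \<in> set P" "g \<in> set (map (\<lambda>g. gprod (\<iota> j) g g') V)" for g g'
    using that V attachable_gvalid(2)[OF P] by (simp only: set_map set_filter) blast
  have val': "gvalid T' g" if "g' \<in> set P" "g \<in> set (map (\<lambda>g. gprod (\<iota> j) g g') (nonvac V))" for g g'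
    using that V attachable_gvalid(2)[OF P] by (simp only: set_map set_filter) blast
  have Pc: "composed.gv g' \<in> carr ?H" if "g' \<in> set P" for g'
    using that by (intro composed.gv_closed attachable_gvalid(1)[OF P])
  have "gvs (gprods (\<iota> j) V P) = composed.ht.vsum (map (\<lambda>g'. gvs (map (\<lambda>g. gprod (\<iota> j) g g') V)) P)"
    unfolding gprods_def by (subst composed.gvs_concat) (use val in blast)+
  also have "map (\<lambda>g'. gvs (map (\<lambda>g. gprod (\<iota> j) g g') V)) P =
      map (\<lambda>g'. add ?H (lact ?H (vacs V) (composed.gv g')) (gvs (map (\<lambda>g. gprod (\<iota> j) g g') (nonvac V)))) P"
    using one by (rule map_cong[OF HOL.refl])
  also have "composed.ht.vsum \<dots> = add ?H (composed.ht.vsum (map (\<lambda>g'. lact ?H (vacs V) (composed.gv g')) P))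
      (composed.ht.vsum (map (\<lambda>g'. gvs (map (\<lambda>g. gprod (\<iota> j) g g') (nonvac V))) P))"
    by (intro composed.ht.vsum_map_add conjI composed.ht.lact_closed Pc composed.gvs_closed) (use val' in blast)+
  also have "composed.ht.vsum (map (\<lambda>g'. gvs (map (\<lambda>g. gprod (\<iota> j) g g') (nonvac V))) P) = gvs (gprods (\<iota> j) (nonvac V) P)"
    unfolding gprods_def by (subst composed.gvs_concat) (use val' in blast)+
  also have "composed.ht.vsum (map (\<lambda>g'. lact ?H (vacs V) (composed.gv g')) P) = lact ?H (vacs V) (gvs P)"
    using Pc by (subst composed.ht.lact_vsum) (auto simp: comp_def)
  finally show ?thesis .
qed

section \<open>Paired vectors in the two modules and their stability under the operations\<close>

abbreviation "kv \<kappa> \<equiv> outer.gv (tgen \<kappa>)"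
abbreviation "hv \<kappa> \<equiv> gvs (Psi \<kappa>)"

lemma kv_closed: "tvalid \<kappa> \<Longrightarrow> kv \<kappa> \<in> carr outer.HT"
  by (intro outer.gv_closed gvalid_tgen)

lemma hv_closed: "tvalid \<kappa> \<Longrightarrow> hv \<kappa> \<in> carr composed.HT"
  by (intro composed.gvs_closed Psi_gvalid)

lemma kv_tlact: "tvalid \<kappa> \<Longrightarrow> kv (tlact a \<kappa>) = lact outer.HT a (kv \<kappa>)"
  by (simp only: tgen_tlact) (intro outer.gv_lgen gvalid_tgen)

lemma hv_tlact:
  assumes "tvalid \<kappa>"
  shows "hv (tlact a \<kappa>) = lact composed.HT a (hv \<kappa>)"
proof -
  have "lact composed.HT a (hv \<kappa>) = composed.ht.vsum (map (lact composed.HT a) (map composed.gv (Psi \<kappa>)))"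
    using Psi_gvalid[OF assms] composed.gv_closed by (intro composed.ht.lact_vsum) (simp only: set_map, blast)
  also have "map (lact composed.HT a) (map composed.gv (Psi \<kappa>)) = map composed.gv (map (lgen a) (Psi \<kappa>))"
    unfolding map_map comp_def
    by (intro map_cong HOL.refl composed.gv_lgen[symmetric] Psi_gvalid[OF assms])
  finally show ?thesis by (simp only: Psi_tlact[OF assms])
qed

text \<open>A copy of \<open>actg\<close> on terms instead of polynomials: \<open>Phi\<close> depends on the chosen terms.\<close>

definition tact :: "nat \<Rightarrow> nat list \<times> 'b bterm list \<times> 'b \<Rightarrow> (nat list \<times> 'b bterm list \<times> 'b) list" where
  "tact j = (\<lambda>(js, ts, b).
     if js \<noteq> [] \<and> hd js = j then
       let t = Times Indet (Plus (hd ts) (Coef (- \<nu> j (abs_bpoly (hd ts)))))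
       in [tlact (\<nu> j (abs_bpoly t)) (tl js, tl ts, b), (js, t # tl ts, b)]
     else if j # js \<in> T then [tlact (\<nu> j indet) (js, ts, b), (j # js, Indet # ts, b)]
     else [])"

lemma abs_bpoly_diff_Coef: "abs_bpoly (Plus t (Coef (- b))) = abs_bpoly t - coef b"
proof -
  have "coef (- b) = - coef b"
    using coef_simps(3)[of "- b" b] by (simp add: coef_simps(2) eq_neg_iff_add_eq_0)
  then show ?thesis by (simp add: abs_bpoly_simps)
qed

lemma map_tgen_tact:
  assumes "tvalid \<kappa>"
  shows "map tgen (tact j \<kappa>) = actg T \<nu> j (tgen \<kappa>)"
proof -
  obtain js ts b where \<kappa>: "\<kappa> = (js, ts, b)" by (cases \<kappa>)
  have l: "length ts = length js" using assms by (simp add: \<kappa> tvalid_def)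
  show ?thesis
  proof (cases "js \<noteq> [] \<and> hd js = j")
    case True
    then obtain t ts' where ts: "ts = t # ts'" using l by (cases ts) auto
    let ?t = "Times Indet (Plus t (Coef (- \<nu> j (abs_bpoly t))))"
    have t: "abs_bpoly ?t = indet * (abs_bpoly t - coef (\<nu> j (abs_bpoly t)))"
      by (simp only: abs_bpoly_simps(2,4) abs_bpoly_diff_Coef)
    have "map tgen (tact j \<kappa>) = [lgen (\<nu> j (abs_bpoly ?t)) (tl js, map abs_bpoly ts', b), (js, abs_bpoly ?t # map abs_bpoly ts', b)]"
      using True by (simp add: \<kappa> ts tact_def Let_def tgen_tlact) (simp add: tgen_def)
    also have "\<dots> = actg T \<nu> j (tgen \<kappa>)"
      unfolding t using True by (simp add: \<kappa> ts actg_def tgen_def Let_def)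
    finally show ?thesis .
  next
    case False
    then show ?thesis
      by (auto simp: \<kappa> tact_def actg_def tgen_tlact) (auto simp: tgen_def abs_bpoly_simps)
  qed
qed

lemma tact_tvalid:
  assumes "tvalid \<kappa>" "\<kappa>' \<in> set (tact j \<kappa>)"
  shows "tvalid \<kappa>'"
proof -
  have "tgen \<kappa>' \<in> set (actg T \<nu> j (tgen \<kappa>))"
    using assms(2) unfolding map_tgen_tact[OF assms(1), symmetric] by simp
  then have "gvalid T (tgen \<kappa>')" by (rule outer.actg_gvalid[OF gvalid_tgen[OF assms(1)]])
  then show ?thesis by (cases \<kappa>') (auto simp: tgen_def gvalid_def tvalid_def)
qed

lemma \<Lambda>_kv:
  assumes "tvalid \<kappa>" "j \<in> {1..k}"
  shows "outer.\<Lambda> j (kv \<kappa>) = outer.ht.vsum (map kv (tact j \<kappa>))"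
  unfolding outer.\<Lambda>_gv[OF gvalid_tgen[OF assms(1)] assms(2)] map_tgen_tact[OF assms(1), of j, symmetric]
    map_map comp_def ..

lemma Phi_attachable:
  assumes "j # js \<in> T" "length ts = length js" "g \<in> set (Phi js ts b)"
  shows "attachable j g"
  using Phi_pieces[OF T_simps(3)[OF assms(1)] assms(2,3)] assms(1) by (auto simp: attachable_def)

text \<open>Applying \<open>X\<close> to the vector of \<open>t\<close>, with its vacuum part kept,
  gives the vector of \<open>Times Indet t\<close>; its vacuum and orthogonal parts are the two
  summands. The outer module shows the same splitting in \<open>att_cl\<close>.\<close>

lemma Y_attach:
  assumes js: "j # js \<in> T" and l: "length ts = length js"
    and h: "h = gvs (gprods (\<iota> j) (E j t) (Phi js ts b))"
  shows "Y j h = add composed.HT (hv (tlact (\<nu> j (abs_bpoly (Times Indet t))) (js, ts, b)))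
    (hv (j # js, Times Indet t # ts, b))"
proof -
  have j: "j \<in> {1..k}" using js by (rule T_simps)
  have v: "tvalid (js, ts, b)" using T_simps(3)[OF js] l by (simp add: tvalid_def)
  have "Y j h = gvs (gprods (\<iota> j) (E j (Times Indet t)) (Phi js ts b))"
    unfolding h by (subst Y_gprods[OF j]) (auto simp: E_def intro: Phi_attachable[OF js l] E_gvalid[OF j, unfolded E_def])
  also have "\<dots> = add composed.HT (lact composed.HT (vacs (E j (Times Indet t))) (gvs (Phi js ts b)))
      (gvs (gprods (\<iota> j) (nonvac (E j (Times Indet t))) (Phi js ts b)))"
    by (rule gvs_gprods_split) (auto intro: Phi_attachable[OF js l] E_gvalid[OF j])
  finally show ?thesis 
    unfolding hv_tlact[OF v] \<nu>_E[OF j] by (simp add: Psi_def del: upt_Suc)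
qed

text \<open>Together with \<open>\<Lambda>_kv\<close> it shows that both modules follow the same
  list \<open>tact\<close>, which is why the relation is stable under the variables.\<close>

lemma Y_hv:
  assumes "tvalid \<kappa>" and j: "j \<in> {1..k}"
  shows "Y j (hv \<kappa>) = composed.ht.vsum (map hv (tact j \<kappa>))"
proof -
  obtain js ts b where \<kappa>: "\<kappa> = (js, ts, b)" by (cases \<kappa>)
  have v: "js \<in> T" "length ts = length js" using assms by (simp_all add: \<kappa> tvalid_def)
  have two: "add composed.HT (hv \<kappa>1) (hv \<kappa>2) = composed.ht.vsum (map hv [\<kappa>1, \<kappa>2])" if "tvalid \<kappa>2" for \<kappa>1 \<kappa>2
    using hv_closed[OF that] by (simp add: composed.ht.add_nul)
  show ?thesis
  proof (cases "js \<noteq> [] \<and> hd js = j")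
    case True
    then obtain js' t ts' where s: "js = j # js'" "ts = t # ts'" "length ts' = length js'"
      using v(2) by (cases js; cases ts) auto
    have js': "j # js' \<in> T" using v(1) s by simp
    \<comment> \<open>The term of \<open>p - \<nu> p\<close>. Its vector has no vacuum component and
      the same orthogonal part as the vector of \<open>t\<close>, so \<open>hv \<kappa>\<close> can
      be formed with the complete list \<open>E j t'\<close>, the shape that \<open>Y_attach\<close>
      requires.\<close>
    define t' where "t' = Plus t (Coef (- \<nu> j (abs_bpoly t)))"
    have Et': "E j t' = E j t @ [([], [], - \<nu> j (abs_bpoly t))]"
      by (simp add: t'_def E_def lgen_def)
    have "vacs (E j t') = 0" by (simp add: Et' \<nu>_E[OF j])
    moreover have "nonvac (E j t') = nonvac (E j t)" by (simp add: Et')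
    moreover have "gvs (gprods (\<iota> j) (E j t') (Phi js' ts' b)) =
        add composed.HT (lact composed.HT (vacs (E j t')) (gvs (Phi js' ts' b)))
          (gvs (gprods (\<iota> j) (nonvac (E j t')) (Phi js' ts' b)))"
      by (rule gvs_gprods_split) (auto intro: Phi_attachable[OF js' s(3)] E_gvalid[OF j])
    moreover have "gvs (Phi js' ts' b) \<in> carr composed.HT" "gvs (Phi js ts b) \<in> carr composed.HT"
      using hv_closed[of "(js', ts', b)"] hv_closed[of "(js, ts, b)"] v s T_simps(3)[OF js']
      by (simp_all add: tvalid_def Psi_def)
    ultimately have "hv \<kappa> = gvs (gprods (\<iota> j) (E j t') (Phi js' ts' b))"
      by (simp add: \<kappa> s Psi_def composed.ht.lact_zero composed.ht.add_nul)
    then have "Y j (hv \<kappa>) = add composed.HT (hv (tlact (\<nu> j (abs_bpoly (Times Indet t'))) (js', ts', b)))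
        (hv (j # js', Times Indet t' # ts', b))"
      by (rule Y_attach[OF js' s(3)])
    also have "\<dots> = composed.ht.vsum (map hv (tact j \<kappa>))"
      using v by (subst two) (simp_all add: tvalid_def s \<kappa> tact_def Let_def t'_def)
    finally show ?thesis .
  next
    case False
    then have nj: "js = [] \<or> hd js \<noteq> j" by blast
    show ?thesis
    proof (cases "j # js \<in> T")
      case True
      \<comment> \<open>\<open>\<xi>\<close> is the vector of the term 1, so a remainder alone
        counts as carrying an empty segment of block \<open>j\<close>.\<close>
      have "gprods (\<iota> j) (E j (Coef 1)) (Phi js ts b) = Phi js ts b"
        by (simp add: gprods_def E_def gprod_vacuum lgen_one)
      then have "hv \<kappa> = gvs (gprods (\<iota> j) (E j (Coef 1)) (Phi js ts b))" by (simp add: \<kappa> Psi_def)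
      then have "Y j (hv \<kappa>) = add composed.HT (hv (tlact (\<nu> j (abs_bpoly (Times Indet (Coef 1)))) (js, ts, b)))
          (hv (j # js, Times Indet (Coef 1) # ts, b))"
        by (rule Y_attach[OF True v(2)])
      also have "abs_bpoly (Times Indet (Coef 1)) = (indet :: 'b bpoly)" by (simp add: abs_bpoly_simps coef_simps)
      also have "hv (j # js, Times Indet (Coef 1) # ts, b) = hv (j # js, Indet # ts, b)"
        by (simp add: Psi_def E_def lgen_def)
      also have "add composed.HT (hv (tlact (\<nu> j indet) (js, ts, b))) (hv (j # js, Indet # ts, b)) =
          composed.ht.vsum (map hv (tact j \<kappa>))"
        using v True False by (subst two) (auto simp: tvalid_def \<kappa> tact_def)
      finally show ?thesis .
    next
      case js: False
      \<comment> \<open>No letter of block \<open>j\<close> is at the head or can be prepended, so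
        every summand is killed, as it is in the outer tree.\<close>
      have "actg T' \<mu>' (\<iota> j i) g = []" if g: "g \<in> set (Psi \<kappa>)" and i: "i \<in> set (blk j)" for g i
      proof -
        have i: "i \<in> {1..ns ! (j - 1)}" using i by auto
        obtain ss where ss: "pieces js ss" "fst g = decode ns js ss"
          using Phi_pieces[OF v, of g b] g by (simp only: \<kappa> Psi_def prod.case) blast
        show ?thesis
          using not_in_T'[OF v(1) ss(1) j i nj js] hd_decode[OF v(1) ss(1) j i nj] ss(2)
          by (cases g) (auto simp: actg_def)
      qed
      then have "actl T' \<mu>' (map (\<iota> j) (blk j)) (Psi \<kappa>) = []"
        by (auto simp: actl_def simp del: upt_Suc)
      then have "Y j (hv \<kappa>) = nul composed.HT"
        using composed.Xs_gvs[OF Psi_gvalid[OF assms(1)] blk_subset[OF j]] by simp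
      moreover have "tact j \<kappa> = []" using False js by (auto simp: \<kappa> tact_def)
      ultimately show ?thesis by simp
    qed
  qed
qed

text \<open>Both components are built from a common list \<open>L\<close>; nothing is claimed about
  one component determining the other.\<close>

definition rel where
  "rel = {(outer.ht.vsum (map kv L), composed.ht.vsum (map hv L)) | L. \<forall>\<kappa>\<in>set L. tvalid \<kappa>}"

lemma rel_closed: "rel \<subseteq> carr outer.HT \<times> carr composed.HT"
proof -
  have "outer.ht.vsum (map kv L) \<in> carr outer.HT" "composed.ht.vsum (map hv L) \<in> carr composed.HT"
    if "\<forall>\<kappa>\<in>set L. tvalid \<kappa>" for L
    using that kv_closed hv_closed
    by (intro outer.ht.vsum_closed composed.ht.vsum_closed; simp only: set_map; blast)+
  then show ?thesis unfolding rel_def by blast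
qed

lemma rel_nul: "(nul outer.HT, nul composed.HT) \<in> rel"
  unfolding rel_def by (rule CollectI, rule exI[of _ "[]"]) simp

lemma rel_add:
  assumes "(h, h') \<in> rel" "(g, g') \<in> rel"
  shows "(add outer.HT h g, add composed.HT h' g') \<in> rel"
proof -
  obtain L M where L: "h = outer.ht.vsum (map kv L)" "h' = composed.ht.vsum (map hv L)" "\<forall>\<kappa>\<in>set L. tvalid \<kappa>"
    and M: "g = outer.ht.vsum (map kv M)" "g' = composed.ht.vsum (map hv M)" "\<forall>\<kappa>\<in>set M. tvalid \<kappa>"
    using assms unfolding rel_def by blast
  have c: "set (map kv L) \<subseteq> carr outer.HT" "set (map kv M) \<subseteq> carr outer.HT"
    "set (map hv L) \<subseteq> carr composed.HT" "set (map hv M) \<subseteq> carr composed.HT"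
    using L(3) M(3) kv_closed hv_closed by (simp_all only: set_map) blast+
  have "add outer.HT h g = outer.ht.vsum (map kv (L @ M))"
    unfolding L M map_append using c by (intro outer.ht.vsum_append[symmetric])
  moreover have "add composed.HT h' g' = composed.ht.vsum (map hv (L @ M))"
    unfolding L M map_append using c by (intro composed.ht.vsum_append[symmetric])
  moreover have "\<forall>\<kappa>\<in>set (L @ M). tvalid \<kappa>" using L(3) M(3) by auto
  ultimately show ?thesis unfolding rel_def by blast
qed

lemma rel_vsum: "(\<And>a. a \<in> set as \<Longrightarrow> (f a, f' a) \<in> rel) \<Longrightarrow>
    (outer.ht.vsum (map f as), composed.ht.vsum (map f' as)) \<in> rel"
  by (induction as) (simp_all add: rel_nul rel_add)

lemma rel_tvalid: "\<forall>\<kappa>\<in>set L. tvalid \<kappa> \<Longrightarrow> (outer.ht.vsum (map kv L), composed.ht.vsum (map hv L)) \<in> rel"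
  unfolding rel_def by blast

lemma rel_lact:
  assumes "(h, h') \<in> rel"
  shows "(lact outer.HT a h, lact composed.HT a h') \<in> rel"
proof -
  obtain L where L: "h = outer.ht.vsum (map kv L)" "h' = composed.ht.vsum (map hv L)" "\<forall>\<kappa>\<in>set L. tvalid \<kappa>"
    using assms unfolding rel_def by blast
  have c: "set (map kv L) \<subseteq> carr outer.HT" "set (map hv L) \<subseteq> carr composed.HT"
    using L(3) kv_closed hv_closed by (simp_all only: set_map) blast+
  have "map (lact outer.HT a) (map kv L) = map kv (map (tlact a) L)"
    "map (lact composed.HT a) (map hv L) = map hv (map (tlact a) L)"
    using L(3) kv_tlact hv_tlact by simp_all
  then show ?thesis
    unfolding L outer.ht.lact_vsum[OF c(1)] composed.ht.lact_vsum[OF c(2)]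
    using L(3) by (simp only:) (rule rel_tvalid, simp add: tvalid_tlact)
qed

lemma rel_block:
  assumes "(h, h') \<in> rel" and j: "j \<in> {1..k}"
  shows "(outer.\<Lambda> j h, Y j h') \<in> rel"
proof -
  obtain L where L: "h = outer.ht.vsum (map kv L)" "h' = composed.ht.vsum (map hv L)" "\<forall>\<kappa>\<in>set L. tvalid \<kappa>"
    using assms unfolding rel_def by blast
  have c: "set (map kv L) \<subseteq> carr outer.HT" "set (map hv L) \<subseteq> carr composed.HT"
    using L(3) kv_closed hv_closed by (simp_all only: set_map) blast+
  have "(outer.\<Lambda> j (kv \<kappa>), Y j (hv \<kappa>)) \<in> rel" if "\<kappa> \<in> set L" for \<kappa>
  proof -
    have v: "tvalid \<kappa>" using that L(3) by blast
    show ?thesis unfolding \<Lambda>_kv[OF v j] Y_hv[OF v j]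
      by (rule rel_tvalid) (blast intro: tact_tvalid[OF v])
  qed
  then have "(outer.ht.vsum (map (\<lambda>\<kappa>. outer.\<Lambda> j (kv \<kappa>)) L), composed.ht.vsum (map (\<lambda>\<kappa>. Y j (hv \<kappa>)) L)) \<in> rel"
    by (rule rel_vsum)
  then show ?thesis
    unfolding L outer.ht.sym_op_vsum[OF outer.sym_op_\<Lambda>[OF j] c(1)]
      composed.ht.sym_op_vsum[OF composed.sym_op_Xs[OF blk_subset[OF j]] c(2)]
    by (simp only: map_map comp_def)
qed

lemma Xs_blocks:
  assumes h: "h \<in> carr composed.HT"
  shows "composed.Xs [1..<Suc N] h = composed.ht.vsum (map (\<lambda>j. Y j h) [1..<Suc k])"
proof -
  have c: "composed.\<Lambda> m h \<in> carr composed.HT" if "m \<in> {1..N}" for m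
    using sym_op_closed[OF composed.sym_op_\<Lambda>[OF that] h] .
  have "composed.Xs [1..<Suc N] h = composed.ht.vsum (map (\<lambda>m. composed.\<Lambda> m h)
      (concat (map (\<lambda>j. map (\<iota> j) (blk j)) [1..<Suc k])))"
    unfolding composed.ht.opsum_apply[OF h] upt_blocks len ..
  also have "\<dots> = composed.ht.vsum (map (\<lambda>j. composed.ht.vsum (map (\<lambda>m. composed.\<Lambda> m h) (map (\<iota> j) (blk j)))) [1..<Suc k])"
    unfolding map_concat map_map[of "map _"] comp_def
  proof (rule composed.ht.vsum_concat)
    fix j assume "j \<in> set [1..<Suc k]"
    then have "j \<in> {1..k}" by auto
    then show "set (map (\<lambda>m. composed.\<Lambda> m h) (map (\<iota> j) (blk j))) \<subseteq> carr composed.HT"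
      using blk_subset c by (simp only: set_map) blast
  qed
  finally show ?thesis unfolding composed.ht.opsum_apply[OF h] .
qed

theorem boxplus_compose: "boxplus T (map2 boxplus Ts \<mu>ss) = boxplus T' (concat \<mu>ss)"
proof -
  have lens: "length (map2 boxplus Ts \<mu>ss) = k" "length (concat \<mu>ss) = N"
    using len len_\<mu>ss by (simp_all add: ns_eq length_concat)
  have o: "tree_laws {1..length (map2 boxplus Ts \<mu>ss)} T \<nu>"
    and c: "tree_laws {1..length (concat \<mu>ss)} T' \<mu>'"
    unfolding lens by (rule outer.tree_laws_axioms composed.tree_laws_axioms)+
  have "law_of outer.HT outer.\<Omega> (outer.Xs [1..<Suc k]) = law_of composed.HT composed.\<Omega> (composed.Xs [1..<Suc N])"
  proof (rule law_of_eqI[OF rel_closed])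
    have v: "\<forall>\<kappa>\<in>set [([], [], 1)]. tvalid \<kappa>" using T_simps(1) by (simp add: tvalid_def)
    have "outer.\<Omega> = outer.ht.vsum (map kv [([], [], 1)])"
      unfolding outer.vacuum_gvs by (simp add: tgen_def)
    moreover have "composed.\<Omega> = composed.ht.vsum (map hv [([], [], 1)])"
      using hv_closed[of "([], [], 1)"] v unfolding composed.vacuum_gvs
      by (simp add: Psi_def composed.ht.add_nul)
    ultimately show "(outer.\<Omega>, composed.\<Omega>) \<in> rel" using rel_tvalid[OF v] by simp
  next
    fix h h' assume hh: "(h, h') \<in> rel"
    then have cl: "h \<in> carr outer.HT" "h' \<in> carr composed.HT" using rel_closed by blast+
    show "(outer.Xs [1..<Suc k] h, composed.Xs [1..<Suc N] h') \<in> rel"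
      unfolding outer.ht.opsum_apply[OF cl(1)] Xs_blocks[OF cl(2)]
      by (rule rel_vsum) (rule rel_block[OF hh], auto simp del: upt_Suc)
    obtain L where L: "h = outer.ht.vsum (map kv L)" "h' = composed.ht.vsum (map hv L)" "\<forall>\<kappa>\<in>set L. tvalid \<kappa>"
      using hh unfolding rel_def by blast
    \<comment> \<open>Vacuum components are computed on the lists, where they agree for each triple
      separately.\<close>
    have "inn outer.HT outer.\<Omega> (outer.gvs (map tgen L)) = vacs (map tgen L)"
      using L(3) gvalid_tgen by (intro outer.inn_vacuum_gvs) auto
    moreover have "inn composed.HT composed.\<Omega> (gvs (concat (map Psi L))) = vacs (concat (map Psi L))"
      using L(3) Psi_gvalid by (intro composed.inn_vacuum_gvs) auto
    moreover have "gvs (concat (map Psi L)) = composed.ht.vsum (map hv L)"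
      using L(3) Psi_gvalid by (intro composed.gvs_concat) blast
    moreover have "vacs (map tgen L) = vacs (concat (map Psi L))"
      using L(3)
    proof (induction L)
      case (Cons \<kappa> L)
      obtain js ts b where \<kappa>: "\<kappa> = (js, ts, b)" by (cases \<kappa>)
      show ?case using Cons vacs_Psi[of js ts b] by (simp add: \<kappa> tgen_def)
    qed simp
    ultimately show "inn outer.HT outer.\<Omega> h = inn composed.HT composed.\<Omega> h'"
      unfolding L by (simp only: map_map comp_def)
  qed (rule rel_add rel_lact, assumption+)+
  then show ?thesis
    unfolding boxplus_eq[OF o] boxplus_eq[OF c] Let_def lens .
qed

end

text \<open>Besides respecting composition, an operad morphism has to preserve the identity, here
  the tree with the strings \<open>[]\<close> and \<open>[1]\<close>; this is the second
  conjunct.\<close>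

theorem corollary5p13:
  fixes k :: nat
    and T :: "nat list set"
    and ns :: "nat list"
    and Ts :: "nat list set list"
    and \<mu>ss :: "'b::unital_cstar law list list"
  assumes "T \<in> Tree k"
    and "length ns = k" and "length Ts = k" and "length \<mu>ss = k"
    and "\<And>j. j < k \<Longrightarrow> Ts ! j \<in> Tree (ns ! j)"
    and "\<And>j. j < k \<Longrightarrow> length (\<mu>ss ! j) = ns ! j"
    and "\<And>j i. j < k \<Longrightarrow> i < ns ! j \<Longrightarrow> is_law (\<mu>ss ! j ! i)"
  shows "boxplus T (map2 boxplus Ts \<mu>ss) = boxplus (tree_compose ns T Ts) (concat \<mu>ss)
    \<and> (\<forall>\<mu>::'b law. is_law \<mu> \<longrightarrow> boxplus {[], [1]} [\<mu>] = \<mu>)"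
proof
  have "law_composition k T ns Ts \<mu>ss"
    by (intro law_composition.intro composition.intro law_composition_axioms.intro
        rooted_tree_Tree is_law_imp_weak_law assms) auto
  then show "boxplus T (map2 boxplus Ts \<mu>ss) = boxplus (tree_compose ns T Ts) (concat \<mu>ss)"
    by (rule law_composition.boxplus_compose)
  show "\<forall>\<mu>::'b law. is_law \<mu> \<longrightarrow> boxplus {[], [1]} [\<mu>] = \<mu>"
    using boxplus_identity[OF is_law_imp_weak_law] by blast
qed

end
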